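(* Let $\mathcal{C}$ be a finite category (resp. a finite EI-category) and let $b$ be the unit element (resp. a central idempotent) of $k\mathcal{C}$. Then for every idempotent endomorphism $e$ in $\mathcal{C}$, $eb$ is a central idempotent in $kG_e$. Let $H$ be any subgroup of $\Gamma_b$. Assume that for every idempotent endomorphism $e$ in $\mathcal{C}$ there is an $(H\times\mathrm{Aut}(G_e))_{be}$-equivariant bijection $\mathcal{S}(kG_e eb)\to \mathcal{W}(k\mathcal{O}_{G_e},eb)$. Then there exists an $(H\times\mathrm{Aut}(\mathcal{C}))_b$-equivariant bijection $\mathcal{S}(k\mathcal{C} b)\to \mathcal{W}(k\mathcal{O}_{\mathcal{C}},b)$.
   Context: Fix a prime $p$, an algebraic closure $k$ of $\mathbb{F}_p$, and $\Gamma=\mathrm{Gal}(k/\mathbb{F}_p)$. Modules are left modules. A category is finite if its morphism class is a finite set, and EI if every endomorphism is an isomorphism. A finite group is regarded as an EI-category with one object. For a finite category $\mathcal{D}$, $k\mathcal{D}$ is the category algebra: $k$-basis $\mathrm{Mor}(\mathcal{D})$, product $ts=t\circ s$ if defined and $0$ otherwise. For an idempotent endomorphism $e$ of an object $X$ of $\mathcal{D}$, $G_e$ is the group of invertible elements of the monoid $e\circ\mathrm{End}_{\mathcal{D}}(X)\circ e$ (if $\mathcal{D}$ is EI, then $e=\mathrm{Id}_X$ and $G_e=\mathrm{End}_{\mathcal{D}}(X)$). $\mathcal{S}(A)$ is the set of isomorphism classes of simple $A$-modules. Transporter and orbit categories. The objects of the $p$-transporter category $\mathcal{T}_{\mathcal{C}}$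 are pairs $(X,P)$ with $X\in\mathrm{Ob}(\mathcal{C})$ and $P$ a not necessarily unitary $p$-subgroup of the monoid $\mathrm{End}_{\mathcal{C}}(X)$ (a finite $p$-group under composition, whose unit $1_P$ may be any idempotent). Morphisms $(X,P)\to(Y,Q)$ are triples $(s,P,Q)$ with $s\in\mathrm{Hom}_{\mathcal{C}}(X,Y)$, $s=s\circ1_P=1_Q\circ s$, $s\circ P\subseteq Q\circ s$; composition is induced from $\mathcal{C}$, and the identity of $(X,P)$ is $(1_P,P,P)$. The $p$-orbit category $\mathcal{O}_{\mathcal{C}}$ has the same objects and $\mathrm{Hom}_{\mathcal{O}_{\mathcal{C}}}((X,P),(Y,Q))=Q\backslash\mathrm{Hom}_{\mathcal{T}_{\mathcal{C}}}((X,P),(Y,Q))/P$. Weights. Idempotents $e\in\mathrm{End}_{\mathcal{D}}(X)$, $f\in\mathrm{End}_{\mathcal{D}}(Y)$ are isomorphic if there are $s\in f\circ\mathrm{Hom}_{\mathcal{D}}(X,Y)\circ e$, $t\in e\circ\mathrm{Hom}_{\mathcal{D}}(Y,X)\circ f$ with $t\circ s=e$, $s\circ t=f$; then $x\mapsto s\circ x\circ t$ induces an isomorphism $\varphi:kG_e\to kG_f$, unique up to inner automorphisms. For an algebra isomorphism $\varphi:A\to B$ and an $A$-module $T$, ${}_\varphi T$ is the $B$-module $T$ with structure map precomposed with $\varphi^{-1}$. Pairs $(e,T)$, $(f,T')$ are isomorphic if $e,f$ are isomorphic and ${}_\varphi T\cong T'$. A weight of $k\mathcal{D}$ is a pair $(e,T)$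 with $e$ an idempotent endomorphism in $\mathcal{D}$ and $T$ a simple projective $kG_e$-module; $\mathcal{W}(k\mathcal{D})$ is the set of isomorphism classes of weights. For a finite group $G$, a weight of $k\mathcal{O}_G$ is a pair $(P,T)$ with $P$ a $p$-subgroup of $G$ and $T$ a simple projective $k(N_G(P)/P)$-module. $b$-weights. If $b=1$, $\mathcal{W}(k\mathcal{O}_{\mathcal{C}},b):=\mathcal{W}(k\mathcal{O}_{\mathcal{C}})$. Let $\mathcal{C}$ be EI and $b$ a central idempotent of $k\mathcal{C}$. A weight of $k\mathcal{O}_{\mathcal{C}}$ is given by an object $(X,P)$ and a simple projective module $T$ over $k\,\mathrm{End}_{\mathcal{O}_{\mathcal{C}}}((X,P))=k(N_{G_e}(P)/P)$, $e=\mathrm{Id}_X$. For a group $G$ and a $p$-subgroup $P$, $\mathrm{br}_P^{kG}:(kG)^P\to kC_G(P)\subseteq kN_G(P)$ sends $\sum_{g\in G}\lambda_g g$ to $\sum_{g\in C_G(P)}\lambda_g g$. The weight is a $b$-weight if $\mathrm{br}_P^{kG_e}(eb)T\ne0$, with $T$ inflated to $kN_{G_e}(P)$; this depends only on its isomorphism class. $\mathcal{W}(k\mathcal{O}_{\mathcal{C}},b)$ is the set of isomorphism classes of $b$-weights. (For $b=1$ this is all of $\mathcal{W}(k\mathcal{O}_{\mathcal{C}})$.) Actions. $\sigma\in\Gamma$ acts on $k\mathcal{D}$ via coefficients, on modules by ${}^\sigma U$ ($U$ with structure map precomposed with $\sigma^{-1}$), and on weights by ${}^\sigma(e,T)=(e,{}^\sigma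 T)$. $\mathrm{Aut}(\mathcal{C})$ is the group of functors $\mathcal{F}:\mathcal{C}\to\mathcal{C}$ having a strict two-sided inverse functor; for a group $G$ it is the group of group automorphisms. $\mathcal{F}$ acts on $k\mathcal{C}$ by $s\mapsto\mathcal{F}(s)$ and on $\mathcal{S}(k\mathcal{C})$ by $U\mapsto{}_{\mathcal{F}}U$. $\mathcal{F}$ induces an automorphism of $\mathcal{O}_{\mathcal{C}}$ with $(X,P)\mapsto(\mathcal{F}(X),\mathcal{F}(P))$, and acts on weights of $k\mathcal{O}_{\mathcal{C}}$ by $(\bar e,T)\mapsto(\mathcal{F}(\bar e),{}_{\mathcal{F}}T)$, where ${}_{\mathcal F}T$ is transported along the isomorphism of group algebras induced by $\mathcal{F}$. These actions commute and give actions of $\Gamma\times\mathrm{Aut}(\mathcal{C})$ on idempotents of $Z(k\mathcal{C})$, on $\mathcal{S}(k\mathcal{C})$ and on $\mathcal{W}(k\mathcal{O}_{\mathcal{C}})$. A subscript $b$ denotes the stabiliser of $b$; e.g. $(H\times\mathrm{Aut}(\mathcal{C}))_b$ is the stabiliser of $b$ in $H\times\mathrm{Aut}(\mathcal{C})$, which acts on $\mathcal{S}(k\mathcal{C}b)$ and $\mathcal{W}(k\mathcal{O}_{\mathcal{C}},b)$. The same applies to the one-object category $G_e$ and the central idempotent $be=eb$ of $kG_e$. *)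

theory Defs
  imports
    "HOL-Algebra.Algebra"
    "HOL-Algebra.Algebraic_Closure_Type"
begin

section \<open>Finite categories\<close>

text \<open>\<open>cmp C s t\<close> is \<open>s \<circ> t\<close>; it is constrained only when \<open>src C s = tgt C t\<close>.\<close>

record ('o, 'm) category =
  Ob :: "'o set"
  Mor :: "'m set"
  src :: "'m \<Rightarrow> 'o"
  tgt :: "'m \<Rightarrow> 'o"
  ident :: "'o \<Rightarrow> 'm"
  cmp :: "'m \<Rightarrow> 'm \<Rightarrow> 'm"

definition Hom :: "('o, 'm) category \<Rightarrow> 'o \<Rightarrow> 'o \<Rightarrow> 'm set" where
  "Hom C V W = {s \<in> Mor C. src C s = V \<and> tgt C s = W}"

locale category =
  fixes C :: "('o, 'm) category"
  assumes src_closed: "s \<in> Mor C \<Longrightarrow> src C s \<in> Ob C"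
    and tgt_closed: "s \<in> Mor C \<Longrightarrow> tgt C s \<in> Ob C"
    and ident_closed: "V \<in> Ob C \<Longrightarrow> ident C V \<in> Hom C V V"
    and cmp_closed: "\<lbrakk>s \<in> Hom C W Z; t \<in> Hom C V W\<rbrakk> \<Longrightarrow> cmp C s t \<in> Hom C V Z"
    and cmp_ident_left: "s \<in> Hom C V W \<Longrightarrow> cmp C (ident C W) s = s"
    and cmp_ident_right: "s \<in> Hom C V W \<Longrightarrow> cmp C s (ident C V) = s"
    and cmp_assoc: "\<lbrakk>r \<in> Hom C W Z; s \<in> Hom C V W; t \<in> Hom C U V\<rbrakk>
      \<Longrightarrow> cmp C (cmp C r s) t = cmp C r (cmp C s t)"

locale finite_category = category +
  assumes finite_Mor: "finite (Mor C)"

definition is_isomorphism :: "('o, 'm) category \<Rightarrow> 'm \<Rightarrow> bool" where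
  "is_isomorphism C s \<longleftrightarrow> s \<in> Mor C \<and>
     (\<exists>t \<in> Hom C (tgt C s) (src C s).
        cmp C t s = ident C (src C s) \<and> cmp C s t = ident C (tgt C s))"

definition EI :: "('o, 'm) category \<Rightarrow> bool" where
  "EI C \<longleftrightarrow> (\<forall>V \<in> Ob C. \<forall>s \<in> Hom C V V. is_isomorphism C s)"

text \<open>A functor is a pair of an object map and a morphism map; only their values on
  \<open>Ob\<close> and \<open>Mor\<close> of the source category matter.\<close>

type_synonym ('o, 'm) endofunctor = "('o \<Rightarrow> 'o) \<times> ('m \<Rightarrow> 'm)"

definition is_endofunctor :: "('o, 'm) category \<Rightarrow> ('o, 'm) endofunctor \<Rightarrow> bool" where
  "is_endofunctor C F \<longleftrightarrow>
     (\<forall>V \<in> Ob C. fst F V \<in> Ob C \<and> snd F (ident C V) = ident C (fst F V)) \<and>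
     (\<forall>V W. \<forall>s \<in> Hom C V W. snd F s \<in> Hom C (fst F V) (fst F W)) \<and>
     (\<forall>V W Z. \<forall>s \<in> Hom C W Z. \<forall>t \<in> Hom C V W.
        snd F (cmp C s t) = cmp C (snd F s) (snd F t))"

definition Aut_cat :: "('o, 'm) category \<Rightarrow> ('o, 'm) endofunctor set" where
  "Aut_cat C = {F. is_endofunctor C F \<and> (\<exists>F'. is_endofunctor C F' \<and>
     (\<forall>V \<in> Ob C. fst F' (fst F V) = V \<and> fst F (fst F' V) = V) \<and>
     (\<forall>s \<in> Mor C. snd F' (snd F s) = s \<and> snd F (snd F' s) = s))}"

definition idem_endo :: "('o, 'm) category \<Rightarrow> 'm \<Rightarrow> bool" where
  "idem_endo C e \<longleftrightarrow> e \<in> Mor C \<and> src C e = tgt C e \<and> cmp C e e = e"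

definition idem_monoid :: "('o, 'm) category \<Rightarrow> 'm \<Rightarrow> 'm monoid" where
  "idem_monoid C e = \<lparr>carrier = {cmp C e (cmp C x e) | x. x \<in> Hom C (src C e) (src C e)},
     monoid.mult = cmp C, one = e\<rparr>"

definition idem_group :: "('o, 'm) category \<Rightarrow> 'm \<Rightarrow> 'm monoid" where
  "idem_group C e = units_of (idem_monoid C e)"

definition group_category :: "'m monoid \<Rightarrow> (unit, 'm) category" where
  "group_category G = \<lparr>Ob = UNIV, Mor = carrier G, src = (\<lambda>_. ()), tgt = (\<lambda>_. ()),
     ident = (\<lambda>_. \<one>\<^bsub>G\<^esub>), cmp = monoid.mult G\<rparr>"


section \<open>Transporter and orbit categories\<close>

text \<open>A \<open>p\<close>-subgroup of the monoid \<open>End(V)\<close> need not contain the identity of \<open>V\<close>.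
  The condition on \<open>card P\<close> forces \<open>P\<close> to be finite.\<close>

definition p_subgroup :: "nat \<Rightarrow> ('o, 'm) category \<Rightarrow> 'o \<Rightarrow> 'm set \<Rightarrow> bool" where
  "p_subgroup p C V P \<longleftrightarrow> P \<subseteq> Hom C V V \<and>
     (\<exists>u. group \<lparr>carrier = P, monoid.mult = cmp C, one = u\<rparr>) \<and> (\<exists>n. card P = p ^ n)"

definition sub_unit :: "('o, 'm) category \<Rightarrow> 'm set \<Rightarrow> 'm" where
  "sub_unit C P = (THE u. group \<lparr>carrier = P, monoid.mult = cmp C, one = u\<rparr>)"

definition transporter_category ::
    "nat \<Rightarrow> ('o, 'm) category \<Rightarrow> ('o \<times> 'm set, 'm \<times> 'm set \<times> 'm set) category" where
  "transporter_category p C = \<lparr>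
     Ob = {(V, P). V \<in> Ob C \<and> p_subgroup p C V P},
     Mor = {(s, P, Q). s \<in> Mor C \<and> p_subgroup p C (src C s) P \<and> p_subgroup p C (tgt C s) Q \<and>
              s = cmp C s (sub_unit C P) \<and> s = cmp C (sub_unit C Q) s \<and>
              (\<lambda>u. cmp C s u) ` P \<subseteq> (\<lambda>v. cmp C v s) ` Q},
     src = (\<lambda>(s, P, Q). (src C s, P)),
     tgt = (\<lambda>(s, P, Q). (tgt C s, Q)),
     ident = (\<lambda>(V, P). (sub_unit C P, P, P)),
     cmp = (\<lambda>(t, Q', R) (s, P, Q). (cmp C t s, P, R))\<rparr>"

fun orbit_of :: "('o, 'm) category \<Rightarrow> 'm \<times> 'm set \<times> 'm set \<Rightarrow> ('m \<times> 'm set \<times> 'm set) set" where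
  "orbit_of C (s, P, Q) = {(cmp C v (cmp C s u), P, Q) | u v. u \<in> P \<and> v \<in> Q}"

text \<open>Morphisms of the orbit category are the double orbits of morphisms of the transporter
  category. All members of such an orbit have the same source and target. As
  \<open>t \<circ> Q \<subseteq> R \<circ> t\<close>, the elementwise product of \<open>R \<circ> t \<circ> Q\<close> and \<open>Q \<circ> s \<circ> P\<close>
  is the orbit \<open>R \<circ> t \<circ> s \<circ> P\<close>.\<close>

definition orbit_category :: "nat \<Rightarrow> ('o, 'm) category
    \<Rightarrow> ('o \<times> 'm set, ('m \<times> 'm set \<times> 'm set) set) category" where
  "orbit_category p C = (let T = transporter_category p C in \<lparr>
     Ob = Ob T,
     Mor = orbit_of C ` Mor T,
     src = (\<lambda>A. src T (SOME t. t \<in> A)),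
     tgt = (\<lambda>A. tgt T (SOME t. t \<in> A)),
     ident = (\<lambda>VP. orbit_of C (ident T VP)),
     cmp = (\<lambda>A B. {cmp T t s | t s. t \<in> A \<and> s \<in> B})\<rparr>)"

definition orbit_functor :: "('o, 'm) endofunctor
    \<Rightarrow> ('o \<times> 'm set, ('m \<times> 'm set \<times> 'm set) set) endofunctor" where
  "orbit_functor F = ((\<lambda>(V, P). (fst F V, snd F ` P)),
     (\<lambda>A. (\<lambda>(s, P, Q). (snd F s, snd F ` P, snd F ` Q)) ` A))"


section \<open>Category algebras\<close>

text \<open>Elements of \<open>kD\<close> are coefficient functions vanishing outside \<open>Mor D\<close>. The definition
  is meant for categories with finitely many morphisms.\<close>

definition cat_algebra :: "('o, 'm) category \<Rightarrow> ('m \<Rightarrow> 'k::field) ring" where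
  "cat_algebra D = \<lparr>
     carrier = {f. \<forall>m. m \<notin> Mor D \<longrightarrow> f m = 0},
     monoid.mult = (\<lambda>f g m. \<Sum>(s, t) \<in> {(s, t). s \<in> Mor D \<and> t \<in> Mor D \<and>
                      src D s = tgt D t \<and> cmp D s t = m}. f s * g t),
     one = (\<lambda>m. if m \<in> ident D ` Ob D then 1 else 0),
     ring.zero = (\<lambda>_. 0),
     add = (\<lambda>f g m. f m + g m)\<rparr>"

definition basis_elt :: "'m \<Rightarrow> 'm \<Rightarrow> 'k::field" where
  "basis_elt s = (\<lambda>m. if m = s then 1 else 0)"

definition group_algebra :: "'m monoid \<Rightarrow> ('m \<Rightarrow> 'k::field) ring" where
  "group_algebra G = cat_algebra (group_category G)"

definition central_idempotent :: "('a, 'c) ring_scheme \<Rightarrow> 'a \<Rightarrow> bool" where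
  "central_idempotent A b \<longleftrightarrow> b \<in> carrier A \<and> b \<otimes>\<^bsub>A\<^esub> b = b \<and>
     (\<forall>a \<in> carrier A. a \<otimes>\<^bsub>A\<^esub> b = b \<otimes>\<^bsub>A\<^esub> a)"

definition block_algebra :: "'a ring \<Rightarrow> 'a \<Rightarrow> 'a ring" where
  "block_algebra A b = A\<lparr>carrier := {a \<otimes>\<^bsub>A\<^esub> b | a. a \<in> carrier A}, one := b\<rparr>"

text \<open>The additive map which on basis elements is \<open>\<lambda>s \<mapsto> \<sigma>(\<lambda>)g(s)\<close>, for \<open>s \<in> S\<close>. For
  \<open>\<sigma> = id\<close> it is the linear extension of \<open>g\<close>.\<close>

definition semilin_ext :: "('k \<Rightarrow> 'k) \<Rightarrow> 'm set \<Rightarrow> ('m \<Rightarrow> 'n) \<Rightarrow> ('m \<Rightarrow> 'k) \<Rightarrow> 'n \<Rightarrow> 'k::field"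
  where "semilin_ext \<sigma> S g a = (\<lambda>n. \<sigma> (\<Sum>s \<in> {s \<in> S. g s = n}. a s))"


section \<open>Modules over rings which need not be commutative\<close>

text \<open>The module record of HOL-Algebra is used, whose locale requires a commutative base ring.
  The ring multiplication and the unit stored in that record play no role.\<close>

locale left_module = R?: ring R + M?: abelian_group M
  for R :: "('a, 'c) ring_scheme" and M :: "('a, 'u, 'd) module_scheme" (structure) +
  assumes smult_closed: "\<lbrakk>a \<in> carrier R; x \<in> carrier M\<rbrakk> \<Longrightarrow> a \<odot>\<^bsub>M\<^esub> x \<in> carrier M"
    and smult_l_distr: "\<lbrakk>a \<in> carrier R; b \<in> carrier R; x \<in> carrier M\<rbrakk>
      \<Longrightarrow> (a \<oplus>\<^bsub>R\<^esub> b) \<odot>\<^bsub>M\<^esub> x = a \<odot>\<^bsub>M\<^esub> x \<oplus>\<^bsub>M\<^esub> b \<odot>\<^bsub>M\<^esub> x"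
    and smult_r_distr: "\<lbrakk>a \<in> carrier R; x \<in> carrier M; y \<in> carrier M\<rbrakk>
      \<Longrightarrow> a \<odot>\<^bsub>M\<^esub> (x \<oplus>\<^bsub>M\<^esub> y) = a \<odot>\<^bsub>M\<^esub> x \<oplus>\<^bsub>M\<^esub> a \<odot>\<^bsub>M\<^esub> y"
    and smult_assoc1: "\<lbrakk>a \<in> carrier R; b \<in> carrier R; x \<in> carrier M\<rbrakk>
      \<Longrightarrow> (a \<otimes>\<^bsub>R\<^esub> b) \<odot>\<^bsub>M\<^esub> x = a \<odot>\<^bsub>M\<^esub> (b \<odot>\<^bsub>M\<^esub> x)"
    and smult_one: "x \<in> carrier M \<Longrightarrow> \<one>\<^bsub>R\<^esub> \<odot>\<^bsub>M\<^esub> x = x"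

definition module_hom :: "'a ring \<Rightarrow> ('a, 'u) module \<Rightarrow> ('a, 'v) module \<Rightarrow> ('u \<Rightarrow> 'v) set" where
  "module_hom A M N = {h \<in> hom (add_monoid M) (add_monoid N).
     \<forall>a \<in> carrier A. \<forall>x \<in> carrier M. h (a \<odot>\<^bsub>M\<^esub> x) = a \<odot>\<^bsub>N\<^esub> h x}"

definition module_iso :: "'a ring \<Rightarrow> ('a, 'u) module \<Rightarrow> ('a, 'v) module \<Rightarrow> bool" where
  "module_iso A M N \<longleftrightarrow> (\<exists>h \<in> module_hom A M N. bij_betw h (carrier M) (carrier N))"

definition simple_module :: "'a ring \<Rightarrow> ('a, 'u) module \<Rightarrow> bool" where
  "simple_module A M \<longleftrightarrow> left_module A M \<and> carrier M \<noteq> {\<zero>\<^bsub>M\<^esub>} \<and>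
     (\<forall>N. submodule N A M \<longrightarrow> N = {\<zero>\<^bsub>M\<^esub>} \<or> N = carrier M)"

text \<open>The lifting property along surjections \<open>M \<rightarrow> N\<close>. The carrier types allow \<open>N = T\<close> and
  \<open>M\<close> the free module on the set \<open>T\<close>, so modules over further types would not change the
  notion.\<close>

definition projective_module :: "'a ring \<Rightarrow> ('a, 'u) module \<Rightarrow> bool" where
  "projective_module A T \<longleftrightarrow> left_module A T \<and>
     (\<forall>(M :: ('a, 'u \<Rightarrow> 'a) module) (N :: ('a, 'u) module).
        left_module A M \<longrightarrow> left_module A N \<longrightarrow>
        (\<forall>g \<in> module_hom A M N. \<forall>h \<in> module_hom A T N. g ` carrier M = carrier N \<longrightarrow>
           (\<exists>l \<in> module_hom A T M. \<forall>x \<in> carrier T. g (l x) = h x)))"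

text \<open>Transport of a module along a ring isomorphism \<open>\<phi>\<close> with domain \<open>A\<close>: the structure map is
  precomposed with the inverse of \<open>\<phi>\<close>.\<close>

definition twist :: "'a ring \<Rightarrow> ('a \<Rightarrow> 'a) \<Rightarrow> ('a, 'u) module \<Rightarrow> ('a, 'u) module" where
  "twist A \<phi> M = M\<lparr>module.smult := (\<lambda>a. module.smult M (inv_into (carrier A) \<phi> a))\<rparr>"

text \<open>Isomorphism classes are formed inside a fixed universe of modules. Every module of finite
  dimension over \<open>k\<close>, hence every simple module over an algebra of finite dimension, is
  isomorphic to one with carrier in \<open>nat \<Rightarrow> 'k\<close>.\<close>

type_synonym ('m, 'k) kmodule = "('m \<Rightarrow> 'k, nat \<Rightarrow> 'k) module"

definition simple_iso_rel ::
    "('m \<Rightarrow> 'k::field) ring \<Rightarrow> (('m, 'k) kmodule \<times> ('m, 'k) kmodule) set" where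
  "simple_iso_rel A = {(M, N). simple_module A M \<and> simple_module A N \<and> module_iso A M N}"

definition simple_classes :: "('m \<Rightarrow> 'k::field) ring \<Rightarrow> ('m, 'k) kmodule set set" where
  "simple_classes A = Collect (simple_module A) // simple_iso_rel A"


section \<open>Weights\<close>

type_synonym ('m, 'k) weight = "'m \<times> ('m, 'k) kmodule"

fun is_weight :: "('o, 'm) category \<Rightarrow> ('m, 'k::field) weight \<Rightarrow> bool" where
  "is_weight D (e, T) \<longleftrightarrow> idem_endo D e \<and>
     simple_module (group_algebra (idem_group D e)) T \<and>
     projective_module (group_algebra (idem_group D e)) T"

fun weights_isomorphic :: "('o, 'm) category \<Rightarrow> ('m, 'k::field) weight \<Rightarrow> ('m, 'k) weight \<Rightarrow> bool" where
  "weights_isomorphic D (e, T) (f, T') \<longleftrightarrow>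
     (\<exists>s \<in> {cmp D f (cmp D x e) | x. x \<in> Hom D (src D e) (src D f)}.
      \<exists>t \<in> {cmp D e (cmp D x f) | x. x \<in> Hom D (src D f) (src D e)}.
        cmp D t s = e \<and> cmp D s t = f \<and>
        module_iso (group_algebra (idem_group D f))
          (twist (group_algebra (idem_group D e))
             (semilin_ext id (carrier (idem_group D e)) (\<lambda>x. cmp D s (cmp D x t))) T) T')"

definition weight_iso_rel ::
    "('o, 'm) category \<Rightarrow> (('m, 'k::field) weight \<times> ('m, 'k) weight) set" where
  "weight_iso_rel D = {(w, w'). is_weight D w \<and> is_weight D w' \<and> weights_isomorphic D w w'}"

definition brauer_map :: "'m monoid \<Rightarrow> 'm set \<Rightarrow> ('m \<Rightarrow> 'k::field) \<Rightarrow> 'm \<Rightarrow> 'k" where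
  "brauer_map G P a =
     (\<lambda>g. if g \<in> carrier G \<and> (\<forall>u \<in> P. g \<otimes>\<^bsub>G\<^esub> u = u \<otimes>\<^bsub>G\<^esub> g) then a g else 0)"

text \<open>A module for the group algebra of \<open>N\<^bsub>G\<^esub>(P)/P = End((V, P))\<close> in the orbit category, inflated
  along \<open>n \<mapsto> \<close> orbit of \<open>(n, P, P)\<close>.\<close>

definition inflate :: "('o, 'm) category \<Rightarrow> 'm monoid \<Rightarrow> 'm set
    \<Rightarrow> (('m \<times> 'm set \<times> 'm set) set, 'k::field) kmodule \<Rightarrow> ('m, 'k) kmodule" where
  "inflate C G P T = \<lparr>carrier = carrier T, monoid.mult = monoid.mult T, one = one T,
     ring.zero = ring.zero T, add = add T,
     module.smult = (\<lambda>a. module.smult T (semilin_ext id (normalizer G P) (\<lambda>n. orbit_of C (n, P, P)) a))\<rparr>"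

text \<open>The case \<open>b = 1\<close> is separate because it is also used when \<open>C\<close> is not EI.\<close>

fun is_b_weight :: "nat \<Rightarrow> ('o, 'm) category \<Rightarrow> ('m \<Rightarrow> 'k::field)
    \<Rightarrow> (('m \<times> 'm set \<times> 'm set) set, 'k) weight \<Rightarrow> bool" where
  "is_b_weight p C b (d, T) \<longleftrightarrow> is_weight (orbit_category p C) (d, T) \<and>
     (b = \<one>\<^bsub>cat_algebra C\<^esub> \<or>
      (let (V, P) = src (orbit_category p C) d;
           e = ident C V;
           G = idem_group C e;
           eb = basis_elt e \<otimes>\<^bsub>cat_algebra C\<^esub> b
       in \<exists>x \<in> carrier T. brauer_map G P eb \<odot>\<^bsub>inflate C G P T\<^esub> x \<noteq> \<zero>\<^bsub>T\<^esub>))"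

definition b_weight_classes :: "nat \<Rightarrow> ('o, 'm) category \<Rightarrow> ('m \<Rightarrow> 'k::field)
    \<Rightarrow> (('m \<times> 'm set \<times> 'm set) set, 'k) weight set set" where
  "b_weight_classes p C b = Collect (is_b_weight p C b) // weight_iso_rel (orbit_category p C)"


section \<open>Actions\<close>

definition galois_group :: "'k itself \<Rightarrow> ('k::field \<Rightarrow> 'k) monoid" where
  "galois_group _ = \<lparr>carrier = {\<sigma> \<in> ring_iso ring_of_type_algebra ring_of_type_algebra.
       \<forall>x \<in> range of_int. \<sigma> x = x},
     monoid.mult = (\<circ>), one = id\<rparr>"

definition galois_stab :: "('o, 'm) category \<Rightarrow> ('m \<Rightarrow> 'k::field) \<Rightarrow> ('k \<Rightarrow> 'k) monoid" where
  "galois_stab C b = (galois_group TYPE('k))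
     \<lparr>carrier := {\<sigma> \<in> carrier (galois_group TYPE('k)). semilin_ext \<sigma> (Mor C) id b = b}\<rparr>"

definition stab :: "('k \<Rightarrow> 'k) set \<Rightarrow> ('o, 'm) category \<Rightarrow> ('m \<Rightarrow> 'k::field)
    \<Rightarrow> (('k \<Rightarrow> 'k) \<times> ('o, 'm) endofunctor) set" where
  "stab H C b = {(\<sigma>, F). \<sigma> \<in> H \<and> F \<in> Aut_cat C \<and> semilin_ext \<sigma> (Mor C) (snd F) b = b}"

definition simple_act :: "('o, 'm) category \<Rightarrow> ('m \<Rightarrow> 'k::field) \<Rightarrow> ('k \<Rightarrow> 'k)
    \<Rightarrow> ('o, 'm) endofunctor \<Rightarrow> ('m, 'k) kmodule set \<Rightarrow> ('m, 'k) kmodule set" where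
  "simple_act C b \<sigma> F c = (let A = block_algebra (cat_algebra C) b in
     simple_iso_rel A `` (twist A (semilin_ext \<sigma> (Mor C) (snd F)) ` c))"

fun weight_twist :: "('o, 'm) category \<Rightarrow> ('k \<Rightarrow> 'k) \<Rightarrow> ('o, 'm) endofunctor
    \<Rightarrow> ('m, 'k::field) weight \<Rightarrow> ('m, 'k) weight" where
  "weight_twist D \<sigma> F (e, T) = (snd F e,
     twist (group_algebra (idem_group D e))
       (semilin_ext \<sigma> (carrier (idem_group D e)) (snd F)) T)"

definition weight_act :: "nat \<Rightarrow> ('o, 'm) category \<Rightarrow> ('k \<Rightarrow> 'k) \<Rightarrow> ('o, 'm) endofunctor
    \<Rightarrow> (('m \<times> 'm set \<times> 'm set) set, 'k::field) weight set
    \<Rightarrow> (('m \<times> 'm set \<times> 'm set) set, 'k) weight set" where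
  "weight_act p C \<sigma> F c = weight_iso_rel (orbit_category p C) ``
     (weight_twist (orbit_category p C) \<sigma> (orbit_functor F) ` c)"

text \<open>For a one-object category \<open>group_category G\<close>, \<open>Aut_cat\<close> amounts to the group automorphisms
  of \<open>G\<close>.\<close>

definition has_equivariant_bij ::
    "nat \<Rightarrow> ('k \<Rightarrow> 'k) set \<Rightarrow> ('o, 'm) category \<Rightarrow> ('m \<Rightarrow> 'k::field) \<Rightarrow> bool" where
  "has_equivariant_bij p H C b \<longleftrightarrow>
     (\<exists>\<Phi>. bij_betw \<Phi> (simple_classes (block_algebra (cat_algebra C) b)) (b_weight_classes p C b) \<and>
        (\<forall>(\<sigma>, F) \<in> stab H C b. \<forall>c \<in> simple_classes (block_algebra (cat_algebra C) b).
           \<Phi> (simple_act C b \<sigma> F c) = weight_act p C \<sigma> F (\<Phi> c)))"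

end

theory Submission
  imports Defs
begin

text \<open>Both sides are fibred over the isomorphism classes of idempotents \<open>e\<close> of \<open>C\<close>. A simple
  \<open>kCb\<close>-module \<open>U\<close> has an apex: an idempotent \<open>e\<close>, unique up to isomorphism, with \<open>eU \<noteq> 0\<close> on which
  the non-invertible elements of \<open>e End(X) e\<close> act as zero; and \<open>U \<mapsto> eU\<close> identifies the simple
  \<open>kCb\<close>-modules with apex \<open>e\<close> with the simple \<open>kG\<^sub>e eb\<close>-modules. On the other side every idempotent of
  the orbit category is isomorphic to the identity of some \<open>(X, P)\<close>, and the weights at those \<open>(X, P)\<close>
  with \<open>1\<^sub>P = e\<close> are the weights of the orbit category of \<open>G\<^sub>e\<close>. A pair \<open>(\<sigma>, F)\<close> for which \<open>F(e)\<close> is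
  isomorphic to \<open>e\<close> acts on both fibres over \<open>e\<close> through \<open>\<sigma>\<close> and an automorphism \<open>x \<mapsto> s F(x) t\<close> of
  \<open>G\<^sub>e\<close>, so the given bijections can be used on one fibre for each orbit and transported to the
  others.\<close>

section \<open>Semilinear isomorphisms\<close>

text \<open>Twists, group actions and isomorphisms of weights all change the structure map of a
  module and determine the result only up to isomorphism. They are therefore expressed by one
  relation, the existence of a semilinear bijection, and a class may be computed with any module so
  related.

  The automorphism \<open>x \<mapsto> s F(x) t\<close> of \<open>G\<^sub>e\<close> depends on the
  witnesses \<open>s\<close> and \<open>t\<close>; other witnesses change it by an inner
  automorphism. No canonical choice is made: one pair is used for the simple modules and for the
  weights alike, and the given bijection for \<open>G\<^sub>e\<close> is equivariant for whatever
  automorphism results.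

  The two cases for \<open>b\<close> are there to keep \<open>eb\<close> in
  \<open>kG\<^sub>e\<close>. In the monoid \<open>{1, z}\<close> with zero \<open>z\<close>, the
  central idempotent \<open>b = z\<close> with \<open>e = 1\<close> would violate this.

  The weight side uses no representation theory: at \<open>(X, P)\<close> the orbit categories of
  \<open>C\<close> and of \<open>G\<^sub>e\<close> have the same automorphism group, so the same
  modules serve. The existence of an apex is the semigroup argument that a minimal principal ideal
  not annihilating \<open>U\<close> is generated by an idempotent.\<close>

definition semi_iso :: "'a ring \<Rightarrow> ('a \<Rightarrow> 'a) \<Rightarrow> ('a, 'u) module \<Rightarrow> ('a, 'v) module \<Rightarrow> bool" where
  "semi_iso A \<phi> M N \<longleftrightarrow> (\<exists>h. bij_betw h (carrier M) (carrier N) \<and>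
     (\<forall>x \<in> carrier M. \<forall>y \<in> carrier M. h (x \<oplus>\<^bsub>M\<^esub> y) = h x \<oplus>\<^bsub>N\<^esub> h y) \<and>
     (\<forall>a \<in> carrier A. \<forall>x \<in> carrier M. h (a \<odot>\<^bsub>M\<^esub> x) = \<phi> a \<odot>\<^bsub>N\<^esub> h x))"

lemma semi_isoI:
  assumes "bij_betw h (carrier M) (carrier N)"
    and "\<And>x y. \<lbrakk>x \<in> carrier M; y \<in> carrier M\<rbrakk> \<Longrightarrow> h (x \<oplus>\<^bsub>M\<^esub> y) = h x \<oplus>\<^bsub>N\<^esub> h y"
    and "\<And>a x. \<lbrakk>a \<in> carrier A; x \<in> carrier M\<rbrakk> \<Longrightarrow> h (a \<odot>\<^bsub>M\<^esub> x) = \<phi> a \<odot>\<^bsub>N\<^esub> h x"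
  shows "semi_iso A \<phi> M N"
  using assms unfolding semi_iso_def by blast

lemma semi_isoE:
  assumes "semi_iso A \<phi> M N"
  obtains h where "bij_betw h (carrier M) (carrier N)"
    and "\<And>x y. \<lbrakk>x \<in> carrier M; y \<in> carrier M\<rbrakk> \<Longrightarrow> h (x \<oplus>\<^bsub>M\<^esub> y) = h x \<oplus>\<^bsub>N\<^esub> h y"
    and "\<And>a x. \<lbrakk>a \<in> carrier A; x \<in> carrier M\<rbrakk> \<Longrightarrow> h (a \<odot>\<^bsub>M\<^esub> x) = \<phi> a \<odot>\<^bsub>N\<^esub> h x"
  using assms unfolding semi_iso_def by blast

lemma module_iso_iff: "module_iso A M N \<longleftrightarrow> semi_iso A id M N"
proof
  assume "module_iso A M N"
  then obtain h where "h \<in> module_hom A M N" "bij_betw h (carrier M) (carrier N)"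
    unfolding module_iso_def by blast
  then show "semi_iso A id M N"
    unfolding module_hom_def hom_def by (intro semi_isoI[of h]) auto
next
  assume "semi_iso A id M N"
  then obtain h where "bij_betw h (carrier M) (carrier N)"
     "\<And>x y. \<lbrakk>x \<in> carrier M; y \<in> carrier M\<rbrakk> \<Longrightarrow> h (x \<oplus>\<^bsub>M\<^esub> y) = h x \<oplus>\<^bsub>N\<^esub> h y"
     "\<And>a x. \<lbrakk>a \<in> carrier A; x \<in> carrier M\<rbrakk> \<Longrightarrow> h (a \<odot>\<^bsub>M\<^esub> x) = id a \<odot>\<^bsub>N\<^esub> h x"
    unfolding semi_iso_def by blast
  then show "module_iso A M N"
    unfolding module_iso_def module_hom_def hom_def by (intro bexI[of _ h]) (auto simp: bij_betw_def)
qed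

lemma semi_iso_comp:
  assumes "semi_iso A \<phi> M N" "semi_iso B \<psi> N L" "\<phi> \<in> carrier A \<rightarrow> carrier B"
    and "\<And>a. a \<in> carrier A \<Longrightarrow> \<chi> a = \<psi> (\<phi> a)"
  shows "semi_iso A \<chi> M L"
proof -
  from assms(1) obtain h where h: "bij_betw h (carrier M) (carrier N)"
     "\<And>x y. \<lbrakk>x \<in> carrier M; y \<in> carrier M\<rbrakk> \<Longrightarrow> h (x \<oplus>\<^bsub>M\<^esub> y) = h x \<oplus>\<^bsub>N\<^esub> h y"
     "\<And>a x. \<lbrakk>a \<in> carrier A; x \<in> carrier M\<rbrakk> \<Longrightarrow> h (a \<odot>\<^bsub>M\<^esub> x) = \<phi> a \<odot>\<^bsub>N\<^esub> h x"
    unfolding semi_iso_def by blast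
  from assms(2) obtain k where k: "bij_betw k (carrier N) (carrier L)"
     "\<And>x y. \<lbrakk>x \<in> carrier N; y \<in> carrier N\<rbrakk> \<Longrightarrow> k (x \<oplus>\<^bsub>N\<^esub> y) = k x \<oplus>\<^bsub>L\<^esub> k y"
     "\<And>a x. \<lbrakk>a \<in> carrier B; x \<in> carrier N\<rbrakk> \<Longrightarrow> k (a \<odot>\<^bsub>N\<^esub> x) = \<psi> a \<odot>\<^bsub>L\<^esub> k x"
    unfolding semi_iso_def by blast
  have hN: "h x \<in> carrier N" if "x \<in> carrier M" for x
    using h(1) that by (auto simp: bij_betw_def)
  show ?thesis
    by (rule semi_isoI[where h = "k \<circ> h"])
      (use h k hN assms(3,4) in \<open>auto simp: bij_betw_trans Pi_iff\<close>)
qed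

lemma semi_iso_cong:
  assumes "semi_iso A \<phi> M N" "\<And>a. a \<in> carrier A \<Longrightarrow> \<psi> a = \<phi> a"
  shows "semi_iso A \<psi> M N"
  using assms unfolding semi_iso_def by auto

lemma semi_iso_refl: "semi_iso A id M M"
  by (rule semi_isoI[where h = id]) auto

text \<open>Applying \<open>h\<close> to \<open>\<psi> c\<close> times the preimage of
  \<open>x\<close> gives \<open>\<phi> (\<psi> c) = c\<close> times \<open>x\<close>, so the inverse
  bijection is semilinear along a right inverse \<open>\<psi>\<close> of
  \<open>\<phi>\<close>.\<close>

lemma semi_iso_inv:
  assumes "semi_iso A \<phi> M N" "left_module A M"
    and \<psi>: "\<And>c. c \<in> carrier B \<Longrightarrow> \<psi> c \<in> carrier A" "\<And>c. c \<in> carrier B \<Longrightarrow> \<phi> (\<psi> c) = c"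
  shows "semi_iso B \<psi> N M"
proof -
  interpret left_module A M by fact
  from assms(1) obtain h where h: "bij_betw h (carrier M) (carrier N)"
     "\<And>x y. \<lbrakk>x \<in> carrier M; y \<in> carrier M\<rbrakk> \<Longrightarrow> h (x \<oplus>\<^bsub>M\<^esub> y) = h x \<oplus>\<^bsub>N\<^esub> h y"
     "\<And>a x. \<lbrakk>a \<in> carrier A; x \<in> carrier M\<rbrakk> \<Longrightarrow> h (a \<odot>\<^bsub>M\<^esub> x) = \<phi> a \<odot>\<^bsub>N\<^esub> h x"
    unfolding semi_iso_def by blast
  let ?k = "inv_into (carrier M) h"
  have kM: "?k y \<in> carrier M" "h (?k y) = y" if "y \<in> carrier N" for y
    using h(1) that by (auto simp: bij_betw_def inv_into_into f_inv_into_f)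
  have kh: "?k (h x) = x" if "x \<in> carrier M" for x
    using h(1) that by (auto simp: bij_betw_def)
  show ?thesis
  proof (rule semi_isoI[where h = ?k])
    show "bij_betw ?k (carrier N) (carrier M)" using h(1) by (rule bij_betw_inv_into)
    show "?k (x \<oplus>\<^bsub>N\<^esub> y) = ?k x \<oplus>\<^bsub>M\<^esub> ?k y" if "x \<in> carrier N" "y \<in> carrier N" for x y
      using h(2)[of "?k x" "?k y"] kM that kh M.a_closed by metis
    show "?k (a \<odot>\<^bsub>N\<^esub> x) = \<psi> a \<odot>\<^bsub>M\<^esub> ?k x" if "a \<in> carrier B" "x \<in> carrier N" for a x
      using h(3)[of "\<psi> a" "?k x"] kM that kh \<psi> smult_closed by metis
  qed
qed

text \<open>The identity map works: \<open>twist\<close> precomposes with \<open>inv_into\<close>,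
  which undoes \<open>\<phi>\<close> on the carrier by injectivity.\<close>

lemma semi_iso_twist: "inj_on \<phi> (carrier A) \<Longrightarrow> semi_iso A \<phi> M (twist A \<phi> M)"
  by (rule semi_isoI[where h = id]) (auto simp: twist_def)

lemma ring_isoD:
  assumes "\<phi> \<in> ring_iso A B"
  shows "\<And>a. a \<in> carrier A \<Longrightarrow> \<phi> a \<in> carrier B"
    "\<And>a b. \<lbrakk>a \<in> carrier A; b \<in> carrier A\<rbrakk> \<Longrightarrow> \<phi> (a \<otimes>\<^bsub>A\<^esub> b) = \<phi> a \<otimes>\<^bsub>B\<^esub> \<phi> b"
    "\<And>a b. \<lbrakk>a \<in> carrier A; b \<in> carrier A\<rbrakk> \<Longrightarrow> \<phi> (a \<oplus>\<^bsub>A\<^esub> b) = \<phi> a \<oplus>\<^bsub>B\<^esub> \<phi> b"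
    "\<phi> \<one>\<^bsub>A\<^esub> = \<one>\<^bsub>B\<^esub>"
    "bij_betw \<phi> (carrier A) (carrier B)" "inj_on \<phi> (carrier A)"
    "\<And>b. b \<in> carrier B \<Longrightarrow> inv_into (carrier A) \<phi> b \<in> carrier A"
    "\<And>b. b \<in> carrier B \<Longrightarrow> \<phi> (inv_into (carrier A) \<phi> b) = b"
    "\<And>a. a \<in> carrier A \<Longrightarrow> inv_into (carrier A) \<phi> (\<phi> a) = a"
  using assms unfolding ring_iso_def ring_hom_def
  by (auto simp: bij_betw_def inv_into_into f_inv_into_f)

lemma ring_iso_inv_into:
  assumes "\<phi> \<in> ring_iso A B" "ring A"
  shows "inv_into (carrier A) \<phi> \<in> ring_iso B A"
  using ring_iso_set_sym[OF assms(2,1)] .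

lemma twist_left_module:
  assumes \<phi>: "\<phi> \<in> ring_iso A B" and "left_module A M" "ring B"
  shows "left_module B (twist A \<phi> M)"
proof -
  interpret left_module A M by fact
  interpret B: ring B by fact
  let ?\<psi> = "inv_into (carrier A) \<phi>"
  note \<psi> = ring_isoD[OF ring_iso_inv_into[OF \<phi> R.ring_axioms]]
  have "abelian_group (twist A \<phi> M)"
    using M.abelian_group_axioms
    unfolding twist_def abelian_group_def abelian_monoid_def abelian_group_axioms_def by simp
  then interpret T: abelian_group "twist A \<phi> M" .
  show ?thesis
    apply (unfold_locales)
    using \<psi> smult_closed smult_l_distr smult_r_distr smult_assoc1 smult_one
    by (auto simp: twist_def)
qed

section \<open>Left modules, and simplicity in terms of generators\<close>

context left_module begin

lemma smult_zero_left: "x \<in> carrier M \<Longrightarrow> \<zero>\<^bsub>R\<^esub> \<odot>\<^bsub>M\<^esub> x = \<zero>\<^bsub>M\<^esub>"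
proof -
  assume x: "x \<in> carrier M"
  have "\<zero>\<^bsub>R\<^esub> \<odot>\<^bsub>M\<^esub> x \<oplus>\<^bsub>M\<^esub> \<zero>\<^bsub>R\<^esub> \<odot>\<^bsub>M\<^esub> x = \<zero>\<^bsub>R\<^esub> \<odot>\<^bsub>M\<^esub> x"
    using x by (simp add: smult_l_distr[symmetric])
  then show ?thesis using smult_closed x by (simp add: M.add.l_cancel_one')
qed

lemma smult_zero_right: "a \<in> carrier R \<Longrightarrow> a \<odot>\<^bsub>M\<^esub> \<zero>\<^bsub>M\<^esub> = \<zero>\<^bsub>M\<^esub>"
proof -
  assume a: "a \<in> carrier R"
  have "a \<odot>\<^bsub>M\<^esub> \<zero>\<^bsub>M\<^esub> \<oplus>\<^bsub>M\<^esub> a \<odot>\<^bsub>M\<^esub> \<zero>\<^bsub>M\<^esub> = a \<odot>\<^bsub>M\<^esub> \<zero>\<^bsub>M\<^esub>"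
    using a by (simp add: smult_r_distr[symmetric])
  then show ?thesis using smult_closed a by (simp add: M.add.l_cancel_one')
qed

lemma smult_neg_right:
  assumes "a \<in> carrier R" "x \<in> carrier M" shows "a \<odot>\<^bsub>M\<^esub> (\<ominus>\<^bsub>M\<^esub> x) = \<ominus>\<^bsub>M\<^esub> (a \<odot>\<^bsub>M\<^esub> x)"
  using assms
  by (intro M.minus_equality[symmetric])
    (simp_all add: smult_closed smult_zero_right M.l_neg flip: smult_r_distr)

lemma smult_neg_left:
  assumes "a \<in> carrier R" "x \<in> carrier M" shows "(\<ominus>\<^bsub>R\<^esub> a) \<odot>\<^bsub>M\<^esub> x = \<ominus>\<^bsub>M\<^esub> (a \<odot>\<^bsub>M\<^esub> x)"
  using assms
  by (intro M.minus_equality[symmetric])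
    (simp_all add: smult_closed smult_zero_left R.l_neg flip: smult_l_distr)

lemma smult_minus_left:
  assumes "a \<in> carrier R" "b \<in> carrier R" "x \<in> carrier M"
  shows "(a \<ominus>\<^bsub>R\<^esub> b) \<odot>\<^bsub>M\<^esub> x = a \<odot>\<^bsub>M\<^esub> x \<ominus>\<^bsub>M\<^esub> b \<odot>\<^bsub>M\<^esub> x"
  using assms by (simp add: R.minus_eq M.minus_eq smult_l_distr smult_neg_left)

lemma smult_minus_right:
  assumes "a \<in> carrier R" "x \<in> carrier M" "y \<in> carrier M"
  shows "a \<odot>\<^bsub>M\<^esub> (x \<ominus>\<^bsub>M\<^esub> y) = a \<odot>\<^bsub>M\<^esub> x \<ominus>\<^bsub>M\<^esub> a \<odot>\<^bsub>M\<^esub> y"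
  using assms by (simp add: M.minus_eq smult_r_distr smult_neg_right)

lemma eq_iff_minus_zero:
  "\<lbrakk>x \<in> carrier M; y \<in> carrier M\<rbrakk> \<Longrightarrow> x \<ominus>\<^bsub>M\<^esub> y = \<zero>\<^bsub>M\<^esub> \<longleftrightarrow> x = y"
  by (metis M.a_inv_closed M.minus_eq M.minus_equality M.minus_minus M.r_neg)

text \<open>Negatives are multiples by the scalar -1, so closure under scalars already yields a
  subgroup.\<close>

lemma submoduleI':
  assumes "H \<subseteq> carrier M" "\<zero>\<^bsub>M\<^esub> \<in> H"
    and "\<And>x y. \<lbrakk>x \<in> H; y \<in> H\<rbrakk> \<Longrightarrow> x \<oplus>\<^bsub>M\<^esub> y \<in> H"
    and "\<And>a x. \<lbrakk>a \<in> carrier R; x \<in> H\<rbrakk> \<Longrightarrow> a \<odot>\<^bsub>M\<^esub> x \<in> H"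
  shows "submodule H R M"
proof (intro submodule.intro subgroup.intro submodule_axioms.intro)
  show "inv\<^bsub>add_monoid M\<^esub> x \<in> H" if "x \<in> H" for x
  proof -
    have "(\<ominus>\<^bsub>R\<^esub> \<one>\<^bsub>R\<^esub>) \<odot>\<^bsub>M\<^esub> x = \<ominus>\<^bsub>M\<^esub> x"
      using that assms(1) by (subst smult_neg_left) (auto simp: smult_one subset_iff)
    then show ?thesis
      using assms(4)[of "\<ominus>\<^bsub>R\<^esub> \<one>\<^bsub>R\<^esub>" x] that by (simp add: a_inv_def)
  qed
qed (use assms in auto)

end

text \<open>The multiples of \<open>v\<close> form a submodule containing \<open>v\<close>, hence
  everything. Together with \<open>simple_moduleI\<close> this replaces submodules by transitivity
  on nonzero elements, the form of simplicity used from here on.\<close>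

lemma simple_moduleD:
  assumes "simple_module A M" "v \<in> carrier M" "v \<noteq> \<zero>\<^bsub>M\<^esub>" "w \<in> carrier M"
  shows "\<exists>a \<in> carrier A. w = a \<odot>\<^bsub>M\<^esub> v"
proof -
  interpret left_module A M using assms(1) unfolding simple_module_def by blast
  let ?N = "(\<lambda>a. a \<odot>\<^bsub>M\<^esub> v) ` carrier A"
  have "submodule ?N A M"
  proof (rule submoduleI')
    show "\<zero>\<^bsub>M\<^esub> \<in> ?N" using assms(2) by (intro image_eqI[where x = "\<zero>\<^bsub>A\<^esub>"]) (auto simp: smult_zero_left)
    show "x \<oplus>\<^bsub>M\<^esub> y \<in> ?N" if "x \<in> ?N" "y \<in> ?N" for x y
      using that assms(2) by (auto simp: smult_l_distr[symmetric])
    show "a \<odot>\<^bsub>M\<^esub> x \<in> ?N" if "a \<in> carrier A" "x \<in> ?N" for a x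
      using that assms(2) by (auto simp: smult_assoc1[symmetric])
  qed (use assms(2) in \<open>auto intro: smult_closed\<close>)
  moreover have "v \<in> ?N" using assms(2) by (intro image_eqI[where x = "\<one>\<^bsub>A\<^esub>"]) (auto simp: smult_one)
  ultimately have "?N = carrier M" using assms(1,3) unfolding simple_module_def by blast
  then show ?thesis using assms(4) by blast
qed

lemma simple_moduleI:
  assumes "left_module A M" "v \<in> carrier M" "v \<noteq> \<zero>\<^bsub>M\<^esub>"
    and tr: "\<And>v w. \<lbrakk>v \<in> carrier M; v \<noteq> \<zero>\<^bsub>M\<^esub>; w \<in> carrier M\<rbrakk> \<Longrightarrow> \<exists>a \<in> carrier A. w = a \<odot>\<^bsub>M\<^esub> v"
  shows "simple_module A M"
proof -
  interpret left_module A M by fact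
  have "N = {\<zero>\<^bsub>M\<^esub>} \<or> N = carrier M" if N: "submodule N A M" for N
  proof (cases "\<exists>v \<in> N. v \<noteq> \<zero>\<^bsub>M\<^esub>")
    case True
    then obtain v where v: "v \<in> N" "v \<noteq> \<zero>\<^bsub>M\<^esub>" by blast
    have NM: "N \<subseteq> carrier M" using subgroup.subset[OF submodule.axioms(1)[OF N]] by simp
    have "w \<in> N" if w: "w \<in> carrier M" for w
    proof -
      obtain a where "a \<in> carrier A" "w = a \<odot>\<^bsub>M\<^esub> v"
        using tr[OF subsetD[OF NM v(1)] v(2) w] by (rule bexE)
      then show ?thesis using submodule.smult_closed[OF N _ v(1)] by simp
    qed
    then show ?thesis using NM by auto
  next
    case False
    moreover have "\<zero>\<^bsub>M\<^esub> \<in> N" using subgroup.one_closed[OF submodule.axioms(1)[OF N]] by simp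
    ultimately have "N = {\<zero>\<^bsub>M\<^esub>}" by (intro equalityI subsetI) (metis singleton_iff)+
    then show ?thesis by simp
  qed
  moreover have "carrier M \<noteq> {\<zero>\<^bsub>M\<^esub>}" using assms(2,3) by blast
  ultimately show ?thesis using assms(1) unfolding simple_module_def by simp
qed

lemma simple_module_nonzero:
  assumes "simple_module A M" obtains v where "v \<in> carrier M" "v \<noteq> \<zero>\<^bsub>M\<^esub>"
proof -
  interpret left_module A M using assms(1) unfolding simple_module_def by blast
  have "carrier M \<noteq> {\<zero>\<^bsub>M\<^esub>}" using assms unfolding simple_module_def by simp
  then show ?thesis using that M.zero_closed by auto
qed

lemma simple_module_left: "simple_module A M \<Longrightarrow> left_module A M"
  unfolding simple_module_def by blast

lemma additive_map_zero:
  assumes "abelian_group M" "abelian_group N" "h ` carrier M \<subseteq> carrier N"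
    and "\<And>x y. \<lbrakk>x \<in> carrier M; y \<in> carrier M\<rbrakk> \<Longrightarrow> h (x \<oplus>\<^bsub>M\<^esub> y) = h x \<oplus>\<^bsub>N\<^esub> h y"
  shows "h \<zero>\<^bsub>M\<^esub> = \<zero>\<^bsub>N\<^esub>"
proof -
  interpret M: abelian_group M by fact
  interpret N: abelian_group N by fact
  have "h \<zero>\<^bsub>M\<^esub> \<oplus>\<^bsub>N\<^esub> h \<zero>\<^bsub>M\<^esub> = h \<zero>\<^bsub>M\<^esub>" using assms(4)[of "\<zero>\<^bsub>M\<^esub>" "\<zero>\<^bsub>M\<^esub>"] by simp
  moreover have "h \<zero>\<^bsub>M\<^esub> \<in> carrier N" using assms(3) by auto
  ultimately show ?thesis by (simp add: N.add.l_cancel_one')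
qed

text \<open>A multiplier \<open>a\<close> that takes one preimage to another is sent to the
  multiplier \<open>\<phi> a\<close>, so transitivity on nonzero elements carries over.\<close>

lemma simple_semi_iso:
  assumes "simple_module A M" "semi_iso A \<phi> M N" "left_module B N" "\<phi> \<in> carrier A \<rightarrow> carrier B"
  shows "simple_module B N"
proof -
  interpret M: left_module A M using assms(1) by (rule simple_module_left)
  interpret N: left_module B N by fact
  from assms(2) obtain h where h: "bij_betw h (carrier M) (carrier N)"
     "\<And>x y. \<lbrakk>x \<in> carrier M; y \<in> carrier M\<rbrakk> \<Longrightarrow> h (x \<oplus>\<^bsub>M\<^esub> y) = h x \<oplus>\<^bsub>N\<^esub> h y"
     "\<And>a x. \<lbrakk>a \<in> carrier A; x \<in> carrier M\<rbrakk> \<Longrightarrow> h (a \<odot>\<^bsub>M\<^esub> x) = \<phi> a \<odot>\<^bsub>N\<^esub> h x"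
    unfolding semi_iso_def by blast
  have h0: "h \<zero>\<^bsub>M\<^esub> = \<zero>\<^bsub>N\<^esub>"
    by (rule additive_map_zero[OF M.M.abelian_group_axioms N.M.abelian_group_axioms])
      (use h in \<open>auto simp: bij_betw_def\<close>)
  obtain v where v: "v \<in> carrier M" "v \<noteq> \<zero>\<^bsub>M\<^esub>" using simple_module_nonzero[OF assms(1)] .
  show ?thesis
  proof (rule simple_moduleI[OF assms(3)])
    show "h v \<in> carrier N" using h(1) v by (auto simp: bij_betw_def)
    show "h v \<noteq> \<zero>\<^bsub>N\<^esub>" using h(1) v h0 M.M.zero_closed by (metis bij_betw_imp_inj_on inj_onD)
  next
    fix x y assume *: "x \<in> carrier N" "x \<noteq> \<zero>\<^bsub>N\<^esub>" "y \<in> carrier N"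
    obtain x' where x': "x' \<in> carrier M" "x = h x'" using h(1) * by (auto simp: bij_betw_def)
    obtain y' where y': "y' \<in> carrier M" "y = h y'" using h(1) * by (auto simp: bij_betw_def)
    note ** = x' y'
    with * h0 simple_moduleD[OF assms(1), of x' y']
    obtain a where "a \<in> carrier A" "y' = a \<odot>\<^bsub>M\<^esub> x'" by blast
    then show "\<exists>a \<in> carrier B. y = a \<odot>\<^bsub>N\<^esub> x" using h(3) ** assms(4) by auto
  qed
qed


text \<open>Cosets would form a module in a type of sets, whereas isomorphism classes are taken
  among modules over one fixed carrier type. So each coset is named by the
  \<open>\<iota>\<close>-image of one chosen member, and the operations are computed on preimages
  under \<open>h\<close>.\<close>

lemma quotient_module_exists:
  fixes M :: "('a, 'w) module" and \<iota> :: "'w \<Rightarrow> 'u"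
  assumes "left_module A M" "submodule N A M" "inj_on \<iota> (carrier M)"
  shows "\<exists>(Q :: ('a, 'u) module) h. left_module A Q \<and> h ` carrier M = carrier Q \<and>
    (\<forall>x \<in> carrier M. \<forall>y \<in> carrier M. h (x \<oplus>\<^bsub>M\<^esub> y) = h x \<oplus>\<^bsub>Q\<^esub> h y) \<and>
    (\<forall>a \<in> carrier A. \<forall>x \<in> carrier M. h (a \<odot>\<^bsub>M\<^esub> x) = a \<odot>\<^bsub>Q\<^esub> h x) \<and>
    (\<forall>x \<in> carrier M. h x = \<zero>\<^bsub>Q\<^esub> \<longleftrightarrow> x \<in> N)"
proof -
  interpret left_module A M by fact
  interpret N: submodule N A M by fact
  define h where "h x = \<iota> (SOME y. y \<in> carrier M \<and> x \<ominus>\<^bsub>M\<^esub> y \<in> N)" for x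
  have NM: "x \<in> carrier M" if "x \<in> N" for x using that N.subset by auto
  have Nadd: "x \<oplus>\<^bsub>M\<^esub> y \<in> N" if "x \<in> N" "y \<in> N" for x y using N.m_closed that by simp
  have Nneg: "\<ominus>\<^bsub>M\<^esub> x \<in> N" if "x \<in> N" for x using N.m_inv_closed that by (simp add: a_inv_def)
  have N0: "\<zero>\<^bsub>M\<^esub> \<in> N" using N.one_closed by simp
  have diff_trans: "x \<ominus>\<^bsub>M\<^esub> z = (x \<ominus>\<^bsub>M\<^esub> y) \<oplus>\<^bsub>M\<^esub> (y \<ominus>\<^bsub>M\<^esub> z)"
    if "x \<in> carrier M" "y \<in> carrier M" "z \<in> carrier M" for x y z
    using that by (simp add: M.minus_eq M.add.m_assoc M.r_neg1)
  have diff_sym: "\<ominus>\<^bsub>M\<^esub> (x \<ominus>\<^bsub>M\<^esub> y) = y \<ominus>\<^bsub>M\<^esub> x" if "x \<in> carrier M" "y \<in> carrier M" for x y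
    using that by (simp add: M.minus_eq M.minus_add M.a_comm)
  have rep: "\<exists>z. z \<in> carrier M \<and> x \<ominus>\<^bsub>M\<^esub> z \<in> N \<and> h x = \<iota> z" if "x \<in> carrier M" for x
  proof -
    have "\<exists>y. y \<in> carrier M \<and> x \<ominus>\<^bsub>M\<^esub> y \<in> N"
      using that N0 eq_iff_minus_zero[of x x] by (intro exI[of _ x]) auto
    then show ?thesis unfolding h_def by (metis (mono_tags, lifting) someI_ex)
  qed
  have heq: "h x = h y \<longleftrightarrow> x \<ominus>\<^bsub>M\<^esub> y \<in> N" if x: "x \<in> carrier M" and y: "y \<in> carrier M" for x y
  proof
    assume eq: "h x = h y"
    obtain z where z: "z \<in> carrier M" "x \<ominus>\<^bsub>M\<^esub> z \<in> N" "h x = \<iota> z" using rep[OF x] by blast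
    obtain w where w: "w \<in> carrier M" "y \<ominus>\<^bsub>M\<^esub> w \<in> N" "h y = \<iota> w" using rep[OF y] by blast
    have "z = w" using z w eq assms(3) by (metis inj_onD)
    then show "x \<ominus>\<^bsub>M\<^esub> y \<in> N"
      using diff_trans[OF x z(1) y] Nadd[OF z(2), of "z \<ominus>\<^bsub>M\<^esub> y"] Nneg[OF w(2)] diff_sym[OF y w(1)]
      by simp
  next
    assume xy: "x \<ominus>\<^bsub>M\<^esub> y \<in> N"
    \<comment> \<open>\<open>x\<close> and \<open>y\<close> have the same coset, so the two
      predicates under \<open>SOME\<close> agree and the same member is picked.\<close>
    have "(z \<in> carrier M \<and> x \<ominus>\<^bsub>M\<^esub> z \<in> N) = (z \<in> carrier M \<and> y \<ominus>\<^bsub>M\<^esub> z \<in> N)" for z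
    proof (cases "z \<in> carrier M")
      case z: True
      show ?thesis
        using diff_trans[OF x y z] diff_trans[OF y x z] Nadd[OF xy, of "y \<ominus>\<^bsub>M\<^esub> z"]
          Nadd[OF Nneg[OF xy], of "x \<ominus>\<^bsub>M\<^esub> z"] diff_sym[OF x y] by auto
    qed simp
    then show "h x = h y" unfolding h_def by simp
  qed
  let ?s = "inv_into (carrier M) h"
  define Q :: "('a, 'u) module" where "Q = \<lparr>carrier = h ` carrier M, monoid.mult = undefined, one = undefined,
     ring.zero = h \<zero>\<^bsub>M\<^esub>, add = (\<lambda>u v. h (?s u \<oplus>\<^bsub>M\<^esub> ?s v)), module.smult = (\<lambda>a u. h (a \<odot>\<^bsub>M\<^esub> ?s u))\<rparr>"
  have s: "?s (h x) \<in> carrier M" "?s (h x) \<ominus>\<^bsub>M\<^esub> x \<in> N" if "x \<in> carrier M" for x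
  proof -
    show 1: "?s (h x) \<in> carrier M" using that by (simp add: inv_into_into)
    have "h (?s (h x)) = h x" using that by (simp add: f_inv_into_f)
    then show "?s (h x) \<ominus>\<^bsub>M\<^esub> x \<in> N" using heq 1 that by blast
  qed
  have hadd: "h x \<oplus>\<^bsub>Q\<^esub> h y = h (x \<oplus>\<^bsub>M\<^esub> y)" if x: "x \<in> carrier M" and y: "y \<in> carrier M" for x y
  proof -
    have "?s (h x) \<oplus>\<^bsub>M\<^esub> ?s (h y) \<ominus>\<^bsub>M\<^esub> (x \<oplus>\<^bsub>M\<^esub> y) = (?s (h x) \<ominus>\<^bsub>M\<^esub> x) \<oplus>\<^bsub>M\<^esub> (?s (h y) \<ominus>\<^bsub>M\<^esub> y)"
      using s x y by (simp add: M.minus_eq M.minus_add M.add.m_ac)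
    then show ?thesis using Nadd[OF s(2)[OF x] s(2)[OF y]] heq s x y by (simp add: Q_def)
  qed
  have hsm: "a \<odot>\<^bsub>Q\<^esub> h x = h (a \<odot>\<^bsub>M\<^esub> x)" if x: "x \<in> carrier M" and a: "a \<in> carrier A" for a x
  proof -
    have "a \<odot>\<^bsub>M\<^esub> ?s (h x) \<ominus>\<^bsub>M\<^esub> a \<odot>\<^bsub>M\<^esub> x = a \<odot>\<^bsub>M\<^esub> (?s (h x) \<ominus>\<^bsub>M\<^esub> x)"
      using s x a by (simp add: smult_minus_right)
    then show ?thesis using N.smult_closed[OF a s(2)[OF x]] heq s x a smult_closed by (simp add: Q_def)
  qed
  have cQ: "carrier Q = h ` carrier M" and zQ: "\<zero>\<^bsub>Q\<^esub> = h \<zero>\<^bsub>M\<^esub>" by (simp_all add: Q_def)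
  have ab: "abelian_group Q"
  proof (rule abelian_groupI)
    fix x assume "x \<in> carrier Q"
    then obtain x' where "x' \<in> carrier M" "x = h x'" by (auto simp: cQ)
    then show "\<exists>y\<in>carrier Q. y \<oplus>\<^bsub>Q\<^esub> x = \<zero>\<^bsub>Q\<^esub>"
      by (intro bexI[of _ "h (\<ominus>\<^bsub>M\<^esub> x')"]) (auto simp: cQ zQ hadd M.l_neg)
  qed (auto simp: cQ zQ hadd M.add.m_ac)
  interpret Q: abelian_group Q by fact
  have "left_module A Q"
    by unfold_locales
     (auto simp: cQ hadd hsm smult_closed smult_l_distr smult_r_distr smult_assoc1 smult_one)
  moreover have "h x = \<zero>\<^bsub>Q\<^esub> \<longleftrightarrow> x \<in> N" if "x \<in> carrier M" for x
    using heq[OF that M.zero_closed] that M.minus_equality[of "\<zero>\<^bsub>M\<^esub>" "\<zero>\<^bsub>M\<^esub>"] by (simp add: zQ M.minus_eq)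
  ultimately show ?thesis using cQ hadd hsm by (intro exI[of _ Q] exI[of _ h]) auto
qed

text \<open>A lifting problem over \<open>B\<close> is twisted along the inverse of
  \<open>\<phi>\<close> into one over \<open>A\<close> with the same carriers. It is solved there
  for \<open>T\<close>, and the lift is precomposed with the inverse of the semilinear bijection
  \<open>k\<close>.\<close>

lemma projective_semi_iso:
  fixes T N :: "('a, 'u) module"
  assumes "projective_module A T" "semi_iso A \<phi> T N" "left_module B N" "\<phi> \<in> ring_iso A B"
  shows "projective_module B N"
  unfolding projective_module_def
proof (intro conjI allI impI ballI)
  fix V :: "('a, 'u \<Rightarrow> 'a) module" and W :: "('a, 'u) module" and g h
  assume V: "left_module B V" and W: "left_module B W" and g: "g \<in> module_hom B V W"
    and h: "h \<in> module_hom B N W" and surj: "g ` carrier V = carrier W"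
  have lT: "left_module A T" using assms(1) by (simp add: projective_module_def)
  interpret T: left_module A T by fact
  interpret N: left_module B N by fact
  let ?\<psi> = "inv_into (carrier A) \<phi>"
  have \<psi>: "?\<psi> \<in> ring_iso B A" by (rule ring_iso_inv_into[OF assms(4) T.R.ring_axioms])
  note \<phi> = ring_isoD[OF assms(4)]
  have \<psi>\<phi>: "inv_into (carrier B) ?\<psi> a = \<phi> a" if "a \<in> carrier A" for a
    using \<phi> that ring_isoD(6,9)[OF \<psi>] by (metis inv_into_f_eq)
  from assms(2) obtain k where k: "bij_betw k (carrier T) (carrier N)"
     "\<And>x y. \<lbrakk>x \<in> carrier T; y \<in> carrier T\<rbrakk> \<Longrightarrow> k (x \<oplus>\<^bsub>T\<^esub> y) = k x \<oplus>\<^bsub>N\<^esub> k y"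
     "\<And>a x. \<lbrakk>a \<in> carrier A; x \<in> carrier T\<rbrakk> \<Longrightarrow> k (a \<odot>\<^bsub>T\<^esub> x) = \<phi> a \<odot>\<^bsub>N\<^esub> k x"
    unfolding semi_iso_def by blast
  have kN: "k x \<in> carrier N" if "x \<in> carrier T" for x using k(1) that by (auto simp: bij_betw_def)
  let ?V = "twist B ?\<psi> V" and ?W = "twist B ?\<psi> W"
  have "left_module A ?V" "left_module A ?W"
    using twist_left_module[OF \<psi> _ T.R.ring_axioms] V W by auto
  moreover have "g \<in> module_hom A ?V ?W"
    using g \<phi>(1) unfolding module_hom_def hom_def twist_def by (auto simp: \<psi>\<phi>)
  moreover have "h \<circ> k \<in> module_hom A T ?W"
    using h k kN \<phi>(1) unfolding module_hom_def hom_def twist_def by (auto simp: \<psi>\<phi>)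
  moreover have "g ` carrier ?V = carrier ?W" using surj by (simp add: twist_def)
  ultimately obtain l where l: "l \<in> module_hom A T ?V" "\<forall>x \<in> carrier T. g (l x) = h (k x)"
    using assms(1) unfolding projective_module_def by (metis comp_apply)
  let ?k = "inv_into (carrier T) k"
  have kM: "?k y \<in> carrier T" "k (?k y) = y" if "y \<in> carrier N" for y
    using k(1) that by (auto simp: bij_betw_def inv_into_into f_inv_into_f)
  have kh: "?k (k x) = x" if "x \<in> carrier T" for x
    using k(1) that by (auto simp: bij_betw_def)
  have kadd: "?k (x \<oplus>\<^bsub>N\<^esub> y) = ?k x \<oplus>\<^bsub>T\<^esub> ?k y" if "x \<in> carrier N" "y \<in> carrier N" for x y
    using k(2)[of "?k x" "?k y"] kM that kh T.M.a_closed by metis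
  have ksm: "?k (a \<odot>\<^bsub>N\<^esub> x) = ?\<psi> a \<odot>\<^bsub>T\<^esub> ?k x" if "a \<in> carrier B" "x \<in> carrier N" for a x
    using k(3)[of "?\<psi> a" "?k x"] kM that kh \<phi> T.smult_closed by metis
  have "l \<circ> ?k \<in> module_hom B N V"
    using l(1) kM kadd ksm \<phi>(7,8) ring_isoD(9)[OF \<psi>] unfolding module_hom_def hom_def twist_def by auto
  moreover have "\<forall>x \<in> carrier N. g ((l \<circ> ?k) x) = h x" using l(2) kM by auto
  ultimately show "\<exists>l \<in> module_hom B N V. \<forall>x \<in> carrier N. g (l x) = h x" by blast
qed (fact assms)


section \<open>Simple modules and corner rings\<close>

definition cut_module :: "'a \<Rightarrow> ('a, 'u) module \<Rightarrow> ('a, 'u) module" where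
  "cut_module e U = U\<lparr>carrier := (\<lambda>u. e \<odot>\<^bsub>U\<^esub> u) ` carrier U\<rparr>"

lemma cut_module_sel [simp]:
  "carrier (cut_module e U) = (\<lambda>u. e \<odot>\<^bsub>U\<^esub> u) ` carrier U"
  "\<zero>\<^bsub>cut_module e U\<^esub> = \<zero>\<^bsub>U\<^esub>" "add (cut_module e U) = add U"
  "module.smult (cut_module e U) = module.smult U"
  by (simp_all add: cut_module_def)

text \<open>\<open>h\<close> carries \<open>e U\<close> onto \<open>\<phi>(e) V\<close>, and
  multiplication by \<open>s\<close> carries \<open>\<phi>(e) V\<close> onto \<open>e V\<close> with
  inverse multiplication by \<open>t\<close>. The composite \<open>u \<mapsto> s h(u)\<close> turns
  the action of \<open>q\<close> into that of \<open>s \<phi>(q) t\<close>.\<close>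

lemma cut_semi_iso:
  assumes "left_module R U" "left_module R V" "semi_iso R \<phi> U V" "\<phi> \<in> ring_iso R R"
    and e: "e \<in> carrier R" "e \<otimes>\<^bsub>R\<^esub> e = e"
    and Q: "\<And>q. q \<in> carrier Q \<Longrightarrow> q \<in> carrier R \<and> q \<otimes>\<^bsub>R\<^esub> e = q"
    and s: "s \<in> carrier R" "e \<otimes>\<^bsub>R\<^esub> s = s" and t: "t \<in> carrier R" "\<phi> e \<otimes>\<^bsub>R\<^esub> t = t"
    and st: "s \<otimes>\<^bsub>R\<^esub> t = e" "t \<otimes>\<^bsub>R\<^esub> s = \<phi> e"
    and \<phi>': "\<And>q. q \<in> carrier Q \<Longrightarrow> \<phi>' q = s \<otimes>\<^bsub>R\<^esub> (\<phi> q \<otimes>\<^bsub>R\<^esub> t)"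
  shows "semi_iso Q \<phi>' (cut_module e U) (cut_module e V)"
proof -
  interpret U: left_module R U by fact
  interpret V: left_module R V by fact
  note \<phi> = ring_isoD[OF assms(4)]
  from assms(3) obtain h where h: "bij_betw h (carrier U) (carrier V)"
     "\<And>x y. \<lbrakk>x \<in> carrier U; y \<in> carrier U\<rbrakk> \<Longrightarrow> h (x \<oplus>\<^bsub>U\<^esub> y) = h x \<oplus>\<^bsub>V\<^esub> h y"
     "\<And>a x. \<lbrakk>a \<in> carrier R; x \<in> carrier U\<rbrakk> \<Longrightarrow> h (a \<odot>\<^bsub>U\<^esub> x) = \<phi> a \<odot>\<^bsub>V\<^esub> h x"
    unfolding semi_iso_def by blast
  have hV: "h u \<in> carrier V" if "u \<in> carrier U" for u using h(1) that by (auto simp: bij_betw_def)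
  have ee: "\<phi> e \<otimes>\<^bsub>R\<^esub> \<phi> e = \<phi> e" using \<phi>(2)[OF e(1) e(1)] e(2) by simp
  have \<phi>e: "\<phi> e \<in> carrier R" using \<phi>(1) e(1) .
  have ts: "t \<odot>\<^bsub>V\<^esub> (s \<odot>\<^bsub>V\<^esub> h (e \<odot>\<^bsub>U\<^esub> u)) = h (e \<odot>\<^bsub>U\<^esub> u)" if "u \<in> carrier U" for u
  proof -
    have "t \<odot>\<^bsub>V\<^esub> (s \<odot>\<^bsub>V\<^esub> h (e \<odot>\<^bsub>U\<^esub> u)) = \<phi> e \<odot>\<^bsub>V\<^esub> (\<phi> e \<odot>\<^bsub>V\<^esub> h u)"
      using that s(1) t(1) st(2) h(3)[OF e(1) that] hV V.smult_assoc1[of t s] \<phi>e V.smult_closed by metis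
    also have "\<dots> = h (e \<odot>\<^bsub>U\<^esub> u)"
      using that h(3)[OF e(1) that] hV V.smult_assoc1[of "\<phi> e" "\<phi> e"] \<phi>e ee by metis
    finally show ?thesis .
  qed
  show ?thesis
  proof (rule semi_isoI[where h = "\<lambda>u. s \<odot>\<^bsub>V\<^esub> h u"])
    show "bij_betw (\<lambda>u. s \<odot>\<^bsub>V\<^esub> h u) (carrier (cut_module e U)) (carrier (cut_module e V))"
    proof (rule bij_betw_imageI)
      show "inj_on (\<lambda>u. s \<odot>\<^bsub>V\<^esub> h u) (carrier (cut_module e U))"
      proof (rule inj_onI)
        fix x y assume x: "x \<in> carrier (cut_module e U)" and y: "y \<in> carrier (cut_module e U)"
          and eq: "s \<odot>\<^bsub>V\<^esub> h x = s \<odot>\<^bsub>V\<^esub> h y"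
        from x obtain u where u: "u \<in> carrier U" "x = e \<odot>\<^bsub>U\<^esub> u" by auto
        from y obtain v where v: "v \<in> carrier U" "y = e \<odot>\<^bsub>U\<^esub> v" by auto
        have "h x = h y" using ts[OF u(1)] ts[OF v(1)] eq unfolding u(2) v(2) by metis
        then show "x = y" using h(1) u v U.smult_closed[OF e(1)] by (metis bij_betw_imp_inj_on inj_onD)
      qed
      show "(\<lambda>u. s \<odot>\<^bsub>V\<^esub> h u) ` carrier (cut_module e U) = carrier (cut_module e V)"
      proof (intro equalityI subsetI)
        fix y assume "y \<in> (\<lambda>u. s \<odot>\<^bsub>V\<^esub> h u) ` carrier (cut_module e U)"
        then obtain u where u: "u \<in> carrier U" "y = s \<odot>\<^bsub>V\<^esub> h (e \<odot>\<^bsub>U\<^esub> u)" by auto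
        have hu: "h (e \<odot>\<^bsub>U\<^esub> u) \<in> carrier V" using hV U.smult_closed[OF e(1) u(1)] .
        have "y = e \<odot>\<^bsub>V\<^esub> (s \<odot>\<^bsub>V\<^esub> h (e \<odot>\<^bsub>U\<^esub> u))"
          using u V.smult_assoc1[OF e(1) s(1) hu] s(2) by simp
        then show "y \<in> carrier (cut_module e V)" using V.smult_closed[OF s(1) hu] by simp
      next
        fix y assume "y \<in> carrier (cut_module e V)"
        then obtain v where v: "v \<in> carrier V" "y = e \<odot>\<^bsub>V\<^esub> v" by auto
        have tv: "t \<odot>\<^bsub>V\<^esub> v \<in> carrier V" using V.smult_closed[OF t(1) v(1)] .
        then obtain u where u: "u \<in> carrier U" "t \<odot>\<^bsub>V\<^esub> v = h u" using h(1) by (auto simp: bij_betw_def)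
        have "h (e \<odot>\<^bsub>U\<^esub> u) = t \<odot>\<^bsub>V\<^esub> v"
          using h(3)[OF e(1) u(1)] u(2) V.smult_assoc1[OF \<phi>e t(1) v(1)] t(2) by simp
        then have "s \<odot>\<^bsub>V\<^esub> h (e \<odot>\<^bsub>U\<^esub> u) = y"
          using V.smult_assoc1[OF s(1) t(1) v(1)] st(1) v(2) by simp
        then show "y \<in> (\<lambda>u. s \<odot>\<^bsub>V\<^esub> h u) ` carrier (cut_module e U)" using u(1) by auto
      qed
    qed
  next
    fix x y assume "x \<in> carrier (cut_module e U)" "y \<in> carrier (cut_module e U)"
    then have "x \<in> carrier U" "y \<in> carrier U" using U.smult_closed[OF e(1)] by auto
    then show "s \<odot>\<^bsub>V\<^esub> h (x \<oplus>\<^bsub>cut_module e U\<^esub> y) = s \<odot>\<^bsub>V\<^esub> h x \<oplus>\<^bsub>cut_module e V\<^esub> s \<odot>\<^bsub>V\<^esub> h y"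
      using h(2) hV V.smult_r_distr[OF s(1)] by simp
  next
    fix q x assume q: "q \<in> carrier Q" and "x \<in> carrier (cut_module e U)"
    then obtain u where u: "u \<in> carrier U" "x = e \<odot>\<^bsub>U\<^esub> u" by auto
    have x: "x \<in> carrier U" using u U.smult_closed[OF e(1)] by auto
    have qR: "q \<in> carrier R" using Q[OF q] by simp
    note \<phi>q = \<phi>(1)[OF qR]
    have sx: "s \<odot>\<^bsub>V\<^esub> h x \<in> carrier V" using V.smult_closed[OF s(1) hV[OF x]] .
    have "\<phi>' q \<odot>\<^bsub>V\<^esub> (s \<odot>\<^bsub>V\<^esub> h x) = s \<odot>\<^bsub>V\<^esub> (\<phi> q \<odot>\<^bsub>V\<^esub> (t \<odot>\<^bsub>V\<^esub> (s \<odot>\<^bsub>V\<^esub> h x)))"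
      using \<phi>'[OF q] V.smult_assoc1[OF s(1) _ sx, of "\<phi> q \<otimes>\<^bsub>R\<^esub> t"] V.smult_assoc1[OF \<phi>q t(1) sx]
        U.R.m_closed[OF \<phi>q t(1)] by simp
    also have "\<dots> = s \<odot>\<^bsub>V\<^esub> h (q \<odot>\<^bsub>U\<^esub> x)" using ts[OF u(1)] u(2) h(3)[OF qR x] by simp
    finally show "s \<odot>\<^bsub>V\<^esub> h (q \<odot>\<^bsub>cut_module e U\<^esub> x) = \<phi>' q \<odot>\<^bsub>cut_module e V\<^esub> (s \<odot>\<^bsub>V\<^esub> h x)" by simp
  qed
qed

text \<open>Both modules are \<open>R\<close> modulo the annihilator of a generator.\<close>

lemma simple_iso_of_annihilators:
  assumes U: "simple_module R U" and V: "simple_module R V"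
    and u: "u \<in> carrier U" "u \<noteq> \<zero>\<^bsub>U\<^esub>" and v: "v \<in> carrier V" "v \<noteq> \<zero>\<^bsub>V\<^esub>"
    and ann: "\<And>a. a \<in> carrier R \<Longrightarrow> a \<odot>\<^bsub>U\<^esub> u = \<zero>\<^bsub>U\<^esub> \<longleftrightarrow> a \<odot>\<^bsub>V\<^esub> v = \<zero>\<^bsub>V\<^esub>"
  shows "semi_iso R id U V"
proof -
  interpret U: left_module R U using U by (rule simple_module_left)
  interpret V: left_module R V using V by (rule simple_module_left)
  have "\<forall>x \<in> carrier U. \<exists>a. a \<in> carrier R \<and> x = a \<odot>\<^bsub>U\<^esub> u" using simple_moduleD[OF U u] by blast
  then obtain c where c: "\<And>x. x \<in> carrier U \<Longrightarrow> c x \<in> carrier R" "\<And>x. x \<in> carrier U \<Longrightarrow> x = c x \<odot>\<^bsub>U\<^esub> u"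
    by metis
  \<comment> \<open>Equal multiples of \<open>u\<close> correspond to equal multiples of
    \<open>v\<close>, so the map built from the coefficients \<open>c\<close> does not depend on how
    they were chosen.\<close>
  have eq: "a \<odot>\<^bsub>U\<^esub> u = b \<odot>\<^bsub>U\<^esub> u \<longleftrightarrow> a \<odot>\<^bsub>V\<^esub> v = b \<odot>\<^bsub>V\<^esub> v" if "a \<in> carrier R" "b \<in> carrier R" for a b
    using ann[of "a \<ominus>\<^bsub>R\<^esub> b"] that u(1) v(1) U.eq_iff_minus_zero[of "a \<odot>\<^bsub>U\<^esub> u" "b \<odot>\<^bsub>U\<^esub> u"]
      V.eq_iff_minus_zero[of "a \<odot>\<^bsub>V\<^esub> v" "b \<odot>\<^bsub>V\<^esub> v"]
    by (simp add: U.smult_minus_left V.smult_minus_left U.smult_closed V.smult_closed)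
  have c': "c (a \<odot>\<^bsub>U\<^esub> u) \<odot>\<^bsub>V\<^esub> v = a \<odot>\<^bsub>V\<^esub> v" if "a \<in> carrier R" for a
    using eq[of "c (a \<odot>\<^bsub>U\<^esub> u)" a] c[of "a \<odot>\<^bsub>U\<^esub> u"] U.smult_closed[OF that u(1)] that by simp
  show ?thesis
  proof (rule semi_isoI[where h = "\<lambda>x. c x \<odot>\<^bsub>V\<^esub> v"])
    show "bij_betw (\<lambda>x. c x \<odot>\<^bsub>V\<^esub> v) (carrier U) (carrier V)"
    proof (rule bij_betw_imageI)
      show "inj_on (\<lambda>x. c x \<odot>\<^bsub>V\<^esub> v) (carrier U)" using eq c by (intro inj_onI) metis
      show "(\<lambda>x. c x \<odot>\<^bsub>V\<^esub> v) ` carrier U = carrier V"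
      proof (intro equalityI subsetI)
        fix y assume "y \<in> carrier V"
        then obtain a where "a \<in> carrier R" "y = a \<odot>\<^bsub>V\<^esub> v" using simple_moduleD[OF V v, of y] by blast
        then show "y \<in> (\<lambda>x. c x \<odot>\<^bsub>V\<^esub> v) ` carrier U" using c' U.smult_closed[of a u] u(1)
            by (intro image_eqI[of _ _ "a \<odot>\<^bsub>U\<^esub> u"]) simp_all
      qed (use c(1) v(1) V.smult_closed in auto)
    qed
  next
    fix x y assume xy: "x \<in> carrier U" "y \<in> carrier U"
    have "x \<oplus>\<^bsub>U\<^esub> y = (c x \<oplus>\<^bsub>R\<^esub> c y) \<odot>\<^bsub>U\<^esub> u"
      using c(2)[OF xy(1)] c(2)[OF xy(2)] U.smult_l_distr[OF c(1)[OF xy(1)] c(1)[OF xy(2)] u(1)] by simp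
    then show "c (x \<oplus>\<^bsub>U\<^esub> y) \<odot>\<^bsub>V\<^esub> v = c x \<odot>\<^bsub>V\<^esub> v \<oplus>\<^bsub>V\<^esub> c y \<odot>\<^bsub>V\<^esub> v"
      using c'[of "c x \<oplus>\<^bsub>R\<^esub> c y"] V.smult_l_distr[OF c(1)[OF xy(1)] c(1)[OF xy(2)] v(1)] c(1) xy by simp
  next
    fix a x assume ax: "a \<in> carrier R" "x \<in> carrier U"
    have "a \<odot>\<^bsub>U\<^esub> x = (a \<otimes>\<^bsub>R\<^esub> c x) \<odot>\<^bsub>U\<^esub> u"
      using c(2)[OF ax(2)] U.smult_assoc1[OF ax(1) c(1)[OF ax(2)] u(1)] by simp
    then show "c (a \<odot>\<^bsub>U\<^esub> x) \<odot>\<^bsub>V\<^esub> v = id a \<odot>\<^bsub>V\<^esub> (c x \<odot>\<^bsub>V\<^esub> v)"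
      using c'[of "a \<otimes>\<^bsub>R\<^esub> c x"] V.smult_assoc1[OF ax(1) c(1)[OF ax(2)] v(1)] c(1) ax by simp
  qed
qed

definition regular_module :: "'a ring \<Rightarrow> ('a, 'a) module" where
  "regular_module R = \<lparr>carrier = carrier R, monoid.mult = monoid.mult R, one = one R,
     ring.zero = ring.zero R, add = add R, module.smult = monoid.mult R\<rparr>"

lemma regular_left_module:
  assumes "ring R" shows "left_module R (regular_module R)"
proof -
  interpret ring R by fact
  have "abelian_group (regular_module R)"
    by (rule abelian_groupI) (auto simp: regular_module_def a_ac intro: add.l_inv_ex)
  then interpret M: abelian_group "regular_module R" .
  show ?thesis by unfold_locales (auto simp: regular_module_def l_distr r_distr m_assoc)
qed

text \<open>The map \<open>\<pi>\<close> is the retraction of \<open>R\<close> onto the subring \<open>Q\<close> of the corner \<open>\<epsilon>R\<epsilon>\<close>. It is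
  multiplicative on the corner; its kernel there is the span of the non-invertible morphisms.\<close>

locale corner = R: ring R + Q: ring Q for R Q :: "'a ring" +
  fixes \<epsilon> :: 'a and \<pi> :: "'a \<Rightarrow> 'a"
  assumes sub: "q \<in> carrier Q \<Longrightarrow> q \<in> carrier R"
    and mult_eq: "\<lbrakk>p \<in> carrier Q; q \<in> carrier Q\<rbrakk> \<Longrightarrow> p \<otimes>\<^bsub>Q\<^esub> q = p \<otimes>\<^bsub>R\<^esub> q"
    and add_eq: "\<lbrakk>p \<in> carrier Q; q \<in> carrier Q\<rbrakk> \<Longrightarrow> p \<oplus>\<^bsub>Q\<^esub> q = p \<oplus>\<^bsub>R\<^esub> q"
    and one_eq: "\<one>\<^bsub>Q\<^esub> = \<epsilon>"
    and pi_closed: "x \<in> carrier R \<Longrightarrow> \<pi> x \<in> carrier Q"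
    and pi_add: "\<lbrakk>x \<in> carrier R; y \<in> carrier R\<rbrakk> \<Longrightarrow> \<pi> (x \<oplus>\<^bsub>R\<^esub> y) = \<pi> x \<oplus>\<^bsub>R\<^esub> \<pi> y"
    and pi_id: "q \<in> carrier Q \<Longrightarrow> \<pi> q = q"
    and pi_left: "x \<in> carrier R \<Longrightarrow> \<pi> (\<epsilon> \<otimes>\<^bsub>R\<^esub> x) = \<pi> x"
    and pi_right: "x \<in> carrier R \<Longrightarrow> \<pi> (x \<otimes>\<^bsub>R\<^esub> \<epsilon>) = \<pi> x"
    and pi_mult: "\<lbrakk>x \<in> carrier R; y \<in> carrier R\<rbrakk> \<Longrightarrow> \<pi> (x \<otimes>\<^bsub>R\<^esub> (\<epsilon> \<otimes>\<^bsub>R\<^esub> y)) = \<pi> x \<otimes>\<^bsub>R\<^esub> \<pi> y"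
begin

text \<open>The equation says that \<open>\<epsilon> x \<epsilon>\<close> acts as its image
  \<open>\<pi> x\<close> in \<open>Q\<close>, that is, the kernel of \<open>\<pi>\<close> on the
  corner annihilates \<open>U\<close>. This is the ring-theoretic form of the condition that
  non-invertible morphisms act as zero; \<open>apex_iff\<close> matches the two.\<close>

definition apex :: "('a, 'u) module \<Rightarrow> bool" where
  "apex U \<longleftrightarrow> simple_module R U \<and> (\<exists>u \<in> carrier U. \<epsilon> \<odot>\<^bsub>U\<^esub> u \<noteq> \<zero>\<^bsub>U\<^esub>) \<and>
     (\<forall>x \<in> carrier R. \<forall>u \<in> carrier U. \<epsilon> \<odot>\<^bsub>U\<^esub> (x \<odot>\<^bsub>U\<^esub> (\<epsilon> \<odot>\<^bsub>U\<^esub> u)) = \<pi> x \<odot>\<^bsub>U\<^esub> u)"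

lemma eps_Q: "\<epsilon> \<in> carrier Q" using Q.one_closed one_eq by simp
lemma eps_R: "\<epsilon> \<in> carrier R" using eps_Q sub by simp
lemma eps_left: "q \<in> carrier Q \<Longrightarrow> \<epsilon> \<otimes>\<^bsub>R\<^esub> q = q" using Q.l_one[of q] mult_eq eps_Q one_eq by simp
lemma eps_right: "q \<in> carrier Q \<Longrightarrow> q \<otimes>\<^bsub>R\<^esub> \<epsilon> = q" using Q.r_one[of q] mult_eq eps_Q one_eq by simp
lemma eps_idem: "\<epsilon> \<otimes>\<^bsub>R\<^esub> \<epsilon> = \<epsilon>" using eps_left eps_Q by simp

lemma zero_eq: "\<zero>\<^bsub>Q\<^esub> = \<zero>\<^bsub>R\<^esub>"
proof -
  have "\<zero>\<^bsub>Q\<^esub> \<oplus>\<^bsub>R\<^esub> \<zero>\<^bsub>Q\<^esub> = \<zero>\<^bsub>Q\<^esub>" using add_eq[of "\<zero>\<^bsub>Q\<^esub>" "\<zero>\<^bsub>Q\<^esub>"] by simp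
  then show ?thesis using sub[OF Q.zero_closed] by (simp add: R.add.l_cancel_one')
qed

lemma pi_zero: "\<pi> \<zero>\<^bsub>R\<^esub> = \<zero>\<^bsub>R\<^esub>" using pi_id[OF Q.zero_closed] zero_eq by simp

lemma pi_neg: assumes "x \<in> carrier R" shows "\<pi> (\<ominus>\<^bsub>R\<^esub> x) = \<ominus>\<^bsub>R\<^esub> \<pi> x"
proof -
  have "\<pi> (\<ominus>\<^bsub>R\<^esub> x) \<oplus>\<^bsub>R\<^esub> \<pi> x = \<zero>\<^bsub>R\<^esub>"
    using pi_add[of "\<ominus>\<^bsub>R\<^esub> x" x] assms pi_zero by (simp add: R.l_neg)
  then show ?thesis using assms pi_closed sub by (metis R.minus_equality R.a_inv_closed)
qed

lemma pi_minus: "\<lbrakk>x \<in> carrier R; y \<in> carrier R\<rbrakk> \<Longrightarrow> \<pi> (x \<ominus>\<^bsub>R\<^esub> y) = \<pi> x \<ominus>\<^bsub>R\<^esub> \<pi> y"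
  by (simp add: R.minus_eq pi_add pi_neg)

lemma minus_Q: "\<lbrakk>p \<in> carrier Q; q \<in> carrier Q\<rbrakk> \<Longrightarrow> p \<ominus>\<^bsub>Q\<^esub> q = p \<ominus>\<^bsub>R\<^esub> q"
proof -
  assume *: "p \<in> carrier Q" "q \<in> carrier Q"
  have "\<ominus>\<^bsub>R\<^esub> q = \<ominus>\<^bsub>Q\<^esub> q"
  proof (rule R.minus_equality)
    show "\<ominus>\<^bsub>Q\<^esub> q \<oplus>\<^bsub>R\<^esub> q = \<zero>\<^bsub>R\<^esub>" using * add_eq[of "\<ominus>\<^bsub>Q\<^esub> q" q] zero_eq by (simp add: Q.l_neg)
  qed (use * sub in auto)
  then show ?thesis using * add_eq by (simp add: R.minus_eq Q.minus_eq)
qed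

lemma cut_left_module:
  assumes "left_module R U" shows "left_module Q (cut_module \<epsilon> U)"
proof -
  interpret U: left_module R U by fact
  have c: "x \<in> carrier (cut_module \<epsilon> U) \<longleftrightarrow> x \<in> carrier U \<and> \<epsilon> \<odot>\<^bsub>U\<^esub> x = x" for x
  proof
    assume "x \<in> carrier (cut_module \<epsilon> U)"
    then obtain u where u: "u \<in> carrier U" "x = \<epsilon> \<odot>\<^bsub>U\<^esub> u" by auto
    then show "x \<in> carrier U \<and> \<epsilon> \<odot>\<^bsub>U\<^esub> x = x"
      using U.smult_assoc1[OF eps_R eps_R u(1)] U.smult_closed[OF eps_R u(1)] eps_idem by simp
  next
    assume x: "x \<in> carrier U \<and> \<epsilon> \<odot>\<^bsub>U\<^esub> x = x"
    then show "x \<in> carrier (cut_module \<epsilon> U)" by (metis cut_module_sel(1) image_eqI)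
  qed
  have neg: "\<epsilon> \<odot>\<^bsub>U\<^esub> (\<ominus>\<^bsub>U\<^esub> x) = \<ominus>\<^bsub>U\<^esub> x" if "x \<in> carrier U" "\<epsilon> \<odot>\<^bsub>U\<^esub> x = x" for x
    using U.smult_neg_right[OF eps_R that(1)] that(2) by simp
  have "abelian_group (cut_module \<epsilon> U)"
  proof (rule abelian_groupI)
    fix x assume "x \<in> carrier (cut_module \<epsilon> U)"
    then show "\<exists>y\<in>carrier (cut_module \<epsilon> U). y \<oplus>\<^bsub>cut_module \<epsilon> U\<^esub> x = \<zero>\<^bsub>cut_module \<epsilon> U\<^esub>"
      unfolding c using neg by (intro bexI[of _ "\<ominus>\<^bsub>U\<^esub> x"]) (auto simp: U.M.l_neg c simp del: cut_module_sel(1))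
  qed (auto simp: c U.smult_r_distr eps_R U.smult_zero_right U.M.add.m_ac simp del: cut_module_sel(1))
  then interpret C: abelian_group "cut_module \<epsilon> U" .
  have closed: "q \<odot>\<^bsub>U\<^esub> x \<in> carrier U \<and> \<epsilon> \<odot>\<^bsub>U\<^esub> (q \<odot>\<^bsub>U\<^esub> x) = q \<odot>\<^bsub>U\<^esub> x" if "q \<in> carrier Q" "x \<in> carrier U" for q x
    using U.smult_assoc1[OF eps_R sub[OF that(1)] that(2)] U.smult_closed[OF sub[OF that(1)] that(2)]
      eps_left[OF that(1)] by simp
  show ?thesis
  proof (intro left_module.intro left_module_axioms.intro)
    show "ring Q" by (rule Q.ring_axioms)
    show "abelian_group (cut_module \<epsilon> U)" by (rule C.abelian_group_axioms)
  qed (auto simp: c closed add_eq mult_eq one_eq sub U.smult_l_distr U.smult_r_distr U.smult_assoc1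
      simp del: cut_module_sel(1))
qed

lemma apex_corner:
  assumes "apex U" "x \<in> carrier R" "u \<in> carrier (cut_module \<epsilon> U)"
  shows "\<epsilon> \<odot>\<^bsub>U\<^esub> (x \<odot>\<^bsub>U\<^esub> u) = \<pi> x \<odot>\<^bsub>U\<^esub> u" "u \<in> carrier U" "\<epsilon> \<odot>\<^bsub>U\<^esub> u = u"
proof -
  have sU: "simple_module R U" using assms(1) by (simp add: apex_def)
  interpret U: left_module R U using sU by (rule simple_module_left)
  obtain v where v: "v \<in> carrier U" "u = \<epsilon> \<odot>\<^bsub>U\<^esub> v" using assms(3) by auto
  show u: "u \<in> carrier U" "\<epsilon> \<odot>\<^bsub>U\<^esub> u = u"
    using U.smult_assoc1[OF eps_R eps_R v(1)] U.smult_closed[OF eps_R v(1)] eps_idem v by simp_all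
  show "\<epsilon> \<odot>\<^bsub>U\<^esub> (x \<odot>\<^bsub>U\<^esub> u) = \<pi> x \<odot>\<^bsub>U\<^esub> u"
    using assms(1,2) u unfolding apex_def by metis
qed

lemma cut_nonzero:
  assumes "apex U" obtains u where "u \<in> carrier (cut_module \<epsilon> U)" "u \<noteq> \<zero>\<^bsub>U\<^esub>"
  using assms unfolding apex_def by auto

text \<open>If \<open>a\<close> takes \<open>v\<close> to \<open>w\<close> and both lie in
  \<open>\<epsilon> U\<close>, then \<open>w = \<epsilon> a v = \<pi>(a) v\<close>, so the
  multiplier may be taken in \<open>Q\<close>.\<close>

lemma cut_simple:
  assumes "apex U" shows "simple_module Q (cut_module \<epsilon> U)"
proof -
  have sU: "simple_module R U" using assms(1) by (simp add: apex_def)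
  obtain u where u: "u \<in> carrier (cut_module \<epsilon> U)" "u \<noteq> \<zero>\<^bsub>U\<^esub>" using cut_nonzero[OF assms] .
  show ?thesis
  proof (rule simple_moduleI[OF cut_left_module[OF simple_module_left[OF sU]] u(1)])
    show "u \<noteq> \<zero>\<^bsub>cut_module \<epsilon> U\<^esub>" using u(2) by simp
  next
    fix v w assume v: "v \<in> carrier (cut_module \<epsilon> U)" "v \<noteq> \<zero>\<^bsub>cut_module \<epsilon> U\<^esub>"
      and w: "w \<in> carrier (cut_module \<epsilon> U)"
    obtain a where a: "a \<in> carrier R" "w = a \<odot>\<^bsub>U\<^esub> v"
      using simple_moduleD[OF sU apex_corner(2)[OF assms eps_R v(1)] _ apex_corner(2)[OF assms eps_R w]] v(2)
      by auto
    have "w = \<pi> a \<odot>\<^bsub>U\<^esub> v"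
      using apex_corner(1)[OF assms a(1) v(1)] apex_corner(3)[OF assms eps_R w] a(2) by simp
    then show "\<exists>a\<in>carrier Q. w = a \<odot>\<^bsub>cut_module \<epsilon> U\<^esub> v" using pi_closed[OF a(1)] by auto
  qed
qed

text \<open>For \<open>w\<close> in \<open>\<epsilon> W\<close>, the product \<open>a w\<close>
  vanishes iff \<open>\<epsilon> r a w = 0\<close> for all \<open>r\<close>, because a nonzero
  \<open>a w\<close> generates \<open>W\<close> and \<open>\<epsilon> W \<noteq> 0\<close>. Since
  \<open>\<epsilon> r a w = \<pi>(r a) w\<close>, the annihilator of \<open>w\<close> in
  \<open>R\<close> can be read off from the \<open>Q\<close>-module
  \<open>\<epsilon> W\<close>.\<close>

lemma cut_reflects_iso:
  assumes U: "apex U" and V: "apex V" and iso: "semi_iso Q id (cut_module \<epsilon> U) (cut_module \<epsilon> V)"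
  shows "semi_iso R id U V"
proof -
  have sU: "simple_module R U" and sV: "simple_module R V" using U V by (simp_all add: apex_def)
  interpret U: left_module R U using sU by (rule simple_module_left)
  interpret V: left_module R V using sV by (rule simple_module_left)
  interpret CU: left_module Q "cut_module \<epsilon> U" by (rule cut_left_module) (rule U.left_module_axioms)
  interpret CV: left_module Q "cut_module \<epsilon> V" by (rule cut_left_module) (rule V.left_module_axioms)
  from iso obtain h where h: "bij_betw h (carrier (cut_module \<epsilon> U)) (carrier (cut_module \<epsilon> V))"
     "\<And>x y. \<lbrakk>x \<in> carrier (cut_module \<epsilon> U); y \<in> carrier (cut_module \<epsilon> U)\<rbrakk> \<Longrightarrow> h (x \<oplus>\<^bsub>U\<^esub> y) = h x \<oplus>\<^bsub>V\<^esub> h y"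
     "\<And>a x. \<lbrakk>a \<in> carrier Q; x \<in> carrier (cut_module \<epsilon> U)\<rbrakk> \<Longrightarrow> h (a \<odot>\<^bsub>U\<^esub> x) = a \<odot>\<^bsub>V\<^esub> h x"
    unfolding semi_iso_def cut_module_sel(3,4) id_apply by blast
  have hV: "h u \<in> carrier (cut_module \<epsilon> V)" if "u \<in> carrier (cut_module \<epsilon> U)" for u
    using h(1) that unfolding bij_betw_def by blast
  have h0: "h \<zero>\<^bsub>U\<^esub> = \<zero>\<^bsub>V\<^esub>"
    using additive_map_zero[OF CU.M.abelian_group_axioms CV.M.abelian_group_axioms, of h] hV h(2) by auto
  have h0': "h x = \<zero>\<^bsub>V\<^esub> \<longleftrightarrow> x = \<zero>\<^bsub>U\<^esub>" if "x \<in> carrier (cut_module \<epsilon> U)" for x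
    using h0 h(1) that CU.M.zero_closed unfolding bij_betw_def inj_on_def by (metis cut_module_sel(2))
  obtain u where u: "u \<in> carrier (cut_module \<epsilon> U)" "u \<noteq> \<zero>\<^bsub>U\<^esub>" using cut_nonzero[OF U] .
  have ann: "a \<odot>\<^bsub>W\<^esub> w = \<zero>\<^bsub>W\<^esub> \<longleftrightarrow> (\<forall>r \<in> carrier R. \<pi> (r \<otimes>\<^bsub>R\<^esub> a) \<odot>\<^bsub>W\<^esub> w = \<zero>\<^bsub>W\<^esub>)"
    if W: "apex W" and w: "w \<in> carrier (cut_module \<epsilon> W)" and a: "a \<in> carrier R"
    for a w and W :: "('a, 'w) module"
  proof -
    have sW: "simple_module R W" using W by (simp add: apex_def)
    interpret W: left_module R W using sW by (rule simple_module_left)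
    have wW: "w \<in> carrier W" by (rule apex_corner(2)[OF W eps_R w])
    have aw: "a \<odot>\<^bsub>W\<^esub> w \<in> carrier W" using a wW by (rule W.smult_closed)
    have eq: "\<pi> (r \<otimes>\<^bsub>R\<^esub> a) \<odot>\<^bsub>W\<^esub> w = \<epsilon> \<odot>\<^bsub>W\<^esub> (r \<odot>\<^bsub>W\<^esub> (a \<odot>\<^bsub>W\<^esub> w))" if r: "r \<in> carrier R" for r
      using apex_corner(1)[OF W R.m_closed[OF r a] w] W.smult_assoc1[OF r a wW] by simp
    show ?thesis
    proof
      assume 0: "a \<odot>\<^bsub>W\<^esub> w = \<zero>\<^bsub>W\<^esub>"
      show "\<forall>r \<in> carrier R. \<pi> (r \<otimes>\<^bsub>R\<^esub> a) \<odot>\<^bsub>W\<^esub> w = \<zero>\<^bsub>W\<^esub>"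
        using eq 0 W.smult_zero_right eps_R by simp
    next
      assume *: "\<forall>r \<in> carrier R. \<pi> (r \<otimes>\<^bsub>R\<^esub> a) \<odot>\<^bsub>W\<^esub> w = \<zero>\<^bsub>W\<^esub>"
      show "a \<odot>\<^bsub>W\<^esub> w = \<zero>\<^bsub>W\<^esub>"
      proof (rule ccontr)
        assume n: "a \<odot>\<^bsub>W\<^esub> w \<noteq> \<zero>\<^bsub>W\<^esub>"
        obtain y where y: "y \<in> carrier W" "\<epsilon> \<odot>\<^bsub>W\<^esub> y \<noteq> \<zero>\<^bsub>W\<^esub>" using W by (auto simp: apex_def)
        obtain r where "r \<in> carrier R" "y = r \<odot>\<^bsub>W\<^esub> (a \<odot>\<^bsub>W\<^esub> w)"
          using simple_moduleD[OF sW aw n y(1)] by blast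
        then show False using eq * y(2) by auto
      qed
    qed
  qed
  have "a \<odot>\<^bsub>U\<^esub> u = \<zero>\<^bsub>U\<^esub> \<longleftrightarrow> a \<odot>\<^bsub>V\<^esub> h u = \<zero>\<^bsub>V\<^esub>" if a: "a \<in> carrier R" for a
  proof -
    have "\<pi> (r \<otimes>\<^bsub>R\<^esub> a) \<odot>\<^bsub>U\<^esub> u = \<zero>\<^bsub>U\<^esub> \<longleftrightarrow> \<pi> (r \<otimes>\<^bsub>R\<^esub> a) \<odot>\<^bsub>V\<^esub> h u = \<zero>\<^bsub>V\<^esub>" if "r \<in> carrier R" for r
    proof -
      have q: "\<pi> (r \<otimes>\<^bsub>R\<^esub> a) \<in> carrier Q" using pi_closed that a by simp
      have "\<pi> (r \<otimes>\<^bsub>R\<^esub> a) \<odot>\<^bsub>U\<^esub> u \<in> carrier (cut_module \<epsilon> U)" using CU.smult_closed[OF q u(1)] by simp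
      then show ?thesis using h0' h(3)[OF q u(1)] by fastforce
    qed
    then show ?thesis using ann[OF U u(1) a] ann[OF V hV[OF u(1)] a] by simp
  qed
  then show ?thesis
    using simple_iso_of_annihilators[OF sU sV, of u "h u"] u hV[OF u(1)] h0' apex_corner(2)[OF U eps_R]
      apex_corner(2)[OF V eps_R] by blast
qed

text \<open>The description of annihilators in \<open>cut_reflects_iso\<close> leaves only one
  candidate: \<open>R\<close> modulo the left ideal \<open>N\<close> of all \<open>x\<close> with
  \<open>\<pi>(r x) s = 0\<close> for every \<open>r\<close>, where \<open>s\<close> is a nonzero
  element of \<open>S\<close>. The injection \<open>\<iota>\<close> places this quotient in the
  prescribed carrier type.\<close>

lemma cut_surjective:
  fixes S :: "('a, 'v) module" and \<iota> :: "'a \<Rightarrow> 'u"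
  assumes S: "simple_module Q S" and "inj_on \<iota> (carrier R)"
  shows "\<exists>U :: ('a, 'u) module. apex U \<and> semi_iso Q id (cut_module \<epsilon> U) S"
proof -
  interpret S: left_module Q S using S by (rule simple_module_left)
  obtain s where s: "s \<in> carrier S" "s \<noteq> \<zero>\<^bsub>S\<^esub>" using simple_module_nonzero[OF S] .
  interpret M: left_module R "regular_module R" by (rule regular_left_module[OF R.ring_axioms])
  have reg: "carrier (regular_module R) = carrier R" "\<zero>\<^bsub>regular_module R\<^esub> = \<zero>\<^bsub>R\<^esub>"
    "add (regular_module R) = add R" "module.smult (regular_module R) = monoid.mult R"
    by (simp_all add: regular_module_def)
  define N where "N = {x \<in> carrier R. \<forall>r \<in> carrier R. \<pi> (r \<otimes>\<^bsub>R\<^esub> x) \<odot>\<^bsub>S\<^esub> s = \<zero>\<^bsub>S\<^esub>}"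
  have zs: "\<zero>\<^bsub>R\<^esub> \<odot>\<^bsub>S\<^esub> s = \<zero>\<^bsub>S\<^esub>" using S.smult_zero_left[OF s(1)] zero_eq by simp
  have "submodule N R (regular_module R)"
  proof (rule M.submoduleI')
    show "N \<subseteq> carrier (regular_module R)" by (auto simp: N_def reg)
    show "\<zero>\<^bsub>regular_module R\<^esub> \<in> N" using zs pi_zero by (simp add: N_def reg)
    show "x \<oplus>\<^bsub>regular_module R\<^esub> y \<in> N" if "x \<in> N" "y \<in> N" for x y
      using that by (auto simp: N_def reg R.r_distr pi_add pi_closed add_eq[symmetric] S.smult_l_distr s(1))
    show "a \<odot>\<^bsub>regular_module R\<^esub> x \<in> N" if "a \<in> carrier R" "x \<in> N" for a x
      using that by (auto simp: N_def reg R.m_assoc[symmetric])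
  qed
  from quotient_module_exists[OF M.left_module_axioms this, of \<iota>] assms(2)
  obtain U :: "('a, 'u) module" and h where U: "left_module R U" and hU: "h ` carrier R = carrier U"
    and hadd: "\<And>x y. \<lbrakk>x \<in> carrier R; y \<in> carrier R\<rbrakk> \<Longrightarrow> h (x \<oplus>\<^bsub>R\<^esub> y) = h x \<oplus>\<^bsub>U\<^esub> h y"
    and hsm: "\<And>x y. \<lbrakk>x \<in> carrier R; y \<in> carrier R\<rbrakk> \<Longrightarrow> h (x \<otimes>\<^bsub>R\<^esub> y) = x \<odot>\<^bsub>U\<^esub> h y"
    and h0: "\<And>x. x \<in> carrier R \<Longrightarrow> h x = \<zero>\<^bsub>U\<^esub> \<longleftrightarrow> x \<in> N"
    unfolding reg by blast
  interpret U: left_module R U by fact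
  have hc: "h x \<in> carrier U" if "x \<in> carrier R" for x using hU that by auto
  have heq: "h x = h y \<longleftrightarrow> (\<forall>r \<in> carrier R. \<pi> (r \<otimes>\<^bsub>R\<^esub> x) \<odot>\<^bsub>S\<^esub> s = \<pi> (r \<otimes>\<^bsub>R\<^esub> y) \<odot>\<^bsub>S\<^esub> s)"
    if x: "x \<in> carrier R" and y: "y \<in> carrier R" for x y
  proof -
    have "h (\<ominus>\<^bsub>R\<^esub> \<one>\<^bsub>R\<^esub> \<otimes>\<^bsub>R\<^esub> y) = \<ominus>\<^bsub>U\<^esub> h y"
      using hsm[of "\<ominus>\<^bsub>R\<^esub> \<one>\<^bsub>R\<^esub>" y] y hc by (simp add: U.smult_neg_left U.smult_one)
    then have "h (x \<ominus>\<^bsub>R\<^esub> y) = h x \<ominus>\<^bsub>U\<^esub> h y"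
      using hadd[of x "\<ominus>\<^bsub>R\<^esub> y"] x y by (simp add: R.minus_eq U.M.minus_eq R.l_minus)
    then have "h x = h y \<longleftrightarrow> x \<ominus>\<^bsub>R\<^esub> y \<in> N"
      using U.eq_iff_minus_zero[OF hc[OF x] hc[OF y]] h0[of "x \<ominus>\<^bsub>R\<^esub> y"] x y by simp
    also have "\<dots> \<longleftrightarrow> (\<forall>r \<in> carrier R. \<pi> (r \<otimes>\<^bsub>R\<^esub> x) \<odot>\<^bsub>S\<^esub> s \<ominus>\<^bsub>S\<^esub> \<pi> (r \<otimes>\<^bsub>R\<^esub> y) \<odot>\<^bsub>S\<^esub> s = \<zero>\<^bsub>S\<^esub>)"
    proof -
      have "\<pi> (r \<otimes>\<^bsub>R\<^esub> (x \<ominus>\<^bsub>R\<^esub> y)) \<odot>\<^bsub>S\<^esub> s = \<pi> (r \<otimes>\<^bsub>R\<^esub> x) \<odot>\<^bsub>S\<^esub> s \<ominus>\<^bsub>S\<^esub> \<pi> (r \<otimes>\<^bsub>R\<^esub> y) \<odot>\<^bsub>S\<^esub> s" if r: "r \<in> carrier R" for r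
      proof -
        have "r \<otimes>\<^bsub>R\<^esub> (x \<ominus>\<^bsub>R\<^esub> y) = r \<otimes>\<^bsub>R\<^esub> x \<ominus>\<^bsub>R\<^esub> r \<otimes>\<^bsub>R\<^esub> y"
          using r x y by (simp add: R.minus_eq R.r_distr R.r_minus)
        then show ?thesis using r x y
          by (simp add: pi_minus minus_Q[symmetric] pi_closed S.smult_minus_left s(1))
      qed
      then show ?thesis using x y by (auto simp: N_def)
    qed
    also have "\<dots> \<longleftrightarrow> (\<forall>r \<in> carrier R. \<pi> (r \<otimes>\<^bsub>R\<^esub> x) \<odot>\<^bsub>S\<^esub> s = \<pi> (r \<otimes>\<^bsub>R\<^esub> y) \<odot>\<^bsub>S\<^esub> s)"
      using S.eq_iff_minus_zero x y pi_closed S.smult_closed s(1) by simp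
    finally show ?thesis .
  qed
  \<comment> \<open>An element of \<open>Q\<close> absorbs \<open>\<epsilon>\<close> on both sides,
    so \<open>pi_mult\<close> applies twice and a factor from \<open>Q\<close> passes through
    \<open>\<pi>\<close> unchanged.\<close>
  have piQ: "\<pi> (r \<otimes>\<^bsub>R\<^esub> (q \<otimes>\<^bsub>R\<^esub> x)) = \<pi> r \<otimes>\<^bsub>Q\<^esub> (q \<otimes>\<^bsub>Q\<^esub> \<pi> x)"
    if r: "r \<in> carrier R" and q: "q \<in> carrier Q" and x: "x \<in> carrier R" for r q x
  proof -
    have "q \<otimes>\<^bsub>R\<^esub> x = q \<otimes>\<^bsub>R\<^esub> (\<epsilon> \<otimes>\<^bsub>R\<^esub> x)"
      using eps_right[OF q] R.m_assoc[OF sub[OF q] eps_R x] by simp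
    then have 1: "\<pi> (q \<otimes>\<^bsub>R\<^esub> x) = q \<otimes>\<^bsub>Q\<^esub> \<pi> x"
      using pi_mult[OF sub[OF q] x] pi_id[OF q] mult_eq[OF q pi_closed[OF x]] by simp
    have "q \<otimes>\<^bsub>R\<^esub> x = \<epsilon> \<otimes>\<^bsub>R\<^esub> (q \<otimes>\<^bsub>R\<^esub> x)"
      using eps_left[OF q] R.m_assoc[OF eps_R sub[OF q] x] by simp
    then have "\<pi> (r \<otimes>\<^bsub>R\<^esub> (q \<otimes>\<^bsub>R\<^esub> x)) = \<pi> r \<otimes>\<^bsub>R\<^esub> \<pi> (q \<otimes>\<^bsub>R\<^esub> x)"
      using pi_mult[OF r R.m_closed[OF sub[OF q] x]] by simp
    then show ?thesis using 1 mult_eq[OF pi_closed[OF r] Q.m_closed[OF q pi_closed[OF x]]] by simp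
  qed
  \<comment> \<open>Right multiplication by \<open>\<epsilon>\<close> is invisible to
    \<open>\<pi>\<close>, hence trivial modulo \<open>N\<close>, so the image of
    \<open>\<epsilon>\<close> generates \<open>U\<close>.\<close>
  have he: "h z = z \<odot>\<^bsub>U\<^esub> h \<epsilon>" if z: "z \<in> carrier R" for z
  proof -
    have "h z = h (z \<otimes>\<^bsub>R\<^esub> \<epsilon>)"
      using heq[OF z R.m_closed[OF z eps_R]] pi_right z eps_R by (simp add: R.m_assoc[symmetric])
    then show ?thesis using hsm[OF z eps_R] by simp
  qed
  have he0: "h \<epsilon> \<noteq> \<zero>\<^bsub>U\<^esub>"
  proof
    assume "h \<epsilon> = \<zero>\<^bsub>U\<^esub>"
    then have "\<epsilon> \<in> N" using h0[OF eps_R] by simp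
    then have "\<pi> (\<one>\<^bsub>R\<^esub> \<otimes>\<^bsub>R\<^esub> \<epsilon>) \<odot>\<^bsub>S\<^esub> s = \<zero>\<^bsub>S\<^esub>" unfolding N_def using R.one_closed by blast
    then show False using s eps_R pi_id[OF eps_Q] S.smult_one[OF s(1)] one_eq by simp
  qed
  have simple: "simple_module R U"
  proof (rule simple_moduleI[OF U hc[OF eps_R] he0])
    fix v w assume v: "v \<in> carrier U" "v \<noteq> \<zero>\<^bsub>U\<^esub>" and w: "w \<in> carrier U"
    obtain x where x: "x \<in> carrier R" "v = h x" using v hU by auto
    obtain z where z: "z \<in> carrier R" "w = h z" using w hU by auto
    from v x h0 obtain r where r: "r \<in> carrier R" "\<pi> (r \<otimes>\<^bsub>R\<^esub> x) \<odot>\<^bsub>S\<^esub> s \<noteq> \<zero>\<^bsub>S\<^esub>" by (auto simp: N_def)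
    note rx = R.m_closed[OF r(1) x(1)]
    obtain q where q: "q \<in> carrier Q" "s = q \<odot>\<^bsub>S\<^esub> (\<pi> (r \<otimes>\<^bsub>R\<^esub> x) \<odot>\<^bsub>S\<^esub> s)"
      using simple_moduleD[OF S S.smult_closed[OF pi_closed[OF rx] s(1)] r(2) s(1)] by blast
    \<comment> \<open>\<open>q\<close> was chosen with \<open>q \<pi>(r x) s = s\<close>; therefore
      \<open>q r x\<close> and \<open>\<epsilon>\<close> agree modulo \<open>N\<close>, and the
      nonzero element \<open>h x\<close> generates the generator.\<close>
    have "h (q \<otimes>\<^bsub>R\<^esub> (r \<otimes>\<^bsub>R\<^esub> x)) = h \<epsilon>"
    proof (subst heq[OF R.m_closed[OF sub[OF q(1)] rx] eps_R], intro ballI)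
      fix r' assume r': "r' \<in> carrier R"
      have "\<pi> (r' \<otimes>\<^bsub>R\<^esub> (q \<otimes>\<^bsub>R\<^esub> (r \<otimes>\<^bsub>R\<^esub> x))) \<odot>\<^bsub>S\<^esub> s = \<pi> r' \<odot>\<^bsub>S\<^esub> (q \<odot>\<^bsub>S\<^esub> (\<pi> (r \<otimes>\<^bsub>R\<^esub> x) \<odot>\<^bsub>S\<^esub> s))"
        using piQ[OF r' q(1) rx] by (simp add: S.smult_assoc1 pi_closed r' q(1) rx s(1) del: R.m_closed)
      then show "\<pi> (r' \<otimes>\<^bsub>R\<^esub> (q \<otimes>\<^bsub>R\<^esub> (r \<otimes>\<^bsub>R\<^esub> x))) \<odot>\<^bsub>S\<^esub> s = \<pi> (r' \<otimes>\<^bsub>R\<^esub> \<epsilon>) \<odot>\<^bsub>S\<^esub> s"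
        using q(2) pi_right[OF r'] by simp
    qed
    then have "w = z \<odot>\<^bsub>U\<^esub> h (q \<otimes>\<^bsub>R\<^esub> (r \<otimes>\<^bsub>R\<^esub> x))" using he[OF z(1)] z(2) by simp
    also have "\<dots> = (z \<otimes>\<^bsub>R\<^esub> (q \<otimes>\<^bsub>R\<^esub> r)) \<odot>\<^bsub>U\<^esub> h x"
      using z x r(1) sub[OF q(1)] by (simp add: hsm[symmetric] R.m_assoc)
    finally show "\<exists>a\<in>carrier R. w = a \<odot>\<^bsub>U\<^esub> v" using z(1) sub[OF q(1)] r(1) x(2) by auto
  qed
  have ap: "apex U"
    unfolding apex_def
  proof (intro conjI ballI bexI[of _ "h \<epsilon>"])
    show "\<epsilon> \<odot>\<^bsub>U\<^esub> h \<epsilon> \<noteq> \<zero>\<^bsub>U\<^esub>" using he[OF eps_R] he0 by simp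
  next
    fix x u assume x: "x \<in> carrier R" and "u \<in> carrier U"
    then obtain z where z: "z \<in> carrier R" "u = h z" using hU by auto
    note xz = R.m_closed[OF x R.m_closed[OF eps_R z(1)]]
    \<comment> \<open>Modulo \<open>N\<close>, the factor \<open>\<epsilon> x \<epsilon>\<close> in
      front of \<open>z\<close> may be replaced by \<open>\<pi> x\<close>; this is the apex
      condition for \<open>U\<close>.\<close>
    have "h (\<epsilon> \<otimes>\<^bsub>R\<^esub> (x \<otimes>\<^bsub>R\<^esub> (\<epsilon> \<otimes>\<^bsub>R\<^esub> z))) = h (\<pi> x \<otimes>\<^bsub>R\<^esub> z)"
    proof (subst heq[OF R.m_closed[OF eps_R xz] R.m_closed[OF sub[OF pi_closed[OF x]] z(1)]], intro ballI)
      fix r assume r: "r \<in> carrier R"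
      have "\<pi> (r \<otimes>\<^bsub>R\<^esub> (\<epsilon> \<otimes>\<^bsub>R\<^esub> (x \<otimes>\<^bsub>R\<^esub> (\<epsilon> \<otimes>\<^bsub>R\<^esub> z)))) = \<pi> r \<otimes>\<^bsub>R\<^esub> (\<pi> x \<otimes>\<^bsub>R\<^esub> \<pi> z)"
        using pi_mult[OF r xz] pi_mult[OF x z(1)] by simp
      also have "\<dots> = \<pi> (r \<otimes>\<^bsub>R\<^esub> (\<pi> x \<otimes>\<^bsub>R\<^esub> z))"
        using piQ[OF r pi_closed[OF x] z(1)] mult_eq[OF pi_closed[OF x] pi_closed[OF z(1)]]
          mult_eq[OF pi_closed[OF r] Q.m_closed[OF pi_closed[OF x] pi_closed[OF z(1)]]] by simp
      finally show "\<pi> (r \<otimes>\<^bsub>R\<^esub> (\<epsilon> \<otimes>\<^bsub>R\<^esub> (x \<otimes>\<^bsub>R\<^esub> (\<epsilon> \<otimes>\<^bsub>R\<^esub> z)))) \<odot>\<^bsub>S\<^esub> s = \<pi> (r \<otimes>\<^bsub>R\<^esub> (\<pi> x \<otimes>\<^bsub>R\<^esub> z)) \<odot>\<^bsub>S\<^esub> s" by simp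
    qed
    then show "\<epsilon> \<odot>\<^bsub>U\<^esub> (x \<odot>\<^bsub>U\<^esub> (\<epsilon> \<odot>\<^bsub>U\<^esub> u)) = \<pi> x \<odot>\<^bsub>U\<^esub> u"
      using z x eps_R sub[OF pi_closed[OF x]] by (simp add: hsm)
  qed (use simple hc eps_R in auto)
  \<comment> \<open>\<open>N\<close> meets \<open>Q\<close> exactly in the annihilator of
    \<open>s\<close>, which identifies the image of \<open>Q\<close> in \<open>U\<close> with
    \<open>Q s\<close>, that is, with \<open>S\<close>.\<close>
  have hQ: "h q = h q' \<longleftrightarrow> q \<odot>\<^bsub>S\<^esub> s = q' \<odot>\<^bsub>S\<^esub> s" if q: "q \<in> carrier Q" and q': "q' \<in> carrier Q" for q q'
  proof
    assume "h q = h q'"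
    then have "\<pi> (\<one>\<^bsub>R\<^esub> \<otimes>\<^bsub>R\<^esub> q) \<odot>\<^bsub>S\<^esub> s = \<pi> (\<one>\<^bsub>R\<^esub> \<otimes>\<^bsub>R\<^esub> q') \<odot>\<^bsub>S\<^esub> s" using heq[OF sub[OF q] sub[OF q']] by blast
    then show "q \<odot>\<^bsub>S\<^esub> s = q' \<odot>\<^bsub>S\<^esub> s" using q q' sub pi_id by simp
  next
    assume *: "q \<odot>\<^bsub>S\<^esub> s = q' \<odot>\<^bsub>S\<^esub> s"
    have "\<pi> (r \<otimes>\<^bsub>R\<^esub> p) \<odot>\<^bsub>S\<^esub> s = \<pi> r \<odot>\<^bsub>S\<^esub> (p \<odot>\<^bsub>S\<^esub> s)" if r: "r \<in> carrier R" and p: "p \<in> carrier Q" for r p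
      using piQ[OF r p eps_R] pi_id[OF eps_Q] p r s(1) eps_right[OF p] eps_Q
        mult_eq[OF p eps_Q] by (simp add: S.smult_assoc1 pi_closed)
    then show "h q = h q'" using heq[OF sub[OF q] sub[OF q']] q q' * by simp
  qed
  have "\<forall>t \<in> carrier S. \<exists>q. q \<in> carrier Q \<and> t = q \<odot>\<^bsub>S\<^esub> s" using simple_moduleD[OF S s] by blast
  then obtain c where c: "\<And>t. t \<in> carrier S \<Longrightarrow> c t \<in> carrier Q" "\<And>t. t \<in> carrier S \<Longrightarrow> c t \<odot>\<^bsub>S\<^esub> s = t"
    by metis
  have c': "h (c (q \<odot>\<^bsub>S\<^esub> s)) = h q" if "q \<in> carrier Q" for q
    using hQ[of "c (q \<odot>\<^bsub>S\<^esub> s)" q] c S.smult_closed[OF that s(1)] that by simp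
  have "semi_iso Q id S (cut_module \<epsilon> U)"
  proof (rule semi_isoI[where h = "\<lambda>t. h (c t)"])
    show "bij_betw (\<lambda>t. h (c t)) (carrier S) (carrier (cut_module \<epsilon> U))"
    proof (rule bij_betw_imageI)
      show "inj_on (\<lambda>t. h (c t)) (carrier S)"
        by (rule inj_onI) (metis c hQ)
      show "(\<lambda>t. h (c t)) ` carrier S = carrier (cut_module \<epsilon> U)"
      proof (intro equalityI subsetI)
        fix y assume "y \<in> (\<lambda>t. h (c t)) ` carrier S"
        then obtain t where t: "t \<in> carrier S" "y = h (c t)" by blast
        have "y = \<epsilon> \<odot>\<^bsub>U\<^esub> h (c t)"
          using t hsm[OF eps_R sub[OF c(1)[OF t(1)]]] eps_left[OF c(1)[OF t(1)]] by simp
        then show "y \<in> carrier (cut_module \<epsilon> U)" using hc[OF sub[OF c(1)[OF t(1)]]] by simp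
      next
        fix y assume "y \<in> carrier (cut_module \<epsilon> U)"
        then obtain z where z: "z \<in> carrier R" "y = \<epsilon> \<odot>\<^bsub>U\<^esub> h z"
          unfolding cut_module_sel(1) hU[symmetric] by blast
        have "h (\<epsilon> \<otimes>\<^bsub>R\<^esub> z) = h (\<pi> z)"
        proof (subst heq[OF R.m_closed[OF eps_R z(1)] sub[OF pi_closed[OF z(1)]]], intro ballI)
          fix r assume r: "r \<in> carrier R"
          have "\<pi> (r \<otimes>\<^bsub>R\<^esub> (\<epsilon> \<otimes>\<^bsub>R\<^esub> z)) = \<pi> (r \<otimes>\<^bsub>R\<^esub> \<pi> z)"
            using piQ[OF r eps_Q z(1)] piQ[OF r eps_Q sub[OF pi_closed[OF z(1)]]]
              eps_left[OF pi_closed[OF z(1)]] pi_id[OF pi_closed[OF z(1)]] by simp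
          then show "\<pi> (r \<otimes>\<^bsub>R\<^esub> (\<epsilon> \<otimes>\<^bsub>R\<^esub> z)) \<odot>\<^bsub>S\<^esub> s = \<pi> (r \<otimes>\<^bsub>R\<^esub> \<pi> z) \<odot>\<^bsub>S\<^esub> s" by simp
        qed
        then have "y = h (c (\<pi> z \<odot>\<^bsub>S\<^esub> s))"
          using z hsm[OF eps_R z(1)] c'[OF pi_closed[OF z(1)]] by simp
        then show "y \<in> (\<lambda>t. h (c t)) ` carrier S" using S.smult_closed[OF pi_closed[OF z(1)] s(1)] by simp
      qed
    qed
  next
    fix t t' assume t: "t \<in> carrier S" "t' \<in> carrier S"
    have "t \<oplus>\<^bsub>S\<^esub> t' = (c t \<oplus>\<^bsub>Q\<^esub> c t') \<odot>\<^bsub>S\<^esub> s" using c t s(1) by (simp add: S.smult_l_distr)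
    then show "h (c (t \<oplus>\<^bsub>S\<^esub> t')) = h (c t) \<oplus>\<^bsub>cut_module \<epsilon> U\<^esub> h (c t')"
      using c'[of "c t \<oplus>\<^bsub>Q\<^esub> c t'"] c(1) t hadd[of "c t" "c t'"] add_eq[of "c t" "c t'"] sub
        Q.a_closed[OF c(1)[OF t(1)] c(1)[OF t(2)]] by simp
  next
    fix q t assume q: "q \<in> carrier Q" and t: "t \<in> carrier S"
    have "q \<odot>\<^bsub>S\<^esub> t = (q \<otimes>\<^bsub>Q\<^esub> c t) \<odot>\<^bsub>S\<^esub> s" using c t s(1) q by (simp add: S.smult_assoc1)
    then show "h (c (q \<odot>\<^bsub>S\<^esub> t)) = id q \<odot>\<^bsub>cut_module \<epsilon> U\<^esub> h (c t)"
      using c'[of "q \<otimes>\<^bsub>Q\<^esub> c t"] c(1) t q hsm[of q "c t"] mult_eq[of q "c t"] sub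
        Q.m_closed[OF q c(1)[OF t]] by simp
  qed
  then have "semi_iso Q id (cut_module \<epsilon> U) S"
    by (rule semi_iso_inv[OF _ S.left_module_axioms]) auto
  with ap show ?thesis by blast
qed

end


section \<open>Category algebras\<close>

definition field_aut :: "('k::field \<Rightarrow> 'k) \<Rightarrow> bool" where
  "field_aut \<sigma> \<longleftrightarrow> bij \<sigma> \<and> (\<forall>x y. \<sigma> (x + y) = \<sigma> x + \<sigma> y) \<and> (\<forall>x y. \<sigma> (x * y) = \<sigma> x * \<sigma> y)"

lemma field_aut_simps:
  assumes "field_aut \<sigma>"
  shows "\<sigma> (x + y) = \<sigma> x + \<sigma> y" "\<sigma> (x * y) = \<sigma> x * \<sigma> y" "\<sigma> 0 = 0" "\<sigma> 1 = 1"
    "\<sigma> (inv_into UNIV \<sigma> x) = x" "inv_into UNIV \<sigma> (\<sigma> x) = x" "\<sigma> x = \<sigma> y \<longleftrightarrow> x = y" "\<sigma> (sum f S) = (\<Sum>s\<in>S. \<sigma> (f s))"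
proof -
  have add: "\<sigma> (x + y) = \<sigma> x + \<sigma> y" and mult: "\<sigma> (x * y) = \<sigma> x * \<sigma> y" for x y
    using assms unfolding field_aut_def by blast+
  have inj: "inj \<sigma>" and surj: "surj \<sigma>" using assms unfolding field_aut_def bij_def by blast+
  show "\<sigma> (x + y) = \<sigma> x + \<sigma> y" "\<sigma> (x * y) = \<sigma> x * \<sigma> y" by (fact add mult)+
  show 0: "\<sigma> 0 = 0" by (metis add add.right_neutral add_left_cancel)
  have "\<sigma> 1 \<noteq> \<sigma> 0" using inj by (metis injD zero_neq_one)
  then show "\<sigma> 1 = 1" using mult[of 1 1] 0 by simp
  show "\<sigma> (inv_into UNIV \<sigma> x) = x" using surj by (rule surj_f_inv_f)
  show "inv_into UNIV \<sigma> (\<sigma> x) = x" using inj by simp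
  show "\<sigma> x = \<sigma> y \<longleftrightarrow> x = y" using inj by (auto dest: injD)
  show "\<sigma> (sum f S) = (\<Sum>s\<in>S. \<sigma> (f s))"
    by (induction S rule: infinite_finite_induct) (simp_all add: 0 add)
qed

lemma field_aut_id: "field_aut id" by (simp add: field_aut_def)

lemma field_aut_comp: "\<lbrakk>field_aut \<sigma>; field_aut \<tau>\<rbrakk> \<Longrightarrow> field_aut (\<sigma> \<circ> \<tau>)"
  unfolding field_aut_def by (simp add: bij_comp)

lemma field_aut_inv: assumes "field_aut \<sigma>" shows "field_aut (inv_into UNIV \<sigma>)"
  unfolding field_aut_def
proof (intro conjI allI)
  note \<sigma> = field_aut_simps[OF assms]
  show "bij (inv_into UNIV \<sigma>)" using assms by (simp add: field_aut_def bij_imp_bij_inv)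
  fix x y
  show "inv_into UNIV \<sigma> (x + y) = inv_into UNIV \<sigma> x + inv_into UNIV \<sigma> y"
    by (subst \<sigma>(7)[symmetric]) (simp only: \<sigma>(1,5))
  show "inv_into UNIV \<sigma> (x * y) = inv_into UNIV \<sigma> x * inv_into UNIV \<sigma> y"
    by (subst \<sigma>(7)[symmetric]) (simp only: \<sigma>(2,5))
qed

definition smon :: "'k::field \<Rightarrow> 'm \<Rightarrow> 'm \<Rightarrow> 'k" where
  "smon c s = (\<lambda>m. if m = s then c else 0)"

lemma basis_elt_eq: "basis_elt s = smon 1 s" by (simp add: basis_elt_def smon_def)

lemma cat_algebra_sel:
  "carrier (cat_algebra D) = {f. \<forall>m. m \<notin> Mor D \<longrightarrow> f m = 0}"
  "\<one>\<^bsub>cat_algebra D\<^esub> = (\<lambda>m. if m \<in> ident D ` Ob D then 1 else 0)"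
  "\<zero>\<^bsub>cat_algebra D\<^esub> = (\<lambda>_. 0)" "f \<oplus>\<^bsub>cat_algebra D\<^esub> g = (\<lambda>m. f m + g m)"
  by (simp_all add: cat_algebra_def)

lemma smon_closed: "s \<in> Mor D \<Longrightarrow> smon c s \<in> carrier (cat_algebra D)"
  by (auto simp: cat_algebra_sel smon_def)

text \<open>Additive statements about finitely supported coefficient functions are reduced to
  monomials by this rule.\<close>

lemma supported_induct:
  assumes "finite S" "\<And>m. m \<notin> S \<Longrightarrow> f m = 0"
    and "P (\<lambda>_. 0)" "\<And>c s. s \<in> S \<Longrightarrow> P (smon c s)"
    and "\<And>f g. \<lbrakk>\<And>m. m \<notin> S \<Longrightarrow> f m = 0; \<And>m. m \<notin> S \<Longrightarrow> g m = 0; P f; P g\<rbrakk> \<Longrightarrow> P (\<lambda>m. f m + g m)"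
  shows "P (f :: 'm \<Rightarrow> 'k::field)"
proof -
  have "P f" if "finite T" "T \<subseteq> S" "\<And>m. m \<notin> T \<Longrightarrow> f m = 0" for T and f :: "'m \<Rightarrow> 'k"
    using that
  proof (induction T arbitrary: f rule: finite_induct)
    case empty
    then have "f = (\<lambda>_. 0)" by auto
    then show ?case using assms(3) by simp
  next
    case (insert x T)
    have "f = (\<lambda>m. smon (f x) x m + (f(x := 0)) m)" by (auto simp: smon_def)
    moreover have "P (\<lambda>m. smon (f x) x m + (f(x := 0)) m)"
    proof (rule assms(5))
      show "P (smon (f x) x)" using insert assms(4) by blast
      show "P (f(x := 0))" using insert.prems by (intro insert.IH) auto
    qed (use insert.prems in \<open>auto simp: smon_def\<close>)
    ultimately show ?case by simp
  qed
  then show ?thesis using assms(1,2) by blast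
qed

context finite_category begin

lemma Mor_Hom: "s \<in> Mor C \<Longrightarrow> s \<in> Hom C (src C s) (tgt C s)" by (simp add: Hom_def)

lemma cmp_Mor [simp]:
  assumes "s \<in> Mor C" "t \<in> Mor C" "src C s = tgt C t"
  shows "cmp C s t \<in> Mor C" "src C (cmp C s t) = src C t" "tgt C (cmp C s t) = tgt C s"
  using cmp_closed[of s "tgt C t" "tgt C s" t "src C t"] assms by (auto simp: Hom_def)

lemma assoc:
  "\<lbrakk>r \<in> Mor C; s \<in> Mor C; t \<in> Mor C; src C r = tgt C s; src C s = tgt C t\<rbrakk>
    \<Longrightarrow> cmp C (cmp C r s) t = cmp C r (cmp C s t)"
  by (rule cmp_assoc[of _ "tgt C s" "tgt C r" _ "tgt C t" _ "src C t"]) (auto simp: Hom_def)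

lemma ident_simps [simp]:
  "V \<in> Ob C \<Longrightarrow> ident C V \<in> Mor C" "V \<in> Ob C \<Longrightarrow> src C (ident C V) = V" "V \<in> Ob C \<Longrightarrow> tgt C (ident C V) = V"
  using ident_closed by (auto simp: Hom_def)

lemma ident_left: "\<lbrakk>s \<in> Mor C; tgt C s = V\<rbrakk> \<Longrightarrow> cmp C (ident C V) s = s"
  using cmp_ident_left Mor_Hom by blast

lemma ident_right: "\<lbrakk>s \<in> Mor C; src C s = V\<rbrakk> \<Longrightarrow> cmp C s (ident C V) = s"
  using cmp_ident_right Mor_Hom by blast

text \<open>In this form both sums run over the fixed set \<open>Mor C\<close> and the condition
  sits in the summand, so sums can be swapped freely.\<close>

lemma cat_mult:
  fixes f g :: "'b \<Rightarrow> 'k::field"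
  shows "(f \<otimes>\<^bsub>cat_algebra C\<^esub> g) m =
    (\<Sum>s \<in> Mor C. \<Sum>t \<in> Mor C. if src C s = tgt C t \<and> cmp C s t = m then f s * g t else 0)"
proof -
  have "(f \<otimes>\<^bsub>cat_algebra C\<^esub> g) m = (\<Sum>(s, t) \<in> {(s, t). s \<in> Mor C \<and> t \<in> Mor C \<and>
                      src C s = tgt C t \<and> cmp C s t = m}. f s * g t)"
    by (simp add: cat_algebra_def)
  also have "\<dots> = (\<Sum>(s, t) \<in> Mor C \<times> Mor C. if src C s = tgt C t \<and> cmp C s t = m then f s * g t else 0)"
    by (rule sum.mono_neutral_cong_left) (auto simp: finite_Mor split: if_splits)
  finally show ?thesis by (simp add: sum.cartesian_product)
qed

lemma cat_mult_closed:
  fixes f g :: "'b \<Rightarrow> 'k::field"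
  shows "f \<otimes>\<^bsub>cat_algebra C\<^esub> g \<in> carrier (cat_algebra C)"
proof -
  have "(f \<otimes>\<^bsub>cat_algebra C\<^esub> g) m = 0" if "m \<notin> Mor C" for m
    unfolding cat_mult using that by (intro sum.neutral ballI) auto
  then show ?thesis by (simp add: cat_algebra_sel)
qed

text \<open>Evaluates the linear functional with values \<open>h\<close> on a product. Associativity
  applies it once to each bracketing.\<close>

lemma cat_mult_functional:
  fixes f g h :: "'b \<Rightarrow> 'k::field"
  shows "(\<Sum>x \<in> Mor C. (f \<otimes>\<^bsub>cat_algebra C\<^esub> g) x * h x) =
    (\<Sum>s \<in> Mor C. \<Sum>t \<in> Mor C. if src C s = tgt C t then f s * g t * h (cmp C s t) else 0)"
proof -
  have "(\<Sum>x \<in> Mor C. (f \<otimes>\<^bsub>cat_algebra C\<^esub> g) x * h x) =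
    (\<Sum>x \<in> Mor C. \<Sum>s \<in> Mor C. \<Sum>t \<in> Mor C.
      if src C s = tgt C t \<and> cmp C s t = x then f s * g t * h x else 0)"
    unfolding cat_mult by (intro sum.cong refl) (simp add: sum_distrib_right if_distrib[of "\<lambda>y. y * _"] cong: if_cong)
  also have "\<dots> = (\<Sum>s \<in> Mor C. \<Sum>x \<in> Mor C. \<Sum>t \<in> Mor C.
      if src C s = tgt C t \<and> cmp C s t = x then f s * g t * h x else 0)"
    by (rule sum.swap)
  also have "\<dots> = (\<Sum>s \<in> Mor C. \<Sum>t \<in> Mor C. \<Sum>x \<in> Mor C.
      if src C s = tgt C t \<and> cmp C s t = x then f s * g t * h x else 0)"
    by (intro sum.cong refl sum.swap)
  also have "\<dots> = (\<Sum>s \<in> Mor C. \<Sum>t \<in> Mor C. if src C s = tgt C t then f s * g t * h (cmp C s t) else 0)"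
  proof (intro sum.cong refl)
    fix s t assume st: "s \<in> Mor C" "t \<in> Mor C"
    show "(\<Sum>x \<in> Mor C. if src C s = tgt C t \<and> cmp C s t = x then f s * g t * h x else 0) =
      (if src C s = tgt C t then f s * g t * h (cmp C s t) else 0)"
      using st by (cases "src C s = tgt C t") (simp_all add: finite_Mor sum.delta')
  qed
  finally show ?thesis .
qed

lemma cat_mult_assoc:
  fixes f g h :: "'b \<Rightarrow> 'k::field"
  shows "(f \<otimes>\<^bsub>cat_algebra C\<^esub> g) \<otimes>\<^bsub>cat_algebra C\<^esub> h = f \<otimes>\<^bsub>cat_algebra C\<^esub> (g \<otimes>\<^bsub>cat_algebra C\<^esub> h)"
proof
  fix m
  let ?M = "Mor C"
  \<comment> \<open>\<open>\<phi> x\<close> is the coefficient of \<open>m\<close> in the product of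
    the morphism \<open>x\<close> with \<open>h\<close>, and \<open>\<psi> s y\<close> is the
    coefficient of \<open>m\<close> in the product of \<open>s\<close> with \<open>y\<close>. These
    are the functionals for the two bracketings.\<close>
  define \<phi> where "\<phi> x = (\<Sum>r \<in> ?M. if src C x = tgt C r \<and> cmp C x r = m then h r else 0)" for x
  define \<psi> :: "'b \<Rightarrow> 'b \<Rightarrow> 'k" where "\<psi> s y = (if src C s = tgt C y \<and> cmp C s y = m then 1 else 0)" for s y
  have "((f \<otimes>\<^bsub>cat_algebra C\<^esub> g) \<otimes>\<^bsub>cat_algebra C\<^esub> h) m = (\<Sum>x \<in> ?M. (f \<otimes>\<^bsub>cat_algebra C\<^esub> g) x * \<phi> x)"
    by (subst cat_mult) (simp add: \<phi>_def sum_distrib_left if_distrib[of "\<lambda>y. _ * y"] cong: if_cong)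
  also have "\<dots> = (\<Sum>s \<in> ?M. \<Sum>t \<in> ?M. if src C s = tgt C t then f s * g t * \<phi> (cmp C s t) else 0)"
    by (rule cat_mult_functional)
  also have "\<dots> = (\<Sum>s \<in> ?M. \<Sum>t \<in> ?M. \<Sum>r \<in> ?M. if src C t = tgt C r then f s * (g t * h r * \<psi> s (cmp C t r)) else 0)"
    by (intro sum.cong refl)
      (auto simp: \<phi>_def \<psi>_def sum_distrib_left assoc intro!: sum.cong sum.neutral)
  also have "\<dots> = (\<Sum>s \<in> ?M. f s * (\<Sum>y \<in> ?M. (g \<otimes>\<^bsub>cat_algebra C\<^esub> h) y * \<psi> s y))"
    unfolding cat_mult_functional
    by (simp add: sum_distrib_left if_distrib[of "\<lambda>y. _ * y"] cong: if_cong)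
  also have "\<dots> = (f \<otimes>\<^bsub>cat_algebra C\<^esub> (g \<otimes>\<^bsub>cat_algebra C\<^esub> h)) m"
    by (subst (2) cat_mult) (simp add: \<psi>_def sum_distrib_left if_distrib[of "\<lambda>y. _ * y"] cong: if_cong)
  finally show "((f \<otimes>\<^bsub>cat_algebra C\<^esub> g) \<otimes>\<^bsub>cat_algebra C\<^esub> h) m = (f \<otimes>\<^bsub>cat_algebra C\<^esub> (g \<otimes>\<^bsub>cat_algebra C\<^esub> h)) m" .
qed

lemma one_closed: "\<one>\<^bsub>cat_algebra C\<^esub> \<in> carrier (cat_algebra C :: ('b \<Rightarrow> 'k::field) ring)"
  by (auto simp: cat_algebra_sel)

lemma is_ident: "\<lbrakk>s \<in> Mor C; s \<in> ident C ` Ob C\<rbrakk> \<Longrightarrow> s = ident C (src C s) \<and> s = ident C (tgt C s)"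
  by auto

lemma cat_one_left:
  fixes f :: "'b \<Rightarrow> 'k::field"
  assumes "f \<in> carrier (cat_algebra C)" shows "\<one>\<^bsub>cat_algebra C\<^esub> \<otimes>\<^bsub>cat_algebra C\<^esub> f = f"
proof
  fix m
  have "(\<one>\<^bsub>cat_algebra C\<^esub> \<otimes>\<^bsub>cat_algebra C\<^esub> f) m = (\<Sum>t \<in> Mor C. \<Sum>s \<in> Mor C.
      if src C s = tgt C t \<and> cmp C s t = m then (if s \<in> ident C ` Ob C then 1 else 0) * f t else 0)"
    unfolding cat_mult cat_algebra_sel(2) by (rule sum.swap)
  also have "\<dots> = (\<Sum>t \<in> Mor C. \<Sum>s \<in> Mor C. if s = ident C (tgt C t) then (if t = m then f t else 0) else 0)"
  proof (intro sum.cong refl)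
    fix t s assume "t \<in> Mor C" "s \<in> Mor C"
    then show "(if src C s = tgt C t \<and> cmp C s t = m then (if s \<in> ident C ` Ob C then 1 else 0) * f t else 0)
      = (if s = ident C (tgt C t) then (if t = m then f t else 0) else 0)"
      using is_ident[of s] tgt_closed[of t] by (cases "s = ident C (tgt C t)") (auto simp: ident_left)
  qed
  also have "\<dots> = (\<Sum>t \<in> Mor C. if t = m then f t else 0)"
    by (intro sum.cong refl) (simp add: finite_Mor tgt_closed)
  also have "\<dots> = f m" using assms by (simp add: finite_Mor cat_algebra_sel)
  finally show "(\<one>\<^bsub>cat_algebra C\<^esub> \<otimes>\<^bsub>cat_algebra C\<^esub> f) m = f m" .
qed

lemma cat_one_right:
  fixes f :: "'b \<Rightarrow> 'k::field"
  assumes "f \<in> carrier (cat_algebra C)" shows "f \<otimes>\<^bsub>cat_algebra C\<^esub> \<one>\<^bsub>cat_algebra C\<^esub> = f"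
proof
  fix m
  have "(f \<otimes>\<^bsub>cat_algebra C\<^esub> \<one>\<^bsub>cat_algebra C\<^esub>) m = (\<Sum>s \<in> Mor C. \<Sum>t \<in> Mor C.
      if src C s = tgt C t \<and> cmp C s t = m then f s * (if t \<in> ident C ` Ob C then 1 else 0) else 0)"
    unfolding cat_mult cat_algebra_sel(2) ..
  also have "\<dots> = (\<Sum>s \<in> Mor C. \<Sum>t \<in> Mor C. if t = ident C (src C s) then (if s = m then f s else 0) else 0)"
  proof (intro sum.cong refl)
    fix s t assume "s \<in> Mor C" "t \<in> Mor C"
    then show "(if src C s = tgt C t \<and> cmp C s t = m then f s * (if t \<in> ident C ` Ob C then 1 else 0) else 0)
      = (if t = ident C (src C s) then (if s = m then f s else 0) else 0)"
      using is_ident[of t] src_closed[of s] by (cases "t = ident C (src C s)") (auto simp: ident_right)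
  qed
  also have "\<dots> = (\<Sum>s \<in> Mor C. if s = m then f s else 0)"
    by (intro sum.cong refl) (simp add: finite_Mor src_closed)
  also have "\<dots> = f m" using assms by (simp add: finite_Mor cat_algebra_sel)
  finally show "(f \<otimes>\<^bsub>cat_algebra C\<^esub> \<one>\<^bsub>cat_algebra C\<^esub>) m = f m" .
qed

lemma cat_ring: "ring (cat_algebra C :: ('b \<Rightarrow> 'k::field) ring)"
proof (rule ringI)
  show "abelian_group (cat_algebra C :: ('b \<Rightarrow> 'k) ring)"
  proof (rule abelian_groupI)
    fix x :: "'b \<Rightarrow> 'k" assume "x \<in> carrier (cat_algebra C)"
    then show "\<exists>y\<in>carrier (cat_algebra C). y \<oplus>\<^bsub>cat_algebra C\<^esub> x = \<zero>\<^bsub>cat_algebra C\<^esub>"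
      by (intro bexI[of _ "\<lambda>m. - x m"]) (auto simp: cat_algebra_sel)
  qed (auto simp: cat_algebra_sel algebra_simps)
  show "monoid (cat_algebra C :: ('b \<Rightarrow> 'k) ring)"
    by (rule monoidI) (auto simp: cat_mult_closed one_closed cat_mult_assoc cat_one_left cat_one_right)
  fix x y z :: "'b \<Rightarrow> 'k"
  show "(x \<oplus>\<^bsub>cat_algebra C\<^esub> y) \<otimes>\<^bsub>cat_algebra C\<^esub> z = x \<otimes>\<^bsub>cat_algebra C\<^esub> z \<oplus>\<^bsub>cat_algebra C\<^esub> y \<otimes>\<^bsub>cat_algebra C\<^esub> z"
    unfolding cat_algebra_sel(4) cat_mult
    by (rule ext, unfold cat_mult sum.distrib[symmetric], intro sum.cong refl) (simp add: distrib_right)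
  show "z \<otimes>\<^bsub>cat_algebra C\<^esub> (x \<oplus>\<^bsub>cat_algebra C\<^esub> y) = z \<otimes>\<^bsub>cat_algebra C\<^esub> x \<oplus>\<^bsub>cat_algebra C\<^esub> z \<otimes>\<^bsub>cat_algebra C\<^esub> y"
    unfolding cat_algebra_sel(4) cat_mult
    by (rule ext, unfold cat_mult sum.distrib[symmetric], intro sum.cong refl) (simp add: distrib_left)
qed

lemma smon_mult:
  assumes "s \<in> Mor C" "t \<in> Mor C"
  shows "smon c s \<otimes>\<^bsub>cat_algebra C\<^esub> smon d t =
    (if src C s = tgt C t then smon (c * d) (cmp C s t) else (\<lambda>_. 0 :: 'k::field))"
proof
  fix m
  have "(smon c s \<otimes>\<^bsub>cat_algebra C\<^esub> smon d t) m = (\<Sum>s' \<in> Mor C. \<Sum>t' \<in> Mor C.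
    if t' = t then (if s' = s then (if src C s = tgt C t \<and> cmp C s t = m then c * d else 0) else 0) else 0)"
    unfolding cat_mult by (intro sum.cong refl) (auto simp: smon_def)
  also have "\<dots> = (if src C s = tgt C t \<and> cmp C s t = m then c * d else 0)"
    using assms by (simp add: finite_Mor)
  finally show "(smon c s \<otimes>\<^bsub>cat_algebra C\<^esub> smon d t) m =
    (if src C s = tgt C t then smon (c * d) (cmp C s t) else (\<lambda>_. 0)) m"
    by (auto simp: smon_def)
qed

lemma smon_comp: "\<lbrakk>s \<in> Mor C; t \<in> Mor C; src C s = tgt C t\<rbrakk> \<Longrightarrow>
    smon c s \<otimes>\<^bsub>cat_algebra C\<^esub> smon d t = smon (c * d :: 'k::field) (cmp C s t)"
  by (simp add: smon_mult)

end

text \<open>Records exactly what the category algebra sees: the morphisms, composability in both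
  directions (vanishing products have to stay zero) and the set of identities. Without an object
  map, categories with different object types can be compared.\<close>

definition cat_iso :: "('o, 'm) category \<Rightarrow> ('q, 'n) category \<Rightarrow> ('m \<Rightarrow> 'n) \<Rightarrow> bool" where
  "cat_iso D D' g \<longleftrightarrow> bij_betw g (Mor D) (Mor D') \<and>
     (\<forall>s \<in> Mor D. \<forall>t \<in> Mor D. (src D s = tgt D t \<longleftrightarrow> src D' (g s) = tgt D' (g t)) \<and>
        (src D s = tgt D t \<longrightarrow> g (cmp D s t) = cmp D' (g s) (g t))) \<and>
     g ` ident D ` Ob D = ident D' ` Ob D'"

lemma semilin_inj:
  assumes "inj_on g S" "s \<in> S" shows "semilin_ext \<sigma> S g a (g s) = \<sigma> (a s)"
proof -
  have "{s' \<in> S. g s' = g s} = {s}" using assms by (auto dest: inj_onD)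
  then show ?thesis by (simp add: semilin_ext_def)
qed

lemma semilin_outside: "n \<notin> g ` S \<Longrightarrow> semilin_ext \<sigma> S g a n = \<sigma> 0"
  unfolding semilin_ext_def by (subst sum.neutral) auto

lemma semilin_cong: "(\<And>s. s \<in> S \<Longrightarrow> g s = g' s) \<Longrightarrow> semilin_ext \<sigma> S g = semilin_ext \<sigma> S g'"
  unfolding semilin_ext_def by (intro ext arg_cong[of _ _ \<sigma>] sum.cong) auto

lemma semilin_id: "(\<And>m. m \<notin> S \<Longrightarrow> a m = 0) \<Longrightarrow> semilin_ext id S id a = a"
proof
  fix n assume *: "\<And>m. m \<notin> S \<Longrightarrow> a m = 0"
  show "semilin_ext id S id a n = a n"
    using * semilin_inj[of id S n id a] semilin_outside[of n id S id a] by (cases "n \<in> S") auto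
qed

lemma semilin_comp:
  assumes "bij_betw g S S'" "inj_on g' S'" "field_aut \<tau>" "field_aut \<sigma>"
  shows "semilin_ext \<tau> S' g' (semilin_ext \<sigma> S g a) = semilin_ext (\<tau> \<circ> \<sigma>) S (g' \<circ> g) a"
proof
  fix n
  have inj: "inj_on g S" "inj_on (g' \<circ> g) S" and S': "S' = g ` S"
    using assms(1,2) by (auto simp: bij_betw_def intro: comp_inj_on)
  show "semilin_ext \<tau> S' g' (semilin_ext \<sigma> S g a) n = semilin_ext (\<tau> \<circ> \<sigma>) S (g' \<circ> g) a n"
  proof (cases "n \<in> (g' \<circ> g) ` S")
    case True
    then obtain s where s: "s \<in> S" "n = g' (g s)" by auto
    then show ?thesis
      using semilin_inj[OF inj(2) s(1), of "\<tau> \<circ> \<sigma>" a] semilin_inj[OF assms(2), of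
          "g s" \<tau>] semilin_inj[OF inj(1) s(1), of \<sigma> a] S'
      by auto
  next
    case False
    then have "n \<notin> g' ` S'" unfolding S' by (simp add: image_comp)
    then show ?thesis
      using semilin_outside[OF False, of "\<tau> \<circ> \<sigma>" a] semilin_outside[of n g' S' \<tau>] field_aut_simps(3)[OF assms(3)]
        field_aut_simps(3)[OF assms(4)] by simp
  qed
qed

lemma semilin_smon:
  assumes "inj_on g S" "s \<in> S" "field_aut \<sigma>"
  shows "semilin_ext \<sigma> S g (smon c s) = smon (\<sigma> c) (g s)"
proof
  fix n
  show "semilin_ext \<sigma> S g (smon c s) n = smon (\<sigma> c) (g s) n"
  proof (cases "n \<in> g ` S")
    case True
    then obtain s' where s': "s' \<in> S" "n = g s'" by auto
    then show ?thesis using semilin_inj[OF assms(1), of s' \<sigma>] assms field_aut_simps(3)[OF assms(3)]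
      by (auto simp: smon_def dest: inj_onD)
  next
    case False
    then show ?thesis using semilin_outside[OF False, of \<sigma>] assms(2) field_aut_simps(3)[OF assms(3)]
      by (auto simp: smon_def)
  qed
qed

lemma semilin_add:
  assumes "field_aut \<sigma>"
  shows "semilin_ext \<sigma> S g (\<lambda>m. a m + b m) = (\<lambda>n. semilin_ext \<sigma> S g a n + semilin_ext \<sigma> S g b n)"
  using field_aut_simps(1)[OF assms] by (simp add: semilin_ext_def sum.distrib)

lemma semilin_zero: "field_aut \<sigma> \<Longrightarrow> semilin_ext \<sigma> S g (\<lambda>_. 0) = (\<lambda>_. 0)"
  using field_aut_simps(3) by (auto simp: semilin_ext_def)

lemma semilin_ring_iso:
  fixes D :: "('o, 'm) category" and D' :: "('q, 'n) category" and \<sigma> :: "'k::field \<Rightarrow> 'k"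
  assumes D: "finite_category D" and D': "finite_category D'" and iso: "cat_iso D D' g" and \<sigma>: "field_aut \<sigma>"
  shows "semilin_ext \<sigma> (Mor D) g \<in> ring_iso (cat_algebra D) (cat_algebra D')"
proof -
  interpret D: finite_category D by fact
  interpret D': finite_category D' by fact
  let ?\<phi> = "semilin_ext \<sigma> (Mor D) g"
  note \<sigma>s = field_aut_simps[OF \<sigma>]
  have bij: "bij_betw g (Mor D) (Mor D')" and inj: "inj_on g (Mor D)" and im: "g ` Mor D = Mor D'"
    using iso by (auto simp: cat_iso_def bij_betw_def)
  have K: "src D s = tgt D t \<longleftrightarrow> src D' (g s) = tgt D' (g t)" if "s \<in> Mor D" "t \<in> Mor D" for s t
    using iso that by (auto simp: cat_iso_def)
  have comp: "cmp D' (g s) (g t) = g (cmp D s t)" if "s \<in> Mor D" "t \<in> Mor D" "src D s = tgt D t" for s t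
    using iso that by (auto simp: cat_iso_def)
  have gM: "g s \<in> Mor D'" if "s \<in> Mor D" for s using im that by auto
  have closed: "?\<phi> a \<in> carrier (cat_algebra D')" for a
    using semilin_outside[of _ g "Mor D" \<sigma> a] im \<sigma>s(3) by (auto simp: cat_algebra_sel)
  have at: "?\<phi> a (g s) = \<sigma> (a s)" if "s \<in> Mor D" for a s using semilin_inj[OF inj that] .
  have ext: "x = y" if "x \<in> carrier (cat_algebra D')" "y \<in> carrier (cat_algebra D')" "\<And>s. s \<in> Mor D \<Longrightarrow> x (g s) = y (g s)"
    for x y
  proof
    fix n show "x n = y n"
    proof (cases "n \<in> Mor D'")
      case True
      then obtain s where "s \<in> Mor D" "n = g s" unfolding im[symmetric] by blast
      then show ?thesis using that(3) by simp
    qed (use that in \<open>simp add: cat_algebra_sel\<close>)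
  qed
  show ?thesis
    unfolding ring_iso_def ring_hom_def
  proof (intro CollectI conjI allI impI)
    show "?\<phi> \<in> carrier (cat_algebra D) \<rightarrow> carrier (cat_algebra D')" using closed by simp
  next
    fix x y :: "'m \<Rightarrow> 'k" assume "x \<in> carrier (cat_algebra D) \<and> y \<in> carrier (cat_algebra D)"
    show "?\<phi> (x \<otimes>\<^bsub>cat_algebra D\<^esub> y) = ?\<phi> x \<otimes>\<^bsub>cat_algebra D'\<^esub> ?\<phi> y"
    proof (rule ext[OF closed D'.cat_mult_closed])
      fix m assume m: "m \<in> Mor D"
      have "(?\<phi> x \<otimes>\<^bsub>cat_algebra D'\<^esub> ?\<phi> y) (g m) = (\<Sum>s \<in> Mor D. \<Sum>t \<in> Mor D.
          if src D' (g s) = tgt D' (g t) \<and> cmp D' (g s) (g t) = g m then \<sigma> (x s) * \<sigma> (y t) else 0)"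
        unfolding D'.cat_mult sum.reindex_bij_betw[OF bij, symmetric]
        by (intro sum.cong refl) (simp add: at)
      also have "\<dots> = (\<Sum>s \<in> Mor D. \<Sum>t \<in> Mor D.
          if src D s = tgt D t \<and> cmp D s t = m then \<sigma> (x s) * \<sigma> (y t) else 0)"
      proof (intro sum.cong refl)
        fix s t assume st: "s \<in> Mor D" "t \<in> Mor D"
        show "(if src D' (g s) = tgt D' (g t) \<and> cmp D' (g s) (g t) = g m then \<sigma> (x s) * \<sigma> (y t) else 0)
          = (if src D s = tgt D t \<and> cmp D s t = m then \<sigma> (x s) * \<sigma> (y t) else 0)"
          using K[OF st] comp[OF st] inj_on_eq_iff[OF inj D.cmp_Mor(1)[OF st] m]
          by (cases "src D s = tgt D t") simp_all
      qed
      also have "\<dots> = \<sigma> ((x \<otimes>\<^bsub>cat_algebra D\<^esub> y) m)"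
        unfolding D.cat_mult \<sigma>s(8) by (intro sum.cong refl) (auto simp: \<sigma>s)
      also have "\<dots> = ?\<phi> (x \<otimes>\<^bsub>cat_algebra D\<^esub> y) (g m)" using at[OF m] by simp
      finally show "?\<phi> (x \<otimes>\<^bsub>cat_algebra D\<^esub> y) (g m) = (?\<phi> x \<otimes>\<^bsub>cat_algebra D'\<^esub> ?\<phi> y) (g m)" by simp
    qed
    show "?\<phi> (x \<oplus>\<^bsub>cat_algebra D\<^esub> y) = ?\<phi> x \<oplus>\<^bsub>cat_algebra D'\<^esub> ?\<phi> y"
      unfolding cat_algebra_sel(4) using semilin_add[OF \<sigma>] .
  next
    show "?\<phi> \<one>\<^bsub>cat_algebra D\<^esub> = \<one>\<^bsub>cat_algebra D'\<^esub>"
    proof (rule ext[OF closed D'.one_closed])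
      fix m assume m: "m \<in> Mor D"
      have "m \<in> ident D ` Ob D \<longleftrightarrow> g m \<in> g ` ident D ` Ob D"
        using m inj D.ident_simps(1) by (auto dest: inj_onD)
      also have "g ` ident D ` Ob D = ident D' ` Ob D'" using iso by (simp add: cat_iso_def)
      finally show "?\<phi> \<one>\<^bsub>cat_algebra D\<^esub> (g m) = \<one>\<^bsub>cat_algebra D'\<^esub> (g m)"
        unfolding at[OF m] cat_algebra_sel(2) by (simp add: \<sigma>s)
    qed
  next
    show "bij_betw ?\<phi> (carrier (cat_algebra D)) (carrier (cat_algebra D'))"
    proof (rule bij_betw_imageI)
      show "inj_on ?\<phi> (carrier (cat_algebra D))"
      proof (rule inj_onI, rule HOL.ext)
        fix x y :: "'m \<Rightarrow> 'k" and m assume *: "x \<in> carrier (cat_algebra D)" "y \<in> carrier (cat_algebra D)" "?\<phi> x = ?\<phi> y"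
        show "x m = y m"
        proof (cases "m \<in> Mor D")
          case True
          then show ?thesis using at[OF True, of x] at[OF True, of y] *(3) \<sigma>s(7) by simp
        qed (use * in \<open>simp add: cat_algebra_sel\<close>)
      qed
      show "?\<phi> ` carrier (cat_algebra D) = carrier (cat_algebra D')"
      proof (intro equalityI subsetI)
        fix y :: "'n \<Rightarrow> 'k" assume y: "y \<in> carrier (cat_algebra D')"
        let ?x = "\<lambda>m. if m \<in> Mor D then inv_into UNIV \<sigma> (y (g m)) else 0"
        have x: "?x \<in> carrier (cat_algebra D)" by (simp add: cat_algebra_sel)
        have "?\<phi> ?x = y" by (rule ext[OF closed y]) (simp add: at \<sigma>s)
        then show "y \<in> ?\<phi> ` carrier (cat_algebra D)" using x by (intro image_eqI[of _ _ ?x]) simp_all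
      qed (use closed in auto)
    qed
  qed
qed

section \<open>Groups as one-object categories, and block algebras\<close>

lemma group_category_sel [simp]:
  "Ob (group_category G) = UNIV" "Mor (group_category G) = carrier G" "src (group_category G) s = ()"
  "tgt (group_category G) s = ()" "ident (group_category G) V = \<one>\<^bsub>G\<^esub>" "cmp (group_category G) = monoid.mult G"
  by (simp_all add: group_category_def)

lemma group_finite_category:
  assumes "group G" "finite (carrier G)" shows "finite_category (group_category G)"
proof -
  interpret group G by fact
  show ?thesis
    using assms(2) by unfold_locales (auto simp: Hom_def m_assoc)
qed

lemma block_algebra_sel [simp]:
  "carrier (block_algebra A b) = {a \<otimes>\<^bsub>A\<^esub> b | a. a \<in> carrier A}"
  "a \<otimes>\<^bsub>block_algebra A b\<^esub> c = a \<otimes>\<^bsub>A\<^esub> c" "a \<oplus>\<^bsub>block_algebra A b\<^esub> c = a \<oplus>\<^bsub>A\<^esub> c"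
  "\<zero>\<^bsub>block_algebra A b\<^esub> = \<zero>\<^bsub>A\<^esub>" "\<one>\<^bsub>block_algebra A b\<^esub> = b"
  by (simp_all add: block_algebra_def)

text \<open>Since \<open>b\<close> is idempotent, \<open>A b\<close> is the fixed set of right
  multiplication by \<open>b\<close>, so membership becomes an equation.\<close>

lemma block_carrier:
  assumes "ring A" "central_idempotent A b"
  shows "x \<in> carrier (block_algebra A b) \<longleftrightarrow> x \<in> carrier A \<and> x \<otimes>\<^bsub>A\<^esub> b = x"
proof -
  interpret ring A by fact
  have b: "b \<in> carrier A" "b \<otimes>\<^bsub>A\<^esub> b = b" using assms(2) by (auto simp: central_idempotent_def)
  show ?thesis
  proof
    assume "x \<in> carrier (block_algebra A b)"
    then show "x \<in> carrier A \<and> x \<otimes>\<^bsub>A\<^esub> b = x" using b by (auto simp: m_assoc)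
  next
    assume "x \<in> carrier A \<and> x \<otimes>\<^bsub>A\<^esub> b = x"
    then show "x \<in> carrier (block_algebra A b)" by (metis (mono_tags, lifting) block_algebra_sel(1) mem_Collect_eq)
  qed
qed

lemma block_ring:
  assumes "ring A" "central_idempotent A b" shows "ring (block_algebra A b)"
proof -
  interpret ring A by fact
  have b: "b \<in> carrier A" "b \<otimes>\<^bsub>A\<^esub> b = b" "\<And>a. a \<in> carrier A \<Longrightarrow> b \<otimes>\<^bsub>A\<^esub> a = a \<otimes>\<^bsub>A\<^esub> b"
    using assms(2) by (auto simp: central_idempotent_def)
  note bc = block_carrier[OF assms]
  show ?thesis
  proof (rule ringI)
    show "abelian_group (block_algebra A b)"
    proof (rule abelian_groupI)
      fix x assume "x \<in> carrier (block_algebra A b)"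
      then show "\<exists>y\<in>carrier (block_algebra A b). y \<oplus>\<^bsub>block_algebra A b\<^esub> x = \<zero>\<^bsub>block_algebra A b\<^esub>"
        unfolding bc by (intro bexI[of _ "\<ominus>\<^bsub>A\<^esub> x"]) (auto simp: bc l_neg l_minus b simp del: block_algebra_sel(1))
    qed (auto simp: bc b l_distr a_ac simp del: block_algebra_sel(1))
    show "monoid (block_algebra A b)"
      by (rule monoidI) (auto simp: bc b m_assoc simp del: block_algebra_sel(1))
  qed (auto simp: bc l_distr r_distr simp del: block_algebra_sel(1))
qed


section \<open>Idempotents and their groups\<close>

text \<open>The witnesses are arguments rather than quantified away because the conjugation
  \<open>x \<mapsto> s x t\<close> they define has to be the same one for simple modules and for
  weights.\<close>

definition idem_iso :: "('o, 'm) category \<Rightarrow> 'm \<Rightarrow> 'm \<Rightarrow> 'm \<Rightarrow> 'm \<Rightarrow> bool" where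
  "idem_iso C e f s t \<longleftrightarrow> s \<in> Mor C \<and> src C s = src C e \<and> tgt C s = src C f \<and> cmp C s e = s \<and> cmp C f s = s \<and>
     t \<in> Mor C \<and> src C t = src C f \<and> tgt C t = src C e \<and> cmp C t f = t \<and> cmp C e t = t \<and>
     cmp C t s = e \<and> cmp C s t = f"

lemma idem_iso_sym: "idem_iso C e f s t \<Longrightarrow> idem_iso C f e t s"
  by (auto simp: idem_iso_def)

lemma idem_isoD:
  assumes "idem_iso C e f s t"
  shows "s \<in> Mor C" "src C s = src C e" "tgt C s = src C f" "cmp C s e = s" "cmp C f s = s"
    "t \<in> Mor C" "src C t = src C f" "tgt C t = src C e" "cmp C t f = t" "cmp C e t = t"
    "cmp C t s = e" "cmp C s t = f"
  using assms by (auto simp: idem_iso_def)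

lemma idem_endoD: "idem_endo C e \<Longrightarrow> e \<in> Mor C \<and> tgt C e = src C e \<and> cmp C e e = e"
  by (simp add: idem_endo_def)

text \<open>Left multiplication by \<open>y\<close> is injective, hence surjective on the finite
  carrier; this gives \<open>y\<close> a right inverse, which must be \<open>x\<close>.\<close>

lemma finite_monoid_inverse:
  assumes "monoid G" "finite (carrier G)" "x \<in> carrier G" "y \<in> carrier G" "x \<otimes>\<^bsub>G\<^esub> y = \<one>\<^bsub>G\<^esub>"
  shows "y \<otimes>\<^bsub>G\<^esub> x = \<one>\<^bsub>G\<^esub>"
proof -
  interpret monoid G by fact
  have xyz: "x \<otimes>\<^bsub>G\<^esub> (y \<otimes>\<^bsub>G\<^esub> z) = z" if "z \<in> carrier G" for z
    using that assms(3-5) by (simp add: m_assoc[symmetric])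
  have "inj_on (\<lambda>z. y \<otimes>\<^bsub>G\<^esub> z) (carrier G)" using xyz by (intro inj_onI) metis
  then have "(\<lambda>z. y \<otimes>\<^bsub>G\<^esub> z) ` carrier G = carrier G"
    using assms(2,4) by (intro endo_inj_surj) auto
  then obtain z where z: "z \<in> carrier G" "y \<otimes>\<^bsub>G\<^esub> z = \<one>\<^bsub>G\<^esub>" using one_closed by (metis imageE)
  then have "z = x" using xyz[OF z(1)] assms(3) by simp
  with z show ?thesis by simp
qed

lemma finite_monoid_idem_power:
  assumes "monoid G" "finite (carrier G)" "a \<in> carrier G"
  shows "\<exists>n > 0. (a [^]\<^bsub>G\<^esub> (n::nat)) \<otimes>\<^bsub>G\<^esub> (a [^]\<^bsub>G\<^esub> n) = a [^]\<^bsub>G\<^esub> n"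
proof -
  interpret monoid G by fact
  have "range (\<lambda>n::nat. a [^]\<^bsub>G\<^esub> n) \<subseteq> carrier G" using assms(3) by auto
  then have "finite (range (\<lambda>n::nat. a [^]\<^bsub>G\<^esub> n))" using assms(2) by (rule finite_subset)
  then have "\<not> inj (\<lambda>n::nat. a [^]\<^bsub>G\<^esub> n)" using finite_imageD infinite_UNIV_nat by blast
  then obtain i j :: nat where "a [^]\<^bsub>G\<^esub> i = a [^]\<^bsub>G\<^esub> j" "i \<noteq> j" by (auto simp: inj_def)
  then obtain i k :: nat where k: "k > 0" "a [^]\<^bsub>G\<^esub> (i + k) = a [^]\<^bsub>G\<^esub> i"
    by (metis less_imp_add_positive linorder_neqE_nat)
  have step: "a [^]\<^bsub>G\<^esub> (m + k) = a [^]\<^bsub>G\<^esub> m" if "m \<ge> i" for m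
  proof -
    obtain d where d: "m = d + i" using \<open>m \<ge> i\<close> by (metis add.commute le_Suc_ex)
    have "a [^]\<^bsub>G\<^esub> (m + k) = a [^]\<^bsub>G\<^esub> d \<otimes>\<^bsub>G\<^esub> a [^]\<^bsub>G\<^esub> (i + k)"
      using assms(3) by (simp add: d nat_pow_mult add.assoc)
    also have "\<dots> = a [^]\<^bsub>G\<^esub> m" using k(2) assms(3) by (simp add: d nat_pow_mult)
    finally show ?thesis .
  qed
  have steps: "a [^]\<^bsub>G\<^esub> (m + l * k) = a [^]\<^bsub>G\<^esub> m" if "m \<ge> i" for m l
  proof (induction l)
    case (Suc l)
    have "a [^]\<^bsub>G\<^esub> (m + Suc l * k) = a [^]\<^bsub>G\<^esub> ((m + l * k) + k)" by (simp add: algebra_simps)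
    then show ?case using step[of "m + l * k"] Suc that by simp
  qed simp
  \<comment> \<open>A multiple of the period \<open>k\<close> lying beyond the preperiod
    \<open>i\<close>: increasing the exponent by it leaves the power unchanged, so the power squares
    to itself.\<close>
  let ?n = "Suc i * k"
  have "i * 1 \<le> Suc i * k" using k(1) by (intro mult_le_mono) auto
  then have "?n \<ge> i" by simp
  then have "a [^]\<^bsub>G\<^esub> (?n + Suc i * k) = a [^]\<^bsub>G\<^esub> ?n" by (rule steps)
  then have "a [^]\<^bsub>G\<^esub> ?n \<otimes>\<^bsub>G\<^esub> a [^]\<^bsub>G\<^esub> ?n = a [^]\<^bsub>G\<^esub> ?n"
    using assms(3) by (simp only: nat_pow_mult)
  moreover have "?n > 0" using k(1) by simp
  ultimately show ?thesis by blast
qed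

lemma idem_group_sel [simp]:
  "monoid.mult (idem_group C e) = cmp C" "\<one>\<^bsub>idem_group C e\<^esub> = e"
  by (simp_all add: idem_group_def idem_monoid_def units_of_def)

context finite_category begin

lemma cat_mult_support:
  fixes f g :: "'b \<Rightarrow> 'k::field"
  assumes "(f \<otimes>\<^bsub>cat_algebra C\<^esub> g) m \<noteq> 0"
  shows "\<exists>s \<in> Mor C. \<exists>t \<in> Mor C. src C s = tgt C t \<and> cmp C s t = m \<and> f s \<noteq> 0 \<and> g t \<noteq> 0"
proof (rule ccontr)
  assume n: "\<not> ?thesis"
  have "(f \<otimes>\<^bsub>cat_algebra C\<^esub> g) m = 0"
    unfolding cat_mult by (intro sum.neutral ballI) (use n in auto)
  with assms show False by simp
qed

lemma idem_absorb:
  assumes "idem_endo C e" "z \<in> Mor C"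
  shows "tgt C z = src C e \<Longrightarrow> cmp C e (cmp C e z) = cmp C e z"
    "src C z = src C e \<Longrightarrow> cmp C (cmp C z e) e = cmp C z e"
proof -
  note e = idem_endoD[OF assms(1)]
  show "cmp C e (cmp C e z) = cmp C e z" if "tgt C z = src C e"
    using assoc[of e e z] e that assms(2) by metis
  show "cmp C (cmp C z e) e = cmp C z e" if "src C z = src C e"
    using assoc[of z e e] e that assms(2) by metis
qed

lemma idem_monoid_carrier:
  assumes "idem_endo C e"
  shows "x \<in> carrier (idem_monoid C e) \<longleftrightarrow>
    x \<in> Mor C \<and> src C x = src C e \<and> tgt C x = src C e \<and> cmp C e x = x \<and> cmp C x e = x"
proof -
  note e = idem_endoD[OF assms]
  show ?thesis
  proof
    assume "x \<in> carrier (idem_monoid C e)"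
    then obtain y where y: "y \<in> Mor C" "src C y = src C e" "tgt C y = src C e" "x = cmp C e (cmp C y e)"
      by (auto simp: idem_monoid_def Hom_def)
    have 1: "cmp C e x = x" using idem_absorb(1)[OF assms, of "cmp C y e"] e y(1-3) unfolding y(4) by simp
    have ye: "cmp C y e \<in> Mor C" "src C (cmp C y e) = src C e" "tgt C (cmp C y e) = src C e"
      using e y(1-3) by simp_all
    have 2: "cmp C x e = x"
      using assoc[of e "cmp C y e" e] idem_absorb(2)[OF assms y(1,2)] e ye unfolding y(4) by metis
    show "x \<in> Mor C \<and> src C x = src C e \<and> tgt C x = src C e \<and> cmp C e x = x \<and> cmp C x e = x"
      using 1 2 cmp_Mor[of e "cmp C y e"] e ye y(4) by metis
  next
    assume "x \<in> Mor C \<and> src C x = src C e \<and> tgt C x = src C e \<and> cmp C e x = x \<and> cmp C x e = x"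
    then show "x \<in> carrier (idem_monoid C e)"
      by (auto simp: idem_monoid_def Hom_def intro!: exI[of _ x])
  qed
qed

lemma idem_monoid: assumes "idem_endo C e" shows "monoid (idem_monoid C e)"
proof -
  have sel: "monoid.mult (idem_monoid C e) = cmp C" "\<one>\<^bsub>idem_monoid C e\<^esub> = e"
    by (simp_all add: idem_monoid_def)
  show ?thesis
  proof (rule monoidI)
    fix x y assume "x \<in> carrier (idem_monoid C e)" "y \<in> carrier (idem_monoid C e)"
    then show "x \<otimes>\<^bsub>idem_monoid C e\<^esub> y \<in> carrier (idem_monoid C e)"
      using idem_endoD[OF assms] unfolding sel idem_monoid_carrier[OF assms]
      by (metis assoc cmp_Mor)
  qed (use idem_endoD[OF assms] in \<open>auto simp: sel idem_monoid_carrier[OF assms] assoc\<close>)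
qed

lemma idem_group_carrier:
  assumes "idem_endo C e"
  shows "x \<in> carrier (idem_group C e) \<longleftrightarrow> x \<in> carrier (idem_monoid C e) \<and>
    (\<exists>y \<in> carrier (idem_monoid C e). cmp C x y = e \<and> cmp C y x = e)"
  by (auto simp: idem_group_def units_of_def Units_def idem_monoid_def)

lemma idem_group: assumes "idem_endo C e" shows "group (idem_group C e)"
  unfolding idem_group_def by (rule monoid.units_group[OF idem_monoid[OF assms]])

lemma idem_group_sub: "\<lbrakk>idem_endo C e; x \<in> carrier (idem_group C e)\<rbrakk> \<Longrightarrow> x \<in> carrier (idem_monoid C e)"
  using idem_group_carrier by blast

lemma idem_groupD:
  assumes "idem_endo C e" "x \<in> carrier (idem_group C e)"
  shows "x \<in> Mor C" "src C x = src C e" "tgt C x = src C e" "cmp C e x = x" "cmp C x e = x"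
  using idem_monoid_carrier[OF assms(1)] idem_group_sub[OF assms] by auto

lemma finite_idem_monoid: assumes "idem_endo C e" shows "finite (carrier (idem_monoid C e))"
  by (rule finite_subset[OF _ finite_Mor]) (use idem_monoid_carrier[OF assms] in auto)

lemma finite_idem_group: assumes "idem_endo C e" shows "finite (carrier (idem_group C e))"
  by (rule finite_subset[OF _ finite_idem_monoid[OF assms]]) (use idem_group_sub[OF assms] in auto)

text \<open>Finiteness makes one-sided inverses two-sided, so a single equation puts both factors
  into \<open>G\<^sub>e\<close>.\<close>

lemma idem_one_sided:
  assumes "idem_endo C e" "x \<in> carrier (idem_monoid C e)" "y \<in> carrier (idem_monoid C e)" "cmp C x y = e"
  shows "x \<in> carrier (idem_group C e)" "y \<in> carrier (idem_group C e)" "cmp C y x = e"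
proof -
  show yx: "cmp C y x = e"
    using finite_monoid_inverse[OF idem_monoid[OF assms(1)] finite_idem_monoid[OF assms(1)] assms(2,3)] assms(4)
    by (simp add: idem_monoid_def)
  show "x \<in> carrier (idem_group C e)" "y \<in> carrier (idem_group C e)"
    using assms yx idem_group_carrier[OF assms(1)] by blast+
qed

lemma idem_monoid_cmp:
  assumes "idem_endo C e" "x \<in> carrier (idem_monoid C e)" "y \<in> carrier (idem_monoid C e)"
  shows "cmp C x y \<in> carrier (idem_monoid C e)"
  using monoid.m_closed[OF idem_monoid[OF assms(1)] assms(2,3)] by (simp add: idem_monoid_def)

lemma idem_group_cmp:
  assumes "idem_endo C e" "x \<in> carrier (idem_group C e)" "y \<in> carrier (idem_group C e)"
  shows "cmp C x y \<in> carrier (idem_group C e)"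
  using monoid.m_closed[OF group.is_monoid[OF idem_group[OF assms(1)]] assms(2,3)] by simp

lemma idem_group_one: "idem_endo C e \<Longrightarrow> e \<in> carrier (idem_group C e)"
  using monoid.one_closed[OF group.is_monoid[OF idem_group]] by fastforce

lemma idem_group_inverse:
  assumes "idem_endo C e" "x \<in> carrier (idem_group C e)"
  obtains y where "y \<in> carrier (idem_group C e)" "cmp C x y = e" "cmp C y x = e"
proof -
  obtain y where "y \<in> carrier (idem_monoid C e)" "cmp C x y = e" "cmp C y x = e"
    using assms idem_group_carrier by blast
  then show ?thesis using that idem_one_sided(2)[OF assms(1) idem_group_sub[OF assms]] by blast
qed

text \<open>In a finite monoid the non-units form a two-sided ideal: an inverse of
  \<open>x y\<close> supplies one-sided inverses of \<open>x\<close> and of \<open>y\<close>. This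
  is what makes restriction of coefficients to \<open>G\<^sub>e\<close> multiplicative.\<close>

lemma idem_group_factors:
  assumes e: "idem_endo C e" and x: "x \<in> carrier (idem_monoid C e)" and y: "y \<in> carrier (idem_monoid C e)"
    and xy: "cmp C x y \<in> carrier (idem_group C e)"
  shows "x \<in> carrier (idem_group C e)" "y \<in> carrier (idem_group C e)"
proof -
  obtain z where z: "z \<in> carrier (idem_group C e)" "cmp C (cmp C x y) z = e" "cmp C z (cmp C x y) = e"
    using idem_group_inverse[OF e xy] .
  note c = idem_monoid_carrier[OF e]
  note zM = idem_group_sub[OF e z(1)]
  have "cmp C x (cmp C y z) = e" using z(2) x y zM unfolding c by (simp add: assoc)
  then show "x \<in> carrier (idem_group C e)" using idem_one_sided(1)[OF e x idem_monoid_cmp[OF e y zM]] by simp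
  have "cmp C (cmp C z x) y = e" using z(3) x y zM unfolding c by (simp add: assoc)
  then show "y \<in> carrier (idem_group C e)" using idem_one_sided(2)[OF e idem_monoid_cmp[OF e zM x] y] by simp
qed

lemma idem_group_category: "idem_endo C e \<Longrightarrow> finite_category (group_category (idem_group C e))"
  by (rule group_finite_category[OF idem_group finite_idem_group])

lemma group_mult_eq:
  fixes f g :: "'b \<Rightarrow> 'k::field"
  assumes e: "idem_endo C e" and f: "\<And>m. m \<notin> carrier (idem_group C e) \<Longrightarrow> f m = 0"
    and g: "\<And>m. m \<notin> carrier (idem_group C e) \<Longrightarrow> g m = 0"
  shows "f \<otimes>\<^bsub>cat_algebra (group_category (idem_group C e))\<^esub> g = f \<otimes>\<^bsub>cat_algebra C\<^esub> g"
proof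
  fix m
  let ?G = "carrier (idem_group C e)"
  have sub: "?G \<subseteq> Mor C" using idem_groupD[OF e] by auto
  have "(f \<otimes>\<^bsub>cat_algebra (group_category (idem_group C e))\<^esub> g) m =
      (\<Sum>s \<in> ?G. \<Sum>t \<in> ?G. if cmp C s t = m then f s * g t else 0)"
    using finite_category.cat_mult[OF idem_group_category[OF e], of f g m] by simp
  also have "\<dots> = (\<Sum>s \<in> ?G. \<Sum>t \<in> ?G. if src C s = tgt C t \<and> cmp C s t = m then f s * g t else 0)"
    using idem_groupD[OF e] by (intro sum.cong refl) simp
  also have "\<dots> = (\<Sum>s \<in> ?G. \<Sum>t \<in> Mor C. if src C s = tgt C t \<and> cmp C s t = m then f s * g t else 0)"
    by (intro sum.cong sum.mono_neutral_left) (use finite_Mor sub g in auto)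
  also have "\<dots> = (\<Sum>s \<in> Mor C. \<Sum>t \<in> Mor C. if src C s = tgt C t \<and> cmp C s t = m then f s * g t else 0)"
    by (intro sum.mono_neutral_left) (use finite_Mor sub f in \<open>auto intro!: sum.neutral\<close>)
  also have "\<dots> = (f \<otimes>\<^bsub>cat_algebra C\<^esub> g) m" by (simp only: cat_mult)
  finally show "(f \<otimes>\<^bsub>cat_algebra (group_category (idem_group C e))\<^esub> g) m = (f \<otimes>\<^bsub>cat_algebra C\<^esub> g) m" .
qed

lemma smon_ident_right:
  fixes f :: "'b \<Rightarrow> 'k::field"
  assumes e: "idem_endo C e" and f: "\<And>m. m \<notin> carrier (idem_monoid C e) \<Longrightarrow> f m = 0"
  shows "f \<otimes>\<^bsub>cat_algebra C\<^esub> smon 1 e = f" "smon 1 e \<otimes>\<^bsub>cat_algebra C\<^esub> f = f"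
proof -
  interpret A: ring "cat_algebra C :: ('b \<Rightarrow> 'k) ring" by (rule cat_ring)
  note c = idem_monoid_carrier[OF e]
  note eM = idem_endoD[OF e]
  have A: "f \<in> carrier (cat_algebra C)" if "\<And>m. m \<notin> carrier (idem_monoid C e) \<Longrightarrow> f m = 0" for f :: "'b \<Rightarrow> 'k"
    using that c by (auto simp: cat_algebra_sel(1))
  have smA: "smon 1 e \<in> carrier (cat_algebra C :: ('b \<Rightarrow> 'k) ring)" using eM by (intro smon_closed) simp
  show "f \<otimes>\<^bsub>cat_algebra C\<^esub> smon 1 e = f"
  proof (rule supported_induct[OF finite_idem_monoid[OF e] f, where P = "\<lambda>f. f \<otimes>\<^bsub>cat_algebra C\<^esub> smon 1 e = f"])
    show "(\<lambda>_. 0 :: 'k) \<otimes>\<^bsub>cat_algebra C\<^esub> smon 1 e = (\<lambda>_. 0 :: 'k)" using A.l_null[OF smA]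
        by (simp add: cat_algebra_sel(3))
    show "smon d s \<otimes>\<^bsub>cat_algebra C\<^esub> smon 1 e = smon d s" if "s \<in> carrier (idem_monoid C e)" for d :: 'k and s
      using that c eM by (simp add: smon_comp)
    show "(\<lambda>m. f m + g m) \<otimes>\<^bsub>cat_algebra C\<^esub> smon 1 e = (\<lambda>m. f m + g m)"
      if fg: "\<And>m. m \<notin> carrier (idem_monoid C e) \<Longrightarrow> f m = 0" "\<And>m. m \<notin> carrier (idem_monoid C e) \<Longrightarrow> g m = 0"
        and "f \<otimes>\<^bsub>cat_algebra C\<^esub> smon 1 e = f" "g \<otimes>\<^bsub>cat_algebra C\<^esub> smon 1 e = g" for f g :: "'b \<Rightarrow> 'k"
      using A.l_distr[OF A[OF fg(1)] A[OF fg(2)] smA] that(3,4) by (simp add: cat_algebra_sel(4))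
  qed
  show "smon 1 e \<otimes>\<^bsub>cat_algebra C\<^esub> f = f"
  proof (rule supported_induct[OF finite_idem_monoid[OF e] f, where P = "\<lambda>f. smon 1 e \<otimes>\<^bsub>cat_algebra C\<^esub> f = f"])
    show "smon 1 e \<otimes>\<^bsub>cat_algebra C\<^esub> (\<lambda>_. 0 :: 'k) = (\<lambda>_. 0 :: 'k)" using A.r_null[OF smA]
        by (simp add: cat_algebra_sel(3))
    show "smon 1 e \<otimes>\<^bsub>cat_algebra C\<^esub> smon d s = smon d s" if "s \<in> carrier (idem_monoid C e)" for d :: 'k and s
      using that c eM by (simp add: smon_comp)
    show "smon 1 e \<otimes>\<^bsub>cat_algebra C\<^esub> (\<lambda>m. f m + g m) = (\<lambda>m. f m + g m)"
      if fg: "\<And>m. m \<notin> carrier (idem_monoid C e) \<Longrightarrow> f m = 0" "\<And>m. m \<notin> carrier (idem_monoid C e) \<Longrightarrow> g m = 0"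
        and "smon 1 e \<otimes>\<^bsub>cat_algebra C\<^esub> f = f" "smon 1 e \<otimes>\<^bsub>cat_algebra C\<^esub> g = g" for f g :: "'b \<Rightarrow> 'k"
      using A.r_distr[OF A[OF fg(1)] A[OF fg(2)] smA] that(3,4) by (simp add: cat_algebra_sel(4))
  qed
qed

lemma corner_support:
  fixes f :: "'b \<Rightarrow> 'k::field"
  assumes e: "idem_endo C e" and m: "m \<notin> carrier (idem_monoid C e)"
  shows "(smon 1 e \<otimes>\<^bsub>cat_algebra C\<^esub> (f \<otimes>\<^bsub>cat_algebra C\<^esub> smon 1 e)) m = 0"
proof (rule ccontr)
  assume "(smon 1 e \<otimes>\<^bsub>cat_algebra C\<^esub> (f \<otimes>\<^bsub>cat_algebra C\<^esub> smon 1 e)) m \<noteq> 0"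
  then obtain s t where s: "s \<in> Mor C" "t \<in> Mor C" "src C s = tgt C t" "cmp C s t = m"
    "smon (1::'k) e s \<noteq> 0" "(f \<otimes>\<^bsub>cat_algebra C\<^esub> smon 1 e) t \<noteq> 0" using cat_mult_support by blast
  from cat_mult_support[OF s(6)] obtain x y where x: "x \<in> Mor C" "y \<in> Mor C" "src C x = tgt C y"
    "cmp C x y = t" "smon (1::'k) e y \<noteq> 0" by blast
  have "s = e" "y = e" using s(5) x(5) by (auto simp: smon_def split: if_splits)
  then have mx: "m = cmp C e (cmp C x e)" using s(4) x(4) by simp
  have "tgt C t = tgt C x" using x cmp_Mor(3) by blast
  then have "x \<in> Hom C (src C e) (src C e)"
    using s(3) x(1,3) idem_endoD[OF e] \<open>s = e\<close> \<open>y = e\<close> by (simp add: Hom_def)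
  then show False using m mx by (auto simp: idem_monoid_def)
qed

text \<open>An invertible idempotent is an identity, and then all endomorphisms of its object are
  units.\<close>

lemma EI_idem:
  assumes "EI C" "idem_endo C e"
  shows "e = ident C (src C e)" "carrier (idem_group C e) = Hom C (src C e) (src C e)"
proof -
  note e = idem_endoD[OF assms(2)]
  have V: "src C e \<in> Ob C" using e src_closed by blast
  have iso: "\<exists>t \<in> Mor C. src C t = src C e \<and> tgt C t = src C e \<and> cmp C t x = ident C (src C e) \<and> cmp C x t
      = ident C (src C e)"
    if "x \<in> Hom C (src C e) (src C e)" for x
  proof -
    have "is_isomorphism C x" using assms(1) V that unfolding EI_def by blast
    then show ?thesis using that unfolding is_isomorphism_def Hom_def by auto
  qed
  obtain t where t: "t \<in> Mor C" "src C t = src C e" "tgt C t = src C e" "cmp C e t = ident C (src C e)"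
    using iso[of e] e by (auto simp: Hom_def)
  have "cmp C e (cmp C e t) = cmp C e t" using idem_absorb(1)[OF assms(2) t(1)] t(3) by simp
  then show eid: "e = ident C (src C e)" using t e ident_right[of e "src C e"] by simp
  have "x \<in> carrier (idem_group C e)" if x: "x \<in> Hom C (src C e) (src C e)" for x
  proof -
    have "y \<in> carrier (idem_monoid C e)" if "y \<in> Hom C (src C e) (src C e)" for y
      unfolding idem_monoid_carrier[OF assms(2)] using that ident_left[of y "src C e"] ident_right[of y "src C e"] eid
      by (auto simp: Hom_def)
    moreover obtain t where "t \<in> Hom C (src C e) (src C e)" "cmp C t x = e" "cmp C x t = e"
      using iso[OF x] eid by (auto simp: Hom_def)
    ultimately show ?thesis using x idem_group_carrier[OF assms(2)] by blast
  qed
  moreover have "x \<in> Hom C (src C e) (src C e)" if "x \<in> carrier (idem_group C e)" for x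
    using idem_groupD(1-3)[OF assms(2) that] by (simp add: Hom_def)
  ultimately show "carrier (idem_group C e) = Hom C (src C e) (src C e)" by blast
qed

end

section \<open>The apex of a simple module\<close>

locale alg_setup = finite_category C for C :: "('o, 'm) category" +
  fixes b :: "'m \<Rightarrow> 'k::field"
  assumes b_cases: "b = \<one>\<^bsub>cat_algebra C\<^esub> \<or> (EI C \<and> central_idempotent (cat_algebra C) b)"
begin

abbreviation A :: "('m \<Rightarrow> 'k) ring" where "A \<equiv> cat_algebra C"
abbreviation R :: "('m \<Rightarrow> 'k) ring" where "R \<equiv> block_algebra A b"
abbreviation G :: "'m \<Rightarrow> 'm set" where "G e \<equiv> carrier (idem_group C e)"
abbreviation E :: "'m \<Rightarrow> 'm set" where "E e \<equiv> carrier (idem_monoid C e)"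
abbreviation kG :: "'m \<Rightarrow> ('m \<Rightarrow> 'k) ring" where "kG e \<equiv> cat_algebra (group_category (idem_group C e))"
abbreviation eb :: "'m \<Rightarrow> 'm \<Rightarrow> 'k" where "eb e \<equiv> smon 1 e \<otimes>\<^bsub>A\<^esub> b"
abbreviation Q :: "'m \<Rightarrow> ('m \<Rightarrow> 'k) ring" where "Q e \<equiv> block_algebra (kG e) (eb e)"

text \<open>The projection of the corner \<open>e(kC)e\<close> modulo the span of the non-units, an
  ideal by \<open>idem_group_factors\<close>, realised as restriction of coefficients to
  \<open>G\<^sub>e\<close>.\<close>

definition \<pi> :: "'m \<Rightarrow> ('m \<Rightarrow> 'k) \<Rightarrow> 'm \<Rightarrow> 'k" where
  "\<pi> e x = (\<lambda>m. if m \<in> G e then (smon 1 e \<otimes>\<^bsub>A\<^esub> (x \<otimes>\<^bsub>A\<^esub> smon 1 e)) m else 0)"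

sublocale A: ring A by (rule cat_ring)

lemma b_central: "central_idempotent A b"
  using b_cases by (auto simp: central_idempotent_def)

lemma b: "b \<in> carrier A" "b \<otimes>\<^bsub>A\<^esub> b = b" "a \<in> carrier A \<Longrightarrow> b \<otimes>\<^bsub>A\<^esub> a = a \<otimes>\<^bsub>A\<^esub> b"
  using b_central by (auto simp: central_idempotent_def)

lemma R_ring: "ring R" by (rule block_ring[OF A.ring_axioms b_central])

lemma R_carrier: "x \<in> carrier R \<longleftrightarrow> x \<in> carrier A \<and> x \<otimes>\<^bsub>A\<^esub> b = x"
  by (rule block_carrier[OF A.ring_axioms b_central])

lemma smon_A: "s \<in> Mor C \<Longrightarrow> smon c s \<in> carrier A" by (rule smon_closed)

lemma b_R: "f \<in> carrier A \<Longrightarrow> f \<otimes>\<^bsub>A\<^esub> b \<in> carrier R"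
  unfolding R_carrier using b(1,2) by (simp add: A.m_assoc)

lemma e_A: "idem_endo C e \<Longrightarrow> smon 1 e \<in> carrier A" using idem_endoD[of C e] by (intro smon_A) simp

lemma smon_idem: "idem_endo C e \<Longrightarrow> smon 1 e \<otimes>\<^bsub>A\<^esub> smon 1 e = (smon 1 e :: 'm \<Rightarrow> 'k)"
  using idem_endoD[of C e] by (simp add: smon_comp)

lemma b_left:
  assumes "a \<in> carrier A" "c \<in> carrier A" shows "b \<otimes>\<^bsub>A\<^esub> (a \<otimes>\<^bsub>A\<^esub> c) = a \<otimes>\<^bsub>A\<^esub> (b \<otimes>\<^bsub>A\<^esub> c)"
  using b(3)[OF assms(1)] assms b(1) by (metis A.m_assoc)

lemma bb_left: "c \<in> carrier A \<Longrightarrow> b \<otimes>\<^bsub>A\<^esub> (b \<otimes>\<^bsub>A\<^esub> c) = b \<otimes>\<^bsub>A\<^esub> c"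
  using b(1,2) by (metis A.m_assoc)

lemma ee_left: "\<lbrakk>idem_endo C e; c \<in> carrier A\<rbrakk> \<Longrightarrow> smon 1 e \<otimes>\<^bsub>A\<^esub> (smon 1 e \<otimes>\<^bsub>A\<^esub> c) = smon 1 e \<otimes>\<^bsub>A\<^esub> c"
  using smon_idem e_A by (metis A.m_assoc)

text \<open>The place where the two cases for \<open>b\<close> are used. If \<open>b = 1\<close>
  then \<open>eb\<close> is \<open>e\<close> itself. In an EI-category \<open>eb = e b e\<close> is
  supported on endomorphisms of the object of \<open>e\<close>, and these are all units.\<close>

lemma eb_outside:
  assumes e: "idem_endo C e" and m: "m \<notin> G e"
  shows "eb e m = 0"
  using b_cases
proof
  assume "b = \<one>\<^bsub>A\<^esub>"
  then have "eb e = smon 1 e" using cat_one_right[OF e_A[OF e]] by simp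
  then show ?thesis using idem_group_one[OF e] m by (auto simp: smon_def)
next
  assume ei: "EI C \<and> central_idempotent A b"
  have "eb e = smon 1 e \<otimes>\<^bsub>A\<^esub> (b \<otimes>\<^bsub>A\<^esub> smon 1 e)"
    using b(3)[OF e_A[OF e]] ee_left[OF e b(1)] by simp
  moreover have "m \<notin> E e"
    using m EI_idem(2)[OF conjunct1[OF ei] e] idem_monoid_carrier[OF e] by (auto simp: Hom_def)
  ultimately show ?thesis using corner_support[OF e] by metis
qed

lemma kG_carrier: "f \<in> carrier (kG e) \<longleftrightarrow> (\<forall>m. m \<notin> G e \<longrightarrow> f m = 0)"
  by (simp add: cat_algebra_sel)

lemma kG_A: assumes "idem_endo C e" "f \<in> carrier (kG e)" shows "f \<in> carrier A"
  using assms(2) idem_groupD(1)[OF assms(1)] by (auto simp: cat_algebra_sel)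

lemma kG_mult: "\<lbrakk>idem_endo C e; f \<in> carrier (kG e); g \<in> carrier (kG e)\<rbrakk> \<Longrightarrow> f \<otimes>\<^bsub>kG e\<^esub> g = f \<otimes>\<^bsub>A\<^esub> g"
  unfolding kG_carrier by (rule group_mult_eq) auto

lemma kG_ring: "idem_endo C e \<Longrightarrow> ring (kG e)"
  by (rule finite_category.cat_ring[OF idem_group_category])

lemma eb_kG: "idem_endo C e \<Longrightarrow> eb e \<in> carrier (kG e)" using eb_outside kG_carrier by blast

lemma kG_e:
  assumes e: "idem_endo C e" and "f \<in> carrier (kG e)"
  shows "f \<otimes>\<^bsub>A\<^esub> smon 1 e = f" "smon 1 e \<otimes>\<^bsub>A\<^esub> f = f"
  using smon_ident_right[OF e, of f] assms(2) idem_group_sub[OF e] unfolding kG_carrier by blast+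

lemma kG_eb:
  assumes e: "idem_endo C e" and f: "f \<in> carrier (kG e)"
  shows "f \<otimes>\<^bsub>kG e\<^esub> eb e = f \<otimes>\<^bsub>A\<^esub> b" "eb e \<otimes>\<^bsub>kG e\<^esub> f = f \<otimes>\<^bsub>A\<^esub> b"
proof -
  note fA = kG_A[OF e f]
  show "f \<otimes>\<^bsub>kG e\<^esub> eb e = f \<otimes>\<^bsub>A\<^esub> b"
    using kG_mult[OF e f eb_kG[OF e]] kG_e(1)[OF e f] A.m_assoc[OF fA e_A[OF e] b(1)] by simp
  have "eb e \<otimes>\<^bsub>A\<^esub> f = (smon 1 e \<otimes>\<^bsub>A\<^esub> f) \<otimes>\<^bsub>A\<^esub> b"
    using fA e_A[OF e] b(1) b(3)[OF fA] by (simp add: A.m_assoc)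
  then show "eb e \<otimes>\<^bsub>kG e\<^esub> f = f \<otimes>\<^bsub>A\<^esub> b"
    using kG_mult[OF e eb_kG[OF e] f] kG_e(2)[OF e f] by simp
qed

lemma eb_central: assumes e: "idem_endo C e" shows "central_idempotent (kG e) (eb e)"
proof -
  have "eb e \<otimes>\<^bsub>kG e\<^esub> eb e = eb e" using kG_eb(1)[OF e eb_kG[OF e]] b(1,2) e_A[OF e] by (simp add: A.m_assoc)
  then show ?thesis using eb_kG[OF e] kG_eb[OF e] by (simp add: central_idempotent_def)
qed

lemma Q_ring: "idem_endo C e \<Longrightarrow> ring (Q e)" by (rule block_ring[OF kG_ring eb_central])

lemma Q_carrier:
  assumes e: "idem_endo C e" shows "q \<in> carrier (Q e) \<longleftrightarrow> q \<in> carrier (kG e) \<and> q \<otimes>\<^bsub>A\<^esub> b = q"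
  unfolding block_carrier[OF kG_ring[OF e] eb_central[OF e]] using kG_eb[OF e] by auto

text \<open>A product in \<open>E e\<close> is a unit iff both factors are units, so the
  coefficients at units come from pairs of units only, and such pairs contribute nowhere
  else.\<close>

lemma restrict_mult:
  fixes f g :: "'m \<Rightarrow> 'k"
  assumes e: "idem_endo C e" and f: "\<And>m. m \<notin> E e \<Longrightarrow> f m = 0" and g: "\<And>m. m \<notin> E e \<Longrightarrow> g m = 0"
  shows "(\<lambda>m. if m \<in> G e then (f \<otimes>\<^bsub>A\<^esub> g) m else 0) =
    (\<lambda>m. if m \<in> G e then f m else 0) \<otimes>\<^bsub>A\<^esub> (\<lambda>m. if m \<in> G e then g m else 0)"
proof
  fix m
  let ?f = "\<lambda>m. if m \<in> G e then f m else 0" and ?g = "\<lambda>m. if m \<in> G e then g m else 0"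
  show "(if m \<in> G e then (f \<otimes>\<^bsub>A\<^esub> g) m else 0) = (?f \<otimes>\<^bsub>A\<^esub> ?g) m"
  proof (cases "m \<in> G e")
    case True
    have "(f \<otimes>\<^bsub>A\<^esub> g) m = (?f \<otimes>\<^bsub>A\<^esub> ?g) m"
      unfolding cat_mult
    proof (intro sum.cong refl)
      fix s t
      show "(if src C s = tgt C t \<and> cmp C s t = m then f s * g t else 0) =
        (if src C s = tgt C t \<and> cmp C s t = m then ?f s * ?g t else 0)"
        using idem_group_factors[OF e, of s t] True f[of s] g[of t] by auto
    qed
    then show ?thesis using True by simp
  next
    case False
    have "(?f \<otimes>\<^bsub>A\<^esub> ?g) m = 0"
    proof (rule ccontr)
      assume "(?f \<otimes>\<^bsub>A\<^esub> ?g) m \<noteq> 0"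
      then obtain s t where "cmp C s t = m" "?f s \<noteq> 0" "?g t \<noteq> 0" using cat_mult_support by blast
      then show False using False idem_group_cmp[OF e, of s t] by (auto split: if_splits)
    qed
    then show ?thesis using False by simp
  qed
qed

lemma corner_A: "\<lbrakk>idem_endo C e; x \<in> carrier A\<rbrakk> \<Longrightarrow> smon 1 e \<otimes>\<^bsub>A\<^esub> (x \<otimes>\<^bsub>A\<^esub> smon 1 e) \<in> carrier A"
  using e_A by simp

lemma pi_kG: "\<pi> e x \<in> carrier (kG e)" by (simp add: \<pi>_def kG_carrier)

lemma R_absorb_b: "x \<in> carrier R \<Longrightarrow> b \<otimes>\<^bsub>A\<^esub> x = x" "x \<in> carrier R \<Longrightarrow> x \<otimes>\<^bsub>A\<^esub> b = x"
  using R_carrier b(3) by auto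

lemma eb_in_R: "idem_endo C e \<Longrightarrow> eb e \<in> carrier R" using b_R e_A by blast

text \<open>For \<open>x\<close> in \<open>R\<close> one has \<open>(e x e)(eb) = e x e\<close>, and
  \<open>eb\<close> is already supported on \<open>G\<^sub>e\<close>. Restricting this equation by
  \<open>restrict_mult\<close> shows that \<open>\<pi> e x\<close> absorbs
  \<open>eb\<close>.\<close>

lemma pi_Q:
  assumes e: "idem_endo C e" and x: "x \<in> carrier R" shows "\<pi> e x \<in> carrier (Q e)"
proof -
  have xA: "x \<in> carrier A" using x R_carrier by blast
  let ?y = "smon 1 e \<otimes>\<^bsub>A\<^esub> (x \<otimes>\<^bsub>A\<^esub> smon 1 e)"
  note ebG = eb_kG[OF e, unfolded kG_carrier]
  have ebE: "\<And>m. m \<notin> E e \<Longrightarrow> eb e m = 0" using ebG idem_group_sub[OF e] by blast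
  have "?y \<otimes>\<^bsub>A\<^esub> eb e = smon 1 e \<otimes>\<^bsub>A\<^esub> (x \<otimes>\<^bsub>A\<^esub> (smon 1 e \<otimes>\<^bsub>A\<^esub> smon 1 e) \<otimes>\<^bsub>A\<^esub> b)"
    using xA e_A[OF e] b(1) by (simp add: A.m_assoc)
  also have "\<dots> = smon 1 e \<otimes>\<^bsub>A\<^esub> ((x \<otimes>\<^bsub>A\<^esub> b) \<otimes>\<^bsub>A\<^esub> smon 1 e)"
    using xA e_A[OF e] b(1) b(3)[OF e_A[OF e]] smon_idem[OF e] by (simp add: A.m_assoc)
  finally have y: "?y \<otimes>\<^bsub>A\<^esub> eb e = ?y" using R_absorb_b(2)[OF x] by simp
  have ebr: "(\<lambda>m. if m \<in> G e then eb e m else 0) = eb e" using ebG by auto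
  have "\<pi> e x \<otimes>\<^bsub>A\<^esub> eb e = \<pi> e x"
    using restrict_mult[where f = ?y and g = "eb e", OF e corner_support[OF e] ebE]
        unfolding y ebr \<pi>_def[symmetric] by simp
  then show ?thesis
    unfolding Q_carrier[OF e] using pi_kG kG_mult[OF e pi_kG eb_kG[OF e]] kG_eb(1)[OF e pi_kG] by simp
qed

lemma corner: assumes e: "idem_endo C e" shows "corner R (Q e) (eb e) (\<pi> e)"
proof (intro corner.intro corner_axioms.intro R_ring Q_ring e)
  show QR: "q \<in> carrier R" if "q \<in> carrier (Q e)" for q
    using that Q_carrier[OF e] R_carrier kG_A[OF e] by blast
  show "\<pi> e x \<in> carrier (Q e)" if "x \<in> carrier R" for x using pi_Q[OF e that] .
  show "p \<otimes>\<^bsub>Q e\<^esub> q = p \<otimes>\<^bsub>R\<^esub> q" if "p \<in> carrier (Q e)" "q \<in> carrier (Q e)" for p q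
    using that kG_mult[OF e] unfolding Q_carrier[OF e] by simp
  show "p \<oplus>\<^bsub>Q e\<^esub> q = p \<oplus>\<^bsub>R\<^esub> q" for p q by (simp add: cat_algebra_sel)
  show "\<one>\<^bsub>Q e\<^esub> = eb e" by simp
  show "\<pi> e (x \<oplus>\<^bsub>R\<^esub> y) = \<pi> e x \<oplus>\<^bsub>R\<^esub> \<pi> e y" if "x \<in> carrier R" "y \<in> carrier R" for x y
  proof -
    have "smon 1 e \<otimes>\<^bsub>A\<^esub> ((x \<oplus>\<^bsub>A\<^esub> y) \<otimes>\<^bsub>A\<^esub> smon 1 e) =
      smon 1 e \<otimes>\<^bsub>A\<^esub> (x \<otimes>\<^bsub>A\<^esub> smon 1 e) \<oplus>\<^bsub>A\<^esub> smon 1 e \<otimes>\<^bsub>A\<^esub> (y \<otimes>\<^bsub>A\<^esub> smon 1 e)"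
      using that e_A[OF e] unfolding R_carrier by (simp add: A.l_distr A.r_distr)
    then show ?thesis unfolding \<pi>_def by (auto simp: cat_algebra_sel(4))
  qed
  show "\<pi> e q = q" if "q \<in> carrier (Q e)" for q
    using that kG_e[OF e] unfolding Q_carrier[OF e] \<pi>_def by (auto simp: kG_carrier)
  show "\<pi> e (eb e \<otimes>\<^bsub>R\<^esub> x) = \<pi> e x" if x: "x \<in> carrier R" for x
  proof -
    have "smon 1 e \<otimes>\<^bsub>A\<^esub> (eb e \<otimes>\<^bsub>A\<^esub> x \<otimes>\<^bsub>A\<^esub> smon 1 e) = (smon 1 e \<otimes>\<^bsub>A\<^esub> smon 1 e) \<otimes>\<^bsub>A\<^esub> ((b \<otimes>\<^bsub>A\<^esub> x) \<otimes>\<^bsub>A\<^esub> smon 1 e)"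
      using x e_A[OF e] b(1) unfolding R_carrier by (simp add: A.m_assoc)
    then show ?thesis using R_absorb_b(1)[OF x] smon_idem[OF e] by (simp add: \<pi>_def cong: if_cong)
  qed
  show "\<pi> e (x \<otimes>\<^bsub>R\<^esub> eb e) = \<pi> e x" if x: "x \<in> carrier R" for x
  proof -
    have xA: "x \<in> carrier A" using x R_carrier by blast
    have "x \<otimes>\<^bsub>A\<^esub> eb e \<otimes>\<^bsub>A\<^esub> smon 1 e = (x \<otimes>\<^bsub>A\<^esub> b) \<otimes>\<^bsub>A\<^esub> smon 1 e"
      using xA e_A[OF e] b(1) b(3)[OF e_A[OF e]] ee_left[OF e] by (simp add: A.m_assoc)
    then show ?thesis using R_absorb_b(2)[OF x] smon_idem[OF e] by (simp add: \<pi>_def cong: if_cong)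
  qed
  show "\<pi> e (x \<otimes>\<^bsub>R\<^esub> (eb e \<otimes>\<^bsub>R\<^esub> y)) = \<pi> e x \<otimes>\<^bsub>R\<^esub> \<pi> e y" if x: "x \<in> carrier R" and y: "y \<in> carrier R" for x y
  proof -
    have xyA: "x \<in> carrier A" "y \<in> carrier A" using x y R_carrier by auto
    let ?x = "smon 1 e \<otimes>\<^bsub>A\<^esub> (x \<otimes>\<^bsub>A\<^esub> smon 1 e)" and ?y = "smon 1 e \<otimes>\<^bsub>A\<^esub> (y \<otimes>\<^bsub>A\<^esub> smon 1 e)"
    have "eb e \<otimes>\<^bsub>A\<^esub> y = smon 1 e \<otimes>\<^bsub>A\<^esub> y" using R_absorb_b(1)[OF y] e_A[OF e] b(1) xyA by (simp add: A.m_assoc)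
    also have "\<dots> = smon 1 e \<otimes>\<^bsub>A\<^esub> (smon 1 e \<otimes>\<^bsub>A\<^esub> y)" using e_A[OF e] smon_idem[OF e] xyA
        by (simp add: A.m_assoc[symmetric])
    finally have "smon 1 e \<otimes>\<^bsub>A\<^esub> ((x \<otimes>\<^bsub>A\<^esub> (eb e \<otimes>\<^bsub>A\<^esub> y)) \<otimes>\<^bsub>A\<^esub> smon 1 e) = ?x \<otimes>\<^bsub>A\<^esub> ?y"
      using e_A[OF e] xyA by (simp add: A.m_assoc)
    then show ?thesis
      using restrict_mult[where f = ?x and g = ?y, OF e corner_support[OF e] corner_support[OF e]]
          unfolding \<pi>_def by (simp cong: if_cong)
  qed
qed

text \<open>A morphism need not lie in \<open>R = A b\<close>, so it acts on
  \<open>R\<close>-modules through its component \<open>s b\<close>.\<close>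

definition act :: "('m \<Rightarrow> 'k, 'u) module \<Rightarrow> 'm \<Rightarrow> 'u \<Rightarrow> 'u" where
  "act U s u = (smon 1 s \<otimes>\<^bsub>A\<^esub> b) \<odot>\<^bsub>U\<^esub> u"

definition has_apex :: "'m \<Rightarrow> ('m \<Rightarrow> 'k, 'u) module \<Rightarrow> bool" where
  "has_apex e U \<longleftrightarrow> simple_module R U \<and> (\<exists>u \<in> carrier U. act U e u \<noteq> \<zero>\<^bsub>U\<^esub>) \<and>
     (\<forall>x \<in> E e - G e. \<forall>u \<in> carrier U. act U x u = \<zero>\<^bsub>U\<^esub>)"

context
  fixes U :: "('m \<Rightarrow> 'k, 'u) module"
  assumes U: "left_module R U"
begin

interpretation U: left_module R U by (rule U)

lemma act_closed: "\<lbrakk>s \<in> Mor C; u \<in> carrier U\<rbrakk> \<Longrightarrow> act U s u \<in> carrier U"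
  unfolding act_def using U.smult_closed b_R smon_A by blast

lemma act_zero: "s \<in> Mor C \<Longrightarrow> act U s \<zero>\<^bsub>U\<^esub> = \<zero>\<^bsub>U\<^esub>"
  unfolding act_def using U.smult_zero_right b_R smon_A by blast

lemma act_mult:
  assumes f: "f \<in> carrier A" and g: "g \<in> carrier A" and u: "u \<in> carrier U"
  shows "(f \<otimes>\<^bsub>A\<^esub> g \<otimes>\<^bsub>A\<^esub> b) \<odot>\<^bsub>U\<^esub> u = (f \<otimes>\<^bsub>A\<^esub> b) \<odot>\<^bsub>U\<^esub> ((g \<otimes>\<^bsub>A\<^esub> b) \<odot>\<^bsub>U\<^esub> u)"
proof -
  have "(f \<otimes>\<^bsub>A\<^esub> b) \<otimes>\<^bsub>R\<^esub> (g \<otimes>\<^bsub>A\<^esub> b) = (f \<otimes>\<^bsub>A\<^esub> (b \<otimes>\<^bsub>A\<^esub> g)) \<otimes>\<^bsub>A\<^esub> b" using f g b(1) by (simp add: A.m_assoc)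
  also have "\<dots> = f \<otimes>\<^bsub>A\<^esub> g \<otimes>\<^bsub>A\<^esub> (b \<otimes>\<^bsub>A\<^esub> b)" using f g b(1) b(3)[OF g] by (simp add: A.m_assoc)
  finally show ?thesis using U.smult_assoc1[OF b_R[OF f] b_R[OF g] u] b(2) by simp
qed

lemma act_cmp:
  assumes "s \<in> Mor C" "t \<in> Mor C" "src C s = tgt C t" "u \<in> carrier U"
  shows "act U (cmp C s t) u = act U s (act U t u)"
  unfolding act_def act_mult[OF smon_A[OF assms(1)] smon_A[OF assms(2)] assms(4), symmetric]
  using assms by (simp add: smon_comp)

lemma act_span_zero:
  fixes f :: "'m \<Rightarrow> 'k"
  assumes "S \<subseteq> Mor C" "u \<in> carrier U" "\<And>s. s \<in> S \<Longrightarrow> act U s u = \<zero>\<^bsub>U\<^esub>" "\<And>m. m \<notin> S \<Longrightarrow> f m = 0"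
  shows "(f \<otimes>\<^bsub>A\<^esub> b) \<odot>\<^bsub>U\<^esub> u = \<zero>\<^bsub>U\<^esub>"
proof -
  have SA: "f \<in> carrier A" if "\<And>m. m \<notin> S \<Longrightarrow> f m = 0" for f :: "'m \<Rightarrow> 'k"
    using that assms(1) by (auto simp: cat_algebra_sel)
  have "finite S" using assms(1) finite_Mor by (rule finite_subset)
  show ?thesis
  proof (rule supported_induct[OF \<open>finite S\<close> assms(4), where P = "\<lambda>f. (f \<otimes>\<^bsub>A\<^esub> b) \<odot>\<^bsub>U\<^esub> u = \<zero>\<^bsub>U\<^esub>"])
    have "\<zero>\<^bsub>A\<^esub> \<otimes>\<^bsub>A\<^esub> b = \<zero>\<^bsub>R\<^esub>" using b(1) by simp
    then show "((\<lambda>_. 0) \<otimes>\<^bsub>A\<^esub> b) \<odot>\<^bsub>U\<^esub> u = \<zero>\<^bsub>U\<^esub>"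
      using U.smult_zero_left[OF assms(2)] by (simp only: cat_algebra_sel(3))
  next
    fix c s assume sS: "s \<in> S"
    then have s: "s \<in> Mor C" using assms(1) by blast
    note i = ident_simps[OF tgt_closed[OF s]]
    \<comment> \<open>The module record carries no scalar multiplication by the field, so the
      coefficient \<open>c\<close> is made to act as a multiple of an identity morphism.\<close>
    have "smon c s = smon c (ident C (tgt C s)) \<otimes>\<^bsub>A\<^esub> smon 1 s"
      using s i by (simp add: smon_comp ident_left)
    then have "(smon c s \<otimes>\<^bsub>A\<^esub> b) \<odot>\<^bsub>U\<^esub> u = (smon c (ident C (tgt C s)) \<otimes>\<^bsub>A\<^esub> b) \<odot>\<^bsub>U\<^esub> act U s u"
      using act_mult[OF smon_A[OF i(1)] smon_A[OF s] assms(2)] by (simp add: act_def)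
    then show "(smon c s \<otimes>\<^bsub>A\<^esub> b) \<odot>\<^bsub>U\<^esub> u = \<zero>\<^bsub>U\<^esub>"
      using assms(3)[OF sS] U.smult_zero_right[OF b_R[OF smon_A[OF i(1)]]] by simp
  next
    fix f g :: "'m \<Rightarrow> 'k" assume fg: "\<And>m. m \<notin> S \<Longrightarrow> f m = 0" "\<And>m. m \<notin> S \<Longrightarrow> g m = 0"
      "(f \<otimes>\<^bsub>A\<^esub> b) \<odot>\<^bsub>U\<^esub> u = \<zero>\<^bsub>U\<^esub>" "(g \<otimes>\<^bsub>A\<^esub> b) \<odot>\<^bsub>U\<^esub> u = \<zero>\<^bsub>U\<^esub>"
    have "(f \<oplus>\<^bsub>A\<^esub> g) \<otimes>\<^bsub>A\<^esub> b = f \<otimes>\<^bsub>A\<^esub> b \<oplus>\<^bsub>R\<^esub> g \<otimes>\<^bsub>A\<^esub> b"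
      using A.l_distr[OF SA[OF fg(1)] SA[OF fg(2)] b(1)] by simp
    then have "((f \<oplus>\<^bsub>A\<^esub> g) \<otimes>\<^bsub>A\<^esub> b) \<odot>\<^bsub>U\<^esub> u = \<zero>\<^bsub>U\<^esub>"
      using fg(3,4) U.smult_l_distr[OF b_R[OF SA[OF fg(1)]] b_R[OF SA[OF fg(2)]] assms(2)] by simp
    then show "((\<lambda>m. f m + g m) \<otimes>\<^bsub>A\<^esub> b) \<odot>\<^bsub>U\<^esub> u = \<zero>\<^bsub>U\<^esub>" by (simp only: cat_algebra_sel(4))
  qed
qed

end

text \<open>A non-unit \<open>x\<close> of \<open>E e\<close> satisfies
  \<open>x b = (eb)(x b)(eb)\<close> and \<open>\<pi> e (x b) = 0\<close>, so it acts as zero under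
  the ring condition. Conversely, \<open>e x e\<close> is \<open>\<pi> e x\<close> plus a
  combination of non-units, and these annihilate \<open>U\<close>.\<close>

lemma apex_iff:
  assumes e: "idem_endo C e"
  shows "corner.apex R (eb e) (\<pi> e) U \<longleftrightarrow> has_apex e U"
proof -
  interpret K: corner R "Q e" "eb e" "\<pi> e" by (rule corner[OF e])
  note c = idem_monoid_carrier[OF e]
  show ?thesis
  proof
    assume ap: "K.apex U"
    then have sU: "simple_module R U" by (simp add: K.apex_def)
    interpret U: left_module R U using sU by (rule simple_module_left)
    have "act U x u = \<zero>\<^bsub>U\<^esub>" if x: "x \<in> E e - G e" and u: "u \<in> carrier U" for x u
    proof -
      have xM: "x \<in> Mor C" using x c by blast
      let ?r = "smon 1 x \<otimes>\<^bsub>A\<^esub> b"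
      have rR: "?r \<in> carrier R" using b_R[OF smon_A[OF xM]] .
      have xe: "smon 1 x \<otimes>\<^bsub>A\<^esub> smon 1 e = (smon 1 x :: 'm \<Rightarrow> 'k)" "smon 1 e \<otimes>\<^bsub>A\<^esub> smon 1 x = (smon 1 x :: 'm \<Rightarrow> 'k)"
        using x c idem_endoD[OF e] by (auto simp: smon_comp)
      have "eb e \<otimes>\<^bsub>A\<^esub> (?r \<otimes>\<^bsub>A\<^esub> eb e) = (smon 1 e \<otimes>\<^bsub>A\<^esub> (smon 1 x \<otimes>\<^bsub>A\<^esub> smon 1 e)) \<otimes>\<^bsub>A\<^esub> b"
        using smon_A[OF xM] e_A[OF e] b(1,2) b(3)[OF e_A[OF e]] b(3)[OF smon_A[OF xM]]
          b_left[OF e_A[OF e]] b_left[OF smon_A[OF xM]] bb_left by (simp add: A.m_assoc)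
      then have ere: "eb e \<otimes>\<^bsub>A\<^esub> (?r \<otimes>\<^bsub>A\<^esub> eb e) = ?r" using xe by simp
      have e1: "smon 1 e \<otimes>\<^bsub>A\<^esub> (?r \<otimes>\<^bsub>A\<^esub> smon 1 e) = smon 1 x \<otimes>\<^bsub>A\<^esub> eb e"
      proof -
        have "smon 1 e \<otimes>\<^bsub>A\<^esub> (?r \<otimes>\<^bsub>A\<^esub> smon 1 e) = (smon 1 e \<otimes>\<^bsub>A\<^esub> smon 1 x) \<otimes>\<^bsub>A\<^esub> (b \<otimes>\<^bsub>A\<^esub> smon 1 e)"
          using smon_A[OF xM] e_A[OF e] b(1) by (simp add: A.m_assoc)
        then show ?thesis using xe b(3)[OF e_A[OF e]] by simp
      qed
      have sx: "smon (1::'k) x m = 0" if "m \<notin> E e" for m using that x by (auto simp: smon_def)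
      have ebE: "eb e m = 0" if "m \<notin> E e" for m using that eb_outside[OF e] idem_group_sub[OF e] by blast
      have "\<pi> e ?r = (\<lambda>m. if m \<in> G e then smon 1 x m else 0) \<otimes>\<^bsub>A\<^esub> (\<lambda>m. if m \<in> G e then eb e m else 0)"
        unfolding \<pi>_def e1 by (rule restrict_mult[OF e sx ebE])
      also have "(\<lambda>m. if m \<in> G e then smon 1 x m else 0) = \<zero>\<^bsub>A\<^esub>"
        using x by (auto simp: smon_def cat_algebra_sel(3))
      also have "\<zero>\<^bsub>A\<^esub> \<otimes>\<^bsub>A\<^esub> (\<lambda>m. if m \<in> G e then eb e m else 0) = \<zero>\<^bsub>A\<^esub>"
        by (rule A.l_null) (use idem_groupD(1)[OF e] in \<open>auto simp: cat_algebra_sel(1)\<close>)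
      finally have pi0: "\<pi> e ?r = \<zero>\<^bsub>R\<^esub>" by simp
      have "?r \<odot>\<^bsub>U\<^esub> u = eb e \<odot>\<^bsub>U\<^esub> (?r \<odot>\<^bsub>U\<^esub> (eb e \<odot>\<^bsub>U\<^esub> u))"
        using ere U.smult_assoc1[OF rR eb_in_R[OF e] u] U.smult_assoc1[OF eb_in_R[OF e] _ u, of "?r \<otimes>\<^bsub>R\<^esub> eb e"]
          K.R.m_closed[OF rR eb_in_R[OF e]] by simp
      also have "\<dots> = \<pi> e ?r \<odot>\<^bsub>U\<^esub> u" using ap rR u unfolding K.apex_def by blast
      finally show ?thesis using pi0 U.smult_zero_left[OF u] by (simp add: act_def)
    qed
    then show "has_apex e U" using ap unfolding has_apex_def K.apex_def act_def by blast
  next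
    assume ap: "has_apex e U"
    then have sU: "simple_module R U" by (simp add: has_apex_def)
    interpret U: left_module R U using sU by (rule simple_module_left)
    have "eb e \<odot>\<^bsub>U\<^esub> (x \<odot>\<^bsub>U\<^esub> (eb e \<odot>\<^bsub>U\<^esub> u)) = \<pi> e x \<odot>\<^bsub>U\<^esub> u" if x: "x \<in> carrier R" and u: "u \<in> carrier U" for x u
    proof -
      have xA: "x \<in> carrier A" using x R_carrier by blast
      let ?y = "smon 1 e \<otimes>\<^bsub>A\<^esub> (x \<otimes>\<^bsub>A\<^esub> smon 1 e)"
      have "eb e \<otimes>\<^bsub>A\<^esub> (x \<otimes>\<^bsub>A\<^esub> eb e) = (smon 1 e \<otimes>\<^bsub>A\<^esub> ((x \<otimes>\<^bsub>A\<^esub> b) \<otimes>\<^bsub>A\<^esub> smon 1 e)) \<otimes>\<^bsub>A\<^esub> b"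
        using xA e_A[OF e] b(1,2) b(3)[OF e_A[OF e]] b(3)[OF xA] b_left[OF e_A[OF e]] b_left[OF xA] bb_left
        by (simp add: A.m_assoc)
      then have y1: "eb e \<otimes>\<^bsub>A\<^esub> (x \<otimes>\<^bsub>A\<^esub> eb e) = ?y \<otimes>\<^bsub>A\<^esub> b" using R_absorb_b(2)[OF x] by simp
      also have "\<dots> = smon 1 e \<otimes>\<^bsub>A\<^esub> ((x \<otimes>\<^bsub>A\<^esub> b) \<otimes>\<^bsub>A\<^esub> smon 1 e)" using xA e_A[OF e] b(1) b(3)[OF e_A[OF e]]
          by (simp add: A.m_assoc)
      finally have y: "eb e \<otimes>\<^bsub>A\<^esub> (x \<otimes>\<^bsub>A\<^esub> eb e) = ?y" using R_absorb_b(2)[OF x] by simp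
      have yR: "?y \<in> carrier R" using y y1 b_R[OF corner_A[OF e xA]] by simp
      have pR: "\<pi> e x \<in> carrier R" using K.sub[OF pi_Q[OF e x]] .
      let ?z = "\<lambda>m. if m \<in> E e - G e then ?y m else 0"
      have zA: "?z \<in> carrier A" using c by (auto simp: cat_algebra_sel(1))
      have dec: "?y = \<pi> e x \<oplus>\<^bsub>A\<^esub> ?z"
        using corner_support[OF e, of _ x] idem_group_sub[OF e] unfolding \<pi>_def cat_algebra_sel(4) by fastforce
      have pA: "\<pi> e x \<in> carrier A" using pR R_carrier by blast
      \<comment> \<open>Both \<open>e x e\<close> and \<open>\<pi> e x\<close> absorb
        \<open>b\<close>, hence so does their difference \<open>?z\<close>. Then \<open>?z\<close>
        acts as \<open>?z b\<close>, to which \<open>act_span_zero\<close> applies.\<close>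
      have "\<pi> e x \<oplus>\<^bsub>A\<^esub> ?z \<otimes>\<^bsub>A\<^esub> b = \<pi> e x \<oplus>\<^bsub>A\<^esub> ?z"
        using A.l_distr[OF pA zA b(1)] R_absorb_b(2)[OF yR] R_absorb_b(2)[OF pR] dec by simp
      then have "?z \<otimes>\<^bsub>A\<^esub> b = ?z" using zA pA b(1) by (simp add: A.add.l_cancel)
      then have zR: "?z \<in> carrier R" using zA R_carrier by blast
      have "(?z \<otimes>\<^bsub>A\<^esub> b) \<odot>\<^bsub>U\<^esub> u = \<zero>\<^bsub>U\<^esub>"
        by (rule act_span_zero[OF U.left_module_axioms, of "E e - G e"])
          (use c u ap in \<open>auto simp: has_apex_def\<close>)
      then have z0: "?z \<odot>\<^bsub>U\<^esub> u = \<zero>\<^bsub>U\<^esub>" using R_absorb_b(2)[OF zR] by simp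
      have "eb e \<odot>\<^bsub>U\<^esub> (x \<odot>\<^bsub>U\<^esub> (eb e \<odot>\<^bsub>U\<^esub> u)) = ?y \<odot>\<^bsub>U\<^esub> u"
        using y U.smult_assoc1[OF x eb_in_R[OF e] u] U.smult_assoc1[OF eb_in_R[OF e] _ u, of "x \<otimes>\<^bsub>R\<^esub> eb e"]
          K.R.m_closed[OF x eb_in_R[OF e]] by simp
      also have "\<dots> = \<pi> e x \<odot>\<^bsub>U\<^esub> u \<oplus>\<^bsub>U\<^esub> ?z \<odot>\<^bsub>U\<^esub> u"
        using U.smult_l_distr[OF pR zR u] dec by simp
      finally show ?thesis using z0 U.smult_closed[OF pR u] by simp
    qed
    then show "K.apex U" using ap unfolding has_apex_def K.apex_def act_def by blast
  qed
qed

end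


lemma block_ring_iso:
  assumes A: "ring A" "central_idempotent A b" and B: "ring B" "central_idempotent B c"
    and \<phi>: "\<phi> \<in> ring_iso A B" "\<phi> b = c"
  shows "\<phi> \<in> ring_iso (block_algebra A b) (block_algebra B c)"
proof -
  note \<phi>D = ring_isoD[OF \<phi>(1)]
  note ac = block_carrier[OF A] and bc = block_carrier[OF B]
  have bA: "b \<in> carrier A" using A(2) by (simp add: central_idempotent_def)
  have im: "\<phi> x \<in> carrier (block_algebra B c) \<longleftrightarrow> x \<in> carrier (block_algebra A b)" if x: "x \<in> carrier A" for x
  proof -
    have "\<phi> x \<otimes>\<^bsub>B\<^esub> c = \<phi> (x \<otimes>\<^bsub>A\<^esub> b)" using \<phi>D(2)[OF x bA] \<phi>(2) by simp
    moreover have "x \<otimes>\<^bsub>A\<^esub> b \<in> carrier A" using x bA A(1) by (simp add: ring.ring_simprules)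
    ultimately show ?thesis unfolding ac bc using x \<phi>D(1)[OF x] inj_onD[OF \<phi>D(6)] by metis
  qed
  have bij: "bij_betw \<phi> (carrier (block_algebra A b)) (carrier (block_algebra B c))"
  proof (rule bij_betw_imageI)
    show "inj_on \<phi> (carrier (block_algebra A b))" using \<phi>D(6) by (rule inj_on_subset) (use ac in blast)
    show "\<phi> ` carrier (block_algebra A b) = carrier (block_algebra B c)"
    proof (intro equalityI subsetI)
      fix y assume "y \<in> \<phi> ` carrier (block_algebra A b)"
      then show "y \<in> carrier (block_algebra B c)" using im ac by blast
    next
      fix y assume y: "y \<in> carrier (block_algebra B c)"
      then have "y \<in> carrier B" using bc by blast
      then obtain x where "x \<in> carrier A" "y = \<phi> x" using \<phi>D(7,8) by metis
      then show "y \<in> \<phi> ` carrier (block_algebra A b)" using im y by blast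
    qed
  qed
  show ?thesis
    unfolding ring_iso_def ring_hom_def
  proof (intro CollectI conjI allI impI)
    show "\<phi> \<in> carrier (block_algebra A b) \<rightarrow> carrier (block_algebra B c)" using im ac by blast
    show "\<phi> (x \<otimes>\<^bsub>block_algebra A b\<^esub> y) = \<phi> x \<otimes>\<^bsub>block_algebra B c\<^esub> \<phi> y"
      if "x \<in> carrier (block_algebra A b) \<and> y \<in> carrier (block_algebra A b)" for x y
      using \<phi>D(2) that ac unfolding block_algebra_sel(2) by blast
    show "\<phi> (x \<oplus>\<^bsub>block_algebra A b\<^esub> y) = \<phi> x \<oplus>\<^bsub>block_algebra B c\<^esub> \<phi> y"
      if "x \<in> carrier (block_algebra A b) \<and> y \<in> carrier (block_algebra A b)" for x y
      using \<phi>D(3) that ac unfolding block_algebra_sel(3) by blast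
    show "\<phi> \<one>\<^bsub>block_algebra A b\<^esub> = \<one>\<^bsub>block_algebra B c\<^esub>" using \<phi>(2) by simp
  qed (rule bij)
qed

section \<open>Functors and conjugation\<close>

context finite_category begin

lemma cmp_collapse:
  "\<lbrakk>cmp C p q = r; p \<in> Mor C; q \<in> Mor C; z \<in> Mor C; src C p = tgt C q; src C q = tgt C z\<rbrakk>
    \<Longrightarrow> cmp C p (cmp C q z) = cmp C r z"
  using assoc[of p q z] by simp

lemma conj_idem_monoid:
  assumes e: "idem_endo C e" and f: "idem_endo C f" and st: "idem_iso C e f s t" and x: "x \<in> carrier (idem_monoid C e)"
  shows "cmp C s (cmp C x t) \<in> carrier (idem_monoid C f)" "cmp C t (cmp C (cmp C s (cmp C x t)) s) = x"
proof -
  note D = idem_isoD[OF st] and xD = x[unfolded idem_monoid_carrier[OF e]]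
  have xt: "cmp C x t \<in> Mor C" "src C (cmp C x t) = src C f" "tgt C (cmp C x t) = src C e"
    using D xD by simp_all
  have sxt: "cmp C s (cmp C x t) \<in> Mor C" "src C (cmp C s (cmp C x t)) = src C f" "tgt C (cmp C s (cmp C x t))
      = src C f"
    using D xt by simp_all
  have 1: "cmp C f (cmp C s (cmp C x t)) = cmp C s (cmp C x t)"
    using cmp_collapse[OF D(5), of "cmp C x t"] D xt idem_endoD[OF f] by metis
  have "cmp C (cmp C x t) f = cmp C x t" using assoc[of x t f] D xD idem_endoD[OF f] by metis
  then have 2: "cmp C (cmp C s (cmp C x t)) f = cmp C s (cmp C x t)"
    using assoc[of s "cmp C x t" f] D xt idem_endoD[OF f] by metis
  show "cmp C s (cmp C x t) \<in> carrier (idem_monoid C f)"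
    unfolding idem_monoid_carrier[OF f] using sxt 1 2 by blast
  have "cmp C (cmp C s (cmp C x t)) s = cmp C s (cmp C (cmp C x t) s)"
    using assoc[of s "cmp C x t" s] D xt by metis
  also have "cmp C (cmp C x t) s = x" using assoc[of x t s] D xD by metis
  finally have "cmp C t (cmp C (cmp C s (cmp C x t)) s) = cmp C t (cmp C s x)" by simp
  also have "\<dots> = x" using cmp_collapse[OF D(11), of x] D xD by metis
  finally show "cmp C t (cmp C (cmp C s (cmp C x t)) s) = x" .
qed

lemma conj_cmp:
  assumes e: "idem_endo C e" and st: "idem_iso C e f s t"
    and x: "x \<in> carrier (idem_monoid C e)" and y: "y \<in> carrier (idem_monoid C e)"
  shows "cmp C (cmp C s (cmp C x t)) (cmp C s (cmp C y t)) = cmp C s (cmp C (cmp C x y) t)"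
proof -
  note D = idem_isoD[OF st] and xD = x[unfolded idem_monoid_carrier[OF e]] and yD
      = y[unfolded idem_monoid_carrier[OF e]]
  have yt: "cmp C y t \<in> Mor C" "src C (cmp C y t) = src C f" "tgt C (cmp C y t) = src C e"
    and xt: "cmp C x t \<in> Mor C" "src C (cmp C x t) = src C f" "tgt C (cmp C x t) = src C e"
    and syt: "cmp C s (cmp C y t) \<in> Mor C" "src C (cmp C s (cmp C y t)) = src C f" "tgt C (cmp C s (cmp C y t))
        = src C f"
    using D xD yD by simp_all
  have "cmp C (cmp C x t) (cmp C s (cmp C y t)) = cmp C x (cmp C t (cmp C s (cmp C y t)))"
    using assoc[of x t "cmp C s (cmp C y t)"] D xD syt by metis
  also have "cmp C t (cmp C s (cmp C y t)) = cmp C e (cmp C y t)"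
    using cmp_collapse[OF D(11), of "cmp C y t"] D yt by metis
  also have "\<dots> = cmp C y t" using cmp_collapse[of e y y t] D yD idem_endoD[OF e] by metis
  also have "cmp C x (cmp C y t) = cmp C (cmp C x y) t" using assoc[of x y t] D xD yD by metis
  finally show ?thesis using assoc[of s "cmp C x t" "cmp C s (cmp C y t)"] D xt syt by metis
qed

lemma conj_idem_group:
  assumes e: "idem_endo C e" and f: "idem_endo C f" and st: "idem_iso C e f s t" and x: "x \<in> carrier (idem_group C e)"
  shows "cmp C s (cmp C x t) \<in> carrier (idem_group C f)"
proof -
  obtain y where y: "y \<in> carrier (idem_group C e)" "cmp C x y = e"
    using idem_group_inverse[OF e x] by blast
  note xM = idem_group_sub[OF e x] and yM = idem_group_sub[OF e y(1)]
  note D = idem_isoD[OF st]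
  have "cmp C (cmp C s (cmp C x t)) (cmp C s (cmp C y t)) = f"
    using conj_cmp[OF e st xM yM] y(2) D by simp
  then show ?thesis
    using idem_one_sided(1)[OF f conj_idem_monoid(1)[OF e f st xM] conj_idem_monoid(1)[OF e f st yM]] by simp
qed

lemma endofunctorD:
  assumes "is_endofunctor C F"
  shows "V \<in> Ob C \<Longrightarrow> fst F V \<in> Ob C" "V \<in> Ob C \<Longrightarrow> snd F (ident C V) = ident C (fst F V)"
    "s \<in> Mor C \<Longrightarrow> snd F s \<in> Mor C" "s \<in> Mor C \<Longrightarrow> src C (snd F s) = fst F (src C s)"
    "s \<in> Mor C \<Longrightarrow> tgt C (snd F s) = fst F (tgt C s)"
    "\<lbrakk>s \<in> Mor C; t \<in> Mor C; src C s = tgt C t\<rbrakk> \<Longrightarrow> snd F (cmp C s t) = cmp C (snd F s) (snd F t)"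
proof -
  show "V \<in> Ob C \<Longrightarrow> fst F V \<in> Ob C" "V \<in> Ob C \<Longrightarrow> snd F (ident C V) = ident C (fst F V)"
    using assms unfolding is_endofunctor_def by blast+
  have "snd F s \<in> Hom C (fst F (src C s)) (fst F (tgt C s))" if "s \<in> Mor C"
    using assms Mor_Hom[OF that] unfolding is_endofunctor_def by blast
  then show "s \<in> Mor C \<Longrightarrow> snd F s \<in> Mor C" "s \<in> Mor C \<Longrightarrow> src C (snd F s) = fst F (src C s)"
    "s \<in> Mor C \<Longrightarrow> tgt C (snd F s) = fst F (tgt C s)" by (auto simp: Hom_def)
  show "snd F (cmp C s t) = cmp C (snd F s) (snd F t)" if "s \<in> Mor C" "t \<in> Mor C" "src C s = tgt C t"
  proof -
    have "s \<in> Hom C (src C s) (tgt C s)" "t \<in> Hom C (src C t) (src C s)" using that by (auto simp: Hom_def)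
    then show ?thesis using assms unfolding is_endofunctor_def by blast
  qed
qed

lemma endofunctorI:
  assumes "\<And>V. V \<in> Ob C \<Longrightarrow> fst F V \<in> Ob C" "\<And>V. V \<in> Ob C \<Longrightarrow> snd F (ident C V) = ident C (fst F V)"
    "\<And>s. s \<in> Mor C \<Longrightarrow> snd F s \<in> Mor C" "\<And>s. s \<in> Mor C \<Longrightarrow> src C (snd F s) = fst F (src C s)"
    "\<And>s. s \<in> Mor C \<Longrightarrow> tgt C (snd F s) = fst F (tgt C s)"
    "\<And>s t. \<lbrakk>s \<in> Mor C; t \<in> Mor C; src C s = tgt C t\<rbrakk> \<Longrightarrow> snd F (cmp C s t) = cmp C (snd F s) (snd F t)"
  shows "is_endofunctor C F"
  using assms unfolding is_endofunctor_def Hom_def by auto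

lemma Aut_catE:
  assumes "F \<in> Aut_cat C"
  obtains F' where "is_endofunctor C F" "is_endofunctor C F'" "F' \<in> Aut_cat C"
    "\<And>V. V \<in> Ob C \<Longrightarrow> fst F' (fst F V) = V" "\<And>V. V \<in> Ob C \<Longrightarrow> fst F (fst F' V) = V"
    "\<And>s. s \<in> Mor C \<Longrightarrow> snd F' (snd F s) = s" "\<And>s. s \<in> Mor C \<Longrightarrow> snd F (snd F' s) = s"
  using assms unfolding Aut_cat_def by blast

lemma Aut_cat_endo: "F \<in> Aut_cat C \<Longrightarrow> is_endofunctor C F" by (simp add: Aut_cat_def)

lemmas autD = endofunctorD[OF Aut_cat_endo]

lemma Aut_cat_bij:
  assumes "F \<in> Aut_cat C" shows "bij_betw (snd F) (Mor C) (Mor C)"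
proof -
  obtain F' where F': "is_endofunctor C F'" "\<And>s. s \<in> Mor C \<Longrightarrow> snd F' (snd F s) = s"
     "\<And>s. s \<in> Mor C \<Longrightarrow> snd F (snd F' s) = s" using Aut_catE[OF assms] by metis
  show ?thesis
    by (rule bij_betw_byWitness[where f' = "snd F'"])
      (use F' endofunctorD(3)[OF F'(1)] autD(3)[OF assms] in auto)
qed

lemma Aut_cat_inj_Ob:
  assumes "F \<in> Aut_cat C" "V \<in> Ob C" "W \<in> Ob C" shows "fst F V = fst F W \<longleftrightarrow> V = W"
  using Aut_catE[OF assms(1)] assms(2,3) by metis

lemma Aut_cat_iso: assumes "F \<in> Aut_cat C" shows "cat_iso C C (snd F)"
proof -
  obtain F' where F': "is_endofunctor C F'" "\<And>V. V \<in> Ob C \<Longrightarrow> fst F (fst F' V) = V" using Aut_catE[OF assms] by metis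
  have "snd F ` ident C ` Ob C = ident C ` fst F ` Ob C"
    using autD(2)[OF assms] by (force simp: image_iff)
  also have "fst F ` Ob C = Ob C"
    using autD(1)[OF assms] endofunctorD(1)[OF F'(1)] F'(2) by (intro equalityI subsetI) (auto, metis image_eqI)
  finally show ?thesis
    unfolding cat_iso_def
    using Aut_cat_bij[OF assms] autD[OF assms] Aut_cat_inj_Ob[OF assms] src_closed tgt_closed by simp
qed

lemma Aut_cat_comp:
  assumes F: "F \<in> Aut_cat C" and H: "H \<in> Aut_cat C"
  shows "(fst F \<circ> fst H, snd F \<circ> snd H) \<in> Aut_cat C"
proof -
  have comp: "is_endofunctor C (fst F \<circ> fst H, snd F \<circ> snd H)"
    if "is_endofunctor C F" "is_endofunctor C H" for F H
    by (rule endofunctorI) (simp_all add: endofunctorD[OF that(1)] endofunctorD[OF that(2)])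
  obtain F' where F': "is_endofunctor C F" "is_endofunctor C F'"
    "\<And>V. V \<in> Ob C \<Longrightarrow> fst F' (fst F V) = V" "\<And>V. V \<in> Ob C \<Longrightarrow> fst F (fst F' V) = V"
    "\<And>s. s \<in> Mor C \<Longrightarrow> snd F' (snd F s) = s" "\<And>s. s \<in> Mor C \<Longrightarrow> snd F (snd F' s) = s"
    using Aut_catE[OF F] by metis
  obtain H' where H': "is_endofunctor C H" "is_endofunctor C H'"
    "\<And>V. V \<in> Ob C \<Longrightarrow> fst H' (fst H V) = V" "\<And>V. V \<in> Ob C \<Longrightarrow> fst H (fst H' V) = V"
    "\<And>s. s \<in> Mor C \<Longrightarrow> snd H' (snd H s) = s" "\<And>s. s \<in> Mor C \<Longrightarrow> snd H (snd H' s) = s"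
    using Aut_catE[OF H] by metis
  show ?thesis
    unfolding Aut_cat_def
    using comp[OF F'(1) H'(1)] comp[OF H'(2) F'(2)] F' H' endofunctorD(1,3)[OF F'(2)] endofunctorD(1,3)[OF H'(1)]
    by (intro CollectI conjI exI[of _ "(fst H' \<circ> fst F', snd H' \<circ> snd F')"]) auto
qed

lemma aut_idem_endo: assumes "F \<in> Aut_cat C" "idem_endo C e" shows "idem_endo C (snd F e)"
  using autD(3-6)[OF assms(1), of e] autD(6)[OF assms(1), of e e] idem_endoD[OF assms(2)]
  by (simp add: idem_endo_def)

lemma aut_idem_iso:
  assumes "F \<in> Aut_cat C" "idem_endo C e" "idem_endo C f" "idem_iso C e f s t"
  shows "idem_iso C (snd F e) (snd F f) (snd F s) (snd F t)"
proof -
  note D = idem_isoD[OF assms(4)] and F = autD[OF assms(1)]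
  note e = idem_endoD[OF assms(2)] and f = idem_endoD[OF assms(3)]
  show ?thesis
    unfolding idem_iso_def
    using D e f F(6)[of s e] F(6)[of f s] F(6)[of t f] F(6)[of e t] F(6)[of t s] F(6)[of s t] by (simp add: F)
qed

lemma aut_idem_monoid:
  assumes "F \<in> Aut_cat C" "idem_endo C e" "x \<in> carrier (idem_monoid C e)"
  shows "snd F x \<in> carrier (idem_monoid C (snd F e))"
  using assms(3) idem_endoD[OF assms(2)] autD(6)[OF assms(1), of e x] autD(6)[OF assms(1), of x e]
  unfolding idem_monoid_carrier[OF assms(2)] idem_monoid_carrier[OF aut_idem_endo[OF assms(1,2)]]
  by (simp add: autD[OF assms(1)])

lemma aut_idem_group:
  assumes F: "F \<in> Aut_cat C" and e: "idem_endo C e" and x: "x \<in> carrier (idem_group C e)"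
  shows "snd F x \<in> carrier (idem_group C (snd F e))"
proof -
  obtain y where y: "y \<in> carrier (idem_group C e)" "cmp C x y = e" using idem_group_inverse[OF e x] by blast
  have "cmp C (snd F x) (snd F y) = snd F e"
    using autD(6)[OF F, of x y] idem_groupD[OF e x] idem_groupD[OF e y(1)] y(2) by simp
  then show ?thesis
    using idem_one_sided(1)[OF aut_idem_endo[OF F e]] aut_idem_monoid[OF F e idem_group_sub[OF e]] x y(1) by blast
qed

lemma idem_iso_refl: "idem_endo C e \<Longrightarrow> idem_iso C e e e e"
  using idem_endoD[of C e] by (simp add: idem_iso_def)

lemma idem_iso_trans:
  assumes e: "idem_endo C e" and f: "idem_endo C f" and g: "idem_endo C g"
    and st: "idem_iso C e f s t" and uv: "idem_iso C f g u v"
  shows "idem_iso C e g (cmp C u s) (cmp C t v)"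
proof -
  note D = idem_isoD[OF st] and D' = idem_isoD[OF uv]
  note E = idem_endoD[OF e] idem_endoD[OF f] idem_endoD[OF g]
  have us: "cmp C u s \<in> Mor C" "src C (cmp C u s) = src C e" "tgt C (cmp C u s) = src C g"
    and tv: "cmp C t v \<in> Mor C" "src C (cmp C t v) = src C g" "tgt C (cmp C t v) = src C e"
    using D D' by simp_all
  have 1: "cmp C (cmp C u s) e = cmp C u s" using assoc[of u s e] D D' E by metis
  have 2: "cmp C g (cmp C u s) = cmp C u s" using assoc[of g u s] D D' E by metis
  have 3: "cmp C (cmp C t v) g = cmp C t v" using assoc[of t v g] D D' E by metis
  have 4: "cmp C e (cmp C t v) = cmp C t v" using assoc[of e t v] D D' E by metis
  have "cmp C v (cmp C u s) = s" using cmp_collapse[OF D'(11), of s] D D' by metis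
  then have 5: "cmp C (cmp C t v) (cmp C u s) = e" using assoc[of t v "cmp C u s"] us D D' by metis
  have "cmp C s (cmp C t v) = v" using cmp_collapse[OF D(12), of v] D D' by metis
  then have 6: "cmp C (cmp C u s) (cmp C t v) = g" using assoc[of u s "cmp C t v"] tv D D' by metis
  show ?thesis unfolding idem_iso_def using us tv 1 2 3 4 5 6 by blast
qed

text \<open>Conjugation \<open>x \<mapsto> s F(x) t\<close> covers both the action of functors and the change of an
  idempotent inside its isomorphism class.\<close>

definition transport :: "('a, 'b) endofunctor \<Rightarrow> 'b \<Rightarrow> 'b \<Rightarrow> 'b \<Rightarrow> 'b" where
  "transport F s t x = cmp C s (cmp C (snd F x) t)"

context
  fixes F :: "('a, 'b) endofunctor" and e f s t :: 'b
  assumes F: "F \<in> Aut_cat C" and e: "idem_endo C e" and f: "idem_endo C f" and st: "idem_iso C (snd F e) f s t"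
begin

lemma transport_group: "x \<in> carrier (idem_group C e) \<Longrightarrow> transport F s t x \<in> carrier (idem_group C f)"
  unfolding transport_def
  using conj_idem_group[OF aut_idem_endo[OF F e] f st aut_idem_group[OF F e]] .

lemma transport_cmp:
  assumes "x \<in> carrier (idem_monoid C e)" "y \<in> carrier (idem_monoid C e)"
  shows "transport F s t (cmp C x y) = cmp C (transport F s t x) (transport F s t y)"
proof -
  have "snd F (cmp C x y) = cmp C (snd F x) (snd F y)"
    using assms autD(6)[OF F, of x y] unfolding idem_monoid_carrier[OF e] by simp
  then show ?thesis
    unfolding transport_def
    using conj_cmp[OF aut_idem_endo[OF F e] st aut_idem_monoid[OF F e assms(1)] aut_idem_monoid[OF F e
        assms(2)]] by simp
qed

lemma transport_one: "transport F s t e = f"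
  using idem_isoD[OF st] by (simp add: transport_def)

lemma transport_bij: "bij_betw (transport F s t) (carrier (idem_group C e)) (carrier (idem_group C f))"
proof -
  obtain F' where F': "F' \<in> Aut_cat C" "\<And>s. s \<in> Mor C \<Longrightarrow> snd F' (snd F s) = s" "\<And>s. s \<in> Mor C \<Longrightarrow> snd F (snd F' s) = s"
    using Aut_catE[OF F] by metis
  let ?g = "\<lambda>y. snd F' (cmp C t (cmp C y s))"
  note Fe = aut_idem_endo[OF F e] and ts = idem_iso_sym[OF st]
  have F'Fe: "snd F' (snd F e) = e" using F'(2) idem_endoD[OF e] by blast
  have M: "x \<in> Mor C" if "x \<in> carrier (idem_group C g)" "idem_endo C g" for x g
    using idem_groupD(1)[OF that(2,1)] .
  show ?thesis
  proof (rule bij_betw_byWitness[where f' = ?g])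
    show "\<forall>x \<in> carrier (idem_group C e). ?g (transport F s t x) = x"
    proof
      fix x assume x: "x \<in> carrier (idem_group C e)"
      show "?g (transport F s t x) = x"
        unfolding transport_def
        using conj_idem_monoid(2)[OF Fe f st idem_group_sub[OF Fe aut_idem_group[OF F e x]]] F'(2)[OF M[OF x e]] by simp
    qed
    show "\<forall>y \<in> carrier (idem_group C f). transport F s t (?g y) = y"
    proof
      fix y assume y: "y \<in> carrier (idem_group C f)"
      have "cmp C t (cmp C y s) \<in> Mor C" using conj_idem_group[OF f Fe ts y] M Fe by blast
      then show "transport F s t (?g y) = y"
        unfolding transport_def
        using conj_idem_monoid(2)[OF f Fe ts idem_group_sub[OF f y]] F'(3) by simp
    qed
    show "transport F s t ` carrier (idem_group C e) \<subseteq> carrier (idem_group C f)" using transport_group by blast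
    show "?g ` carrier (idem_group C f) \<subseteq> carrier (idem_group C e)"
      using aut_idem_group[OF F'(1) Fe conj_idem_group[OF f Fe ts]] unfolding F'Fe by blast
  qed
qed

text \<open>Covers all of \<open>E f\<close>, whereas \<open>transport_bij\<close> concerns only the
  units. The vanishing condition of an apex is about non-units, so it needs these preimages.\<close>

lemma transport_monoid_preimage:
  assumes y: "y \<in> carrier (idem_monoid C f)"
  obtains x where "x \<in> carrier (idem_monoid C e)" "cmp C t (cmp C y s) = snd F x" "y = transport F s t x"
proof -
  obtain F' where F': "F' \<in> Aut_cat C" "\<And>s. s \<in> Mor C \<Longrightarrow> snd F' (snd F s) = s" "\<And>s. s \<in> Mor C \<Longrightarrow> snd F (snd F' s) = s"
    using Aut_catE[OF F] by metis
  note Fe = aut_idem_endo[OF F e] and ts = idem_iso_sym[OF st]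
  have F'Fe: "snd F' (snd F e) = e" using F'(2) idem_endoD[OF e] by blast
  have c: "cmp C t (cmp C y s) \<in> carrier (idem_monoid C (snd F e))" by (rule conj_idem_monoid(1)[OF f Fe ts y])
  have cM: "cmp C t (cmp C y s) \<in> Mor C" using c idem_monoid_carrier[OF Fe] by blast
  show ?thesis
  proof (rule that[of "snd F' (cmp C t (cmp C y s))"])
    show "snd F' (cmp C t (cmp C y s)) \<in> carrier (idem_monoid C e)"
      using aut_idem_monoid[OF F'(1) Fe c] F'Fe by simp
    show "cmp C t (cmp C y s) = snd F (snd F' (cmp C t (cmp C y s)))" using F'(3)[OF cM] by simp
    then show "y = transport F s t (snd F' (cmp C t (cmp C y s)))"
      unfolding transport_def using conj_idem_monoid(2)[OF f Fe ts y] by simp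
  qed
qed

lemma transport_cat_iso:
  "cat_iso (group_category (idem_group C e)) (group_category (idem_group C f)) (transport F s t)"
  unfolding cat_iso_def using transport_bij transport_cmp transport_one idem_group_sub[OF e] by auto

end

lemma transport_ring_iso:
  assumes "field_aut \<sigma>" "F \<in> Aut_cat C" "idem_endo C e" "idem_endo C f" "idem_iso C (snd F e) f s t"
  shows "semilin_ext \<sigma> (carrier (idem_group C e)) (transport F s t) \<in>
    ring_iso (group_algebra (idem_group C e)) (group_algebra (idem_group C f))"
  using semilin_ring_iso[OF idem_group_category[OF assms(3)] idem_group_category[OF assms(4)]
      transport_cat_iso[OF assms(2-5)] assms(1)] by (simp add: group_algebra_def)

end

lemma group_Aut_cat:
  assumes G: "group G" and g: "bij_betw g (carrier G) (carrier G)"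
    "\<And>x y. \<lbrakk>x \<in> carrier G; y \<in> carrier G\<rbrakk> \<Longrightarrow> g (x \<otimes>\<^bsub>G\<^esub> y) = g x \<otimes>\<^bsub>G\<^esub> g y" "g \<one>\<^bsub>G\<^esub> = \<one>\<^bsub>G\<^esub>"
  shows "((\<lambda>_. ()), g) \<in> Aut_cat (group_category G)"
proof -
  interpret group G by fact
  let ?h = "inv_into (carrier G) g"
  have gc: "g x \<in> carrier G" if "x \<in> carrier G" for x using g(1) that by (auto simp: bij_betw_def)
  have h: "?h x \<in> carrier G" "g (?h x) = x" if "x \<in> carrier G" for x
    using g(1) that by (auto simp: bij_betw_def inv_into_into f_inv_into_f)
  have hg: "?h (g x) = x" if "x \<in> carrier G" for x using g(1) that by (auto simp: bij_betw_def)
  have h1: "?h \<one>\<^bsub>G\<^esub> = \<one>\<^bsub>G\<^esub>" using hg[OF one_closed] g(3) by simp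
  have hm: "?h (x \<otimes>\<^bsub>G\<^esub> y) = ?h x \<otimes>\<^bsub>G\<^esub> ?h y" if "x \<in> carrier G" "y \<in> carrier G" for x y
    using g(2)[OF h(1)[OF that(1)] h(1)[OF that(2)]] h(2)[OF that(1)] h(2)[OF that(2)]
      hg[OF m_closed[OF h(1)[OF that(1)] h(1)[OF that(2)]]] by simp
  have "is_endofunctor (group_category G) ((\<lambda>_. ()), g)"
    using gc g(2,3) by (auto simp: is_endofunctor_def Hom_def)
  moreover have "is_endofunctor (group_category G) ((\<lambda>_. ()), ?h)"
    using h(1) h1 hm by (auto simp: is_endofunctor_def Hom_def)
  ultimately show ?thesis
    unfolding Aut_cat_def using h hg by (intro CollectI conjI exI[of _ "((\<lambda>_. ()), ?h)"]) auto
qed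

section \<open>Existence and uniqueness of the apex\<close>

context alg_setup begin

text \<open>Write \<open>w = a u\<close>. Then \<open>m w\<close> is \<open>m a\<close> applied to
  \<open>u\<close>, and \<open>m a\<close> is a combination of morphisms \<open>m c\<close>; they
  cannot all annihilate \<open>u\<close>.\<close>

lemma act_nonzero:
  assumes "simple_module R U" "u \<in> carrier U" "u \<noteq> \<zero>\<^bsub>U\<^esub>" "m \<in> Mor C" "w \<in> carrier U" "act U m w \<noteq> \<zero>\<^bsub>U\<^esub>"
  shows "\<exists>c \<in> Mor C. src C m = tgt C c \<and> act U (cmp C m c) u \<noteq> \<zero>\<^bsub>U\<^esub>"
proof (rule ccontr)
  assume n: "\<not> ?thesis"
  interpret U: left_module R U using assms(1) by (rule simple_module_left)
  obtain a where a: "a \<in> carrier R" "w = a \<odot>\<^bsub>U\<^esub> u" using simple_moduleD[OF assms(1-3,5)] by blast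
  have aA: "a \<in> carrier A" using a R_carrier by blast
  note mA = smon_A[OF assms(4)]
  let ?S = "{cmp C m c | c. c \<in> Mor C \<and> src C m = tgt C c}"
  have "(smon 1 m \<otimes>\<^bsub>A\<^esub> a \<otimes>\<^bsub>A\<^esub> b) \<odot>\<^bsub>U\<^esub> u = \<zero>\<^bsub>U\<^esub>"
  proof (rule act_span_zero[OF U.left_module_axioms, of ?S])
    show "?S \<subseteq> Mor C" using assms(4) by auto
    show "act U s u = \<zero>\<^bsub>U\<^esub>" if "s \<in> ?S" for s using n that by blast
    show "(smon 1 m \<otimes>\<^bsub>A\<^esub> a) x = 0" if "x \<notin> ?S" for x
    proof (rule ccontr)
      assume "(smon 1 m \<otimes>\<^bsub>A\<^esub> a) x \<noteq> 0"
      then obtain s c where "c \<in> Mor C" "src C s = tgt C c" "cmp C s c = x" "smon (1::'k) m s \<noteq> 0"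
        using cat_mult_support by blast
      then show False using that by (auto simp: smon_def split: if_splits)
    qed
  qed (fact assms(2))
  moreover have "act U m w = (smon 1 m \<otimes>\<^bsub>A\<^esub> a \<otimes>\<^bsub>A\<^esub> b) \<odot>\<^bsub>U\<^esub> u"
  proof -
    have "(smon 1 m \<otimes>\<^bsub>A\<^esub> a \<otimes>\<^bsub>A\<^esub> b) = (smon 1 m \<otimes>\<^bsub>A\<^esub> b) \<otimes>\<^bsub>R\<^esub> a"
      using mA aA b(1) b(3)[OF aA] by (simp add: A.m_assoc)
    then show ?thesis using U.smult_assoc1[OF b_R[OF mA] a(1) assms(2)] a(2) by (simp add: act_def)
  qed
  ultimately show False using assms(6) by simp
qed

text \<open>\<open>b\<close> is the unit of \<open>R\<close> and a combination of morphisms, so if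
  every morphism acted as zero then \<open>U\<close> would vanish.\<close>

lemma act_nontrivial:
  assumes "simple_module R U" shows "\<exists>s \<in> Mor C. \<exists>u \<in> carrier U. act U s u \<noteq> \<zero>\<^bsub>U\<^esub>"
proof (rule ccontr)
  assume n: "\<not> ?thesis"
  interpret U: left_module R U using assms by (rule simple_module_left)
  obtain u where u: "u \<in> carrier U" "u \<noteq> \<zero>\<^bsub>U\<^esub>" using simple_module_nonzero[OF assms] .
  have "(b \<otimes>\<^bsub>A\<^esub> b) \<odot>\<^bsub>U\<^esub> u = \<zero>\<^bsub>U\<^esub>"
    by (rule act_span_zero[OF U.left_module_axioms, of "Mor C"]) (use n u b(1) in \<open>auto simp: cat_algebra_sel(1)\<close>)
  then show False using u b(2) U.smult_one[OF u(1)] by simp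
qed

text \<open>The principal two-sided ideal of \<open>s\<close>. Equality of these ideals is Green's
  relation J.\<close>

definition two_sided :: "'m \<Rightarrow> 'm set" where
  "two_sided s = {cmp C x (cmp C s y) | x y. x \<in> Mor C \<and> y \<in> Mor C \<and> src C x = tgt C s \<and> src C s = tgt C y}"

lemma two_sided_refl: "s \<in> Mor C \<Longrightarrow> s \<in> two_sided s"
  unfolding two_sided_def
  using ident_simps[OF src_closed[of s]] ident_simps[OF tgt_closed[of s]] ident_left[of s] ident_right[of s]
  by (intro CollectI exI[of _ "ident C (tgt C s)"] exI[of _ "ident C (src C s)"]) simp

lemma two_sided_Mor: "s \<in> Mor C \<Longrightarrow> two_sided s \<subseteq> Mor C"
  unfolding two_sided_def by auto

lemma two_sided_mono:
  assumes s: "s \<in> Mor C" and t: "t \<in> two_sided s" shows "two_sided t \<subseteq> two_sided s"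
proof
  fix r assume "r \<in> two_sided t"
  from t obtain x y where xy: "x \<in> Mor C" "y \<in> Mor C" "src C x = tgt C s" "src C s = tgt C y" "t = cmp C x (cmp C s y)"
    by (auto simp: two_sided_def)
  from \<open>r \<in> two_sided t\<close> obtain u v where uv: "u \<in> Mor C" "v \<in> Mor C" "src C u = tgt C t" "src C t = tgt C v" "r
      = cmp C u (cmp C t v)"
    by (auto simp: two_sided_def)
  have tt: "tgt C t = tgt C x" "src C t = src C y" using s xy by simp_all
  have "cmp C t v = cmp C x (cmp C s (cmp C y v))"
    using s xy uv(2,4) tt unfolding xy(5) by (simp add: assoc)
  then have "r = cmp C (cmp C u x) (cmp C s (cmp C y v))"
    using s xy(1-4) uv tt by (simp add: assoc)
  then show "r \<in> two_sided s" unfolding two_sided_def using s xy(1-4) uv(1-4) tt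
    by (intro CollectI exI[of _ "cmp C u x"] exI[of _ "cmp C y v"]) simp
qed

text \<open>From \<open>e = u x v\<close>, compressing \<open>u\<close> and \<open>v\<close> to
  \<open>E e\<close> gives a product of three elements of \<open>E e\<close> that equals its unit
  \<open>e\<close>; by finiteness each of them is a unit.\<close>

lemma two_sided_idem_unit:
  assumes e: "idem_endo C e" and x: "x \<in> E e" and m: "e \<in> two_sided x" shows "x \<in> G e"
proof -
  note xD = x[unfolded idem_monoid_carrier[OF e]] and eD = idem_endoD[OF e]
  obtain u v where uv: "u \<in> Mor C" "v \<in> Mor C" "src C u = src C e" "src C e = tgt C v" "e = cmp C u (cmp C x v)"
    using m xD by (auto simp: two_sided_def)
  have tu: "tgt C u = src C e" and sv: "src C v = src C e"
    using uv xD eD cmp_Mor[of x v] cmp_Mor(2,3)[of u "cmp C x v"] by metis+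
  let ?u = "cmp C e (cmp C u e)" and ?v = "cmp C e (cmp C v e)"
  have u: "?u \<in> E e" and v: "?v \<in> E e"
    using uv tu sv by (auto simp: idem_monoid_def Hom_def)
  have xv: "cmp C x ?v = cmp C (cmp C x v) e"
    using assoc[of x e "cmp C v e"] assoc[of x v e] uv sv xD eD cmp_Mor[of v e] by metis
  have xvM: "cmp C x v \<in> Mor C" "src C (cmp C x v) = src C e" "tgt C (cmp C x v) = src C e"
    using uv sv xD by simp_all
  have exv: "cmp C e (cmp C x v) = cmp C x v" using assoc[of e x v] uv xD eD by metis
  have "cmp C (cmp C u e) (cmp C (cmp C x v) e) = cmp C (cmp C u (cmp C e (cmp C x v))) e"
    using assoc[of u e "cmp C (cmp C x v) e"] assoc[of e "cmp C x v" e] assoc[of u "cmp C e (cmp C x v)" e] uv tu eD xvM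
      cmp_Mor[of "cmp C x v" e] cmp_Mor[of e "cmp C x v"] by metis
  also have "\<dots> = e" using exv uv(5) eD by simp
  finally have "cmp C (cmp C u e) (cmp C x ?v) = e" using xv by simp
  then have "cmp C ?u (cmp C x ?v) = e"
    using assoc[of e "cmp C u e" "cmp C x ?v"] uv tu eD xv xvM cmp_Mor[of u e] cmp_Mor[of "cmp C x v" e] by metis
  then have "cmp C x ?v \<in> G e" using idem_one_sided(2)[OF e u idem_monoid_cmp[OF e x v]] by blast
  then show ?thesis using idem_group_factors(1)[OF e x v] by blast
qed

text \<open>Among the morphisms not annihilating \<open>U\<close>, one whose principal ideal is
  smallest generates the same ideal as some idempotent \<open>e\<close>. A non-unit of
  \<open>E e\<close> generates a strictly smaller ideal and must therefore annihilate
  \<open>U\<close>.\<close>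

lemma apex_exists:
  assumes sU: "simple_module R U" shows "\<exists>e. idem_endo C e \<and> has_apex e U"
proof -
  interpret U: left_module R U using sU by (rule simple_module_left)
  note lU = U.left_module_axioms
  let ?nz = "\<lambda>s. s \<in> Mor C \<and> (\<exists>u \<in> carrier U. act U s u \<noteq> \<zero>\<^bsub>U\<^esub>)"
  have "\<exists>s. ?nz s" using act_nontrivial[OF sU] by blast
  \<comment> \<open>Smallest cardinality replaces minimality under inclusion: inside
    \<open>two_sided s\<close>, every morphism that does not annihilate \<open>U\<close> generates
    the same ideal.\<close>
  then obtain s where s: "?nz s" and min: "\<And>t. ?nz t \<Longrightarrow> card (two_sided s) \<le> card (two_sided t)"
    using ex_has_least_nat[of ?nz _ "\<lambda>s. card (two_sided s)"] by blast
  have sM: "s \<in> Mor C" using s by blast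
  have minimal: "two_sided t = two_sided s" if "?nz t" "t \<in> two_sided s" for t
    using card_seteq[OF finite_subset[OF two_sided_Mor[OF sM] finite_Mor] two_sided_mono[OF sM that(2)]] min[OF
        that(1)] by blast
  obtain u where u: "u \<in> carrier U" "act U s u \<noteq> \<zero>\<^bsub>U\<^esub>" using s by blast
  \<comment> \<open>Simplicity enters here: the nonzero vector \<open>s u\<close> generates
    \<open>U\<close>, so \<open>s c s\<close> does not annihilate \<open>U\<close> for a suitable
    \<open>c\<close>.\<close>
  obtain c where c: "c \<in> Mor C" "src C s = tgt C c" "act U (cmp C s c) (act U s u) \<noteq> \<zero>\<^bsub>U\<^esub>"
    using act_nonzero[OF sU act_closed[OF lU sM u(1)] u(2) sM u] by blast
  \<comment> \<open>If \<open>c\<close> and \<open>s\<close> were not composable, their product in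
    the algebra and hence its action on \<open>u\<close> would be zero.\<close>
  have cs: "src C c = tgt C s"
  proof (rule ccontr)
    assume "src C c \<noteq> tgt C s"
    then have "smon 1 (cmp C s c) \<otimes>\<^bsub>A\<^esub> smon 1 s = \<zero>\<^bsub>A\<^esub>"
      using sM c by (simp add: smon_mult cat_algebra_sel(3))
    then have "act U (cmp C s c) (act U s u) = (\<zero>\<^bsub>A\<^esub> \<otimes>\<^bsub>A\<^esub> b) \<odot>\<^bsub>U\<^esub> u"
      using act_mult[OF lU smon_A[OF cmp_Mor(1)[OF sM c(1,2)]] smon_A[OF sM] u(1), of 1 1] by (simp add: act_def)
    then show False using c(3) U.smult_zero_left[OF u(1)] b(1) by simp
  qed
  let ?t = "cmp C s (cmp C c s)"
  have scs: "cmp C (cmp C s c) s = ?t" using assoc[OF sM c(1) sM c(2) cs] .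
  have "act U ?t u \<noteq> \<zero>\<^bsub>U\<^esub>"
    using c(3) act_cmp[OF lU, of "cmp C s c" s u] scs sM c(1,2) cs u(1) by simp
  then have nzt: "?nz ?t" using sM c cs u(1) by auto
  have "?t \<in> two_sided s"
  proof -
    have i: "ident C (tgt C s) \<in> Mor C" "src C (ident C (tgt C s)) = tgt C s" "tgt C (ident C (tgt C s)) = tgt C s"
      using ident_simps[OF tgt_closed[OF sM]] by simp_all
    have "?t = cmp C (ident C (tgt C s)) (cmp C s (cmp C c s))"
      using sM c cs by (simp add: ident_left)
    then show ?thesis unfolding two_sided_def using i sM c(1,2) cs
      by (intro CollectI exI[of _ "ident C (tgt C s)"] exI[of _ "cmp C c s"]) simp
  qed
  then have "s \<in> two_sided ?t" using minimal[OF nzt] two_sided_refl[OF sM] by simp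
  then obtain x y where xy: "x \<in> Mor C" "y \<in> Mor C" "src C x = tgt C s" "src C s = tgt C y" "s = cmp C x (cmp C ?t y)"
    using sM c(1,2) cs unfolding two_sided_def by auto
  have tx: "tgt C x = tgt C s" and sy: "src C y = src C s"
    using xy sM c cs cmp_Mor[of ?t y] cmp_Mor[of x "cmp C ?t y"] cmp_Mor[of s "cmp C c s"] cmp_Mor[of c s] by metis+
  define V where "V = tgt C s"
  \<comment> \<open>From \<open>s = x (s c s) y\<close> one gets \<open>s = a s y\<close> with the
    endomorphism \<open>a = x s c\<close>; a power of \<open>a\<close> will be the
    idempotent.\<close>
  define a where "a = cmp C x (cmp C s c)"
  have a: "a \<in> Mor C" "src C a = V" "tgt C a = V" using xy(1,3) sM c cs tx by (simp_all add: a_def V_def)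
  have say: "s = cmp C a (cmp C s y)"
    using xy(5) unfolding a_def using xy(1-4) sM c(1,2) cs tx sy by (simp add: assoc)
  have V: "V \<in> Ob C" using sM by (simp add: V_def tgt_closed)
  define M where "M = idem_monoid C (ident C V)"
  have iV: "idem_endo C (ident C V)" using V by (simp add: idem_endo_def ident_left)
  interpret M: monoid M unfolding M_def by (rule idem_monoid[OF iV])
  have Mm: "monoid.mult M = cmp C" "\<one>\<^bsub>M\<^esub> = ident C V" by (simp_all add: M_def idem_monoid_def)
  have Mc: "z \<in> carrier M \<longleftrightarrow> z \<in> Mor C \<and> src C z = V \<and> tgt C z = V" for z
    unfolding M_def idem_monoid_carrier[OF iV] using V by (auto simp: ident_left ident_right)
  have aM: "a \<in> carrier M" using a Mc by blast
  \<comment> \<open>Iterating \<open>s = a s y\<close> gives \<open>s = a^n s z\<close> with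
    \<open>z\<close> the n-th power of \<open>y\<close>, so an idempotent power of \<open>a\<close>
    fixes \<open>s\<close> from the left.\<close>
  have pow: "\<exists>z \<in> Mor C. src C z = src C s \<and> tgt C z = src C s \<and> s = cmp C (a [^]\<^bsub>M\<^esub> n) (cmp C s z)" for n :: nat
  proof (induction n)
    case 0
    have i: "ident C (src C s) \<in> Mor C" "src C (ident C (src C s)) = src C s" "tgt C (ident C (src C s)) = src C s"
      using ident_simps[OF src_closed[OF sM]] by simp_all
    have "cmp C s (ident C (src C s)) = s" "cmp C (ident C V) s = s" using sM
        by (simp_all add: ident_right ident_left V_def)
    then show ?case using i by (intro bexI[of _ "ident C (src C s)"]) (simp_all add: Mm)
  next
    case (Suc n)
    then obtain z where z: "z \<in> Mor C" "src C z = src C s" "tgt C z = src C s" "s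
        = cmp C (a [^]\<^bsub>M\<^esub> n) (cmp C s z)" by blast
    have an: "a [^]\<^bsub>M\<^esub> n \<in> Mor C" "src C (a [^]\<^bsub>M\<^esub> n) = V" "tgt C (a [^]\<^bsub>M\<^esub> n) = V"
      using M.nat_pow_closed[OF aM, of n] Mc by auto
    have sy': "cmp C s y \<in> Mor C" "tgt C (cmp C s y) = V" "src C (cmp C s y) = src C s"
      using sM xy sy by (simp_all add: V_def)
    have "cmp C s z = cmp C a (cmp C s (cmp C y z))"
      using say assoc[of a "cmp C s y" z] assoc[of s y z] a sy' z(1-3) sM xy sy by metis
    then have "s = cmp C (a [^]\<^bsub>M\<^esub> n) (cmp C a (cmp C s (cmp C y z)))" using z(4) by simp
    also have "\<dots> = cmp C (cmp C (a [^]\<^bsub>M\<^esub> n) a) (cmp C s (cmp C y z))"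
      using assoc[of "a [^]\<^bsub>M\<^esub> n" a "cmp C s (cmp C y z)"] an a sM z(1-3) xy(2,4) sy by (simp add: V_def)
    also have "cmp C (a [^]\<^bsub>M\<^esub> n) a = a [^]\<^bsub>M\<^esub> Suc n" by (simp add: Mm)
    finally show ?case using z(1-3) xy(2,4) sy by (intro bexI[of _ "cmp C y z"]) simp_all
  qed
  have "finite (carrier M)" unfolding M_def by (rule finite_idem_monoid[OF iV])
  then obtain n :: nat where n: "n > 0" "(a [^]\<^bsub>M\<^esub> n) \<otimes>\<^bsub>M\<^esub> (a [^]\<^bsub>M\<^esub> n) = a [^]\<^bsub>M\<^esub> n"
    using finite_monoid_idem_power[OF M.monoid_axioms _ aM] by blast
  define e where "e = a [^]\<^bsub>M\<^esub> n"
  have eM: "e \<in> Mor C" "src C e = V" "tgt C e = V" using M.nat_pow_closed[OF aM, of n] Mc by (auto simp: e_def)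
  have e: "idem_endo C e" using n(2) eM by (simp add: idem_endo_def e_def Mm)
  obtain z where z: "z \<in> Mor C" "src C z = src C s" "tgt C z = src C s" "s = cmp C e (cmp C s z)"
      using pow[of n] e_def by blast
  have "act U e (act U (cmp C s z) u) \<noteq> \<zero>\<^bsub>U\<^esub>"
    using u z act_cmp[OF lU, of e "cmp C s z" u] eM sM by (simp add: V_def)
  then have nze: "?nz e" using eM act_closed[OF lU, of "cmp C s z" u] sM z(1,3) u(1) by auto
  have "e \<in> two_sided s"
  proof -
    \<comment> \<open>A positive exponent guarantees at least one factor \<open>a = x s c\<close>,
      which puts \<open>e\<close> into the ideal of \<open>s\<close>.\<close>
    obtain k where k: "n = Suc k" using n(1) by (cases n) auto
    let ?p = "a [^]\<^bsub>M\<^esub> k"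
    have p: "?p \<in> Mor C" "src C ?p = V" "tgt C ?p = V" using M.nat_pow_closed[OF aM, of k] Mc by auto
    have "e = cmp C ?p a" by (simp add: e_def k Mm)
    also have "\<dots> = cmp C (cmp C ?p x) (cmp C s c)"
      using assoc[of ?p x "cmp C s c"] p xy(1,3) sM c(1,2) tx cmp_Mor[of s c] a_def V_def by metis
    finally show ?thesis unfolding two_sided_def using p xy(1,3) c(1,2) tx
      by (intro CollectI exI[of _ "cmp C ?p x"] exI[of _ c]) (simp add: V_def)
  qed
  then have ets: "two_sided e = two_sided s" by (rule minimal[OF nze])
  \<comment> \<open>A non-unit \<open>w\<close> not annihilating \<open>U\<close> would, by
    minimality, generate the same ideal as \<open>e\<close>, and \<open>two_sided_idem_unit\<close>
    would make it a unit.\<close>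
  have "act U w v = \<zero>\<^bsub>U\<^esub>" if w: "w \<in> E e - G e" and v: "v \<in> carrier U" for w v
  proof (rule ccontr)
    assume nz: "act U w v \<noteq> \<zero>\<^bsub>U\<^esub>"
    have wE: "w \<in> E e" using w by blast
    note wD = wE[unfolded idem_monoid_carrier[OF e]]
    have "w = cmp C e (cmp C e w)" using wD by simp
    then have "w \<in> two_sided e" unfolding two_sided_def using wD eM e
      by (intro CollectI exI[of _ e] exI[of _ w]) simp
    moreover have "?nz w" using wD v nz by blast
    ultimately have "two_sided w = two_sided e" using minimal ets by blast
    then have "e \<in> two_sided w" using two_sided_refl[OF eM(1)] by simp
    then show False using two_sided_idem_unit[OF e wE] w by blast
  qed
  then have "has_apex e U" unfolding has_apex_def using sU nze by blast
  then show ?thesis using e by blast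
qed

text \<open>Choose \<open>s = f c e\<close> and \<open>t = e d f\<close> such that
  \<open>t s\<close> does not annihilate \<open>U\<close>. The apex condition at \<open>e\<close>
  makes \<open>t s\<close> a unit; after normalising \<open>t\<close>, the element
  \<open>s t\<close> is an idempotent of \<open>E f\<close> not annihilating \<open>U\<close>, hence
  by the condition at \<open>f\<close> a unit, and therefore \<open>f\<close>.\<close>

lemma apex_unique:
  assumes e: "idem_endo C e" and f: "idem_endo C f" and ae: "has_apex e U" and af: "has_apex f U"
  shows "\<exists>s t. idem_iso C e f s t"
proof -
  have sU: "simple_module R U" using ae by (simp add: has_apex_def)
  note lU = simple_module_left[OF sU]
  note eD = idem_endoD[OF e] and fD = idem_endoD[OF f]
  obtain u where u: "u \<in> carrier U" "act U e u \<noteq> \<zero>\<^bsub>U\<^esub>" using ae by (auto simp: has_apex_def)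
  obtain w where w: "w \<in> carrier U" "act U f w \<noteq> \<zero>\<^bsub>U\<^esub>" using af by (auto simp: has_apex_def)
  have eu: "act U e u \<in> carrier U" using act_closed[OF lU _ u(1)] eD by blast
  have zero: "act U p (act U q v) = \<zero>\<^bsub>U\<^esub>" if "p \<in> Mor C" "q \<in> Mor C" "src C p \<noteq> tgt C q" "v \<in> carrier U" for p q v
  proof -
    interpret U: left_module R U by (rule lU)
    have "smon 1 p \<otimes>\<^bsub>A\<^esub> smon 1 q = \<zero>\<^bsub>A\<^esub>" using that by (simp add: smon_mult cat_algebra_sel(3))
    then have "act U p (act U q v) = (\<zero>\<^bsub>A\<^esub> \<otimes>\<^bsub>A\<^esub> b) \<odot>\<^bsub>U\<^esub> v"
      using act_mult[OF lU smon_A[OF that(1)] smon_A[OF that(2)] that(4), of 1 1] by (simp add: act_def)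
    then show ?thesis using U.smult_zero_left[OF that(4)] b(1) by simp
  qed
  obtain c where c: "c \<in> Mor C" "src C f = tgt C c" "act U (cmp C f c) (act U e u) \<noteq> \<zero>\<^bsub>U\<^esub>"
    using act_nonzero[OF sU eu u(2) conjunct1[OF fD] w] by blast
  have ce: "src C c = src C e" using zero[of "cmp C f c" e u] c fD eD u(1) by auto
  define s where "s = cmp C (cmp C f c) e"
  have s: "s \<in> Mor C" "src C s = src C e" "tgt C s = src C f" using c(1,2) ce eD fD by (simp_all add: s_def)
  have fcM: "cmp C f c \<in> Mor C" "src C (cmp C f c) = src C e" "tgt C (cmp C f c) = src C f"
    using c(1,2) ce fD by simp_all
  have se: "cmp C s e = s" unfolding s_def using idem_absorb(2)[OF e fcM(1,2)] .
  have "cmp C f (cmp C f c) = cmp C f c" using idem_absorb(1)[OF f c(1)] c(2) by simp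
  then have fs: "cmp C f s = s" unfolding s_def using assoc[of f "cmp C f c" e] fcM fD eD by metis
  have su: "act U s u \<noteq> \<zero>\<^bsub>U\<^esub>" using c(3) act_cmp[OF lU fcM(1) _ _ u(1), of e] fcM(2) eD by (simp add: s_def)
  obtain d where d: "d \<in> Mor C" "src C e = tgt C d" "act U (cmp C e d) (act U s u) \<noteq> \<zero>\<^bsub>U\<^esub>"
    using act_nonzero[OF sU act_closed[OF lU s(1) u(1)] su conjunct1[OF eD] u] by blast
  have df: "src C d = src C f" using zero[of "cmp C e d" s u] d s eD u(1) by auto
  define t where "t = cmp C (cmp C e d) f"
  have edM: "cmp C e d \<in> Mor C" "src C (cmp C e d) = src C f" "tgt C (cmp C e d) = src C e"
    using d(1,2) df eD by simp_all
  have t: "t \<in> Mor C" "src C t = src C f" "tgt C t = src C e" using edM fD by (simp_all add: t_def)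
  have tf: "cmp C t f = t" unfolding t_def using idem_absorb(2)[OF f edM(1,2)] .
  have "cmp C e (cmp C e d) = cmp C e d" using idem_absorb(1)[OF e d(1)] d(2) by simp
  then have et: "cmp C e t = t" unfolding t_def using assoc[of e "cmp C e d" f] edM fD eD by metis
  have "cmp C t s = cmp C (cmp C e d) s" unfolding t_def using assoc[of "cmp C e d" f s] edM fD s fs by metis
  then have tsu: "act U (cmp C t s) u \<noteq> \<zero>\<^bsub>U\<^esub>" using d(3) act_cmp[OF lU edM(1) s(1) _ u(1)] edM(2) s(3) by simp
  have tsE: "cmp C t s \<in> E e"
    unfolding idem_monoid_carrier[OF e] using assoc[of e t s] assoc[of t s e] s t se et eD by (metis cmp_Mor)
  then have "cmp C t s \<in> G e" using ae tsu u(1) unfolding has_apex_def by blast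
  then obtain g where g: "g \<in> G e" "cmp C g (cmp C t s) = e" using idem_group_inverse[OF e] by metis
  note gD = idem_groupD[OF e g(1)]
  \<comment> \<open>Multiplying by the inverse \<open>g\<close> of \<open>t s\<close> makes
    \<open>s\<close> and \<open>t'\<close> exact inverses on the side of \<open>e\<close>.\<close>
  define t' where "t' = cmp C g t"
  have t': "t' \<in> Mor C" "src C t' = src C f" "tgt C t' = src C e" using gD t by (simp_all add: t'_def)
  have t'f: "cmp C t' f = t'" unfolding t'_def using assoc[of g t f] gD t tf fD by metis
  have et': "cmp C e t' = t'" unfolding t'_def using assoc[of e g t] gD t eD by metis
  have t's: "cmp C t' s = e" unfolding t'_def using assoc[of g t s] gD t s g(2) by metis
  have stE: "cmp C s t' \<in> E f"
    unfolding idem_monoid_carrier[OF f] using assoc[of f s t'] assoc[of s t' f] s t' fs t'f fD by (metis cmp_Mor)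
  have idem: "cmp C (cmp C s t') (cmp C s t') = cmp C s t'"
    using assoc[of s t' "cmp C s t'"] cmp_collapse[OF t's, of t'] s t' et' cmp_Mor[of s t'] by metis
  have sts: "cmp C (cmp C s t') s = s" using assoc[of s t' s] s t' t's se by metis
  have "act U (cmp C s t') (act U s u) \<noteq> \<zero>\<^bsub>U\<^esub>"
    using su act_cmp[OF lU, of "cmp C s t'" s u] sts s t' u(1) by simp
  then have "cmp C s t' \<in> G f" using af stE act_closed[OF lU s(1) u(1)] unfolding has_apex_def by blast
  then obtain h where h: "h \<in> G f" "cmp C h (cmp C s t') = f" using idem_group_inverse[OF f] by metis
  note hD = idem_groupD[OF f h(1)]
  have stM: "cmp C s t' \<in> Mor C" "src C (cmp C s t') = src C f" "tgt C (cmp C s t') = src C f" using s t' by simp_all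
  \<comment> \<open>An idempotent that is a unit equals the unit element: cancel it with its inverse
    \<open>h\<close>.\<close>
  have "cmp C s t' = cmp C (cmp C h (cmp C s t')) (cmp C s t')"
    using h(2) stE unfolding idem_monoid_carrier[OF f] by simp
  also have "\<dots> = cmp C h (cmp C (cmp C s t') (cmp C s t'))"
    using assoc[of h "cmp C s t'" "cmp C s t'"] hD stM by metis
  also have "\<dots> = f" using idem h(2) by simp
  finally have "cmp C s t' = f" .
  then show ?thesis unfolding idem_iso_def using s t' se fs t'f et' t's by blast
qed

end


section \<open>Isomorphism classes of simple modules\<close>

definition cls :: "('m \<Rightarrow> 'k::field) ring \<Rightarrow> ('m, 'k) kmodule \<Rightarrow> ('m, 'k) kmodule set" where
  "cls A U = {N. simple_module A N \<and> semi_iso A id U N}"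

lemma cls_eq: "simple_module A U \<Longrightarrow> simple_iso_rel A `` {U} = cls A U"
  by (auto simp: simple_iso_rel_def cls_def module_iso_iff)

lemma simple_classes_iff: "c \<in> simple_classes A \<longleftrightarrow> (\<exists>U. simple_module A U \<and> c = cls A U)"
  unfolding simple_classes_def quotient_def using cls_eq by fastforce

lemma cls_self: "simple_module A U \<Longrightarrow> U \<in> cls A U"
  by (simp add: cls_def semi_iso_refl)

lemma semi_iso_id_trans: "\<lbrakk>semi_iso A id M N; semi_iso A \<phi> N L\<rbrakk> \<Longrightarrow> semi_iso A \<phi> M L"
  by (rule semi_iso_comp[where \<phi> = id and \<psi> = \<phi> and B = A]) auto

lemma semi_iso_trans_id: "\<lbrakk>semi_iso A \<phi> M N; semi_iso A id N L; \<phi> \<in> carrier A \<rightarrow> carrier A\<rbrakk> \<Longrightarrow> semi_iso A \<phi> M L"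
  by (rule semi_iso_comp[where \<phi> = \<phi> and \<psi> = id and B = A]) auto

lemma semi_iso_id_sym: "\<lbrakk>semi_iso A id M N; left_module A M\<rbrakk> \<Longrightarrow> semi_iso A id N M"
  by (rule semi_iso_inv[where \<phi> = id]) auto

lemma cls_eq_iff:
  assumes "simple_module A U" "simple_module A V"
  shows "cls A U = cls A V \<longleftrightarrow> semi_iso A id U V"
proof
  assume "cls A U = cls A V"
  then show "semi_iso A id U V" using cls_self[OF assms(2)] unfolding cls_def by blast
next
  assume *: "semi_iso A id U V"
  note lU = simple_module_left[OF assms(1)]
  show "cls A U = cls A V"
    unfolding cls_def using semi_iso_id_trans[OF *] semi_iso_id_trans[OF semi_iso_id_sym[OF * lU]] by blast
qed

lemma cls_mem: "N \<in> cls A U \<longleftrightarrow> simple_module A N \<and> semi_iso A id U N"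
  by (simp add: cls_def)

lemma simple_twist:
  assumes "\<phi> \<in> ring_iso A B" "simple_module A U" "ring B"
  shows "simple_module B (twist A \<phi> U)"
  by (rule simple_semi_iso[OF assms(2) semi_iso_twist twist_left_module])
    (use assms ring_isoD[OF assms(1)] simple_module_left in auto)

text \<open>Any \<open>V\<close> that is a semilinear image of \<open>U\<close> represents the class
  of the twist, because two semilinear images of \<open>U\<close> along the same
  \<open>\<phi>\<close> are isomorphic. Explicit twists can be avoided from here on.\<close>

lemma twist_class:
  assumes A: "ring A" and \<phi>: "\<phi> \<in> ring_iso A A" and U: "simple_module A U" and V: "simple_module A V"
    and iso: "semi_iso A \<phi> U V"
  shows "simple_iso_rel A `` (twist A \<phi> ` cls A U) = cls A V"
proof -
  note \<phi>D = ring_isoD[OF \<phi>]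
  have tw: "semi_iso A \<phi> M (twist A \<phi> M)" for M :: "('a, 'b) kmodule" by (rule semi_iso_twist[OF \<phi>D(6)])
  have sW: "simple_module A (twist A \<phi> M)" if "simple_module A M" for M :: "('a, 'b) kmodule"
    by (rule simple_twist[OF \<phi> that A])
  have transfer: "semi_iso A id N L" if "semi_iso A \<phi> M N" "semi_iso A \<phi> M L" "left_module A M" for M N L ::
      "('a, 'b) kmodule"
    by (rule semi_iso_comp[OF semi_iso_inv[OF that(1,3), of A "inv_into (carrier A) \<phi>"] that(2)]) (use \<phi>D in auto)
  show ?thesis
  proof (intro equalityI subsetI)
    fix N assume "N \<in> simple_iso_rel A `` (twist A \<phi> ` cls A U)"
    then obtain M :: "('a, 'b) kmodule" where M: "simple_module A M" "semi_iso A id U M" and N: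
        "simple_module A N" "semi_iso A id (twist A \<phi> M) N"
      by (auto simp: simple_iso_rel_def cls_def module_iso_iff)
    have "semi_iso A \<phi> U N"
      using semi_iso_id_trans[OF M(2) semi_iso_trans_id[OF tw N(2)]] \<phi>D(1) by auto
    then show "N \<in> cls A V" using transfer[OF iso _ simple_module_left[OF U]] N(1) by (simp add: cls_def)
  next
    fix N assume "N \<in> cls A V"
    then have N: "simple_module A N" "semi_iso A id V N" by (auto simp: cls_def)
    have "semi_iso A \<phi> U N" using semi_iso_trans_id[OF iso N(2)] \<phi>D(1) by auto
    then have "semi_iso A id (twist A \<phi> U) N" using transfer[OF tw _ simple_module_left[OF U]] by blast
    then have "(twist A \<phi> U, N) \<in> simple_iso_rel A" using N(1) sW[OF U] by (simp add: simple_iso_rel_def module_iso_iff)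
    then show "N \<in> simple_iso_rel A `` (twist A \<phi> ` cls A U)" using cls_self[OF U] by blast
  qed
qed

lemma id_ring_iso: "id \<in> ring_iso A A"
  by (auto simp: ring_iso_def ring_hom_def)

section \<open>Field automorphisms and functors acting on simple modules with given apex\<close>

context alg_setup begin

definition kaut :: "('k \<Rightarrow> 'k) \<Rightarrow> ('o, 'm) endofunctor \<Rightarrow> bool" where
  "kaut \<sigma> F \<longleftrightarrow> field_aut \<sigma> \<and> F \<in> Aut_cat C \<and> semilin_ext \<sigma> (Mor C) (snd F) b = b"

abbreviation \<Phi> :: "('k \<Rightarrow> 'k) \<Rightarrow> ('o, 'm) endofunctor \<Rightarrow> ('m \<Rightarrow> 'k) \<Rightarrow> 'm \<Rightarrow> 'k" where
  "\<Phi> \<sigma> F \<equiv> semilin_ext \<sigma> (Mor C) (snd F)"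

abbreviation \<Psi> :: "('k \<Rightarrow> 'k) \<Rightarrow> ('o, 'm) endofunctor \<Rightarrow> 'm \<Rightarrow> 'm \<Rightarrow> 'm \<Rightarrow> ('m \<Rightarrow> 'k) \<Rightarrow> 'm \<Rightarrow> 'k" where
  "\<Psi> \<sigma> F e s t \<equiv> semilin_ext \<sigma> (G e) (transport F s t)"

lemma kautD: "kaut \<sigma> F \<Longrightarrow> field_aut \<sigma>" "kaut \<sigma> F \<Longrightarrow> F \<in> Aut_cat C" "kaut \<sigma> F \<Longrightarrow> \<Phi> \<sigma> F b = b"
  by (auto simp: kaut_def)

lemma Phi_iso_A: "kaut \<sigma> F \<Longrightarrow> \<Phi> \<sigma> F \<in> ring_iso A A"
  by (rule semilin_ring_iso[OF finite_category_axioms finite_category_axioms Aut_cat_iso]) (auto simp: kaut_def)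

lemma Phi_iso_R: "kaut \<sigma> F \<Longrightarrow> \<Phi> \<sigma> F \<in> ring_iso R R"
  using block_ring_iso[OF A.ring_axioms b_central A.ring_axioms b_central Phi_iso_A] kautD(3) by blast

lemma Phi_smon: "\<lbrakk>kaut \<sigma> F; s \<in> Mor C\<rbrakk> \<Longrightarrow> \<Phi> \<sigma> F (smon c s) = smon (\<sigma> c) (snd F s)"
  using semilin_smon Aut_cat_bij[of F] kautD by (metis bij_betw_imp_inj_on)

lemma Phi_smon_b:
  assumes "kaut \<sigma> F" "s \<in> Mor C" shows "\<Phi> \<sigma> F (smon 1 s \<otimes>\<^bsub>A\<^esub> b) = smon 1 (snd F s) \<otimes>\<^bsub>A\<^esub> b"
  using ring_isoD(2)[OF Phi_iso_A[OF assms(1)] smon_A[OF assms(2)] b(1)] Phi_smon[OF assms] kautD(1,3)[OF assms(1)]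
    field_aut_simps(4) by metis

lemma kaut_id: "kaut id (id, id)"
proof -
  have "(id, id) \<in> Aut_cat C"
    unfolding Aut_cat_def using is_endofunctor_def
    by (intro CollectI conjI exI[of _ "(id, id)"]) (auto simp: is_endofunctor_def)
  moreover have "semilin_ext id (Mor C) id b = b" using b(1) by (intro semilin_id) (simp add: cat_algebra_sel)
  ultimately show ?thesis by (simp add: kaut_def field_aut_id)
qed

lemma Phi_id: "a \<in> carrier R \<Longrightarrow> \<Phi> id (id, id) a = a"
  using R_carrier by (simp add: cat_algebra_sel semilin_id)

lemma kaut_comp:
  assumes "kaut \<sigma> F" "kaut \<tau> H" shows "kaut (\<sigma> \<circ> \<tau>) (fst F \<circ> fst H, snd F \<circ> snd H)"
proof -
  have "\<Phi> (\<sigma> \<circ> \<tau>) (fst F \<circ> fst H, snd F \<circ> snd H) b = \<Phi> \<sigma> F (\<Phi> \<tau> H b)"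
    using semilin_comp[of "snd H" "Mor C" "Mor C" "snd F" \<sigma> \<tau> b] Aut_cat_bij[OF kautD(2)[OF assms(1)]]
      Aut_cat_bij[OF kautD(2)[OF assms(2)]] kautD(1) assms by (simp add: bij_betw_imp_inj_on)
  then show ?thesis
    using assms field_aut_comp[of \<sigma> \<tau>] Aut_cat_comp[of F H] unfolding kaut_def by simp
qed

lemma Phi_comp:
  assumes "kaut \<sigma> F" "kaut \<tau> H" shows "\<Phi> (\<sigma> \<circ> \<tau>) (fst F \<circ> fst H, snd F \<circ> snd H) a = \<Phi> \<sigma> F (\<Phi> \<tau> H a)"
  using semilin_comp[of "snd H" "Mor C" "Mor C" "snd F" \<sigma> \<tau> a] Aut_cat_bij[OF kautD(2)[OF assms(1)]]
      Aut_cat_bij[OF kautD(2)[OF assms(2)]] kautD(1) assms by (simp add: bij_betw_imp_inj_on)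

text \<open>Along \<open>h\<close> the action of \<open>x\<close> on \<open>U\<close> becomes that
  of \<open>F(x)\<close> on \<open>V\<close>. A non-unit \<open>y\<close> of \<open>E f\<close> has
  the form \<open>s F(x) t\<close> with \<open>x\<close> a non-unit of \<open>E e\<close>, so it
  acts through the zero map of \<open>x\<close>; and \<open>s\<close> moves a vector detected by
  \<open>F(e)\<close> to one detected by \<open>f\<close>.\<close>

lemma apex_transport:
  assumes k: "kaut \<sigma> F" and e: "idem_endo C e" and f: "idem_endo C f" and st: "idem_iso C (snd F e) f s t"
    and ap: "has_apex e U" and V: "simple_module R V" and iso: "semi_iso R (\<Phi> \<sigma> F) U V"
  shows "has_apex f V"
proof -
  have sU: "simple_module R U" using ap by (simp add: has_apex_def)
  note lU = simple_module_left[OF sU] and lV = simple_module_left[OF V]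
  interpret U: left_module R U by (rule lU)
  interpret V: left_module R V by (rule lV)
  note F = kautD(2)[OF k] and D = idem_isoD[OF st]
  from iso obtain h where h: "bij_betw h (carrier U) (carrier V)"
     "\<And>x y. \<lbrakk>x \<in> carrier U; y \<in> carrier U\<rbrakk> \<Longrightarrow> h (x \<oplus>\<^bsub>U\<^esub> y) = h x \<oplus>\<^bsub>V\<^esub> h y"
     "\<And>a x. \<lbrakk>a \<in> carrier R; x \<in> carrier U\<rbrakk> \<Longrightarrow> h (a \<odot>\<^bsub>U\<^esub> x) = \<Phi> \<sigma> F a \<odot>\<^bsub>V\<^esub> h x"
    unfolding semi_iso_def by blast
  have hV: "h u \<in> carrier V" if "u \<in> carrier U" for u using h(1) that by (auto simp: bij_betw_def)
  have h0: "h \<zero>\<^bsub>U\<^esub> = \<zero>\<^bsub>V\<^esub>"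
    by (rule additive_map_zero[OF U.M.abelian_group_axioms V.M.abelian_group_axioms]) (use hV h(2) in auto)
  have hact: "h (act U m u) = act V (snd F m) (h u)" if "m \<in> Mor C" "u \<in> carrier U" for m u
    unfolding act_def using h(3)[OF b_R[OF smon_A[OF that(1)]] that(2)] Phi_smon_b[OF k that(1)] by simp
  note eD = idem_endoD[OF e] and fD = idem_endoD[OF f]
  obtain u where u: "u \<in> carrier U" "act U e u \<noteq> \<zero>\<^bsub>U\<^esub>" using ap by (auto simp: has_apex_def)
  have "act V (snd F e) (h u) \<noteq> \<zero>\<^bsub>V\<^esub>"
    using u hact[of e u] h0 h(1) act_closed[OF lU, of e u] eD U.M.zero_closed
    by (metis bij_betw_imp_inj_on inj_onD)
  then have "act V t (act V s (h u)) \<noteq> \<zero>\<^bsub>V\<^esub>" using act_cmp[OF lV, of t s "h u"] D hV[OF u(1)] by simp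
  moreover have "act V s (h u) \<in> carrier V" using act_closed[OF lV D(1) hV[OF u(1)]] .
  moreover have "act V f (act V s (h u)) = act V s (h u)"
    using act_cmp[OF lV, of f s "h u"] D fD hV[OF u(1)] by simp
  ultimately have 1: "\<exists>v \<in> carrier V. act V f v \<noteq> \<zero>\<^bsub>V\<^esub>" using act_zero[OF lV D(6)] by metis
  have "act V y v = \<zero>\<^bsub>V\<^esub>" if y: "y \<in> E f - G f" and v: "v \<in> carrier V" for y v
  proof -
    obtain x where x: "x \<in> E e" "cmp C t (cmp C y s) = snd F x" "y = transport F s t x"
      using transport_monoid_preimage[OF F e f st, of y] y by blast
    have xn: "x \<in> E e - G e" using x y transport_group[OF F e f st, of x] by blast
    have xM: "x \<in> Mor C" using x(1) idem_monoid_carrier[OF e] by blast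
    obtain u where u: "u \<in> carrier U" "act V t v = h u"
      using act_closed[OF lV D(6) v] h(1) by (auto simp: bij_betw_def)
    have Fx: "snd F x \<in> Mor C" "src C (snd F x) = src C (snd F e)" "tgt C (snd F x) = src C (snd F e)"
      using idem_monoid_carrier[OF aut_idem_endo[OF F e]] aut_idem_monoid[OF F e x(1)] by auto
    have "act V y v = act V s (act V (snd F x) (act V t v))"
      using x(3) act_cmp[OF lV D(1) _ _ v, of "cmp C (snd F x) t"] act_cmp[OF lV Fx(1) D(6) _ v] Fx D
      by (simp add: transport_def)
    also have "\<dots> = act V s (h (act U x u))" using u hact[OF xM u(1)] by simp
    also have "act U x u = \<zero>\<^bsub>U\<^esub>" using ap xn u(1) unfolding has_apex_def by blast
    finally show ?thesis using h0 act_zero[OF lV D(1)] by simp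
  qed
  then show ?thesis unfolding has_apex_def using 1 V by blast
qed

text \<open>Both sides are additive and agree on monomials. The product form is what fits the corner
  calculus of \<open>cut_semi_iso\<close>.\<close>

lemma transport_semilin:
  assumes k: "kaut \<sigma> F" and e: "idem_endo C e" and f: "idem_endo C f" and st: "idem_iso C (snd F e) f s t"
    and q: "q \<in> carrier (kG e)"
  shows "\<Psi> \<sigma> F e s t q = smon 1 s \<otimes>\<^bsub>A\<^esub> (\<Phi> \<sigma> F q \<otimes>\<^bsub>A\<^esub> smon 1 t)"
proof -
  note \<Phi> = ring_isoD[OF Phi_iso_A[OF k]] and D = idem_isoD[OF st] and \<sigma> = kautD(1)[OF k] and F = kautD(2)[OF k]
  have inj: "inj_on (transport F s t) (G e)" using transport_bij[OF F e f st] by (simp add: bij_betw_def)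
  note sA = smon_A[OF D(1), of 1] and tA = smon_A[OF D(6), of 1]
  have G0: "g \<in> carrier A" if "\<And>m. m \<notin> G e \<Longrightarrow> g m = 0" for g :: "'m \<Rightarrow> 'k"
    using that kG_A[OF e] kG_carrier by blast
  have q0: "\<And>m. m \<notin> G e \<Longrightarrow> q m = 0" using q kG_carrier by blast
  show ?thesis
  proof (rule supported_induct[OF finite_idem_group[OF e] q0,
        where P = "\<lambda>q. \<Psi> \<sigma> F e s t q = smon 1 s \<otimes>\<^bsub>A\<^esub> (\<Phi> \<sigma> F q \<otimes>\<^bsub>A\<^esub> smon 1 t)"])
    have "smon 1 s \<otimes>\<^bsub>A\<^esub> (\<zero>\<^bsub>A\<^esub> \<otimes>\<^bsub>A\<^esub> smon 1 t) = \<zero>\<^bsub>A\<^esub>" using sA tA by simp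
    then show "\<Psi> \<sigma> F e s t (\<lambda>_. 0) = smon 1 s \<otimes>\<^bsub>A\<^esub> (\<Phi> \<sigma> F (\<lambda>_. 0) \<otimes>\<^bsub>A\<^esub> smon 1 t)"
      unfolding semilin_zero[OF \<sigma>] cat_algebra_sel(3) by simp
  next
    fix c x assume x: "x \<in> G e"
    have Fx: "snd F x \<in> Mor C" "src C (snd F x) = src C (snd F e)" "tgt C (snd F x) = src C (snd F e)"
      using idem_groupD[OF aut_idem_endo[OF F e] aut_idem_group[OF F e x]] by auto
    have "smon 1 s \<otimes>\<^bsub>A\<^esub> (\<Phi> \<sigma> F (smon c x) \<otimes>\<^bsub>A\<^esub> smon 1 t) = smon (\<sigma> c) (transport F s t x)"
      using Phi_smon[OF k idem_groupD(1)[OF e x]] Fx D by (simp add: smon_comp transport_def)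
    then show "\<Psi> \<sigma> F e s t (smon c x) = smon 1 s \<otimes>\<^bsub>A\<^esub> (\<Phi> \<sigma> F (smon c x) \<otimes>\<^bsub>A\<^esub> smon 1 t)"
      using semilin_smon[OF inj x \<sigma>] by simp
  next
    fix g h :: "'m \<Rightarrow> 'k" assume g: "\<And>m. m \<notin> G e \<Longrightarrow> g m = 0" and h: "\<And>m. m \<notin> G e \<Longrightarrow> h m = 0"
      and IH: "\<Psi> \<sigma> F e s t g = smon 1 s \<otimes>\<^bsub>A\<^esub> (\<Phi> \<sigma> F g \<otimes>\<^bsub>A\<^esub> smon 1 t)"
        "\<Psi> \<sigma> F e s t h = smon 1 s \<otimes>\<^bsub>A\<^esub> (\<Phi> \<sigma> F h \<otimes>\<^bsub>A\<^esub> smon 1 t)"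
    note gA = \<Phi>(1)[OF G0[OF g]] and hA = \<Phi>(1)[OF G0[OF h]]
    have "smon 1 s \<otimes>\<^bsub>A\<^esub> (\<Phi> \<sigma> F (g \<oplus>\<^bsub>A\<^esub> h) \<otimes>\<^bsub>A\<^esub> smon 1 t) =
        smon 1 s \<otimes>\<^bsub>A\<^esub> (\<Phi> \<sigma> F g \<otimes>\<^bsub>A\<^esub> smon 1 t) \<oplus>\<^bsub>A\<^esub> smon 1 s \<otimes>\<^bsub>A\<^esub> (\<Phi> \<sigma> F h \<otimes>\<^bsub>A\<^esub> smon 1 t)"
      using gA hA sA tA \<Phi>(3)[OF G0[OF g] G0[OF h]] by (simp add: A.l_distr A.r_distr)
    then show "\<Psi> \<sigma> F e s t (\<lambda>m. g m + h m) = smon 1 s \<otimes>\<^bsub>A\<^esub> (\<Phi> \<sigma> F (\<lambda>m. g m + h m) \<otimes>\<^bsub>A\<^esub> smon 1 t)"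
      unfolding semilin_add[OF \<sigma>, of "G e"] IH cat_algebra_sel(4) by simp
  qed
qed

text \<open>\<open>b\<close> is central and fixed by \<open>(\<sigma>, F)\<close>, so
  \<open>s F(e) b t = s t b\<close>, which is \<open>f b\<close>.\<close>

lemma transport_eb:
  assumes k: "kaut \<sigma> F" and e: "idem_endo C e" and f: "idem_endo C f" and st: "idem_iso C (snd F e) f s t"
  shows "\<Psi> \<sigma> F e s t (eb e) = eb f"
proof -
  note D = idem_isoD[OF st] and Fe = aut_idem_endo[OF kautD(2)[OF k] e]
  note sA = smon_A[OF D(1), of 1] and tA = smon_A[OF D(6), of 1]
  have "\<Psi> \<sigma> F e s t (eb e) = smon 1 s \<otimes>\<^bsub>A\<^esub> (smon 1 (snd F e) \<otimes>\<^bsub>A\<^esub> b \<otimes>\<^bsub>A\<^esub> smon 1 t)"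
    using transport_semilin[OF assms eb_kG[OF e]] Phi_smon_b[OF k, of e] idem_endoD[OF e] by simp
  also have "\<dots> = (smon 1 s \<otimes>\<^bsub>A\<^esub> smon 1 (snd F e)) \<otimes>\<^bsub>A\<^esub> (smon 1 t \<otimes>\<^bsub>A\<^esub> b)"
    using sA tA e_A[OF Fe] b(1) b(3)[OF tA] by (simp add: A.m_assoc)
  also have "smon 1 s \<otimes>\<^bsub>A\<^esub> smon 1 (snd F e) = (smon 1 s :: 'm \<Rightarrow> 'k)"
    using D idem_endoD[OF Fe] by (simp add: smon_comp)
  also have "smon 1 s \<otimes>\<^bsub>A\<^esub> (smon 1 t \<otimes>\<^bsub>A\<^esub> b) = (smon 1 s \<otimes>\<^bsub>A\<^esub> smon 1 t) \<otimes>\<^bsub>A\<^esub> b"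
    using sA tA b(1) by (simp add: A.m_assoc)
  also have "smon 1 s \<otimes>\<^bsub>A\<^esub> smon 1 t = (smon 1 f :: 'm \<Rightarrow> 'k)" using D by (simp add: smon_comp)
  finally show ?thesis .
qed

lemma transport_Q_iso:
  assumes k: "kaut \<sigma> F" and e: "idem_endo C e" and f: "idem_endo C f" and st: "idem_iso C (snd F e) f s t"
  shows "\<Psi> \<sigma> F e s t \<in> ring_iso (Q e) (Q f)"
  using block_ring_iso[OF kG_ring[OF e] eb_central[OF e] kG_ring[OF f] eb_central[OF f]
        transport_ring_iso[OF kautD(1,2)[OF k] e f st, unfolded group_algebra_def]] transport_eb[OF assms] by blast

text \<open>An instance of \<open>cut_semi_iso\<close> inside \<open>R = A b\<close>, where the
  witnesses have to be replaced by their components \<open>s b\<close> and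
  \<open>t b\<close>.\<close>

lemma cut_transport:
  assumes k: "kaut \<sigma> F" and e: "idem_endo C e" and st: "idem_iso C (snd F e) e s t"
    and U: "left_module R U" and V: "left_module R V" and iso: "semi_iso R (\<Phi> \<sigma> F) U V"
  shows "semi_iso (Q e) (\<Psi> \<sigma> F e s t) (cut_module (eb e) U) (cut_module (eb e) V)"
proof -
  interpret K: corner R "Q e" "eb e" "\<pi> e" by (rule corner[OF e])
  note D = idem_isoD[OF st] and F = kautD(2)[OF k] and eD = idem_endoD[OF e]
  note Fe = aut_idem_endo[OF F e]
  note sA = smon_A[OF D(1), of 1] and tA = smon_A[OF D(6), of 1]
  let ?s = "smon 1 s \<otimes>\<^bsub>A\<^esub> b" and ?t = "smon 1 t \<otimes>\<^bsub>A\<^esub> b"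
  have bmult: "(x \<otimes>\<^bsub>A\<^esub> b) \<otimes>\<^bsub>A\<^esub> (y \<otimes>\<^bsub>A\<^esub> b) = (x \<otimes>\<^bsub>A\<^esub> y) \<otimes>\<^bsub>A\<^esub> b" if "x \<in> carrier A" "y \<in> carrier A" for x y
    using that b(1,2) b(3)[OF that(2)] b_left[OF that(2) b(1)] by (simp add: A.m_assoc)
  have mm: "(smon 1 x \<otimes>\<^bsub>A\<^esub> b) \<otimes>\<^bsub>A\<^esub> (smon 1 y \<otimes>\<^bsub>A\<^esub> b) = smon 1 (cmp C x y) \<otimes>\<^bsub>A\<^esub> b"
    if "x \<in> Mor C" "y \<in> Mor C" "src C x = tgt C y" for x y
    using bmult[OF smon_A[OF that(1)] smon_A[OF that(2)], of 1 1] that by (simp add: smon_comp)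
  have \<Phi>e: "\<Phi> \<sigma> F (eb e) = smon 1 (snd F e) \<otimes>\<^bsub>A\<^esub> b" using Phi_smon_b[OF k, of e] eD by simp
  show ?thesis
  proof (rule cut_semi_iso[OF U V iso Phi_iso_R[OF k], where s = ?s and t = ?t])
    show "eb e \<in> carrier R" by (rule K.eps_R)
    show "eb e \<otimes>\<^bsub>R\<^esub> eb e = eb e" by (rule K.eps_idem)
    show "q \<in> carrier R \<and> q \<otimes>\<^bsub>R\<^esub> eb e = q" if "q \<in> carrier (Q e)" for q
      using K.sub[OF that] K.eps_right[OF that] by blast
    show "?s \<in> carrier R" "?t \<in> carrier R" using b_R[OF sA] b_R[OF tA] .
    show "eb e \<otimes>\<^bsub>R\<^esub> ?s = ?s" using mm[of e s] D eD by simp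
    show "\<Phi> \<sigma> F (eb e) \<otimes>\<^bsub>R\<^esub> ?t = ?t" using mm[of "snd F e" t] D idem_endoD[OF Fe] \<Phi>e by simp
    show "?s \<otimes>\<^bsub>R\<^esub> ?t = eb e" using mm[of s t] D by simp
    show "?t \<otimes>\<^bsub>R\<^esub> ?s = \<Phi> \<sigma> F (eb e)" using mm[of t s] D \<Phi>e by simp
    show "\<Psi> \<sigma> F e s t q = ?s \<otimes>\<^bsub>R\<^esub> (\<Phi> \<sigma> F q \<otimes>\<^bsub>R\<^esub> ?t)" if q: "q \<in> carrier (Q e)" for q
    proof -
      have qR: "q \<in> carrier R" using K.sub[OF q] .
      have pR: "\<Phi> \<sigma> F q \<in> carrier R" using ring_isoD(1)[OF Phi_iso_R[OF k] qR] .
      then have pA: "\<Phi> \<sigma> F q \<in> carrier A" using R_carrier by blast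
      have "?s \<otimes>\<^bsub>A\<^esub> (\<Phi> \<sigma> F q \<otimes>\<^bsub>A\<^esub> ?t) = ?s \<otimes>\<^bsub>A\<^esub> ((\<Phi> \<sigma> F q \<otimes>\<^bsub>A\<^esub> smon 1 t) \<otimes>\<^bsub>A\<^esub> b)"
        using pA tA b(1) by (simp add: A.m_assoc)
      also have "\<dots> = smon 1 s \<otimes>\<^bsub>A\<^esub> (\<Phi> \<sigma> F q \<otimes>\<^bsub>A\<^esub> smon 1 t) \<otimes>\<^bsub>A\<^esub> b"
        using bmult[OF sA, of "\<Phi> \<sigma> F q \<otimes>\<^bsub>A\<^esub> smon 1 t"] pA tA by simp
      also have "\<dots> = smon 1 s \<otimes>\<^bsub>A\<^esub> ((\<Phi> \<sigma> F q \<otimes>\<^bsub>A\<^esub> b) \<otimes>\<^bsub>A\<^esub> smon 1 t)"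
        using pA sA tA b(1) b(3)[OF tA] by (simp add: A.m_assoc)
      also have "\<dots> = \<Psi> \<sigma> F e s t q"
        using R_absorb_b(2)[OF pR] transport_semilin[OF k e e st, of q] q Q_carrier[OF e] by simp
      finally show ?thesis by simp
    qed
  qed
qed

definition apex_classes :: "'m \<Rightarrow> ('m, 'k) kmodule set set" where
  "apex_classes e = {c \<in> simple_classes R. \<exists>U \<in> c. has_apex e U}"

text \<open>The representative picked by \<open>SOME\<close> does not matter, since isomorphic
  modules have isomorphic cuts; see \<open>alpha_cls\<close>.\<close>

definition \<alpha> :: "'m \<Rightarrow> ('m, 'k) kmodule set \<Rightarrow> ('m, 'k) kmodule set" where
  "\<alpha> e c = cls (Q e) (cut_module (eb e) (SOME U. U \<in> c))"

lemma idem_iso_id: "idem_endo C e \<Longrightarrow> idem_iso C (snd (id, id) e) e e e"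
  using idem_iso_refl by simp

lemma has_apex_iso:
  assumes "idem_endo C e" "has_apex e U" "simple_module R V" "semi_iso R id U V"
  shows "has_apex e V"
  by (rule apex_transport[OF kaut_id assms(1,1) idem_iso_id[OF assms(1)] assms(2,3)])
    (rule semi_iso_cong[OF assms(4)], metis Phi_id id_apply)

lemma apex_classes_iff:
  assumes "idem_endo C e" shows "c \<in> apex_classes e \<longleftrightarrow> (\<exists>U. has_apex e U \<and> c = cls R U)"
proof
  assume "c \<in> apex_classes e"
  then obtain U V where U: "simple_module R U" "c = cls R U" and V: "V \<in> c" "has_apex e V"
    unfolding apex_classes_def simple_classes_iff by blast
  have "has_apex e U"
    using has_apex_iso[OF assms V(2) U(1)] semi_iso_id_sym[OF _ simple_module_left[OF U(1)]] V(1) U(2) cls_mem by blast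
  then show "\<exists>U. has_apex e U \<and> c = cls R U" using U(2) by blast
next
  assume "\<exists>U. has_apex e U \<and> c = cls R U"
  then show "c \<in> apex_classes e" unfolding apex_classes_def simple_classes_iff using cls_self has_apex_def by blast
qed

lemma cut_iso:
  assumes e: "idem_endo C e" and U: "has_apex e U" and V: "has_apex e V"
  shows "semi_iso (Q e) id (cut_module (eb e) U) (cut_module (eb e) V) \<longleftrightarrow> semi_iso R id U V"
proof
  interpret K: corner R "Q e" "eb e" "\<pi> e" by (rule corner[OF e])
  show "semi_iso R id U V" if "semi_iso (Q e) id (cut_module (eb e) U) (cut_module (eb e) V)"
    by (rule K.cut_reflects_iso[OF iffD2[OF apex_iff[OF e] U] iffD2[OF apex_iff[OF e] V] that])
  assume *: "semi_iso R id U V"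
  have l: "left_module R U" "left_module R V" using U V simple_module_left unfolding has_apex_def by blast+
  have q: "eb e \<otimes>\<^bsub>R\<^esub> (id q \<otimes>\<^bsub>R\<^esub> eb e) = q" if "q \<in> carrier (Q e)" for q
    using K.eps_left[OF that] K.eps_right[OF that] by simp
  show "semi_iso (Q e) id (cut_module (eb e) U) (cut_module (eb e) V)"
    by (rule cut_semi_iso[OF l * id_ring_iso K.eps_R K.eps_idem, where s = "eb e" and t = "eb e"])
      (use K.sub K.eps_right K.eps_R K.eps_idem q in \<open>auto simp del: block_algebra_sel\<close>)
qed

lemma cut_simple': "\<lbrakk>idem_endo C e; has_apex e U\<rbrakk> \<Longrightarrow> simple_module (Q e) (cut_module (eb e) U)"
  using corner.cut_simple[OF corner] apex_iff by blast

lemma alpha_cls: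
  assumes e: "idem_endo C e" and U: "has_apex e U"
  shows "\<alpha> e (cls R U) = cls (Q e) (cut_module (eb e) U)"
proof -
  have sU: "simple_module R U" using U by (simp add: has_apex_def)
  let ?V = "SOME V. V \<in> cls R U"
  have "?V \<in> cls R U" using cls_self[OF sU] by (rule someI)
  then have V: "simple_module R ?V" "semi_iso R id U ?V" by (auto simp: cls_mem)
  have ap: "has_apex e ?V" by (rule has_apex_iso[OF e U V])
  show ?thesis
    unfolding \<alpha>_def using cls_eq_iff[OF cut_simple'[OF e U] cut_simple'[OF e ap]] cut_iso[OF e U ap] V(2) by simp
qed

text \<open>Numbering the finitely many morphisms encodes coefficient functions as sequences. This
  supplies the injection that \<open>cut_surjective\<close> requires for the carrier type of
  \<open>kmodule\<close>.\<close>

lemma encoding_exists: "\<exists>\<iota> :: ('m \<Rightarrow> 'k) \<Rightarrow> nat \<Rightarrow> 'k. inj_on \<iota> (carrier R)"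
proof -
  obtain \<kappa> :: "'m \<Rightarrow> nat" where \<kappa>: "inj_on \<kappa> (Mor C)" using finite_imp_inj_to_nat_seg[OF finite_Mor] by blast
  have "inj_on (semilin_ext id (Mor C) \<kappa>) (carrier R)"
  proof (rule inj_onI, rule ext)
    fix x y m assume *: "x \<in> carrier R" "y \<in> carrier R" "semilin_ext id (Mor C) \<kappa> x = semilin_ext id (Mor C) \<kappa> y"
    show "x m = y m"
    proof (cases "m \<in> Mor C")
      case True
      then show ?thesis using semilin_inj[OF \<kappa> True, of id x] semilin_inj[OF \<kappa> True, of id y] *(3) by simp
    next
      case False
      then show ?thesis using * R_carrier by (simp add: cat_algebra_sel)
    qed
  qed
  then show ?thesis by blast
qed

lemma alpha_bij: assumes e: "idem_endo C e" shows "bij_betw (\<alpha> e) (apex_classes e) (simple_classes (Q e))"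
proof (rule bij_betw_imageI)
  show "inj_on (\<alpha> e) (apex_classes e)"
  proof (rule inj_onI)
    fix c d assume c: "c \<in> apex_classes e" and d: "d \<in> apex_classes e" and eq: "\<alpha> e c = \<alpha> e d"
    obtain U where U: "has_apex e U" "c = cls R U" using apex_classes_iff[OF e] c by blast
    obtain V where V: "has_apex e V" "d = cls R V" using apex_classes_iff[OF e] d by blast
    have "semi_iso (Q e) id (cut_module (eb e) U) (cut_module (eb e) V)"
      using eq alpha_cls[OF e] U V cls_eq_iff[OF cut_simple'[OF e U(1)] cut_simple'[OF e V(1)]] by simp
    then have "semi_iso R id U V" using cut_iso[OF e U(1) V(1)] by blast
    then show "c = d" using U V cls_eq_iff[of R U V] by (simp add: has_apex_def)
  qed
  show "\<alpha> e ` apex_classes e = simple_classes (Q e)"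
  proof (intro equalityI subsetI)
    fix c assume "c \<in> \<alpha> e ` apex_classes e"
    then obtain U where "has_apex e U" "c = cls (Q e) (cut_module (eb e) U)"
        using apex_classes_iff[OF e] alpha_cls[OF e] by auto
    then show "c \<in> simple_classes (Q e)" unfolding simple_classes_iff using cut_simple'[OF e] by blast
  next
    fix c assume "c \<in> simple_classes (Q e)"
    then obtain S where S: "simple_module (Q e) S" "c = cls (Q e) S" unfolding simple_classes_iff by blast
    obtain \<iota> :: "('m \<Rightarrow> 'k) \<Rightarrow> nat \<Rightarrow> 'k" where \<iota>: "inj_on \<iota> (carrier R)" using encoding_exists by blast
    obtain U :: "('m, 'k) kmodule" where U: "corner.apex R (eb e) (\<pi> e) U" "semi_iso (Q e) id (cut_module (eb e) U) S"
      using corner.cut_surjective[OF corner[OF e] S(1) \<iota>] by blast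
    have ap: "has_apex e U" using U(1) apex_iff[OF e] by blast
    have "c = \<alpha> e (cls R U)"
      using cls_eq_iff[OF cut_simple'[OF e ap] S(1)] U(2) S(2) alpha_cls[OF e ap] by simp
    then show "c \<in> \<alpha> e ` apex_classes e" using apex_classes_iff[OF e] ap by blast
  qed
qed

lemma simple_act_cls:
  assumes "kaut \<sigma> F" "simple_module R U" "simple_module R V" "semi_iso R (\<Phi> \<sigma> F) U V"
  shows "simple_act C b \<sigma> F (cls R U) = cls R V"
  unfolding simple_act_def Let_def by (rule twist_class[OF R_ring Phi_iso_R[OF assms(1)] assms(2-4)])

lemma Phi_twist:
  assumes "kaut \<sigma> F" "simple_module R U"
  shows "simple_module R (twist R (\<Phi> \<sigma> F) U)" "semi_iso R (\<Phi> \<sigma> F) U (twist R (\<Phi> \<sigma> F) U)"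
  using simple_twist[OF Phi_iso_R[OF assms(1)] assms(2) R_ring] semi_iso_twist[OF ring_isoD(6)[OF Phi_iso_R[OF
      assms(1)]]]
  by blast+

lemma simple_act_closed:
  assumes "kaut \<sigma> F" "c \<in> simple_classes R" shows "simple_act C b \<sigma> F c \<in> simple_classes R"
  using assms(2) simple_act_cls[OF assms(1)] Phi_twist[OF assms(1)] unfolding simple_classes_iff by metis

lemma simple_act_comp:
  assumes k: "kaut \<sigma> F" and l: "kaut \<tau> H" and c: "c \<in> simple_classes R"
  shows "simple_act C b (\<sigma> \<circ> \<tau>) (fst F \<circ> fst H, snd F \<circ> snd H) c = simple_act C b \<sigma> F (simple_act C b \<tau> H c)"
proof -
  obtain U where U: "simple_module R U" "c = cls R U" using c simple_classes_iff by blast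
  note V = Phi_twist[OF l U(1)] and W = Phi_twist[OF k Phi_twist(1)[OF l U(1)]]
  have "semi_iso R (\<Phi> (\<sigma> \<circ> \<tau>) (fst F \<circ> fst H, snd F \<circ> snd H)) U (twist R (\<Phi> \<sigma> F) (twist R (\<Phi> \<tau> H) U))"
    by (rule semi_iso_comp[OF V(2) W(2)]) (use ring_isoD(1)[OF Phi_iso_R[OF l]] Phi_comp[OF k l] in blast)+
  then show ?thesis
    using simple_act_cls[OF kaut_comp[OF k l] U(1) W(1)] simple_act_cls[OF l U(1) V(1,2)]
      simple_act_cls[OF k V(1) W(1,2)] U(2) by simp
qed

text \<open>A functor followed by its inverse is the identity only on the morphisms of
  \<open>C\<close>, not as a function on the whole type; hence the pointwise assumption on
  \<open>F\<close>.\<close>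

lemma simple_act_trivial:
  assumes k: "kaut \<sigma> F" and id: "\<sigma> = id" "\<And>s. s \<in> Mor C \<Longrightarrow> snd F s = s" and c: "c \<in> simple_classes R"
  shows "simple_act C b \<sigma> F c = c"
proof -
  obtain U where U: "simple_module R U" "c = cls R U" using c simple_classes_iff by blast
  have "semilin_ext \<sigma> (Mor C) (snd F) = semilin_ext id (Mor C) id"
    unfolding id(1) by (rule semilin_cong) (simp add: id(2))
  then have "\<Phi> \<sigma> F a = a" if "a \<in> carrier R" for a using Phi_id[OF that] by simp
  then have "semi_iso R (\<Phi> \<sigma> F) U U" using semi_iso_cong[OF semi_iso_refl] by (metis id_apply)
  then show ?thesis using simple_act_cls[OF k U(1,1)] U(2) by simp
qed

lemma apex_classes_transport:
  assumes k: "kaut \<sigma> F" and e: "idem_endo C e" and f: "idem_endo C f" and st: "idem_iso C (snd F e) f s t"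
      and c: "c \<in> apex_classes e"
  shows "simple_act C b \<sigma> F c \<in> apex_classes f"
proof -
  obtain U where U: "has_apex e U" "c = cls R U" using c apex_classes_iff[OF e] by blast
  have sU: "simple_module R U" using U by (simp add: has_apex_def)
  note V = Phi_twist[OF k sU]
  show ?thesis
    using apex_classes_iff[OF f] apex_transport[OF k e f st U(1) V] simple_act_cls[OF k sU V] U(2) by blast
qed

text \<open>\<open>cut_transport\<close> read on classes: when \<open>F(e)\<close> is isomorphic to
  \<open>e\<close>, the pair \<open>(\<sigma>, F)\<close> acts on the cut modules through
  \<open>\<sigma>\<close> and the automorphism \<open>x \<mapsto> s F(x) t\<close> of
  \<open>G\<^sub>e\<close>.\<close>

lemma alpha_equivariant:
  assumes k: "kaut \<sigma> F" and e: "idem_endo C e" and st: "idem_iso C (snd F e) e s t" and c: "c \<in> apex_classes e"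
  shows "\<alpha> e (simple_act C b \<sigma> F c) =
    simple_act (group_category (idem_group C e)) (eb e) \<sigma> ((\<lambda>_. ()), transport F s t) (\<alpha> e c)"
proof -
  obtain U where U: "has_apex e U" "c = cls R U" using c apex_classes_iff[OF e] by blast
  have sU: "simple_module R U" using U by (simp add: has_apex_def)
  note V = Phi_twist[OF k sU]
  have aV: "has_apex e (twist R (\<Phi> \<sigma> F) U)" by (rule apex_transport[OF k e e st U(1) V])
  have "simple_act (group_category (idem_group C e)) (eb e) \<sigma> ((\<lambda>_. ()), transport F s t) (cls (Q e) (cut_module
      (eb e) U))
    = cls (Q e) (cut_module (eb e) (twist R (\<Phi> \<sigma> F) U))"
    unfolding simple_act_def Let_def snd_conv group_category_sel(2)
    by (rule twist_class[OF Q_ring[OF e] transport_Q_iso[OF k e e st] cut_simple'[OF e U(1)] cut_simple'[OF e aV]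
          cut_transport[OF k e st simple_module_left[OF sU] simple_module_left[OF V(1)] V(2)]])
  then show ?thesis
    using alpha_cls[OF e U(1)] alpha_cls[OF e aV] simple_act_cls[OF k sU V] U(2) by simp
qed

lemma apex_classes_cover: assumes "c \<in> simple_classes R" shows "\<exists>e. idem_endo C e \<and> c \<in> apex_classes e"
  using assms apex_exists apex_classes_iff unfolding simple_classes_iff by metis

lemma apex_classes_unique:
  assumes e: "idem_endo C e" and f: "idem_endo C f" and "c \<in> apex_classes e" "c \<in> apex_classes f"
  shows "\<exists>s t. idem_iso C e f s t"
proof -
  obtain U where U: "has_apex e U" "c = cls R U" using assms(3) apex_classes_iff[OF e] by blast
  have "has_apex f U"
  proof -
    obtain V where V: "has_apex f V" "c = cls R V" using assms(4) apex_classes_iff[OF f] by blast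
    have "simple_module R U" "simple_module R V" using U V by (auto simp: has_apex_def)
    then show ?thesis using has_apex_iso[OF f V(1)] cls_eq_iff U(2) V(2) by metis
  qed
  then show ?thesis using apex_unique[OF e f U(1)] by blast
qed

end


section \<open>The orbit category\<close>

declare orbit_of.simps [simp del]

text \<open>Since \<open>s P \<subseteq> Q s\<close>, the double orbit of \<open>s\<close> is already the left orbit \<open>Q s\<close>.\<close>

definition orb :: "('o, 'm) category \<Rightarrow> 'm \<Rightarrow> 'm set \<Rightarrow> 'm set \<Rightarrow> ('m \<times> 'm set \<times> 'm set) set" where
  "orb C s P Q = (\<lambda>v. (cmp C v s, P, Q)) ` Q"

text \<open>The identity orbit of \<open>(X, P)\<close>, written with \<open>P\<close> alone. In
  this form it is literally the same element in the orbit categories of \<open>C\<close> and of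
  \<open>G\<^sub>e\<close>.\<close>

definition unit_orb :: "'m set \<Rightarrow> ('m \<times> 'm set \<times> 'm set) set" where
  "unit_orb P = (\<lambda>v. (v, P, P)) ` P"

context finite_category begin

text \<open>A \<open>p\<close>-subgroup of \<open>End(X)\<close> with unit \<open>e\<close> is a subgroup of \<open>G\<^sub>e\<close>; inverses come from finiteness.\<close>

definition psub :: "nat \<Rightarrow> 'b \<Rightarrow> 'b set \<Rightarrow> bool" where
  "psub p e P \<longleftrightarrow> P \<subseteq> carrier (idem_group C e) \<and> e \<in> P \<and> (\<forall>u \<in> P. \<forall>v \<in> P. cmp C u v \<in> P) \<and> (\<exists>n. card P = p ^ n)"

lemma psubD:
  assumes "psub p e P"
  shows "u \<in> P \<Longrightarrow> u \<in> carrier (idem_group C e)" "e \<in> P" "\<lbrakk>u \<in> P; v \<in> P\<rbrakk> \<Longrightarrow> cmp C u v \<in> P"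
  using assms unfolding psub_def by blast+

lemma psub_Mor:
  assumes "idem_endo C e" "psub p e P" "u \<in> P"
  shows "u \<in> Mor C" "src C u = src C e" "tgt C u = src C e" "cmp C e u = u" "cmp C u e = u"
  using idem_groupD[OF assms(1) psubD(1)[OF assms(2,3)]] by auto

lemma psub_finite: "\<lbrakk>idem_endo C e; psub p e P\<rbrakk> \<Longrightarrow> finite P"
  using finite_subset[OF _ finite_idem_group] unfolding psub_def by blast

text \<open>Left translation by \<open>u\<close> maps the finite set \<open>P\<close> injectively
  into itself, hence onto. Hitting \<open>u\<close> shows that \<open>e\<close> lies in
  \<open>P\<close>, and hitting \<open>e\<close> gives the inverse.\<close>

lemma closed_inverse:
  assumes e: "idem_endo C e" and P: "P \<subseteq> carrier (idem_group C e)" "\<And>u v. \<lbrakk>u \<in> P; v \<in> P\<rbrakk> \<Longrightarrow> cmp C u v \<in> P"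
    and u: "u \<in> P"
  obtains v where "v \<in> P" "cmp C u v = e" "cmp C v u = e"
proof -
  note M = idem_groupD[OF e]
  obtain w where w: "w \<in> carrier (idem_group C e)" "cmp C u w = e" "cmp C w u = e"
    using idem_group_inverse[OF e] P(1) u by blast
  have wu: "cmp C w (cmp C u x) = x" if "x \<in> P" for x
    using cmp_collapse[OF w(3), of x] M[OF w(1)] M[of u] M[of x] u that P(1) by (metis subsetD)
  have "inj_on (cmp C u) P" using wu by (metis inj_onI)
  moreover have "cmp C u ` P \<subseteq> P" using P(2)[OF u] by (rule image_subsetI)
  moreover have "finite P" by (rule finite_subset[OF P(1) finite_idem_group[OF e]])
  ultimately have im: "cmp C u ` P = P" by (metis endo_inj_surj)
  then obtain v where v: "v \<in> P" "cmp C u v = u" using u by (metis imageE)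
  then have "v = e" using wu[OF v(1)] w(3) by simp
  then obtain v' where v': "v' \<in> P" "cmp C u v' = e" using im v(1) by (metis imageE)
  moreover have "cmp C v' u = e"
    by (rule idem_one_sided(3)[OF e idem_group_sub[OF e subsetD[OF P(1) u]] idem_group_sub[OF e subsetD[OF P(1)
        v'(1)]] v'(2)])
  ultimately show ?thesis using that by blast
qed

lemma psub_inverse:
  assumes "idem_endo C e" "psub p e P" "u \<in> P"
  obtains v where "v \<in> P" "cmp C u v = e" "cmp C v u = e"
proof -
  have "P \<subseteq> carrier (idem_group C e)" using assms(2) by (simp add: psub_def)
  then show ?thesis using closed_inverse[OF assms(1) _ psubD(3)[OF assms(2)] assms(3)] that by blast
qed

lemma sub_unit_eq:
  assumes "group \<lparr>carrier = P, monoid.mult = cmp C, one = u\<rparr>" shows "sub_unit C P = u"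
  unfolding sub_unit_def
proof (rule the_equality)
  show "group \<lparr>carrier = P, monoid.mult = cmp C, one = u\<rparr>" by (fact assms)
  fix v assume v: "group \<lparr>carrier = P, monoid.mult = cmp C, one = v\<rparr>"
  interpret U: group "\<lparr>carrier = P, monoid.mult = cmp C, one = u\<rparr>" by (fact assms)
  interpret V: group "\<lparr>carrier = P, monoid.mult = cmp C, one = v\<rparr>" by (fact v)
  show "v = u" using U.l_one[of v] V.r_one[of u] U.one_closed V.one_closed by simp
qed

text \<open>Bridge to the notion used for the orbit category: there the unit is extracted from
  \<open>P\<close> by \<open>THE\<close>, here it is an explicit parameter.\<close>

lemma psub_iff:
  assumes e: "idem_endo C e"
  shows "psub p e P \<longleftrightarrow> p_subgroup p C (src C e) P \<and> sub_unit C P = e"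
proof
  assume P: "psub p e P"
  note M = psub_Mor[OF e P]
  have "group \<lparr>carrier = P, monoid.mult = cmp C, one = e\<rparr>"
  proof (rule groupI)
    fix x assume "x \<in> carrier \<lparr>carrier = P, monoid.mult = cmp C, one = e\<rparr>"
    then have "x \<in> P" by simp
    then obtain y where "y \<in> P" "cmp C y x = e" using psub_inverse[OF e P] by metis
    then show "\<exists>y\<in>carrier \<lparr>carrier = P, monoid.mult = cmp C, one = e\<rparr>.
        y \<otimes>\<^bsub>\<lparr>carrier = P, monoid.mult = cmp C, one = e\<rparr>\<^esub> x = \<one>\<^bsub>\<lparr>carrier = P, monoid.mult = cmp C, one = e\<rparr>\<^esub>"
      by auto
  next
    fix x y z
    let ?G = "\<lparr>carrier = P, monoid.mult = cmp C, one = e\<rparr>"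
    assume "x \<in> carrier ?G" "y \<in> carrier ?G" "z \<in> carrier ?G"
    then show "x \<otimes>\<^bsub>?G\<^esub> y \<otimes>\<^bsub>?G\<^esub> z = x \<otimes>\<^bsub>?G\<^esub> (y \<otimes>\<^bsub>?G\<^esub> z)"
      using assoc[of x y z] M[of x] M[of y] M[of z] by simp
  qed (use psubD(2,3)[OF P] M(4) in simp_all)
  then show "p_subgroup p C (src C e) P \<and> sub_unit C P = e"
    using sub_unit_eq P M(1-3) unfolding p_subgroup_def psub_def Hom_def by blast
next
  assume *: "p_subgroup p C (src C e) P \<and> sub_unit C P = e"
  then obtain u where "group \<lparr>carrier = P, monoid.mult = cmp C, one = u\<rparr>" by (auto simp: p_subgroup_def)
  then have "group \<lparr>carrier = P, monoid.mult = cmp C, one = e\<rparr>" using sub_unit_eq * by blast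
  then interpret P: group "\<lparr>carrier = P, monoid.mult = cmp C, one = e\<rparr>" .
  have E: "x \<in> carrier (idem_monoid C e)" if "x \<in> P" for x
    unfolding idem_monoid_carrier[OF e] using * that P.l_one[of x] P.r_one[of x]
    by (auto simp: p_subgroup_def Hom_def)
  have "x \<in> carrier (idem_group C e)" if x: "x \<in> P" for x
  proof -
    obtain y where "y \<in> P" "cmp C x y = e" using P.r_inv_ex[of x] x by auto
    then show ?thesis using idem_one_sided(1)[OF e E E] x by blast
  qed
  then show "psub p e P" using * P.one_closed P.m_closed unfolding psub_def p_subgroup_def by auto
qed

lemma p_subgroupE:
  assumes "p_subgroup p C V P"
  obtains e where "idem_endo C e" "src C e = V" "psub p e P" "sub_unit C P = e"
proof -
  obtain u where u: "group \<lparr>carrier = P, monoid.mult = cmp C, one = u\<rparr>" using assms by (auto simp: p_subgroup_def)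
  interpret P: group "\<lparr>carrier = P, monoid.mult = cmp C, one = u\<rparr>" by (fact u)
  have uP: "u \<in> P" using P.one_closed by simp
  then have "u \<in> Hom C V V" using assms by (auto simp: p_subgroup_def)
  then have "idem_endo C u" "src C u = V" using P.l_one[OF P.one_closed] by (auto simp: idem_endo_def Hom_def)
  then show ?thesis using that sub_unit_eq[OF u] psub_iff assms by blast
qed

text \<open>Morphisms of the transporter category, with the units \<open>e\<close> of \<open>P\<close> and \<open>f\<close> of \<open>Q\<close> made explicit.\<close>

definition tm :: "nat \<Rightarrow> 'b \<Rightarrow> 'b set \<Rightarrow> 'b \<Rightarrow> 'b set \<Rightarrow> 'b \<Rightarrow> bool" where
  "tm p e P f Q s \<longleftrightarrow> idem_endo C e \<and> idem_endo C f \<and> psub p e P \<and> psub p f Q \<and> s \<in> Mor C \<and>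
     src C s = src C e \<and> tgt C s = src C f \<and> cmp C s e = s \<and> cmp C f s = s \<and>
     (\<forall>u \<in> P. \<exists>v \<in> Q. cmp C s u = cmp C v s)"

lemma tmD:
  assumes "tm p e P f Q s"
  shows "idem_endo C e" "idem_endo C f" "psub p e P" "psub p f Q" "s \<in> Mor C" "src C s = src C e" "tgt C s = src C f"
    "cmp C s e = s" "cmp C f s = s" "u \<in> P \<Longrightarrow> \<exists>v \<in> Q. cmp C s u = cmp C v s"
  using assms unfolding tm_def by blast+

lemma Mor_transporter:
  "(s, P, Q) \<in> Mor (transporter_category p C) \<longleftrightarrow> (\<exists>e f. tm p e P f Q s)"
proof
  assume "(s, P, Q) \<in> Mor (transporter_category p C)"
  then have s: "s \<in> Mor C" "p_subgroup p C (src C s) P" "p_subgroup p C (tgt C s) Q" "s = cmp C s (sub_unit C P)"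
    "s = cmp C (sub_unit C Q) s" "(\<lambda>u. cmp C s u) ` P \<subseteq> (\<lambda>v. cmp C v s) ` Q"
    by (auto simp: transporter_category_def)
  obtain e where e: "idem_endo C e" "src C e = src C s" "psub p e P" "sub_unit C P = e" using p_subgroupE[OF s(2)] .
  obtain f where f: "idem_endo C f" "src C f = tgt C s" "psub p f Q" "sub_unit C Q = f" using p_subgroupE[OF s(3)] .
  have "\<forall>u \<in> P. \<exists>v \<in> Q. cmp C s u = cmp C v s" using s(6) by blast
  then have "tm p e P f Q s" unfolding tm_def using s(1,4,5) e f by metis
  then show "\<exists>e f. tm p e P f Q s" by blast
next
  assume "\<exists>e f. tm p e P f Q s"
  then obtain e f where "tm p e P f Q s" by blast
  note D = tmD[OF this]
  have "(\<lambda>u. cmp C s u) ` P \<subseteq> (\<lambda>v. cmp C v s) ` Q" using D(10) by blast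
  moreover have "p_subgroup p C (src C s) P" "p_subgroup p C (tgt C s) Q" "sub_unit C P = e" "sub_unit C Q = f"
    using D psub_iff by metis+
  ultimately show "(s, P, Q) \<in> Mor (transporter_category p C)"
    using D(5,8,9) by (simp add: transporter_category_def)
qed

lemma tm_comp:
  assumes s: "tm p e P f Q s" and t: "tm p f Q g R t" shows "tm p e P g R (cmp C t s)"
proof -
  note S = tmD[OF s] and T = tmD[OF t]
  note eD = idem_endoD[OF S(1)] and gD = idem_endoD[OF T(2)]
  have "\<exists>w \<in> R. cmp C (cmp C t s) u = cmp C w (cmp C t s)" if u: "u \<in> P" for u
  proof -
    obtain v where v: "v \<in> Q" "cmp C s u = cmp C v s" using S(10)[OF u] by blast
    obtain w where w: "w \<in> R" "cmp C t v = cmp C w t" using T(10)[OF v(1)] by blast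
    note uM = psub_Mor[OF S(1,3) u] and vM = psub_Mor[OF S(2,4) v(1)] and wM = psub_Mor[OF T(2,4) w(1)]
    have "cmp C (cmp C t s) u = cmp C t (cmp C v s)" using assoc[of t s u] S T uM v(2) by metis
    also have "\<dots> = cmp C (cmp C w t) s" using assoc[of t v s] S T vM w(2) by metis
    also have "\<dots> = cmp C w (cmp C t s)" using assoc[of w t s] S T wM by metis
    finally show ?thesis using w(1) by blast
  qed
  moreover have "cmp C (cmp C t s) e = cmp C t s" using assoc[of t s e] S T eD by metis
  moreover have "cmp C g (cmp C t s) = cmp C t s" using assoc[of g t s] S T gD by metis
  moreover have "cmp C t s \<in> Mor C" "src C (cmp C t s) = src C e" "tgt C (cmp C t s) = src C g" using S T by simp_all
  ultimately show ?thesis unfolding tm_def using S(1,3) T(2,4) by blast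
qed

text \<open>\<open>u v = (u v u') u\<close> with \<open>u'\<close> the inverse of \<open>u\<close>
  in \<open>P\<close>.\<close>

lemma tm_psub: assumes "idem_endo C e" "psub p e P" "u \<in> P" shows "tm p e P e P u"
proof -
  note M = psub_Mor[OF assms]
  have "\<exists>w \<in> P. cmp C u v = cmp C w u" if v: "v \<in> P" for v
  proof -
    obtain u' where u': "u' \<in> P" "cmp C u' u = e" using psub_inverse[OF assms] by metis
    note vM = psub_Mor[OF assms(1,2) v] and u'M = psub_Mor[OF assms(1,2) u'(1)]
    have uv: "cmp C u v \<in> P" using psubD(3)[OF assms(2,3) v] .
    note uvM = psub_Mor[OF assms(1,2) uv]
    have "cmp C (cmp C (cmp C u v) u') u = cmp C u v" using assoc[of "cmp C u v" u' u] M u'M uvM u'(2) by metis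
    then show ?thesis using psubD(3)[OF assms(2) uv u'(1)] by metis
  qed
  then show ?thesis unfolding tm_def using assms(1,2) M by blast
qed

lemma orbit_of_tm:
  assumes "tm p e P f Q s" shows "orbit_of C (s, P, Q) = orb C s P Q"
proof -
  note S = tmD[OF assms]
  have 1: "cmp C v (cmp C s u) \<in> (\<lambda>v. cmp C v s) ` Q" if "u \<in> P" "v \<in> Q" for u v
  proof -
    obtain w where w: "w \<in> Q" "cmp C s u = cmp C w s" using S(10)[OF \<open>u \<in> P\<close>] by blast
    have "cmp C v (cmp C w s) = cmp C (cmp C v w) s"
      using assoc[of v w s] psub_Mor[OF S(2,4) \<open>v \<in> Q\<close>] psub_Mor[OF S(2,4) w(1)] S by metis
    then show ?thesis using psubD(3)[OF S(4) \<open>v \<in> Q\<close> w(1)] w(2) by (intro image_eqI) auto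
  qed
  have 2: "cmp C v s = cmp C v (cmp C s e)" for v using S(8) by simp
  show ?thesis
  proof (intro equalityI subsetI)
    fix x assume "x \<in> orbit_of C (s, P, Q)"
    then obtain u v where "u \<in> P" "v \<in> Q" "x = (cmp C v (cmp C s u), P, Q)" unfolding orbit_of.simps by blast
    then show "x \<in> orb C s P Q" using 1[of u v] by (auto simp: orb_def)
  next
    fix x assume "x \<in> orb C s P Q"
    then obtain v where "v \<in> Q" "x = (cmp C v s, P, Q)" by (auto simp: orb_def)
    then show "x \<in> orbit_of C (s, P, Q)" unfolding orbit_of.simps using 2[of v] psubD(2)[OF S(3)] by blast
  qed
qed

lemma orb_mem: assumes "tm p e P f Q s" shows "(s, P, Q) \<in> orb C s P Q"
  using tmD(9)[OF assms] psubD(2)[OF tmD(4)[OF assms]] unfolding orb_def by (metis (mono_tags, lifting) image_eqI)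

text \<open>Right translation by \<open>v\<close> permutes \<open>Q\<close>, so every member of an
  orbit may serve as its representative.\<close>

lemma orb_shift:
  assumes s: "tm p e P f Q s" and v: "v \<in> Q"
  shows "tm p e P f Q (cmp C v s)" "orb C (cmp C v s) P Q = orb C s P Q"
proof -
  note S = tmD[OF s]
  show "tm p e P f Q (cmp C v s)" by (rule tm_comp[OF s tm_psub[OF S(2,4) v]])
  note vM = psub_Mor[OF S(2,4) v]
  obtain v' where v': "v' \<in> Q" "cmp C v' v = f" using psub_inverse[OF S(2,4) v] by metis
  note v'M = psub_Mor[OF S(2,4) v'(1)]
  show "orb C (cmp C v s) P Q = orb C s P Q"
  proof (intro equalityI subsetI)
    fix x assume "x \<in> orb C (cmp C v s) P Q"
    then obtain w where w: "w \<in> Q" "x = (cmp C w (cmp C v s), P, Q)" by (auto simp: orb_def)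
    have "cmp C w (cmp C v s) = cmp C (cmp C w v) s" using assoc[of w v s] psub_Mor[OF S(2,4) w(1)] vM S by metis
    then show "x \<in> orb C s P Q" unfolding orb_def using w psubD(3)[OF S(4) w(1) v] by (intro image_eqI[of _ _
        "cmp C w v"]) auto
  next
    fix x assume "x \<in> orb C s P Q"
    then obtain w where w: "w \<in> Q" "x = (cmp C w s, P, Q)" by (auto simp: orb_def)
    note wM = psub_Mor[OF S(2,4) w(1)]
    have "cmp C v' (cmp C v s) = s" using cmp_collapse[OF v'(2), of s] vM v'M S by metis
    then have "cmp C w s = cmp C (cmp C w v') (cmp C v s)"
      using assoc[of w v' "cmp C v s"] wM v'M vM S cmp_Mor[of v s] by metis
    then show "x \<in> orb C (cmp C v s) P Q" unfolding orb_def using w(1,2) psubD(3)[OF S(4) w(1) v'(1)]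
        by (intro image_eqI[of _ _ "cmp C w v'"]) metis+
  qed
qed

lemma orb_eqD:
  assumes s: "tm p e P f Q s" and s': "tm p e' P' f' Q' s'" and eq: "orb C s P Q = orb C s' P' Q'"
  shows "P = P'" "Q = Q'" "\<exists>v \<in> Q. s' = cmp C v s"
  using orb_mem[OF s'] eq[symmetric] unfolding orb_def by auto

lemma unit_orb_eq:
  assumes "idem_endo C e" "psub p e P" shows "unit_orb P = orb C e P P"
  unfolding unit_orb_def orb_def using psub_Mor(5)[OF assms] by (intro image_cong) auto

lemma orb_unit_iff:
  assumes s: "tm p e P e P s" shows "orb C s P P = unit_orb P \<longleftrightarrow> s \<in> P"
proof
  note S = tmD[OF s]
  assume "orb C s P P = unit_orb P"
  then show "s \<in> P" using orb_mem[OF s] by (auto simp: unit_orb_def)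
next
  note S = tmD[OF s]
  assume sP: "s \<in> P"
  have "orb C (cmp C s e) P P = orb C e P P"
    using orb_shift(2)[OF tm_psub[OF S(1,3) psubD(2)[OF S(3)]] sP] .
  then show "orb C s P P = unit_orb P" using S(8) unit_orb_eq[OF S(1,3)] by simp
qed

lemma orbit_category_sel:
  "Ob (orbit_category p C) = {(V, P). V \<in> Ob C \<and> p_subgroup p C V P}"
  "Mor (orbit_category p C) = orbit_of C ` Mor (transporter_category p C)"
  "ident (orbit_category p C) VP = orbit_of C (ident (transporter_category p C) VP)"
  "src (orbit_category p C) A = src (transporter_category p C) (SOME t. t \<in> A)"
  "tgt (orbit_category p C) A = tgt (transporter_category p C) (SOME t. t \<in> A)"
  "cmp (orbit_category p C) A B = {(cmp C t s, P, R) | t Q' R s P Q. (t, Q', R) \<in> A \<and> (s, P, Q) \<in> B}"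
proof -
  let ?T = "transporter_category p C"
  show "Ob (orbit_category p C) = {(V, P). V \<in> Ob C \<and> p_subgroup p C V P}"
    by (simp add: orbit_category_def Let_def transporter_category_def)
  show "Mor (orbit_category p C) = orbit_of C ` Mor ?T" "ident (orbit_category p C) VP = orbit_of C (ident ?T VP)"
    "src (orbit_category p C) A = src ?T (SOME t. t \<in> A)" "tgt (orbit_category p C) A = tgt ?T (SOME t. t \<in> A)"
    by (simp_all add: orbit_category_def Let_def)
  have T: "cmp ?T (t, Q', R) (s, P, Q) = (cmp C t s, P, R)" for t Q' R s P Q
    by (simp add: transporter_category_def)
  have "cmp (orbit_category p C) A B = {cmp ?T t s | t s. t \<in> A \<and> s \<in> B}"
    by (simp add: orbit_category_def Let_def)
  also have "\<dots> = {(cmp C t s, P, R) | t Q' R s P Q. (t, Q', R) \<in> A \<and> (s, P, Q) \<in> B}"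
  proof (intro equalityI subsetI)
    fix x assume "x \<in> {cmp ?T t s | t s. t \<in> A \<and> s \<in> B}"
    then obtain t s where ts: "t \<in> A" "s \<in> B" "x = cmp ?T t s" by blast
    obtain t0 Q' R where t: "t = (t0, Q', R)" by (rule prod_cases3)
    obtain s0 P Q where s: "s = (s0, P, Q)" by (rule prod_cases3)
    show "x \<in> {(cmp C t s, P, R) | t Q' R s P Q. (t, Q', R) \<in> A \<and> (s, P, Q) \<in> B}"
      using ts unfolding t s T by blast
  next
    fix x assume "x \<in> {(cmp C t s, P, R) | t Q' R s P Q. (t, Q', R) \<in> A \<and> (s, P, Q) \<in> B}"
    then show "x \<in> {cmp ?T t s | t s. t \<in> A \<and> s \<in> B}" using T[symmetric] by blast
  qed
  finally show "cmp (orbit_category p C) A B = {(cmp C t s, P, R) | t Q' R s P Q. (t, Q', R) \<in> A \<and> (s, P, Q) \<in> B}" .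
qed

lemma Mor_orbit: "A \<in> Mor (orbit_category p C) \<longleftrightarrow> (\<exists>e P f Q s. tm p e P f Q s \<and> A = orb C s P Q)"
proof
  assume "A \<in> Mor (orbit_category p C)"
  then obtain x where x: "x \<in> Mor (transporter_category p C)" "A = orbit_of C x"
    unfolding orbit_category_sel by blast
  obtain s P Q where "x = (s, P, Q)" by (rule prod_cases3)
  then obtain e f where "tm p e P f Q s" using x(1) Mor_transporter by blast
  then show "\<exists>e P f Q s. tm p e P f Q s \<and> A = orb C s P Q" using x(2) \<open>x = (s, P, Q)\<close> orbit_of_tm by blast
next
  assume "\<exists>e P f Q s. tm p e P f Q s \<and> A = orb C s P Q"
  then obtain e P f Q s where "tm p e P f Q s" "A = orb C s P Q" by blast
  then show "A \<in> Mor (orbit_category p C)"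
    unfolding orbit_category_sel using Mor_transporter orbit_of_tm by (metis image_eqI)
qed

lemma orb_src_tgt:
  assumes s: "tm p e P f Q s"
  shows "src (orbit_category p C) (orb C s P Q) = (src C e, P)" "tgt (orbit_category p C) (orb C s P Q) = (src C f, Q)"
proof -
  note S = tmD[OF s]
  have "(SOME t. t \<in> orb C s P Q) \<in> orb C s P Q" using orb_mem[OF s] by (rule someI)
  then obtain v where v: "v \<in> Q" "(SOME t. t \<in> orb C s P Q) = (cmp C v s, P, Q)" by (auto simp: orb_def)
  note V = tmD[OF orb_shift(1)[OF s v(1)]]
  show "src (orbit_category p C) (orb C s P Q) = (src C e, P)" "tgt (orbit_category p C) (orb C s P Q) = (src C f, Q)"
    unfolding orbit_category_sel v(2) using V(6,7) by (simp_all add: transporter_category_def)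
qed

lemma orb_cmp:
  assumes s: "tm p e P f Q s" and t: "tm p f Q g R t"
  shows "cmp (orbit_category p C) (orb C t Q R) (orb C s P Q) = orb C (cmp C t s) P R"
proof -
  note S = tmD[OF s] and T = tmD[OF t]
  show ?thesis
  proof (intro equalityI subsetI)
    fix x assume "x \<in> cmp (orbit_category p C) (orb C t Q R) (orb C s P Q)"
    then obtain w v where wv: "w \<in> R" "v \<in> Q" "x = (cmp C (cmp C w t) (cmp C v s), P, R)"
      unfolding orbit_category_sel orb_def by auto
    obtain w' where w': "w' \<in> R" "cmp C t v = cmp C w' t" using T(10)[OF wv(2)] by blast
    note wM = psub_Mor[OF T(2,4) wv(1)] and w'M = psub_Mor[OF T(2,4) w'(1)] and vM = psub_Mor[OF S(2,4) wv(2)]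
    have vs: "cmp C v s \<in> Mor C" "src C (cmp C v s) = src C e" "tgt C (cmp C v s) = src C f"
        using S(5-7) vM(1-3) by simp_all
    have ts: "cmp C t s \<in> Mor C" "src C (cmp C t s) = src C e" "tgt C (cmp C t s) = src C g" using S(5-7) T(5-7)
        by simp_all
    have "cmp C (cmp C w t) (cmp C v s) = cmp C w (cmp C t (cmp C v s))" using assoc[of w t "cmp C v s"] wM T vs
        by metis
    also have "cmp C t (cmp C v s) = cmp C (cmp C t v) s" using assoc[of t v s] S T vM by metis
    also have "\<dots> = cmp C w' (cmp C t s)" using assoc[of w' t s] w' S T w'M by metis
    also have "cmp C w \<dots> = cmp C (cmp C w w') (cmp C t s)" using assoc[of w w' "cmp C t s"] wM w'M ts by metis
    finally show "x \<in> orb C (cmp C t s) P R"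
      unfolding orb_def using wv(3) psubD(3)[OF T(4) wv(1) w'(1)] by (intro image_eqI[of _ _ "cmp C w w'"]) auto
  next
    fix x assume "x \<in> orb C (cmp C t s) P R"
    then obtain w where w: "w \<in> R" "x = (cmp C w (cmp C t s), P, R)" by (auto simp: orb_def)
    have "cmp C w (cmp C t s) = cmp C (cmp C w t) s" using assoc[of w t s] psub_Mor[OF T(2,4) w(1)] S T by metis
    moreover have "(cmp C w t, Q, R) \<in> orb C t Q R" using w(1) by (simp add: orb_def)
    ultimately show "x \<in> cmp (orbit_category p C) (orb C t Q R) (orb C s P Q)"
      unfolding orbit_category_sel using orb_mem[OF s] w(2) by blast
  qed
qed

lemma tm_unique:
  assumes "tm p e P f Q s" shows "e = sub_unit C P" "f = sub_unit C Q"
  using tmD(1-4)[OF assms] psub_iff by metis+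

lemma orbit_HomE:
  assumes "A \<in> Hom (orbit_category p C) x y"
  obtains e P f Q s where "tm p e P f Q s" "A = orb C s P Q" "x = (src C e, P)" "y = (src C f, Q)"
proof -
  have "A \<in> Mor (orbit_category p C)" using assms by (simp add: Hom_def)
  then obtain e P f Q s where s: "tm p e P f Q s" "A = orb C s P Q" unfolding Mor_orbit by blast
  have "src (orbit_category p C) A = x" "tgt (orbit_category p C) A = y" using assms by (simp_all add: Hom_def)
  then have "x = (src C e, P)" "y = (src C f, Q)" unfolding s(2) orb_src_tgt[OF s(1)] by simp_all
  then show ?thesis by (rule that[OF s])
qed

lemma orbit_ident:
  assumes "idem_endo C e" "psub p e P" shows "ident (orbit_category p C) (src C e, P) = orb C e P P"
  unfolding orbit_category_sel using orbit_of_tm[OF tm_psub[OF assms psubD(2)[OF assms(2)]]] psub_iff[OF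
      assms(1)] assms(2)
  by (simp add: transporter_category_def)

lemma orbit_finite_category: "finite_category (orbit_category p C)"
proof -
  let ?O = "orbit_category p C"
  have Ob: "(src C e, P) \<in> Ob ?O" if "idem_endo C e" "psub p e P" for e P
    using that(2) psub_iff[OF that(1)] idem_endoD[OF that(1)] src_closed unfolding orbit_category_sel by blast
  have ObE: "\<exists>e P. idem_endo C e \<and> psub p e P \<and> x = (src C e, P)" if xO: "x \<in> Ob ?O" for x
  proof -
    obtain V P where x: "x = (V, P)" "p_subgroup p C V P"
      using xO unfolding orbit_category_sel by (cases x) simp
    obtain e where "idem_endo C e" "src C e = V" "psub p e P" using p_subgroupE[OF x(2)] by metis
    then show ?thesis using x(1) by blast
  qed
  have Hom: "orb C s P Q \<in> Hom ?O (src C e, P) (src C f, Q)" if "tm p e P f Q s" for e P f Q s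
    using that Mor_orbit orb_src_tgt[OF that] unfolding Hom_def by blast
  \<comment> \<open>Composable orbits share the subgroup in the middle, and a subgroup determines
    its unit by \<open>tm_unique\<close>; hence their representatives are composable with the same
    \<open>f\<close> and \<open>Q\<close>.\<close>
  have comp2: "\<exists>e P f Q g R s t. tm p e P f Q s \<and> tm p f Q g R t \<and> A = orb C t Q R \<and> B = orb C s P Q \<and>
      x = (src C e, P) \<and> z = (src C g, R) \<and> y = (src C f, Q)"
    if A: "A \<in> Hom ?O y z" and B: "B \<in> Hom ?O x y" for A B x y z
  proof -
    obtain f Q g R t where t: "tm p f Q g R t" "A = orb C t Q R" "y = (src C f, Q)" "z = (src C g, R)"
        by (rule orbit_HomE[OF A])
    obtain e P f' Q' s where s: "tm p e P f' Q' s" "B = orb C s P Q'" "x = (src C e, P)" "y = (src C f', Q')"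
        by (rule orbit_HomE[OF B])
    have Q: "Q' = Q" using t(3) s(4) by simp
    then have "f' = f" using tm_unique(2)[OF s(1)] tm_unique(1)[OF t(1)] by simp
    then show ?thesis using s t Q by blast
  qed
  have "Mor (transporter_category p C) \<subseteq> Mor C \<times> (Pow (Mor C) \<times> Pow (Mor C))"
  proof
    fix x assume x: "x \<in> Mor (transporter_category p C)"
    obtain s P Q where xx: "x = (s, P, Q)" by (rule prod_cases3)
    then obtain e f where "tm p e P f Q s" using x Mor_transporter by blast
    note S = tmD[OF this]
    show "x \<in> Mor C \<times> (Pow (Mor C) \<times> Pow (Mor C))" using xx S(5) psub_Mor(1)[OF S(1,3)] psub_Mor(1)[OF S(2,4)] by blast
  qed
  then have fin: "finite (Mor ?O)"
    unfolding orbit_category_sel using finite_Mor by (meson finite_Pow_iff finite_SigmaI finite_imageI finite_subset)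
  show ?thesis
  proof (unfold_locales)
    show "finite (Mor ?O)" by (fact fin)
    show "src ?O A \<in> Ob ?O" if A: "A \<in> Mor ?O" for A
    proof -
      obtain e P f Q s where s: "tm p e P f Q s" "A = orb C s P Q" using A unfolding Mor_orbit by blast
      show ?thesis unfolding s(2) orb_src_tgt[OF s(1)] by (rule Ob[OF tmD(1,3)[OF s(1)]])
    qed
    show "tgt ?O A \<in> Ob ?O" if A: "A \<in> Mor ?O" for A
    proof -
      obtain e P f Q s where s: "tm p e P f Q s" "A = orb C s P Q" using A unfolding Mor_orbit by blast
      show ?thesis unfolding s(2) orb_src_tgt[OF s(1)] by (rule Ob[OF tmD(2,4)[OF s(1)]])
    qed
    show "ident ?O V \<in> Hom ?O V V" if V: "V \<in> Ob ?O" for V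
    proof -
      obtain e P where e: "idem_endo C e" "psub p e P" "V = (src C e, P)" using ObE[OF V] by blast
      show ?thesis unfolding e(3) orbit_ident[OF e(1,2)] by (rule Hom[OF tm_psub[OF e(1,2) psubD(2)[OF e(2)]]])
    qed
    show "cmp ?O A B \<in> Hom ?O V Z" if AB: "A \<in> Hom ?O W Z" "B \<in> Hom ?O V W" for A B V W Z
    proof -
      obtain e P f Q g R s t where st: "tm p e P f Q s" "tm p f Q g R t" "A = orb C t Q R" "B = orb C s P Q"
        "V = (src C e, P)" "Z = (src C g, R)" using comp2[OF AB] by blast
      show ?thesis unfolding st(3-6) orb_cmp[OF st(1,2)] by (rule Hom[OF tm_comp[OF st(1,2)]])
    qed
    show "cmp ?O (ident ?O W) A = A" if A: "A \<in> Hom ?O V W" for A V W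
    proof -
      obtain e P f Q s where s: "tm p e P f Q s" "A = orb C s P Q" "V = (src C e, P)" "W = (src C f, Q)"
          by (rule orbit_HomE[OF A])
      note S = tmD[OF s(1)]
      show ?thesis
        unfolding s(2,4) orbit_ident[OF S(2,4)] orb_cmp[OF s(1) tm_psub[OF S(2,4) psubD(2)[OF S(4)]]] S(9) ..
    qed
    show "cmp ?O A (ident ?O V) = A" if A: "A \<in> Hom ?O V W" for A V W
    proof -
      obtain e P f Q s where s: "tm p e P f Q s" "A = orb C s P Q" "V = (src C e, P)" "W = (src C f, Q)"
          by (rule orbit_HomE[OF A])
      note S = tmD[OF s(1)]
      show ?thesis
        unfolding s(2,3) orbit_ident[OF S(1,3)] orb_cmp[OF tm_psub[OF S(1,3) psubD(2)[OF S(3)]] s(1)] S(8) ..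
    qed
    show "cmp ?O (cmp ?O A B) D = cmp ?O A (cmp ?O B D)"
      if A: "A \<in> Hom ?O W Z" and B: "B \<in> Hom ?O V W" and D: "D \<in> Hom ?O U V" for A B D U V W Z
    proof -
      obtain e P f Q g R s t where st: "tm p e P f Q s" "tm p f Q g R t" "B = orb C t Q R" "D = orb C s P Q" "W
          = (src C g, R)"
        using comp2[OF B D] by blast
      obtain g' R' h S r where r: "tm p g' R' h S r" "A = orb C r R' S" "W = (src C g', R')" "Z = (src C h, S)"
          by (rule orbit_HomE[OF A])
      have RR: "R' = R" using st(5) r(3) by simp
      then have "g' = g" using tm_unique(2)[OF st(2)] tm_unique(1)[OF r(1)] by simp
      then have r1: "tm p g R h S r" "A = orb C r R S" using r RR by auto
      have "cmp C (cmp C r t) s = cmp C r (cmp C t s)" using assoc[of r t s] tmD[OF st(1)] tmD[OF st(2)] tmD[OF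
          r1(1)] by metis
      then show ?thesis
        unfolding st(3,4) r1(2) orb_cmp[OF st(2) r1(1)] orb_cmp[OF st(1,2)] orb_cmp[OF st(1) tm_comp[OF st(2) r1(1)]]
          orb_cmp[OF tm_comp[OF st(1,2)] r1(1)] by simp
    qed
  qed
qed

lemma unit_orb_idem:
  assumes e: "idem_endo C e" and P: "psub p e P"
  shows "idem_endo (orbit_category p C) (unit_orb P)" "src (orbit_category p C) (unit_orb P) = (src C e, P)"
proof -
  have t: "tm p e P e P e" by (rule tm_psub[OF e P psubD(2)[OF P]])
  show "src (orbit_category p C) (unit_orb P) = (src C e, P)" using orb_src_tgt(1)[OF t] unit_orb_eq[OF e P] by simp
  have "cmp C e e = e" using idem_endoD[OF e] by blast
  moreover have "orb C e P P \<in> Mor (orbit_category p C)" using Mor_orbit t by blast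
  ultimately show "idem_endo (orbit_category p C) (unit_orb P)"
    unfolding idem_endo_def unit_orb_eq[OF e P] orb_cmp[OF t t] orb_src_tgt[OF t] by simp
qed

lemma orb_idem_monoid:
  assumes e: "idem_endo C e" and P: "psub p e P"
  shows "A \<in> carrier (idem_monoid (orbit_category p C) (unit_orb P)) \<longleftrightarrow> (\<exists>n. tm p e P e P n \<and> A = orb C n P P)"
proof -
  interpret O: finite_category "orbit_category p C" by (rule orbit_finite_category)
  have t: "tm p e P e P e" by (rule tm_psub[OF e P psubD(2)[OF P]])
  note U = unit_orb_idem[OF e P]
  show ?thesis
  proof
    assume "A \<in> carrier (idem_monoid (orbit_category p C) (unit_orb P))"
    then have A: "A \<in> Hom (orbit_category p C) (src C e, P) (src C e, P)"
      unfolding O.idem_monoid_carrier[OF U(1)] U(2) Hom_def by blast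
    obtain e' P' f' Q' s where s: "tm p e' P' f' Q' s" "A = orb C s P' Q'" "(src C e, P) = (src C e', P')"
        "(src C e, P) = (src C f', Q')"
      by (rule orbit_HomE[OF A])
    have PQ: "P' = P" "Q' = P" using s(3,4) by simp_all
    have "e' = e" "f' = e" using tm_unique[OF s(1)] psub_iff[OF e] P PQ by auto
    then show "\<exists>n. tm p e P e P n \<and> A = orb C n P P" using s PQ by blast
  next
    assume "\<exists>n. tm p e P e P n \<and> A = orb C n P P"
    then obtain n where n: "tm p e P e P n" "A = orb C n P P" by blast
    note N = tmD[OF n(1)]
    show "A \<in> carrier (idem_monoid (orbit_category p C) (unit_orb P))"
      unfolding O.idem_monoid_carrier[OF U(1)] U(2) n(2)
      unfolding unit_orb_eq[OF e P] orb_cmp[OF n(1) t] orb_cmp[OF t n(1)] N(8,9) orb_src_tgt[OF n(1)]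
      using Mor_orbit n(1) by blast
  qed
qed

lemma tm_idem_monoid: "tm p e P e P n \<Longrightarrow> n \<in> carrier (idem_monoid C e)"
  using tmD(1,5-9)[of p e P e P n] idem_monoid_carrier by blast

text \<open>Both translations by the invertible \<open>n\<close> are injective, so the inclusion of
  \<open>n P\<close> in \<open>P n\<close> is an equality by counting. An equality can be conjugated
  back by \<open>m\<close>.\<close>

lemma tm_inverse:
  assumes n: "tm p e P e P n" "cmp C n m = e" "m \<in> carrier (idem_group C e)"
  shows "tm p e P e P m"
proof -
  note N = tmD[OF n(1)]
  note mM = idem_groupD[OF N(1) n(3)]
  have mn: "cmp C m n = e" using idem_one_sided(3)[OF N(1) tm_idem_monoid[OF n(1)] idem_group_sub[OF N(1) n(3)] n(2)] .
  have 1: "cmp C m (cmp C n u) = u" if "u \<in> P" for u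
    using cmp_collapse[OF mn, of u] psub_Mor[OF N(1,3) that] N(5-7) mM by metis
  have 2: "cmp C (cmp C u n) m = u" if "u \<in> P" for u
  proof -
    note uM = psub_Mor[OF N(1,3) that]
    have "cmp C (cmp C u n) m = cmp C u (cmp C n m)" by (rule assoc) (use uM(1,2) N(5-7) mM(1,3) in simp_all)
    then show ?thesis using n(2) uM(5) by simp
  qed
  have inj1: "inj_on (\<lambda>u. cmp C n u) P" by (rule inj_on_inverseI[where g = "cmp C m"]) (rule 1)
  have inj2: "inj_on (\<lambda>u. cmp C u n) P" by (rule inj_on_inverseI[where g = "\<lambda>u. cmp C u m"]) (rule 2)
  have fin: "finite P" by (rule psub_finite[OF N(1,3)])
  have im: "(\<lambda>u. cmp C n u) ` P = (\<lambda>u. cmp C u n) ` P"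
  proof (rule card_subset_eq)
    show "(\<lambda>u. cmp C n u) ` P \<subseteq> (\<lambda>u. cmp C u n) ` P" using N(10) by blast
  qed (use fin in \<open>simp_all add: card_image[OF inj1] card_image[OF inj2]\<close>)
  have "\<exists>v \<in> P. cmp C m u = cmp C v m" if u: "u \<in> P" for u
  proof -
    obtain v where v: "v \<in> P" "cmp C u n = cmp C n v" using im u by blast
    note uM = psub_Mor[OF N(1,3) u] and vM = psub_Mor[OF N(1,3) v(1)]
    have nv: "cmp C n v \<in> Mor C" "tgt C (cmp C n v) = src C e" "src C (cmp C n v) = src C e"
        using N(5-7) vM(1-3) by simp_all
    have "cmp C m u = cmp C m (cmp C (cmp C u n) m)" using 2[OF u] by simp
    also have "\<dots> = cmp C (cmp C m (cmp C n v)) m" using assoc[of m "cmp C n v" m] nv mM v(2) by metis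
    also have "cmp C m (cmp C n v) = v" by (rule 1[OF v(1)])
    finally show ?thesis using v(1) by blast
  qed
  then show ?thesis unfolding tm_def using N(1,3) mM by blast
qed

text \<open>This group is \<open>N(P)/P\<close> inside \<open>G\<^sub>e\<close>. If the orbit of
  \<open>n\<close> has the orbit of \<open>m\<close> as inverse, then \<open>n m\<close> lies in
  \<open>P\<close> and is a unit, so \<open>n\<close> is itself a unit of \<open>E e\<close>. Hence
  nothing outside \<open>G\<^sub>e\<close> can contribute, although \<open>C\<close> may have many
  more endomorphisms.\<close>

lemma orb_idem_group:
  assumes e: "idem_endo C e" and P: "psub p e P"
  shows "carrier (idem_group (orbit_category p C) (unit_orb P)) =
    {orb C n P P | n. tm p e P e P n \<and> n \<in> carrier (idem_group C e)}"
proof -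
  interpret O: finite_category "orbit_category p C" by (rule orbit_finite_category)
  note U = unit_orb_idem[OF e P] and M = orb_idem_monoid[OF e P]
  show ?thesis
  proof (intro equalityI subsetI)
    fix A assume A: "A \<in> carrier (idem_group (orbit_category p C) (unit_orb P))"
    obtain B where B: "B \<in> carrier (idem_group (orbit_category p C) (unit_orb P))" "cmp (orbit_category p C) A B
        = unit_orb P"
      using O.idem_group_inverse[OF U(1) A] by metis
    obtain n where n: "tm p e P e P n" "A = orb C n P P" using M O.idem_group_sub[OF U(1) A] by blast
    obtain m where m: "tm p e P e P m" "B = orb C m P P" using M O.idem_group_sub[OF U(1) B(1)] by blast
    have "cmp C n m \<in> P" using B(2) orb_unit_iff[OF tm_comp[OF m(1) n(1)]] orb_cmp[OF m(1) n(1)] n(2) m(2) by simp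
    then have "n \<in> carrier (idem_group C e)"
      using idem_group_factors(1)[OF e tm_idem_monoid[OF n(1)] tm_idem_monoid[OF m(1)]] psubD(1)[OF P] by blast
    then show "A \<in> {orb C n P P | n. tm p e P e P n \<and> n \<in> carrier (idem_group C e)}" using n by blast
  next
    fix A assume "A \<in> {orb C n P P | n. tm p e P e P n \<and> n \<in> carrier (idem_group C e)}"
    then obtain n where n: "tm p e P e P n" "n \<in> carrier (idem_group C e)" "A = orb C n P P" by blast
    obtain m where m: "m \<in> carrier (idem_group C e)" "cmp C n m = e" using idem_group_inverse[OF e n(2)] by metis
    have tmm: "tm p e P e P m" by (rule tm_inverse[OF n(1) m(2,1)])
    have "cmp (orbit_category p C) A (orb C m P P) = unit_orb P"
      unfolding n(3) orb_cmp[OF tmm n(1)] m(2) unit_orb_eq[OF e P] ..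
    then show "A \<in> carrier (idem_group (orbit_category p C) (unit_orb P))"
      using O.idem_one_sided(1)[OF U(1)] M n(1,3) tmm by blast
  qed
qed

text \<open>Up to isomorphism every idempotent of the orbit category is an identity: replace \<open>(V, P)\<close>
  by \<open>(V, f P)\<close> for an idempotent representative \<open>f\<close>.\<close>

lemma orbit_idem_reduce:
  assumes p: "Factorial_Ring.prime p" and d: "idem_endo (orbit_category p C) d"
  shows "\<exists>f Q S T. idem_endo C f \<and> psub p f Q \<and> idem_iso (orbit_category p C) d (unit_orb Q) S T \<and>
    (EI C \<longrightarrow> d = unit_orb Q)"
proof -
  interpret O: finite_category "orbit_category p C" by (rule orbit_finite_category)
  note dD = idem_endoD[OF d]
  have "d \<in> Mor (orbit_category p C)" using dD by blast
  then obtain e P e' P' s where s0: "tm p e P e' P' s" "d = orb C s P P'" unfolding Mor_orbit by blast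
  have PP: "P' = P" using dD orb_src_tgt[OF s0(1)] s0(2) by simp
  then have "e' = e" using tm_unique[OF s0(1)] by simp
  then have s: "tm p e P e P s" "d = orb C s P P" using s0 PP by auto
  note S = tmD[OF s(1)]
  have e: "idem_endo C e" and P: "psub p e P" using S by auto
  have "orb C s P P = orb C (cmp C s s) P P" using dD orb_cmp[OF s(1,1)] s(2) by simp
  \<comment> \<open>Idempotence in the orbit category only says that \<open>s s\<close> equals
    \<open>s\<close> up to a factor from \<open>P\<close>.\<close>
  then obtain v where v: "v \<in> P" "cmp C s s = cmp C v s"
    using orb_eqD(3)[OF s(1) tm_comp[OF s(1,1)]] by blast
  define M where "M = idem_monoid C e"
  interpret M: monoid M unfolding M_def by (rule idem_monoid[OF e])
  have Mm: "monoid.mult M = cmp C" "\<one>\<^bsub>M\<^esub> = e" by (simp_all add: M_def idem_monoid_def)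
  have sM: "s \<in> carrier M" unfolding M_def by (rule tm_idem_monoid[OF s(1)])
  \<comment> \<open>All positive powers of \<open>s\<close> stay in \<open>P s\<close>, so each of
    them represents \<open>d\<close>; an idempotent power is then an idempotent
    representative.\<close>
  have pow: "\<exists>w \<in> P. s [^]\<^bsub>M\<^esub> Suc n = cmp C w s" for n :: nat
  proof (induction n)
    case 0
    have "s [^]\<^bsub>M\<^esub> Suc 0 = cmp C e s" using sM M.l_one[OF sM] by (simp add: Mm)
    then show ?case using psubD(2)[OF P] by blast
  next
    case (Suc n)
    then obtain w where w: "w \<in> P" "s [^]\<^bsub>M\<^esub> Suc n = cmp C w s" by blast
    note wM = psub_Mor[OF e P w(1)] and vM = psub_Mor[OF e P v(1)]
    have "s [^]\<^bsub>M\<^esub> Suc (Suc n) = cmp C (s [^]\<^bsub>M\<^esub> Suc n) s" by (simp only: M.nat_pow_Suc Mm)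
    also have "\<dots> = cmp C (cmp C w s) s" unfolding w(2) ..
    also have "\<dots> = cmp C w (cmp C v s)" using assoc[of w s s] wM S(5-7) v(2) by metis
    also have "\<dots> = cmp C (cmp C w v) s" using assoc[of w v s] wM vM S(5-7) by metis
    finally show ?case using psubD(3)[OF P w(1) v(1)] by blast
  qed
  have "finite (carrier M)" unfolding M_def by (rule finite_idem_monoid[OF e])
  then obtain n :: nat where n: "n > 0" "(s [^]\<^bsub>M\<^esub> n) \<otimes>\<^bsub>M\<^esub> (s [^]\<^bsub>M\<^esub> n) = s [^]\<^bsub>M\<^esub> n"
    using finite_monoid_idem_power[OF M.monoid_axioms _ sM] by blast
  define f where "f = s [^]\<^bsub>M\<^esub> n"
  have ff: "cmp C f f = f" using n(2) by (simp add: f_def Mm)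
  obtain k where k: "n = Suc k" using n(1) by (cases n) auto
  obtain w where w: "w \<in> P" "f = cmp C w s" using pow[of k] unfolding f_def k by blast
  have ftm: "tm p e P e P f" and fd: "d = orb C f P P" using orb_shift[OF s(1) w(1)] w(2) s(2) by auto
  note FD = tmD[OF ftm]
  have f: "idem_endo C f" using FD(5-7) ff by (simp add: idem_endo_def)
  have srcf: "src C f = src C e" using FD(6) .
  \<comment> \<open>On \<open>P\<close> the map \<open>u \<mapsto> f u\<close> is a homomorphism,
    because \<open>f u\<close> absorbs \<open>f\<close> on the right. Its image \<open>Q\<close> is
    a group with unit \<open>f\<close>.\<close>
  define Q where "Q = cmp C f ` P"
  have uP: "cmp C f u \<in> Mor C" "src C (cmp C f u) = src C e" "tgt C (cmp C f u) = src C e" if "u \<in> P" for u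
    using psub_Mor(1-3)[OF e P that] FD(5-7) by simp_all
  have ffu: "cmp C f (cmp C f u) = cmp C f u" if "u \<in> P" for u
    using idem_absorb(1)[OF f psub_Mor(1)[OF e P that]] psub_Mor(3)[OF e P that] srcf by simp
  have fuf: "cmp C (cmp C f u) f = cmp C f u" if u: "u \<in> P" for u
  proof -
    obtain u' where u': "u' \<in> P" "cmp C f u = cmp C u' f" using FD(10)[OF u] by blast
    show ?thesis unfolding u'(2) using idem_absorb(2)[OF f psub_Mor(1)[OF e P u'(1)]] psub_Mor(2)[OF e P u'(1)]
        srcf by simp
  qed
  have hom: "cmp C (cmp C f u) (cmp C f v) = cmp C f (cmp C u v)" if "u \<in> P" "v \<in> P" for u v
  proof -
    note uM = psub_Mor[OF e P that(1)] and vM = psub_Mor[OF e P that(2)]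
    have "cmp C (cmp C f u) (cmp C f v) = cmp C (cmp C (cmp C f u) f) v"
      using assoc[of "cmp C f u" f v] uP[OF that(1)] vM FD(5-7) by metis
    then show ?thesis using fuf[OF that(1)] assoc[of f u v] uM vM FD(5-7) by metis
  qed
  have fe: "cmp C f e = f" by (rule FD(8))
  have QE: "x \<in> carrier (idem_monoid C f)" if x: "x \<in> Q" for x
  proof -
    obtain u where u: "u \<in> P" "x = cmp C f u" using x by (auto simp: Q_def)
    show ?thesis unfolding idem_monoid_carrier[OF f] srcf u(2) using uP[OF u(1)] ffu[OF u(1)] fuf[OF u(1)] by blast
  qed
  have QG: "x \<in> carrier (idem_group C f)" if x: "x \<in> Q" for x
  proof -
    obtain u where u: "u \<in> P" "x = cmp C f u" using x by (auto simp: Q_def)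
    obtain u' where u': "u' \<in> P" "cmp C u u' = e" using psub_inverse[OF e P u(1)] by metis
    have "cmp C x (cmp C f u') = f" using hom[OF u(1) u'(1)] u'(2) u(2) fe by simp
    then show ?thesis using idem_one_sided(1)[OF f QE[OF x] QE] u'(1) by (auto simp: Q_def)
  qed
  have Qc: "cmp C x y \<in> Q" if "x \<in> Q" "y \<in> Q" for x y
    using that hom psubD(3)[OF P] by (auto simp: Q_def)
  have fQ: "f \<in> Q" unfolding Q_def using psubD(2)[OF P] fe by (metis image_eqI)
  have "\<exists>k. card Q = p ^ k"
  proof -
    have fin: "finite P" by (rule psub_finite[OF e P])
    \<comment> \<open>All fibres of the homomorphism from \<open>P\<close> onto \<open>Q\<close> are
      translates of the fibre over \<open>f\<close>, so the order of \<open>Q\<close> divides that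
      of \<open>P\<close> and is a power of \<open>p\<close>.\<close>
    have "card P = (\<Sum>q \<in> Q. card {u \<in> P. cmp C f u = q})"
      unfolding Q_def using sum.image_gen[OF fin, of "\<lambda>_. 1::nat" "cmp C f"] by simp
    also have "\<dots> = (\<Sum>q \<in> Q. card {u \<in> P. cmp C f u = f})"
    proof (intro sum.cong refl)
      fix q assume "q \<in> Q"
      then obtain u where u: "u \<in> P" "q = cmp C f u" by (auto simp: Q_def)
      obtain u' where u': "u' \<in> P" "cmp C u u' = e" "cmp C u' u = e" using psub_inverse[OF e P u(1)] by metis
      note uM = psub_Mor[OF e P u(1)] and u'M = psub_Mor[OF e P u'(1)]
      have c1: "cmp C u' (cmp C u x) = x" if "x \<in> P" for x
        using cmp_collapse[OF u'(3), of x] psub_Mor[OF e P that] uM u'M by metis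
      have c2: "cmp C u (cmp C u' x) = x" if "x \<in> P" for x
        using cmp_collapse[OF u'(2), of x] psub_Mor[OF e P that] uM u'M by metis
      have b: "bij_betw (cmp C u) {x \<in> P. cmp C f x = f} {x \<in> P. cmp C f x = q}"
      proof (rule bij_betw_byWitness[where f' = "cmp C u'"])
        show "\<forall>x\<in>{x \<in> P. cmp C f x = f}. cmp C u' (cmp C u x) = x" using c1 by blast
        show "\<forall>x\<in>{x \<in> P. cmp C f x = q}. cmp C u (cmp C u' x) = x" using c2 by blast
        show "cmp C u ` {x \<in> P. cmp C f x = f} \<subseteq> {x \<in> P. cmp C f x = q}"
        proof
          fix y assume "y \<in> cmp C u ` {x \<in> P. cmp C f x = f}"
          then obtain x where x: "x \<in> P" "cmp C f x = f" "y = cmp C u x" by blast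
          have "cmp C f y = cmp C (cmp C f u) f" using hom[OF u(1) x(1)] x(2,3) by simp
          then show "y \<in> {x \<in> P. cmp C f x = q}" using fuf[OF u(1)] u x psubD(3)[OF P] by simp
        qed
        show "cmp C u' ` {x \<in> P. cmp C f x = q} \<subseteq> {x \<in> P. cmp C f x = f}"
        proof
          fix y assume "y \<in> cmp C u' ` {x \<in> P. cmp C f x = q}"
          then obtain x where x: "x \<in> P" "cmp C f x = q" "y = cmp C u' x" by blast
          have "cmp C f y = cmp C (cmp C f u') (cmp C f u)" using hom[OF u'(1) x(1)] x(2,3) u(2) by simp
          also have "\<dots> = f" using hom[OF u'(1) u(1)] u'(3) fe by simp
          finally show "y \<in> {x \<in> P. cmp C f x = f}" using x u' psubD(3)[OF P] by simp
        qed
      qed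
      show "card {u \<in> P. cmp C f u = q} = card {u \<in> P. cmp C f u = f}" using bij_betw_same_card[OF b] by simp
    qed
    finally have "card Q dvd card P" by simp
    moreover obtain k where "card P = p ^ k" using P by (auto simp: psub_def)
    ultimately show ?thesis using divides_primepow_nat[OF p] by metis
  qed
  then have Q: "psub p f Q" unfolding psub_def using QG Qc fQ by blast
  have "\<exists>v \<in> Q. cmp C f u = cmp C v f" if u: "u \<in> P" for u
    using fuf[OF u] u unfolding Q_def by (metis image_eqI)
  \<comment> \<open>The single morphism \<open>f\<close> represents the isomorphism between
    \<open>d\<close> and the identity of \<open>(V, Q)\<close> in both directions.\<close>
  then have s1: "tm p e P f Q f"
    unfolding tm_def using e f P Q FD(5-8) ff srcf by simp
  have "\<exists>v \<in> P. cmp C f x = cmp C v f" if x: "x \<in> Q" for x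
  proof -
    obtain u where u: "u \<in> P" "x = cmp C f u" using x by (auto simp: Q_def)
    show ?thesis using FD(10)[OF u(1)] ffu[OF u(1)] u(2) by simp
  qed
  then have s2: "tm p f Q e P f"
    unfolding tm_def using e f P Q FD(5-9) ff srcf by simp
  have uQ: "unit_orb Q = orb C f Q Q" by (rule unit_orb_eq[OF f Q])
  have tQ: "tm p f Q f Q f" by (rule tm_psub[OF f Q fQ])
  have "idem_iso (orbit_category p C) d (unit_orb Q) (orb C f P Q) (orb C f Q P)"
    unfolding idem_iso_def uQ fd orb_cmp[OF ftm s1] orb_cmp[OF s1 tQ] orb_cmp[OF tQ s2] orb_cmp[OF s2 ftm]
      orb_cmp[OF s1 s2] orb_cmp[OF s2 s1] ff orb_src_tgt[OF s1] orb_src_tgt[OF s2] orb_src_tgt[OF ftm]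
          orb_src_tgt[OF tQ]
    using Mor_orbit s1 s2 by blast
  \<comment> \<open>In an EI-category an idempotent endomorphism is an identity, so
    \<open>f = e\<close> and the replacement changes nothing.\<close>
  moreover have "d = unit_orb Q" if ei: "EI C"
  proof -
    have fe': "f = e" using EI_idem(1)[OF ei f] EI_idem(1)[OF ei e] srcf by simp
    moreover have "Q = P" unfolding Q_def fe' using psub_Mor(4)[OF e P] by simp
    ultimately show ?thesis using fd uQ by simp
  qed
  ultimately show ?thesis using f Q by blast
qed

end


section \<open>Weights\<close>

lemma module_iso_twist_iff:
  assumes \<psi>: "\<psi> \<in> ring_iso A B" and T: "left_module A T"
  shows "module_iso B (twist A \<psi> T) T' \<longleftrightarrow> semi_iso A \<psi> T T'"
proof
  note \<psi>D = ring_isoD[OF \<psi>]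
  have tw: "semi_iso A \<psi> T (twist A \<psi> T)" by (rule semi_iso_twist[OF \<psi>D(6)])
  show "semi_iso A \<psi> T T'" if "module_iso B (twist A \<psi> T) T'"
    by (rule semi_iso_comp[OF tw that[unfolded module_iso_iff]]) (use \<psi>D(1) in auto)
  show "module_iso B (twist A \<psi> T) T'" if "semi_iso A \<psi> T T'"
    unfolding module_iso_iff
    by (rule semi_iso_comp[OF semi_iso_inv[OF tw T, of B "inv_into (carrier A) \<psi>"] that]) (use \<psi>D(7,8) in auto)
qed

context finite_category begin

lemma Aut_cat_id: "(id, id) \<in> Aut_cat C"
proof -
  have "is_endofunctor C (id, id)" by (simp add: is_endofunctor_def)
  then show ?thesis unfolding Aut_cat_def by (intro CollectI conjI exI[of _ "(id, id)"]) simp_all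
qed

lemma group_algebra_ring: "idem_endo C e \<Longrightarrow> ring (group_algebra (idem_group C e) :: ('b \<Rightarrow> 'k::field) ring)"
  unfolding group_algebra_def by (rule finite_category.cat_ring[OF idem_group_category])

text \<open>The weight \<open>w'\<close> is isomorphic to the translate of \<open>w\<close> under \<open>(\<sigma>, F)\<close>.\<close>

definition wrel :: "('k::field \<Rightarrow> 'k) \<Rightarrow> ('a, 'b) endofunctor \<Rightarrow> ('b, 'k) weight \<Rightarrow> ('b, 'k) weight \<Rightarrow> bool" where
  "wrel \<sigma> F w w' \<longleftrightarrow> is_weight C w \<and> is_weight C w' \<and> (\<exists>s t. idem_iso C (snd F (fst w)) (fst w') s t \<and>
     semi_iso (group_algebra (idem_group C (fst w)))
       (semilin_ext \<sigma> (carrier (idem_group C (fst w))) (transport F s t)) (snd w) (snd w'))"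

definition wcls :: "('b, 'k::field) weight \<Rightarrow> ('b, 'k) weight set" where
  "wcls w = {w'. wrel id (id, id) w w'}"

lemma idem_hom_iff:
  assumes e: "idem_endo C e" and f: "idem_endo C f"
  shows "s \<in> {cmp C f (cmp C x e) | x. x \<in> Hom C (src C e) (src C f)} \<longleftrightarrow>
    s \<in> Mor C \<and> src C s = src C e \<and> tgt C s = src C f \<and> cmp C s e = s \<and> cmp C f s = s"
proof
  note eD = idem_endoD[OF e] and fD = idem_endoD[OF f]
  assume "s \<in> {cmp C f (cmp C x e) | x. x \<in> Hom C (src C e) (src C f)}"
  then obtain x where x: "x \<in> Mor C" "src C x = src C e" "tgt C x = src C f" "s = cmp C f (cmp C x e)"
    by (auto simp: Hom_def)
  have xe: "cmp C x e \<in> Mor C" "src C (cmp C x e) = src C e" "tgt C (cmp C x e) = src C f"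
    using x(1-3) eD by simp_all
  have "cmp C f s = s" unfolding x(4) using idem_absorb(1)[OF f xe(1,3)] .
  moreover have "cmp C s e = cmp C f (cmp C (cmp C x e) e)" unfolding x(4) using assoc[of f
      "cmp C x e" e] xe eD fD by metis
  moreover have "cmp C (cmp C x e) e = cmp C x e" by (rule idem_absorb(2)[OF e x(1,2)])
  moreover have "s \<in> Mor C \<and> src C s = src C e \<and> tgt C s = src C f" unfolding x(4) using xe fD by simp
  ultimately show "s \<in> Mor C \<and> src C s = src C e \<and> tgt C s = src C f \<and> cmp C s e = s \<and> cmp C f s = s"
    using x(4) by simp
next
  assume *: "s \<in> Mor C \<and> src C s = src C e \<and> tgt C s = src C f \<and> cmp C s e = s \<and> cmp C f s = s"
  then have "s = cmp C f (cmp C s e)" "s \<in> Hom C (src C e) (src C f)" by (simp_all add: Hom_def)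
  then show "s \<in> {cmp C f (cmp C x e) | x. x \<in> Hom C (src C e) (src C f)}" by blast
qed

lemma is_weightD:
  assumes "is_weight C w"
  shows "idem_endo C (fst w)" "simple_module (group_algebra (idem_group C (fst w))) (snd w)"
    "projective_module (group_algebra (idem_group C (fst w))) (snd w)"
    "left_module (group_algebra (idem_group C (fst w))) (snd w)"
proof -
  obtain e T where "w = (e, T)" by (cases w)
  then show "idem_endo C (fst w)" and s: "simple_module (group_algebra (idem_group C (fst w))) (snd w)"
    and "projective_module (group_algebra (idem_group C (fst w))) (snd w)" using assms by auto
  show "left_module (group_algebra (idem_group C (fst w))) (snd w)" by (rule simple_module_left[OF s])
qed

text \<open>Isomorphism of weights becomes the case \<open>\<sigma> = id\<close>,
  \<open>F = id\<close> of \<open>wrel\<close>, so that actions and isomorphisms can be composed by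
  the same lemmas.\<close>

lemma weight_iso_rel_eq: "weight_iso_rel C = {(w, w'). wrel id (id, id) w w'}"
proof -
  have "weights_isomorphic C w w' \<longleftrightarrow> (\<exists>s t. idem_iso C (snd (id, id) (fst w)) (fst w') s t \<and>
     semi_iso (group_algebra (idem_group C (fst w)))
       (semilin_ext id (carrier (idem_group C (fst w))) (transport (id, id) s t)) (snd w) (snd w'))"
    if w: "is_weight C w" and w': "is_weight C w'" for w w' :: "('b, 'k::field) weight"
  proof -
    obtain e T where eT: "w = (e, T)" by (cases w)
    obtain f T' where fT': "w' = (f, T')" by (cases w')
    have e: "idem_endo C e" and f: "idem_endo C f" using w w' eT fT' by auto
    have lT: "left_module (group_algebra (idem_group C e)) T" using is_weightD(4)[OF w] eT by simp
    have tr: "transport (id, id) s t = (\<lambda>x. cmp C s (cmp C x t))" for s t by (auto simp: transport_def)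
    have m: "module_iso (group_algebra (idem_group C f))
          (twist (group_algebra (idem_group C e))
             (semilin_ext id (carrier (idem_group C e)) (\<lambda>x. cmp C s (cmp C x t))) T) T' \<longleftrightarrow>
        semi_iso (group_algebra (idem_group C e)) (semilin_ext id (carrier (idem_group C e)) (transport (id, id)
            s t)) T T'"
      if "idem_iso C e f s t" for s t
      using module_iso_twist_iff[OF transport_ring_iso[OF field_aut_id Aut_cat_id e f] lT] that unfolding tr by simp
    define S where "S = {cmp C f (cmp C x e) | x. x \<in> Hom C (src C e) (src C f)}"
    define S' where "S' = {cmp C e (cmp C x f) | x. x \<in> Hom C (src C f) (src C e)}"
    have i: "idem_iso C e f s t \<longleftrightarrow> s \<in> S \<and> t \<in> S' \<and> cmp C t s = e \<and> cmp C s t = f" for s t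
      unfolding S_def S'_def idem_hom_iff[OF e f] idem_hom_iff[OF f e] idem_iso_def by blast
    show ?thesis
    proof -
      have "weights_isomorphic C w w' \<longleftrightarrow> (\<exists>s t. (s \<in> S \<and> t \<in> S' \<and> cmp C t s = e \<and> cmp C s t = f) \<and>
          module_iso (group_algebra (idem_group C f))
            (twist (group_algebra (idem_group C e))
               (semilin_ext id (carrier (idem_group C e)) (\<lambda>x. cmp C s (cmp C x t))) T) T')"
        unfolding eT fT' weights_isomorphic.simps S_def S'_def by (simp only: Bex_def) blast
      also have "\<dots> \<longleftrightarrow> (\<exists>s t. idem_iso C e f s t \<and>
          semi_iso (group_algebra (idem_group C e)) (semilin_ext id (carrier (idem_group C e)) (transport (id,
              id) s t)) T T')"
        unfolding i[symmetric] using m by blast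
      finally show ?thesis unfolding eT fT' by simp
    qed
  qed
  then show ?thesis unfolding weight_iso_rel_def wrel_def by blast
qed

text \<open>Simplicity and projectivity travel along the semilinear isomorphism, so a new weight
  only requires a target idempotent and a module over its group algebra.\<close>

lemma wrel_intro:
  assumes \<sigma>: "field_aut \<sigma>" and F: "F \<in> Aut_cat C" and w: "is_weight C (e, T)" and f: "idem_endo C f"
    and st: "idem_iso C (snd F e) f s t" and T': "left_module (group_algebra (idem_group C f)) T'"
    and iso: "semi_iso (group_algebra (idem_group C e)) (semilin_ext \<sigma> (carrier (idem_group C e)) (transport F s
        t)) T T'"
  shows "is_weight C (f, T')" "wrel \<sigma> F (e, T) (f, T')"
proof -
  have e: "idem_endo C e" using w by simp
  note r = transport_ring_iso[OF \<sigma> F e f st]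
  show w': "is_weight C (f, T')"
    using f simple_semi_iso[OF _ iso T'] projective_semi_iso[OF _ iso T' r] w ring_isoD(1)[OF r] by simp
  show "wrel \<sigma> F (e, T) (f, T')" unfolding wrel_def using w w' st iso by auto
qed

lemma wrel_exists:
  assumes \<sigma>: "field_aut \<sigma>" and F: "F \<in> Aut_cat C" and w: "is_weight C (e, T)" and f: "idem_endo C f"
    and st: "idem_iso C (snd F e) f s t"
  shows "wrel \<sigma> F (e, T) (f, twist (group_algebra (idem_group C e))
    (semilin_ext \<sigma> (carrier (idem_group C e)) (transport F s t)) T)"
proof -
  have e: "idem_endo C e" using w by simp
  note r = transport_ring_iso[OF \<sigma> F e f st]
  have "left_module (group_algebra (idem_group C e)) T" using is_weightD(4)[OF w] by simp
  then show ?thesis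
    using wrel_intro(2)[OF \<sigma> F w f st twist_left_module[OF r _ group_algebra_ring[OF f]] semi_iso_twist[OF
        ring_isoD(6)[OF r]]] by blast
qed

text \<open>Both witnesses are \<open>F(e)\<close>, the unit of \<open>G\<close> at
  \<open>F(e)\<close>; conjugating by it changes nothing, which recovers the plain twist that
  defines the action.\<close>

lemma wrel_twist:
  assumes \<sigma>: "field_aut \<sigma>" and F: "F \<in> Aut_cat C" and w: "is_weight C w"
  shows "wrel \<sigma> F w (weight_twist C \<sigma> F w)"
proof -
  obtain e T where eT: "w = (e, T)" by (cases w)
  have e: "idem_endo C e" using w eT by simp
  note Fe = aut_idem_endo[OF F e]
  have "transport F (snd F e) (snd F e) x = snd F x" if "x \<in> carrier (idem_group C e)" for x
    using idem_groupD[OF Fe aut_idem_group[OF F e that]] by (simp add: transport_def)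
  then have "semilin_ext \<sigma> (carrier (idem_group C e)) (transport F (snd F e) (snd F e))
      = semilin_ext \<sigma> (carrier (idem_group C e)) (snd F)"
    by (rule semilin_cong)
  then show ?thesis using wrel_exists[OF \<sigma> F w[unfolded eT] Fe idem_iso_refl[OF Fe]] unfolding eT by simp
qed

text \<open>Witnesses compose as \<open>u H(s)\<close> and \<open>H(t) v\<close>, and with these the
  transport of the composite functor is the composite of the two transports.\<close>

lemma wrel_comp:
  assumes \<sigma>: "field_aut \<sigma>" and \<tau>: "field_aut \<tau>" and F: "F \<in> Aut_cat C" and H: "H \<in> Aut_cat C"
    and w1: "wrel \<sigma> F w w'" and w2: "wrel \<tau> H w' w''"
  shows "wrel (\<tau> \<circ> \<sigma>) (fst H \<circ> fst F, snd H \<circ> snd F) w w''"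
proof -
  define e f g where "e = fst w" and "f = fst w'" and "g = fst w''"
  have W: "is_weight C w" "is_weight C w'" "is_weight C w''" using w1 w2 by (auto simp: wrel_def)
  have e: "idem_endo C e" and f: "idem_endo C f" and g: "idem_endo C g"
    unfolding e_def f_def g_def using W is_weightD(1) by blast+
  obtain s t where st: "idem_iso C (snd F e) f s t"
    "semi_iso (group_algebra (idem_group C e)) (semilin_ext \<sigma> (carrier (idem_group C e)) (transport F s t)) (snd
        w) (snd w')"
    using w1 unfolding wrel_def e_def f_def by blast
  obtain u v where uv: "idem_iso C (snd H f) g u v"
    "semi_iso (group_algebra (idem_group C f)) (semilin_ext \<tau> (carrier (idem_group C f)) (transport H u v)) (snd
        w') (snd w'')"
    using w2 unfolding wrel_def f_def g_def by blast
  note Fe = aut_idem_endo[OF F e] and Hf = aut_idem_endo[OF H f]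
  note HFe = aut_idem_endo[OF H Fe]
  note Hst = aut_idem_iso[OF H Fe f st(1)]
  define s' t' where "s' = cmp C u (snd H s)" and "t' = cmp C (snd H t) v"
  have iso: "idem_iso C (snd H (snd F e)) g s' t'" unfolding s'_def t'_def
      by (rule idem_iso_trans[OF HFe Hf g Hst uv(1)])
  note D = idem_isoD[OF st(1)] and D' = idem_isoD[OF uv(1)] and DH = idem_isoD[OF Hst]
  have tr: "transport (fst H \<circ> fst F, snd H \<circ> snd F) s' t' x = (transport H u v \<circ> transport F s t) x"
    if x: "x \<in> carrier (idem_group C e)" for x
  proof -
    define y where "y = snd F x"
    have y: "y \<in> Mor C" "src C y = src C (snd F e)" "tgt C y = src C (snd F e)"
      unfolding y_def using idem_groupD[OF Fe aut_idem_group[OF F e x]] by auto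
    have Hy: "snd H y \<in> Mor C" "src C (snd H y) = src C (snd H (snd F e))" "tgt C (snd H y) = src C (snd H (snd F e))"
      using autD(3-5)[OF H] y D(1) idem_endoD[OF Fe] by auto
    have yt: "cmp C y t \<in> Mor C" "src C (cmp C y t) = src C f" "tgt C (cmp C y t) = src C (snd F e)"
      using y D by simp_all
    have Hyt: "cmp C (snd H y) (snd H t) \<in> Mor C" "src C (cmp C (snd H y) (snd H t)) = src C (snd H f)"
        "tgt C (cmp C (snd H y) (snd H t)) = src C (snd H (snd F e))"
      using Hy DH by simp_all
    have "snd H (cmp C s (cmp C y t)) = cmp C (snd H s) (cmp C (snd H y) (snd H t))"
      using autD(6)[OF H, of s "cmp C y t"] autD(6)[OF H, of y t] y D yt by simp
    then have "(transport H u v \<circ> transport F s t) x = cmp C u (cmp C (cmp C (snd H s) (cmp C (snd H y) (snd H t))) v)"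
      by (simp add: transport_def y_def)
    also have "cmp C (cmp C (snd H s) (cmp C (snd H y) (snd H t))) v
        = cmp C (snd H s) (cmp C (cmp C (snd H y) (snd H t)) v)"
      using assoc[of "snd H s" "cmp C (snd H y) (snd H t)" v] Hyt DH(1-3) D'(6-8) by metis
    also have "cmp C (cmp C (snd H y) (snd H t)) v = cmp C (snd H y) t'"
      unfolding t'_def using assoc[of "snd H y" "snd H t" v] Hy DH(6-8) D'(6-8) by metis
    also have "cmp C u (cmp C (snd H s) (cmp C (snd H y) t')) = cmp C s' (cmp C (snd H y) t')"
      unfolding s'_def using assoc[of u "snd H s" "cmp C (snd H y) t'"] Hy DH(1-3) D'(1-3) idem_isoD(6-8)[OF
          iso] cmp_Mor[of "snd H y" t']
      by metis
    finally show ?thesis by (simp add: transport_def y_def)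
  qed
  have cong: "semilin_ext (\<tau> \<circ> \<sigma>) (carrier (idem_group C e)) (transport (fst H \<circ> fst F, snd H \<circ> snd F) s' t') =
      semilin_ext (\<tau> \<circ> \<sigma>) (carrier (idem_group C e)) (transport H u v \<circ> transport F s t)"
    by (rule semilin_cong) (rule tr)
  have "semi_iso (group_algebra (idem_group C e)) (semilin_ext (\<tau> \<circ> \<sigma>) (carrier (idem_group C e))
      (transport (fst H \<circ> fst F, snd H \<circ> snd F) s' t')) (snd w) (snd w'')"
  proof (rule semi_iso_comp[OF st(2) uv(2)])
    show "semilin_ext \<sigma> (carrier (idem_group C e)) (transport F s t) \<in>
        carrier (group_algebra (idem_group C e)) \<rightarrow> carrier (group_algebra (idem_group C f))"
      using ring_isoD(1)[OF transport_ring_iso[OF \<sigma> F e f st(1)]] by blast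
    show "semilin_ext (\<tau> \<circ> \<sigma>) (carrier (idem_group C e)) (transport (fst H \<circ> fst F, snd H \<circ> snd F) s' t') a =
        semilin_ext \<tau> (carrier (idem_group C f)) (transport H u v) (semilin_ext \<sigma> (carrier (idem_group C e))
            (transport F s t) a)" for a
      using semilin_comp[OF transport_bij[OF F e f st(1)] bij_betw_imp_inj_on[OF transport_bij[OF H f g uv(1)]]
          \<tau> \<sigma>, of a]
        cong by simp
  qed
  then show ?thesis unfolding wrel_def e_def[symmetric] g_def[symmetric] using W iso by auto
qed

text \<open>The witnesses for the way back are \<open>F'(t)\<close> and \<open>F'(s)\<close>; the
  transport they define is inverse to the given one on \<open>G\<^sub>f\<close>.\<close>

lemma wrel_inv:
  assumes \<sigma>: "field_aut \<sigma>" and F: "F \<in> Aut_cat C" and F': "F' \<in> Aut_cat C"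
    and inv: "\<And>s. s \<in> Mor C \<Longrightarrow> snd F' (snd F s) = s" "\<And>s. s \<in> Mor C \<Longrightarrow> snd F (snd F' s) = s"
    and w: "wrel \<sigma> F w w'"
  shows "wrel (inv_into UNIV \<sigma>) F' w' w"
proof -
  define e f where "e = fst w" and "f = fst w'"
  have W: "is_weight C w" "is_weight C w'" using w by (auto simp: wrel_def)
  have e: "idem_endo C e" and f: "idem_endo C f" unfolding e_def f_def using W is_weightD(1) by blast+
  obtain s t where st: "idem_iso C (snd F e) f s t"
    "semi_iso (group_algebra (idem_group C e)) (semilin_ext \<sigma> (carrier (idem_group C e)) (transport F s t)) (snd
        w) (snd w')"
    using w unfolding wrel_def e_def f_def by blast
  note Fe = aut_idem_endo[OF F e]
  have "idem_iso C (snd F' f) (snd F' (snd F e)) (snd F' t) (snd F' s)"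
    by (rule aut_idem_iso[OF F' f Fe idem_iso_sym[OF st(1)]])
  then have iso: "idem_iso C (snd F' f) e (snd F' t) (snd F' s)" using inv(1) idem_endoD[OF e] by simp
  note \<sigma>' = field_aut_inv[OF \<sigma>]
  note bij = transport_bij[OF F e f st(1)] and bij' = transport_bij[OF F' f e iso]
  note D = idem_isoD[OF st(1)]
  have tr: "(transport F s t \<circ> transport F' (snd F' t) (snd F' s)) y = y" if y: "y \<in> carrier (idem_group C f)" for y
  proof -
    note yM = idem_groupD[OF f y]
    note c = conj_idem_monoid[OF f Fe idem_iso_sym[OF st(1)] idem_group_sub[OF f y]]
    have cM: "cmp C t (cmp C y s) \<in> Mor C" using c(1) idem_monoid_carrier[OF Fe] by blast
    have ys: "cmp C y s \<in> Mor C" "tgt C (cmp C y s) = src C f" using yM D by simp_all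
    have "transport F' (snd F' t) (snd F' s) y = snd F' (cmp C t (cmp C y s))"
      using autD(6)[OF F', of t "cmp C y s"] autD(6)[OF F', of y s] D yM ys by (simp add: transport_def)
    then have "(transport F s t \<circ> transport F' (snd F' t) (snd F' s)) y = cmp C s (cmp C (cmp C t (cmp C y s)) t)"
      using inv(2)[OF cM] by (simp add: transport_def)
    then show ?thesis using c(2) by simp
  qed
  note r = transport_ring_iso[OF \<sigma> F e f st(1)] and r' = transport_ring_iso[OF \<sigma>' F' f e iso]
  have "semi_iso (group_algebra (idem_group C f)) (semilin_ext (inv_into UNIV \<sigma>) (carrier (idem_group C f))
      (transport F' (snd F' t) (snd F' s)))
      (snd w') (snd w)"
  proof (rule semi_iso_inv[OF st(2)])
    show "left_module (group_algebra (idem_group C e)) (snd w)" using is_weightD(4)[OF W(1)] by (simp add: e_def)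
    fix c :: "'b \<Rightarrow> 'c" assume c: "c \<in> carrier (group_algebra (idem_group C f))"
    show "semilin_ext (inv_into UNIV \<sigma>) (carrier (idem_group C f)) (transport F' (snd F' t) (snd F' s)) c
        \<in> carrier (group_algebra (idem_group C e))"
      by (rule ring_isoD(1)[OF r' c])
    have "semilin_ext \<sigma> (carrier (idem_group C e)) (transport F s t)
        (semilin_ext (inv_into UNIV \<sigma>) (carrier (idem_group C f)) (transport F' (snd F' t) (snd F' s)) c) =
        semilin_ext (\<sigma> \<circ> inv_into UNIV \<sigma>) (carrier (idem_group C f)) (transport F s t \<circ> transport F' (snd F' t)
            (snd F' s)) c"
      by (rule semilin_comp[OF bij' bij_betw_imp_inj_on[OF bij] \<sigma> \<sigma>'])
    also have "\<dots> = semilin_ext id (carrier (idem_group C f)) id c"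
    proof -
      have "\<sigma> \<circ> inv_into UNIV \<sigma> = id" using field_aut_simps(5)[OF \<sigma>] by (intro HOL.ext) simp
      moreover have "semilin_ext id (carrier (idem_group C f)) (transport F s t \<circ> transport F' (snd F' t) (snd F' s)) =
          (semilin_ext id (carrier (idem_group C f)) id :: ('b \<Rightarrow> 'c) \<Rightarrow> _)"
        by (rule semilin_cong) (simp only: tr id_apply)
      ultimately show ?thesis by simp
    qed
    also have "\<dots> = c" using c by (intro semilin_id) (simp add: group_algebra_def cat_algebra_sel)
    finally show "semilin_ext \<sigma> (carrier (idem_group C e)) (transport F s t)
        (semilin_ext (inv_into UNIV \<sigma>) (carrier (idem_group C f)) (transport F' (snd F' t) (snd F' s)) c) = c" .
  qed
  then show ?thesis unfolding wrel_def e_def[symmetric] f_def[symmetric] using W iso by blast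
qed

lemma wrel_cong:
  assumes "\<And>s. s \<in> Mor C \<Longrightarrow> snd F s = snd H s" "wrel \<sigma> F w w'"
  shows "wrel \<sigma> H w w'"
proof -
  have W: "is_weight C w" using assms(2) by (simp add: wrel_def)
  note e = is_weightD(1)[OF W]
  have "transport F s t x = transport H s t x" if "x \<in> carrier (idem_group C (fst w))" for s t x
    using assms(1)[OF idem_groupD(1)[OF e that]] by (simp add: transport_def)
  then have "semilin_ext \<sigma> (carrier (idem_group C (fst w))) (transport F s t)
      = semilin_ext \<sigma> (carrier (idem_group C (fst w))) (transport H s t)" for s t
    by (rule semilin_cong)
  moreover have "snd F (fst w) = snd H (fst w)" using assms(1) idem_endoD[OF e] by blast
  ultimately show ?thesis using assms(2) unfolding wrel_def by simp
qed

lemma wrel_post: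
  assumes "field_aut \<sigma>" "F \<in> Aut_cat C" "wrel \<sigma> F w w'" "wrel id (id, id) w' w''" shows "wrel \<sigma> F w w''"
  using wrel_comp[OF assms(1) field_aut_id assms(2) Aut_cat_id assms(3,4)] by simp

lemma wrel_pre:
  assumes "field_aut \<sigma>" "F \<in> Aut_cat C" "wrel id (id, id) w w'" "wrel \<sigma> F w' w''" shows "wrel \<sigma> F w w''"
  using wrel_comp[OF field_aut_id assms(1) Aut_cat_id assms(2,3,4)] by simp

text \<open>Go back from \<open>w1\<close> along the inverse of \<open>(\<sigma>, F)\<close> and
  forward to \<open>w2\<close>. The composite functor is the identity on morphisms only, which is
  why \<open>wrel_cong\<close> is applied at the end.\<close>

lemma wrel_diff:
  assumes \<sigma>: "field_aut \<sigma>" and F: "F \<in> Aut_cat C" and w: "wrel \<sigma> F w w1" "wrel \<sigma> F w w2"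
  shows "wrel id (id, id) w1 w2"
proof -
  obtain F' where F': "F' \<in> Aut_cat C" "\<And>s. s \<in> Mor C \<Longrightarrow> snd F' (snd F s) = s" "\<And>s. s \<in> Mor C \<Longrightarrow> snd F (snd F' s) = s"
    using Aut_catE[OF F] by metis
  have "\<sigma> \<circ> inv_into UNIV \<sigma> = id" using field_aut_simps(5)[OF \<sigma>] by (intro HOL.ext) simp
  then have "wrel id (fst F \<circ> fst F', snd F \<circ> snd F') w1 w2"
    using wrel_comp[OF field_aut_inv[OF \<sigma>] \<sigma> F'(1) F wrel_inv[OF \<sigma> F F' w(1)] w(2)] by simp
  then show ?thesis by (rule wrel_cong[rotated]) (simp add: F'(3))
qed

lemma wrel_sym: assumes "wrel id (id, id) w w'" shows "wrel id (id, id) w' w"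
  using wrel_inv[OF field_aut_id Aut_cat_id Aut_cat_id _ _ assms] by (simp add: inv_id)

lemma wrel_refl: assumes "is_weight C w" shows "wrel id (id, id) w w"
proof -
  note tw = wrel_twist[OF field_aut_id Aut_cat_id assms]
  show ?thesis by (rule wrel_post[OF field_aut_id Aut_cat_id tw wrel_sym[OF tw]])
qed

lemma wcls_eq_iff:
  assumes "is_weight C w" "is_weight C w'"
  shows "wcls w = wcls w' \<longleftrightarrow> wrel id (id, id) w w'"
proof
  assume "wcls w = wcls w'"
  then show "wrel id (id, id) w w'" using wrel_refl[OF assms(2)] unfolding wcls_def by blast
next
  assume *: "wrel id (id, id) w w'"
  show "wcls w = wcls w'"
    unfolding wcls_def using wrel_post[OF field_aut_id Aut_cat_id *] wrel_post[OF field_aut_id Aut_cat_id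
        wrel_sym[OF *]] by blast
qed

text \<open>The counterpart of \<open>twist_class\<close> for weights: every weight related to
  \<open>w\<close> by \<open>wrel \<sigma> F\<close> represents the image of the class of
  \<open>w\<close>.\<close>

lemma wcls_act:
  assumes \<sigma>: "field_aut \<sigma>" and F: "F \<in> Aut_cat C" and w: "wrel \<sigma> F w w1"
  shows "weight_iso_rel C `` (weight_twist C \<sigma> F ` wcls w) = wcls w1"
proof (intro equalityI subsetI)
  have W: "is_weight C w" using w by (simp add: wrel_def)
  fix w' assume "w' \<in> weight_iso_rel C `` (weight_twist C \<sigma> F ` wcls w)"
  then obtain w2 where w2: "wrel id (id, id) w w2" "wrel id (id, id) (weight_twist C \<sigma> F w2) w'"
    unfolding weight_iso_rel_eq wcls_def by blast
  have "is_weight C w2" using w2(1) by (simp add: wrel_def)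
  then have "wrel \<sigma> F w w'"
    using wrel_pre[OF \<sigma> F w2(1) wrel_post[OF \<sigma> F wrel_twist[OF \<sigma> F] w2(2)]] by blast
  then show "w' \<in> wcls w1" unfolding wcls_def using wrel_diff[OF \<sigma> F w] by blast
next
  have W: "is_weight C w" using w by (simp add: wrel_def)
  fix w' assume "w' \<in> wcls w1"
  then have "wrel \<sigma> F w w'" unfolding wcls_def using wrel_post[OF \<sigma> F w] by blast
  then have "wrel id (id, id) (weight_twist C \<sigma> F w) w'" using wrel_diff[OF \<sigma> F wrel_twist[OF \<sigma> F W]] by blast
  moreover have "w \<in> wcls w" unfolding wcls_def using wrel_refl[OF W] by blast
  ultimately show "w' \<in> weight_iso_rel C `` (weight_twist C \<sigma> F ` wcls w)" unfolding weight_iso_rel_eq by blast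
qed

section \<open>Transport of subgroups and orbits\<close>

lemma psub_aut:
  assumes F: "F \<in> Aut_cat C" and e: "idem_endo C e" and P: "psub p e P"
  shows "psub p (snd F e) (snd F ` P)"
proof -
  have "P \<subseteq> Mor C" using psub_Mor(1)[OF e P] by blast
  then have "inj_on (snd F) P" using inj_on_subset[OF bij_betw_imp_inj_on[OF Aut_cat_bij[OF F]]] by blast
  then have card: "card (snd F ` P) = card P" by (rule card_image)
  have 1: "snd F ` P \<subseteq> carrier (idem_group C (snd F e))"
    using aut_idem_group[OF F e psubD(1)[OF P]] by blast
  have 2: "cmp C u v \<in> snd F ` P" if uv: "u \<in> snd F ` P" "v \<in> snd F ` P" for u v
  proof -
    obtain x y where xy: "x \<in> P" "y \<in> P" "u = snd F x" "v = snd F y" using uv by blast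
    have "cmp C u v = snd F (cmp C x y)"
      unfolding xy(3,4) using autD(6)[OF F, of x y] psub_Mor(1-3)[OF e P xy(1)] psub_Mor(1-3)[OF e P xy(2)] by simp
    then show ?thesis using psubD(3)[OF P xy(1,2)] by blast
  qed
  show ?thesis unfolding psub_def card using 1 2 psubD(2)[OF P] P unfolding psub_def by blast
qed

lemma tm_aut:
  assumes F: "F \<in> Aut_cat C" and s: "tm p e P f Q s"
  shows "tm p (snd F e) (snd F ` P) (snd F f) (snd F ` Q) (snd F s)"
    "snd (orbit_functor F) (orb C s P Q) = orb C (snd F s) (snd F ` P) (snd F ` Q)"
proof -
  note S = tmD[OF s] and FD = autD[OF F]
  note eD = idem_endoD[OF S(1)] and fD = idem_endoD[OF S(2)]
  have vs: "snd F (cmp C v s) = cmp C (snd F v) (snd F s)" if "v \<in> Q" for v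
    using FD(6)[of v s] psub_Mor(1-3)[OF S(2,4) that] S(5-7) by simp
  have 1: "\<exists>v \<in> snd F ` Q. cmp C (snd F s) u = cmp C v (snd F s)" if u: "u \<in> snd F ` P" for u
  proof -
    obtain x where x: "x \<in> P" "u = snd F x" using u by blast
    obtain v where v: "v \<in> Q" "cmp C s x = cmp C v s" using S(10)[OF x(1)] by blast
    have "cmp C (snd F s) u = snd F (cmp C s x)" unfolding x(2)
        using FD(6)[of s x] psub_Mor(1-3)[OF S(1,3) x(1)] S(5-7) by simp
    then show ?thesis using v vs[OF v(1)] by auto
  qed
  have 2: "cmp C (snd F s) (snd F e) = snd F s" using FD(6)[of s e] S(5-8) eD by simp
  have 3: "cmp C (snd F f) (snd F s) = snd F s" using FD(6)[of f s] S(5-9) fD by simp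
  show "tm p (snd F e) (snd F ` P) (snd F f) (snd F ` Q) (snd F s)"
    unfolding tm_def using 1 2 3 aut_idem_endo[OF F S(1)] aut_idem_endo[OF F S(2)] psub_aut[OF F S(1,3)]
        psub_aut[OF F S(2,4)]
      FD(3-5) S(5-7) eD fD by simp
  show "snd (orbit_functor F) (orb C s P Q) = orb C (snd F s) (snd F ` P) (snd F ` Q)"
    unfolding orbit_functor_def orb_def snd_conv image_image using vs by (intro image_cong) simp_all
qed

lemma unit_orb_aut: "snd (orbit_functor F) (unit_orb P) = unit_orb (snd F ` P)"
  unfolding orbit_functor_def unit_orb_def snd_conv image_image by simp

lemma orbit_functor_endo:
  assumes F: "F \<in> Aut_cat C" shows "is_endofunctor (orbit_category p C) (orbit_functor F)"
proof -
  interpret O: finite_category "orbit_category p C" by (rule orbit_finite_category)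
  note FD = autD[OF F]
  have fst: "fst (orbit_functor F) (V, P) = (fst F V, snd F ` P)" for V P by (simp add: orbit_functor_def)
  have Fe: "src C (snd F e) = fst F (src C e)" if "idem_endo C e" for e using FD(4) idem_endoD[OF that] by blast
  have ObE: "\<exists>e P. idem_endo C e \<and> psub p e P \<and> x = (src C e, P)" if xO: "x \<in> Ob (orbit_category p C)" for x
  proof -
    obtain V P where x: "x = (V, P)" "p_subgroup p C V P"
      using xO unfolding orbit_category_sel by (cases x) simp
    obtain e where "idem_endo C e" "src C e = V" "psub p e P" using p_subgroupE[OF x(2)] by metis
    then show ?thesis using x(1) by blast
  qed
  show ?thesis
  proof (rule O.endofunctorI)
    fix x assume "x \<in> Ob (orbit_category p C)"
    then obtain e P where e: "idem_endo C e" "psub p e P" "x = (src C e, P)" using ObE by blast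
    note Fe' = aut_idem_endo[OF F e(1)] and FP = psub_aut[OF F e(1,2)]
    have fx: "fst (orbit_functor F) x = (src C (snd F e), snd F ` P)" unfolding e(3) fst Fe[OF e(1)] ..
    show "fst (orbit_functor F) x \<in> Ob (orbit_category p C)"
      unfolding fx orbit_category_sel using psub_iff[OF Fe'] FP src_closed idem_endoD[OF Fe'] by simp
    show "snd (orbit_functor F) (ident (orbit_category p C) x) = ident (orbit_category p C) (fst (orbit_functor F) x)"
      unfolding fx unfolding e(3) orbit_ident[OF e(1,2)] orbit_ident[OF Fe' FP] tm_aut(2)[OF F tm_psub[OF e(1,2)
          psubD(2)[OF e(2)]]] ..
  next
    fix A assume "A \<in> Mor (orbit_category p C)"
    then obtain e P f Q s where s: "tm p e P f Q s" "A = orb C s P Q" unfolding Mor_orbit by blast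
    note Fs = tm_aut[OF F s(1)]
    show "snd (orbit_functor F) A \<in> Mor (orbit_category p C)" unfolding s(2) Fs(2) Mor_orbit using Fs(1) by blast
    show "src (orbit_category p C) (snd (orbit_functor F) A) = fst (orbit_functor F) (src (orbit_category p C) A)"
      unfolding s(2) Fs(2) orb_src_tgt[OF s(1)] orb_src_tgt[OF Fs(1)] fst Fe[OF tmD(1)[OF s(1)]] ..
    show "tgt (orbit_category p C) (snd (orbit_functor F) A) = fst (orbit_functor F) (tgt (orbit_category p C) A)"
      unfolding s(2) Fs(2) orb_src_tgt[OF s(1)] orb_src_tgt[OF Fs(1)] fst Fe[OF tmD(2)[OF s(1)]] ..
  next
    fix A B assume A: "A \<in> Mor (orbit_category p C)" and B: "B \<in> Mor (orbit_category p C)"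
      and AB: "src (orbit_category p C) A = tgt (orbit_category p C) B"
    obtain f Q g R t where t: "tm p f Q g R t" "A = orb C t Q R" using A unfolding Mor_orbit by blast
    obtain e P f' Q' s where s: "tm p e P f' Q' s" "B = orb C s P Q'" using B unfolding Mor_orbit by blast
    have QQ: "Q' = Q" using AB unfolding t(2) s(2) orb_src_tgt[OF t(1)] orb_src_tgt[OF s(1)] by simp
    then have "f' = f" using tm_unique(2)[OF s(1)] tm_unique(1)[OF t(1)] by simp
    then have s1: "tm p e P f Q s" "B = orb C s P Q" using s QQ by simp_all
    have ts: "snd F (cmp C t s) = cmp C (snd F t) (snd F s)"
      using FD(6)[of t s] tmD(5-7)[OF s1(1)] tmD(5-7)[OF t(1)] by simp
    show "snd (orbit_functor F) (cmp (orbit_category p C) A B) =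
        cmp (orbit_category p C) (snd (orbit_functor F) A) (snd (orbit_functor F) B)"
      unfolding t(2) s1(2) orb_cmp[OF s1(1) t(1)] tm_aut(2)[OF F t(1)] tm_aut(2)[OF F s1(1)]
        tm_aut(2)[OF F tm_comp[OF s1(1) t(1)]] orb_cmp[OF tm_aut(1)[OF F s1(1)] tm_aut(1)[OF F t(1)]] ts ..
  qed
qed

lemma orbit_functor_comp:
  "orbit_functor (fst F \<circ> fst H, snd F \<circ> snd H) =
    (fst (orbit_functor F) \<circ> fst (orbit_functor H), snd (orbit_functor F) \<circ> snd (orbit_functor H))"
proof -
  have "fst (orbit_functor (fst F \<circ> fst H, snd F \<circ> snd H)) = fst (orbit_functor F) \<circ> fst (orbit_functor H)"
    by (intro HOL.ext) (auto simp: orbit_functor_def)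
  moreover have "snd (orbit_functor (fst F \<circ> fst H, snd F \<circ> snd H)) = snd (orbit_functor F) \<circ> snd (orbit_functor H)"
    by (intro HOL.ext) (simp add: orbit_functor_def image_image case_prod_beta)
  ultimately show ?thesis by (metis prod.collapse)
qed

lemma orbit_functor_Aut:
  assumes F: "F \<in> Aut_cat C" shows "orbit_functor F \<in> Aut_cat (orbit_category p C)"
proof -
  obtain F' where F': "F' \<in> Aut_cat C" "\<And>V. V \<in> Ob C \<Longrightarrow> fst F' (fst F V) = V" "\<And>V. V \<in> Ob C \<Longrightarrow> fst F (fst F' V) = V"
    "\<And>s. s \<in> Mor C \<Longrightarrow> snd F' (snd F s) = s" "\<And>s. s \<in> Mor C \<Longrightarrow> snd F (snd F' s) = s"
    using Aut_catE[OF F] by metis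
  have P: "P \<subseteq> Mor C" if "p_subgroup p C V P" for V P using that by (auto simp: p_subgroup_def Hom_def)
  have ob: "fst (orbit_functor G) (fst (orbit_functor H) x) = x"
    if x: "x \<in> Ob (orbit_category p C)" and inv: "\<And>V. V \<in> Ob C \<Longrightarrow> fst G (fst H V) = V" "\<And>s. s \<in> Mor C
        \<Longrightarrow> snd G (snd H s) = s"
    for x and G H :: "('a, 'b) endofunctor"
  proof -
    obtain V P where VP: "x = (V, P)" "V \<in> Ob C" "p_subgroup p C V P" using x unfolding orbit_category_sel by blast
    have "(\<lambda>s. snd G (snd H s)) ` P = id ` P" using inv(2) P[OF VP(3)] by (intro image_cong) auto
    then show ?thesis unfolding VP(1) using inv(1)[OF VP(2)] by (simp add: orbit_functor_def image_image)
  qed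
  have mor: "snd (orbit_functor G) (snd (orbit_functor H) A) = A"
    if A: "A \<in> Mor (orbit_category p C)" and inv: "\<And>s. s \<in> Mor C \<Longrightarrow> snd G (snd H s) = s" and G: "G \<in> Aut_cat C"
        and H: "H \<in> Aut_cat C"
    for A and G H :: "('a, 'b) endofunctor"
  proof -
    obtain e P f Q s where s: "tm p e P f Q s" "A = orb C s P Q" using A unfolding Mor_orbit by blast
    note S = tmD[OF s(1)]
    have "(\<lambda>s. snd G (snd H s)) ` P = id ` P" "(\<lambda>s. snd G (snd H s)) ` Q = id ` Q"
      using inv psub_Mor(1)[OF S(1,3)] psub_Mor(1)[OF S(2,4)] by (intro image_cong; simp)+
    then show ?thesis
      unfolding s(2) tm_aut(2)[OF H s(1)] tm_aut(2)[OF G tm_aut(1)[OF H s(1)]] image_image using inv[OF S(5)] by simp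
  qed
  show ?thesis
    unfolding Aut_cat_def
    using orbit_functor_endo[OF F] orbit_functor_endo[OF F'(1)] ob[of _ F' F] ob[of _ F F'] mor[of _ F' F]
        mor[of _ F F'] F F'
    by (intro CollectI conjI exI[of _ "orbit_functor F'"] ballI) simp_all
qed

lemma psub_transport:
  assumes F: "F \<in> Aut_cat C" and e: "idem_endo C e" and f: "idem_endo C f" and st: "idem_iso C (snd F e) f s t"
      and P: "psub p e P"
  shows "psub p f (transport F s t ` P)"
proof -
  have sub: "P \<subseteq> carrier (idem_group C e)" using psubD(1)[OF P] by blast
  have "inj_on (transport F s t) P" by (rule inj_on_subset[OF bij_betw_imp_inj_on[OF transport_bij[OF F e f st]] sub])
  then have card: "card (transport F s t ` P) = card P" by (rule card_image)
  have 1: "transport F s t ` P \<subseteq> carrier (idem_group C f)" using transport_group[OF F e f st] sub by blast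
  have 2: "cmp C u v \<in> transport F s t ` P" if uv: "u \<in> transport F s t ` P" "v \<in> transport F s t ` P" for u v
  proof -
    obtain x y where xy: "x \<in> P" "y \<in> P" "u = transport F s t x" "v = transport F s t y" using uv by blast
    have "cmp C u v = transport F s t (cmp C x y)"
      unfolding xy(3,4) using transport_cmp[OF F e f st idem_group_sub[OF e psubD(1)[OF P xy(1)]]
          idem_group_sub[OF e psubD(1)[OF P xy(2)]]] by simp
    then show ?thesis using psubD(3)[OF P xy(1,2)] by blast
  qed
  have 3: "f \<in> transport F s t ` P" using psubD(2)[OF P] transport_one[OF F e f st] by force
  show ?thesis unfolding psub_def card using 1 2 3 P unfolding psub_def by blast
qed

text \<open>\<open>s u = (s u t) s\<close> for one morphism and \<open>t (s u t) = u t\<close> for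
  the other.\<close>

lemma conj_tm:
  assumes e: "idem_endo C e" and f: "idem_endo C f" and st: "idem_iso C e f s t" and P: "psub p e P"
    and Q: "Q = (\<lambda>x. cmp C s (cmp C x t)) ` P" and Q': "psub p f Q"
  shows "tm p e P f Q s" "tm p f Q e P t"
proof -
  note D = idem_isoD[OF st]
  have "\<exists>v \<in> Q. cmp C s u = cmp C v s" if u: "u \<in> P" for u
  proof -
    note uM = psub_Mor[OF e P u]
    have ut: "cmp C u t \<in> Mor C" "src C (cmp C u t) = src C f" "tgt C (cmp C u t) = src C e" using uM D by simp_all
    have "cmp C (cmp C s (cmp C u t)) s = cmp C s (cmp C (cmp C u t) s)" using assoc[of s "cmp C u t" s] ut D by metis
    also have "cmp C (cmp C u t) s = u" using assoc[of u t s] uM D by metis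
    finally show ?thesis using u unfolding Q by (metis image_eqI)
  qed
  then show "tm p e P f Q s" unfolding tm_def using e f P Q' D by blast
  have "\<exists>v \<in> P. cmp C t x = cmp C v t" if x: "x \<in> Q" for x
  proof -
    obtain u where u: "u \<in> P" "x = cmp C s (cmp C u t)" using x unfolding Q by blast
    note uM = psub_Mor[OF e P u(1)]
    have ut: "cmp C u t \<in> Mor C" "src C (cmp C u t) = src C f" "tgt C (cmp C u t) = src C e" using uM D by simp_all
    have "cmp C t x = cmp C e (cmp C u t)" unfolding u(2) using cmp_collapse[OF D(11), of "cmp C u t"] ut D by metis
    also have "\<dots> = cmp C u t" using cmp_collapse[OF uM(4), of t] uM D idem_endoD[OF e] by metis
    finally show ?thesis using u(1) by blast
  qed
  then show "tm p f Q e P t" unfolding tm_def using e f P Q' D by blast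
qed

lemma orb_idem_iso:
  assumes e: "idem_endo C e" and f: "idem_endo C f" and st: "idem_iso C e f s t" and P: "psub p e P"
    and Q: "Q = (\<lambda>x. cmp C s (cmp C x t)) ` P" and Q': "psub p f Q"
  shows "idem_iso (orbit_category p C) (unit_orb P) (unit_orb Q) (orb C s P Q) (orb C t Q P)"
proof -
  note T = conj_tm[OF assms] and D = idem_isoD[OF st]
  note tP = tm_psub[OF e P psubD(2)[OF P]] and tQ = tm_psub[OF f Q' psubD(2)[OF Q']]
  have "orb C s P Q \<in> Mor (orbit_category p C)" "orb C t Q P \<in> Mor (orbit_category p C)"
    unfolding Mor_orbit using T by blast+
  then show ?thesis
    unfolding idem_iso_def unit_orb_eq[OF e P] unit_orb_eq[OF f Q'] orb_cmp[OF tP T(1)] orb_cmp[OF T(1) tQ]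
      orb_cmp[OF tQ T(2)] orb_cmp[OF T(2) tP] orb_cmp[OF T] orb_cmp[OF T(2,1)] D orb_src_tgt[OF T(1)]
          orb_src_tgt[OF T(2)]
      orb_src_tgt[OF tP] orb_src_tgt[OF tQ] by simp
qed

lemma orb_conj:
  assumes e: "idem_endo C e" and f: "idem_endo C f" and st: "idem_iso C e f s t" and P: "psub p e P"
    and Q: "Q = (\<lambda>x. cmp C s (cmp C x t)) ` P" and Q': "psub p f Q" and n: "tm p e P e P n"
  shows "tm p f Q f Q (cmp C s (cmp C n t))"
    "cmp (orbit_category p C) (orb C s P Q) (cmp (orbit_category p C) (orb C n P P) (orb C t Q P))
        = orb C (cmp C s (cmp C n t)) Q Q"
proof -
  note T = conj_tm[OF e f st P Q Q']
  show "tm p f Q f Q (cmp C s (cmp C n t))" by (rule tm_comp[OF tm_comp[OF T(2) n] T(1)])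
  show "cmp (orbit_category p C) (orb C s P Q) (cmp (orbit_category p C) (orb C n P P) (orb C t Q P))
      = orb C (cmp C s (cmp C n t)) Q Q"
    unfolding orb_cmp[OF T(2) n] orb_cmp[OF tm_comp[OF T(2) n] T(1)] ..
qed

text \<open>Representatives of \<open>S\<close> and \<open>T\<close> compose to an element of
  \<open>P\<close>, which has an inverse there, so \<open>T\<close> has a representative
  \<open>t\<close> with \<open>t s = e\<close>. Then \<open>s t\<close> is an idempotent in the
  group \<open>Q\<close>, hence equal to \<open>f\<close>. Thus isomorphisms between identities of
  the orbit category come from \<open>C\<close>.\<close>

lemma orb_iso_reverse:
  assumes e: "idem_endo C e" and f: "idem_endo C f" and P: "psub p e P" and Q: "psub p f Q"
    and ST: "idem_iso (orbit_category p C) (unit_orb P) (unit_orb Q) S T"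
  shows "\<exists>s t. idem_iso C e f s t \<and> Q = (\<lambda>x. cmp C s (cmp C x t)) ` P \<and> S = orb C s P Q \<and> T = orb C t Q P"
proof -
  note D = idem_isoD[OF ST]
  note UP = unit_orb_idem[OF e P] and UQ = unit_orb_idem[OF f Q]
  have S: "S \<in> Hom (orbit_category p C) (src C e, P) (src C f, Q)" using D(1-3) UP(2) UQ(2) by (simp add: Hom_def)
  have T: "T \<in> Hom (orbit_category p C) (src C f, Q) (src C e, P)" using D(6-8) UP(2) UQ(2) by (simp add: Hom_def)
  have eu: "sub_unit C P = e" "sub_unit C Q = f" using psub_iff[OF e] psub_iff[OF f] P Q by auto
  obtain s where s: "tm p e P f Q s" "S = orb C s P Q"
  proof -
    obtain e' P' f' Q' s where x: "tm p e' P' f' Q' s" "S = orb C s P' Q'" "(src C e, P) = (src C e', P')"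
        "(src C f, Q) = (src C f', Q')"
      by (rule orbit_HomE[OF S])
    have "P' = P" "Q' = Q" using x(3,4) by simp_all
    moreover then have "e' = e" "f' = f" using tm_unique[OF x(1)] eu by simp_all
    ultimately show ?thesis using that x(1,2) by simp
  qed
  obtain t0 where t0: "tm p f Q e P t0" "T = orb C t0 Q P"
  proof -
    obtain e' P' f' Q' s where x: "tm p e' P' f' Q' s" "T = orb C s P' Q'" "(src C f, Q) = (src C e', P')"
        "(src C e, P) = (src C f', Q')"
      by (rule orbit_HomE[OF T])
    have "P' = Q" "Q' = P" using x(3,4) by simp_all
    moreover then have "e' = f" "f' = e" using tm_unique[OF x(1)] eu by simp_all
    ultimately show ?thesis using that x(1,2) by simp
  qed
  note sD = tmD[OF s(1)] and t0D = tmD[OF t0(1)]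
  have "orb C (cmp C t0 s) P P = unit_orb P" using D(11) unfolding s(2) t0(2) orb_cmp[OF s(1) t0(1)] .
  then have tsP: "cmp C t0 s \<in> P" using orb_unit_iff[OF tm_comp[OF s(1) t0(1)]] by simp
  obtain g where g: "g \<in> P" "cmp C g (cmp C t0 s) = e" using psub_inverse[OF e P tsP] by metis
  define t where "t = cmp C g t0"
  have t: "tm p f Q e P t" "T = orb C t Q P" using orb_shift[OF t0(1) g(1)] t0(2) unfolding t_def by simp_all
  note tD = tmD[OF t(1)] and gM = psub_Mor[OF e P g(1)]
  have ts: "cmp C t s = e" unfolding t_def using assoc[of g t0 s] gM sD(5-7) t0D(5-7) g(2) by metis
  have "orb C (cmp C s t) Q Q = unit_orb Q" using D(12) unfolding s(2) t(2) orb_cmp[OF t(1) s(1)] .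
  then have stQ: "cmp C s t \<in> Q" using orb_unit_iff[OF tm_comp[OF t(1) s(1)]] by simp
  note stM = psub_Mor[OF f Q stQ]
  have idem: "cmp C (cmp C s t) (cmp C s t) = cmp C s t"
    using assoc[of s t "cmp C s t"] cmp_collapse[OF ts, of t] stM sD(5-7) tD(5-9) by metis
  obtain h where h: "h \<in> Q" "cmp C h (cmp C s t) = f" using psub_inverse[OF f Q stQ] by metis
  note hM = psub_Mor[OF f Q h(1)]
  have "cmp C h (cmp C (cmp C s t) (cmp C s t)) = cmp C f (cmp C s t)"
    using cmp_collapse[OF h(2), of "cmp C s t"] hM stM by metis
  then have st: "cmp C s t = f" using idem h(2) stM(4) by simp
  have iso: "idem_iso C e f s t" unfolding idem_iso_def using sD(5-9) tD(5-9) ts st by blast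
  \<comment> \<open>The two transporter conditions give the two inclusions: \<open>t q = u t\<close>
    yields \<open>q = s u t\<close>, and \<open>s u = v s\<close> yields
    \<open>s u t = v\<close>.\<close>
  have "Q = (\<lambda>x. cmp C s (cmp C x t)) ` P"
  proof (intro equalityI subsetI)
    fix q assume q: "q \<in> Q"
    note qM = psub_Mor[OF f Q q]
    obtain u where u: "u \<in> P" "cmp C t q = cmp C u t" using tD(10)[OF q] by blast
    have "cmp C s (cmp C u t) = q" using cmp_collapse[OF st, of q] qM sD(5-7) tD(5-7) u(2) by metis
    then show "q \<in> (\<lambda>x. cmp C s (cmp C x t)) ` P" using u(1) by (metis image_eqI)
  next
    fix q assume "q \<in> (\<lambda>x. cmp C s (cmp C x t)) ` P"
    then obtain u where u: "u \<in> P" "q = cmp C s (cmp C u t)" by blast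
    note uM = psub_Mor[OF e P u(1)]
    obtain v where v: "v \<in> Q" "cmp C s u = cmp C v s" using sD(10)[OF u(1)] by blast
    note vM = psub_Mor[OF f Q v(1)]
    have "q = cmp C (cmp C v s) t" unfolding u(2) using assoc[of s u t] uM sD(5-7) tD(5-7) v(2) by metis
    also have "\<dots> = v" using assoc[of v s t] vM sD(5-7) tD(5-7) st by metis
    finally show "q \<in> Q" using v(1) by simp
  qed
  then show ?thesis using iso s(2) t(2) by blast
qed

text \<open>Passes from witnesses in \<open>C\<close> to witnesses in the orbit category. Afterwards
  transport on \<open>N(P)/P\<close> can be computed on representatives as
  \<open>n \<mapsto> s F(n) t\<close>.\<close>

lemma orbit_transport:
  fixes p :: nat
  assumes F: "F \<in> Aut_cat C" and e: "idem_endo C e" and f: "idem_endo C f" and st: "idem_iso C (snd F e) f s t"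
      and P: "psub p e P"
  defines "Q \<equiv> transport F s t ` P"
  shows "psub p f Q"
    "idem_iso (orbit_category p C) (snd (orbit_functor F) (unit_orb P)) (unit_orb Q) (orb C s (snd F ` P) Q)
        (orb C t Q (snd F ` P))"
    "tm p e P e P n \<Longrightarrow> tm p f Q f Q (transport F s t n)"
    "tm p e P e P n \<Longrightarrow> finite_category.transport (orbit_category p C) (orbit_functor F) (orb C s (snd F ` P) Q)
        (orb C t Q (snd F ` P)) (orb C n P P)
      = orb C (transport F s t n) Q Q"
proof -
  interpret O: finite_category "orbit_category p C" by (rule orbit_finite_category)
  note Fe = aut_idem_endo[OF F e] and FP = psub_aut[OF F e P]
  show Q: "psub p f Q" unfolding Q_def by (rule psub_transport[OF F e f st P])
  have QQ: "Q = (\<lambda>x. cmp C s (cmp C x t)) ` (snd F ` P)" unfolding Q_def image_image transport_def ..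
  show "idem_iso (orbit_category p C) (snd (orbit_functor F) (unit_orb P)) (unit_orb Q) (orb C s (snd F ` P) Q)
      (orb C t Q (snd F ` P))"
    unfolding unit_orb_aut by (rule orb_idem_iso[OF Fe f st FP QQ Q])
  assume n: "tm p e P e P n"
  note Fn = tm_aut[OF F n]
  show "tm p f Q f Q (transport F s t n)" unfolding transport_def by (rule orb_conj(1)[OF Fe f st FP QQ Q Fn(1)])
  show "O.transport (orbit_functor F) (orb C s (snd F ` P) Q) (orb C t Q (snd F ` P)) (orb C n P P)
      = orb C (transport F s t n) Q Q"
    unfolding O.transport_def Fn(2) orb_conj(2)[OF Fe f st FP QQ Q Fn(1)] unfolding transport_def ..
qed

section \<open>The one-object category of the group of an idempotent\<close>

context
  fixes e :: 'b assumes e: "idem_endo C e"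
begin

interpretation D: finite_category "group_category (idem_group C e)" by (rule idem_group_category[OF e])

lemma group_cat_idem: "idem_endo (group_category (idem_group C e)) e"
  using idem_group_one[OF e] idem_endoD[OF e] by (simp add: idem_endo_def)

lemma group_cat_monoid: "x \<in> carrier (idem_monoid (group_category (idem_group C e)) e) \<longleftrightarrow> x \<in> carrier (idem_group C e)"
  unfolding D.idem_monoid_carrier[OF group_cat_idem] using idem_groupD(4,5)[OF e] by auto

lemma group_cat_group: "idem_group (group_category (idem_group C e)) e = idem_group C e"
proof -
  have "carrier (idem_group (group_category (idem_group C e)) e) = carrier (idem_group C e)"
  proof (intro equalityI subsetI)
    fix x assume "x \<in> carrier (idem_group (group_category (idem_group C e)) e)"
    then show "x \<in> carrier (idem_group C e)" using D.idem_group_sub[OF group_cat_idem] group_cat_monoid by blast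
  next
    fix x assume x: "x \<in> carrier (idem_group C e)"
    obtain y where y: "y \<in> carrier (idem_group C e)" "cmp C x y = e" "cmp C y x = e" using idem_group_inverse[OF e x] .
    show "x \<in> carrier (idem_group (group_category (idem_group C e)) e)"
      unfolding D.idem_group_carrier[OF group_cat_idem] group_category_sel(6) idem_group_sel(1) group_cat_monoid
      by (intro conjI bexI[of _ y]) (use x y in \<open>simp_all add: group_cat_monoid\<close>)
  qed
  then show ?thesis by (intro monoid.equality) simp_all
qed

lemma group_cat_idem_unique: "idem_endo (group_category (idem_group C e)) f \<Longrightarrow> f = e"
proof -
  assume f: "idem_endo (group_category (idem_group C e)) f"
  then have fG: "f \<in> carrier (idem_group C e)" "cmp C f f = f" unfolding idem_endo_def by simp_all
  obtain y where y: "y \<in> carrier (idem_group C e)" "cmp C f y = e" using idem_group_inverse[OF e fG(1)] by metis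
  note fM = idem_groupD[OF e fG(1)] and yM = idem_groupD[OF e y(1)]
  have "cmp C (cmp C f f) y = cmp C f (cmp C f y)" by (rule assoc) (use fM(1-3) yM(1-3) in simp_all)
  then show "f = e" using fG(2) y(2) fM(5) by simp
qed

text \<open>Puts \<open>G\<^sub>e\<close> into the EI case, so that the theory developed for
  \<open>C\<close> and \<open>b\<close> applies to \<open>G\<^sub>e\<close> and \<open>eb\<close> as
  well.\<close>

lemma group_cat_EI: "EI (group_category (idem_group C e))"
  unfolding EI_def is_isomorphism_def
proof (intro ballI conjI)
  fix V s assume "s \<in> Hom (group_category (idem_group C e)) V V"
  then have s: "s \<in> carrier (idem_group C e)" by (simp add: Hom_def)
  then show "s \<in> Mor (group_category (idem_group C e))" by simp
  obtain t where "t \<in> carrier (idem_group C e)" "cmp C s t = e" "cmp C t s = e" using idem_group_inverse[OF e s] .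
  then show "\<exists>t\<in>Hom (group_category (idem_group C e)) (tgt (group_category (idem_group C e)) s) (src
      (group_category (idem_group C e)) s).
      cmp (group_category (idem_group C e)) t s = ident (group_category (idem_group C e)) (src (group_category
          (idem_group C e)) s) \<and>
      cmp (group_category (idem_group C e)) s t = ident (group_category (idem_group C e)) (tgt (group_category
          (idem_group C e)) s)"
    by (intro bexI[of _ t]) (simp_all add: Hom_def)
qed

lemma group_cat_psub: "D.psub p e P \<longleftrightarrow> psub p e P"
  unfolding D.psub_def psub_def group_cat_group by simp

lemma group_cat_orb: "orb (group_category (idem_group C e)) = orb C"
  by (intro HOL.ext) (simp add: orb_def)

lemma group_cat_tm: "D.tm p e P e P n \<longleftrightarrow> n \<in> carrier (idem_group C e) \<and> tm p e P e P n"
  unfolding D.tm_def tm_def group_cat_psub using group_cat_idem e idem_groupD[OF e, of n] by auto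

lemma group_cat_orbit_cmp: "cmp (orbit_category p (group_category (idem_group C e))) = cmp (orbit_category p C)"
  by (intro HOL.ext) (simp only: orbit_category_sel D.orbit_category_sel group_category_sel idem_group_sel)

text \<open>An equality of monoids, not just an isomorphism: orbits are sets of triples over the
  same type of morphisms, \<open>G\<^sub>e\<close> inherits its composition from \<open>C\<close>,
  and by \<open>orb_idem_group\<close> only members of \<open>G\<^sub>e\<close> occur. Hence a
  module for one orbit category is a module for the other without transport.\<close>

lemma group_cat_orbit_group:
  assumes P: "psub p e P"
  shows "idem_group (orbit_category p (group_category (idem_group C e))) (unit_orb P)
      = idem_group (orbit_category p C) (unit_orb P)"
proof -
  have "carrier (idem_group (orbit_category p (group_category (idem_group C e))) (unit_orb P))
      = carrier (idem_group (orbit_category p C) (unit_orb P))"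
    unfolding D.orb_idem_group[OF group_cat_idem iffD2[OF group_cat_psub P]] orb_idem_group[OF e P]
        group_cat_orb group_cat_tm group_cat_group by blast
  then show ?thesis by (intro monoid.equality) (simp_all add: group_cat_orbit_cmp)
qed

lemma group_cat_weight:
  assumes P: "psub p e P"
  shows "is_weight (orbit_category p (group_category (idem_group C e))) (unit_orb P, T)
      \<longleftrightarrow> is_weight (orbit_category p C) (unit_orb P, T)"
  using unit_orb_idem(1)[OF e P] D.unit_orb_idem(1)[OF group_cat_idem iffD2[OF group_cat_psub P]]
  by (simp add: group_cat_orbit_group[OF P])

end

end


section \<open>Weights of a block\<close>

lemma semilin_arg_cong: "(\<And>s. s \<in> S \<Longrightarrow> a s = a' s) \<Longrightarrow> semilin_ext \<sigma> S g a = semilin_ext \<sigma> S g a'"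
  unfolding semilin_ext_def by (intro HOL.ext arg_cong[where f = \<sigma>] sum.cong) auto

text \<open>Companion of \<open>semilin_comp\<close> for many-to-one maps such as the passage from
  \<open>n\<close> to its orbit: sums over fibres of \<open>g\<close> are regrouped into sums over
  fibres of the composite.\<close>

lemma semilin_comp_finite:
  assumes fin: "finite S" "finite S'" and g: "g ` S \<subseteq> S'" and \<tau>: "field_aut \<tau>" and \<sigma>: "field_aut \<sigma>"
  shows "semilin_ext \<tau> S' g' (semilin_ext \<sigma> S g a) = semilin_ext (\<tau> \<circ> \<sigma>) S (g' \<circ> g) a"
proof (rule HOL.ext)
  fix n
  define T where "T = {s' \<in> S'. g' s' = n}"
  define T' where "T' = {s \<in> S. g' (g s) = n}"
  have "(\<Sum>s' \<in> T. \<Sum>s \<in> {s \<in> S. g s = s'}. a s) = (\<Sum>s' \<in> T. \<Sum>s \<in> {s \<in> T'. g s = s'}. a s)"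
    by (intro sum.cong refl) (auto simp: T_def T'_def)
  also have "\<dots> = sum a T'" by (rule sum.group) (use fin g in \<open>auto simp: T_def T'_def\<close>)
  finally have "(\<Sum>s' \<in> T. \<Sum>s \<in> {s \<in> S. g s = s'}. a s) = sum a T'" .
  then show "semilin_ext \<tau> S' g' (semilin_ext \<sigma> S g a) n = semilin_ext (\<tau> \<circ> \<sigma>) S (g' \<circ> g) a n"
    unfolding semilin_ext_def field_aut_simps(8)[OF \<sigma>, symmetric] T_def[symmetric] by (simp add: T'_def)
qed

context finite_category begin

definition cent :: "'b \<Rightarrow> 'b set \<Rightarrow> 'b set" where
  "cent e P = {n \<in> carrier (idem_group C e). \<forall>u \<in> P. cmp C n u = cmp C u n}"

text \<open>The Brauer map followed by the projection \<open>kC\<^bsub>G\<^esub>(P) \<rightarrow> k(N\<^bsub>G\<^esub>(P)/P)\<close>, which is what acts on the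
  inflated module.\<close>

definition orb_brauer :: "'b \<Rightarrow> 'b set \<Rightarrow> ('b \<Rightarrow> 'k::field) \<Rightarrow> ('b \<times> 'b set \<times> 'b set) set \<Rightarrow> 'k" where
  "orb_brauer e P = semilin_ext id (cent e P) (\<lambda>n. orb C n P P)"

lemma cent_tm:
  assumes "idem_endo C e" "psub p e P" "n \<in> cent e P" shows "tm p e P e P n"
  using assms idem_groupD[OF assms(1), of n] unfolding tm_def cent_def by blast

lemma cent_orb:
  assumes "idem_endo C e" "psub p e P" "n \<in> cent e P"
  shows "orb C n P P \<in> carrier (idem_group (orbit_category p C) (unit_orb P))"
  using cent_tm[OF assms] assms(3) unfolding orb_idem_group[OF assms(1,2)] cent_def by blast

lemma cent_finite: "idem_endo C e \<Longrightarrow> finite (cent e P)"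
  using finite_idem_group by (simp add: cent_def)

lemma cent_normalizer:
  assumes e: "idem_endo C e" and P: "psub p e P" and n: "n \<in> cent e P"
  shows "n \<in> normalizer (idem_group C e) P"
proof -
  interpret G: group "idem_group C e" by (rule idem_group[OF e])
  have nG: "n \<in> carrier (idem_group C e)" and c: "\<And>u. u \<in> P \<Longrightarrow> cmp C n u = cmp C u n" using n by (auto simp: cent_def)
  have sub: "P \<subseteq> carrier (idem_group C e)" using psubD(1)[OF P] by blast
  have u: "cmp C (cmp C n u) (inv\<^bsub>idem_group C e\<^esub> n) = u" if "u \<in> P" for u
    using G.m_assoc[of u n "inv\<^bsub>idem_group C e\<^esub> n"] G.r_inv[OF nG] G.r_one[of u] G.inv_closed[OF nG] nG that sub
        c[OF that] by auto
  have "n <#\<^bsub>idem_group C e\<^esub> P #>\<^bsub>idem_group C e\<^esub> inv\<^bsub>idem_group C e\<^esub> n = (\<Union>u \<in> P. {u})"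
    unfolding l_coset_def r_coset_def using u by simp
  then show ?thesis unfolding normalizer_def stabilizer_def using nG sub by simp
qed

text \<open>The Brauer image vanishes outside the centraliser, and the centraliser lies in the
  normaliser, so the sum over the normaliser reduces to \<open>cent e P\<close>.\<close>

lemma inflate_brauer:
  assumes e: "idem_endo C e" and P: "psub p e P"
  shows "semilin_ext id (normalizer (idem_group C e) P) (\<lambda>n. orbit_of C (n, P, P)) (brauer_map (idem_group C e)
      P a) = orb_brauer e P a"
proof (rule HOL.ext)
  fix \<omega>
  have sub: "normalizer (idem_group C e) P \<subseteq> carrier (idem_group C e)" by (auto simp: normalizer_def stabilizer_def)
  have orb: "orbit_of C (n, P, P) = orb C n P P" if "n \<in> cent e P" for n
    using orbit_of_tm[OF cent_tm[OF e P that]] .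
  have "(\<Sum>n \<in> {n \<in> normalizer (idem_group C e) P. orbit_of C (n, P, P) = \<omega>}. brauer_map (idem_group C e) P a n) =
      (\<Sum>n \<in> {n \<in> cent e P. orb C n P P = \<omega>}. a n)"
  proof (rule sum.mono_neutral_cong_right)
    show "finite {n \<in> normalizer (idem_group C e) P. orbit_of C (n, P, P) = \<omega>}"
      using finite_subset[OF sub finite_idem_group[OF e]] by simp
    show "{n \<in> cent e P. orb C n P P = \<omega>} \<subseteq> {n \<in> normalizer (idem_group C e) P. orbit_of C (n, P, P) = \<omega>}"
      using cent_normalizer[OF e P] orb by auto
    show "\<forall>n \<in> {n \<in> normalizer (idem_group C e) P. orbit_of C (n, P, P) = \<omega>} - {n \<in> cent e P. orb C n P P = \<omega>}.
        brauer_map (idem_group C e) P a n = 0"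
      using orb by (auto simp: brauer_map_def cent_def)
    show "brauer_map (idem_group C e) P a n = a n" if "n \<in> {n \<in> cent e P. orb C n P P = \<omega>}" for n
      using that by (simp add: brauer_map_def cent_def)
  qed
  then show "semilin_ext id (normalizer (idem_group C e) P) (\<lambda>n. orbit_of C (n, P, P)) (brauer_map (idem_group C
      e) P a) \<omega> = orb_brauer e P a \<omega>"
    by (simp add: semilin_ext_def orb_brauer_def)
qed

lemma orb_brauer_one:
  assumes e: "idem_endo C e" and P: "psub p e P"
  shows "orb_brauer e P (smon 1 e :: 'b \<Rightarrow> 'k::field) = \<one>\<^bsub>group_algebra (idem_group (orbit_category p C) (unit_orb P))\<^esub>"
proof (rule HOL.ext)
  fix \<omega>
  have m: "e \<in> cent e P" using idem_group_one[OF e] psub_Mor[OF e P] by (simp add: cent_def)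
  have "orb_brauer e P (smon 1 e :: 'b \<Rightarrow> 'k) \<omega> = (\<Sum>n \<in> {n \<in> cent e P. orb C n P P = \<omega>}. if n = e then 1 else 0 :: 'k)"
    by (simp add: orb_brauer_def semilin_ext_def smon_def)
  also have "\<dots> = (if unit_orb P = \<omega> then 1 else 0)" using cent_finite[OF e, of P] m unit_orb_eq[OF e P] by simp
  finally show "orb_brauer e P (smon 1 e :: 'b \<Rightarrow> 'k) \<omega> = (\<one>\<^bsub>group_algebra (idem_group (orbit_category p C)
      (unit_orb P))\<^esub> :: _ \<Rightarrow> 'k) \<omega>"
    by (auto simp: group_algebra_def cat_algebra_sel)
qed

lemma orb_brauer_closed:
  assumes e: "idem_endo C e" and P: "psub p e P"
  shows "orb_brauer e P a \<in> carrier (group_algebra (idem_group (orbit_category p C) (unit_orb P)))"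
proof -
  have "orb_brauer e P a \<omega> = 0" if "\<omega> \<notin> carrier (idem_group (orbit_category p C) (unit_orb P))" for \<omega>
  proof -
    have "\<omega> \<notin> (\<lambda>n. orb C n P P) ` cent e P" using that cent_orb[OF e P] by blast
    then show ?thesis unfolding orb_brauer_def by (subst semilin_outside) simp_all
  qed
  then show ?thesis by (simp add: group_algebra_def cat_algebra_sel)
qed

lemma cent_transport:
  assumes F: "F \<in> Aut_cat C" and e: "idem_endo C e" and f: "idem_endo C f" and st: "idem_iso C (snd F e) f s t"
      and P: "psub p e P"
  shows "transport F s t ` cent e P = cent f (transport F s t ` P)"
proof -
  have bij: "bij_betw (transport F s t) (carrier (idem_group C e)) (carrier (idem_group C f))"
      by (rule transport_bij[OF F e f st])
  note inj = bij_betw_imp_inj_on[OF bij]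
  have c: "cmp C (transport F s t n) (transport F s t u) = cmp C (transport F s t u) (transport F s t n)
      \<longleftrightarrow> cmp C n u = cmp C u n"
    if n: "n \<in> carrier (idem_group C e)" and u: "u \<in> P" for n u
  proof -
    note uG = psubD(1)[OF P u]
    note tc = transport_cmp[OF F e f st]
    show ?thesis
      using tc[OF idem_group_sub[OF e n] idem_group_sub[OF e uG]] tc[OF idem_group_sub[OF e uG] idem_group_sub[OF e n]]
        inj_on_eq_iff[OF inj idem_group_cmp[OF e n uG] idem_group_cmp[OF e uG n]] by simp
  qed
  show ?thesis
  proof (intro equalityI subsetI)
    fix y assume "y \<in> transport F s t ` cent e P"
    then obtain n where n: "n \<in> carrier (idem_group C e)" "\<forall>u \<in> P. cmp C n u = cmp C u n" "y = transport F s t n"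
      unfolding cent_def by blast
    then show "y \<in> cent f (transport F s t ` P)"
      using c[OF n(1)] bij_betwE[OF bij] by (simp add: cent_def)
  next
    fix y assume y: "y \<in> cent f (transport F s t ` P)"
    then obtain n where n: "n \<in> carrier (idem_group C e)" "y = transport F s t n"
      using bij_betw_imp_surj_on[OF bij] unfolding cent_def by blast
    then show "y \<in> transport F s t ` cent e P" using y c[OF n(1)] by (simp add: cent_def)
  qed
qed

text \<open>Both sides send \<open>n\<close> in \<open>cent e P\<close> to the orbit of
  \<open>s F(n) t\<close>. Transport maps \<open>cent e P\<close> onto \<open>cent f Q\<close>, so
  coefficients may be cut down to the centraliser before or after it.\<close>

lemma orb_brauer_transport:
  assumes F: "F \<in> Aut_cat C" and e: "idem_endo C e" and f: "idem_endo C f" and st: "idem_iso C (snd F e) f s t"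
      and P: "psub p e P"
    and \<sigma>: "field_aut \<sigma>" and Q: "Q = transport F s t ` P"
  shows "semilin_ext \<sigma> (carrier (idem_group (orbit_category p C) (unit_orb P)))
      (finite_category.transport (orbit_category p C) (orbit_functor F) (orb C s (snd F ` P) Q) (orb C t Q (snd
          F ` P))) (orb_brauer e P a)
    = orb_brauer f Q (semilin_ext \<sigma> (carrier (idem_group C e)) (transport F s t) a)"
proof -
  interpret O: finite_category "orbit_category p C" by (rule orbit_finite_category)
  let ?tr = "O.transport (orbit_functor F) (orb C s (snd F ` P) Q) (orb C t Q (snd F ` P))"
  note U = unit_orb_idem(1)[OF e P]
  have inj: "inj_on (transport F s t) (carrier (idem_group C e))"
      by (rule bij_betw_imp_inj_on[OF transport_bij[OF F e f st]])
  have sub: "cent e P \<subseteq> carrier (idem_group C e)" by (auto simp: cent_def)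
  have "semilin_ext \<sigma> (carrier (idem_group (orbit_category p C) (unit_orb P))) ?tr (orb_brauer e P a) =
      semilin_ext (\<sigma> \<circ> id) (cent e P) (?tr \<circ> (\<lambda>n. orb C n P P)) a"
    unfolding orb_brauer_def
    by (rule semilin_comp_finite[OF cent_finite[OF e] O.finite_idem_group[OF U] _ \<sigma> field_aut_id]) (use
        cent_orb[OF e P] in blast)
  also have "\<dots> = semilin_ext \<sigma> (cent e P) (\<lambda>n. orb C (transport F s t n) Q Q) a"
    unfolding o_id using orbit_transport(4)[OF F e f st P cent_tm[OF e P]] unfolding Q
        by (intro semilin_cong[THEN fun_cong]) simp
  also have "\<dots> = semilin_ext (id \<circ> \<sigma>) (cent e P) ((\<lambda>n. orb C n Q Q) \<circ> transport F s t) a" by (simp add: o_def)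
  also have "\<dots> = semilin_ext id (cent f Q) (\<lambda>n. orb C n Q Q) (semilin_ext \<sigma> (cent e P) (transport F s t) a)"
    by (rule semilin_comp_finite[OF cent_finite[OF e] cent_finite[OF f] _ field_aut_id \<sigma>, symmetric])
      (use cent_transport[OF F e f st P] Q in simp)
  also have "\<dots> = orb_brauer f Q (semilin_ext \<sigma> (carrier (idem_group C e)) (transport F s t) a)"
    unfolding orb_brauer_def
  proof (rule semilin_arg_cong)
    fix y assume "y \<in> cent f Q"
    then obtain n where n: "n \<in> cent e P" "y = transport F s t n" using cent_transport[OF F e f st P] Q by blast
    then show "semilin_ext \<sigma> (cent e P) (transport F s t) a y
        = semilin_ext \<sigma> (carrier (idem_group C e)) (transport F s t) a y"
      using semilin_inj[OF inj_on_subset[OF inj sub] n(1), of \<sigma> a] semilin_inj[OF inj, of n \<sigma> a] sub by auto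
  qed
  finally show ?thesis .
qed

end

lemma orbit_functor_id: "orbit_functor (id, id) = (id, id)"
proof -
  have "(\<lambda>(V, P). (id V, id ` P)) = id" "(\<lambda>(s, P, Q). (id s, id ` P, id ` Q)) = id" by auto
  then show ?thesis by (simp add: orbit_functor_def fun_eq_iff)
qed

locale block_weights = alg_setup C b for C :: "('o, 'm) category" and b :: "'m \<Rightarrow> 'k::field" +
  fixes p :: nat
  assumes p: "Factorial_Ring.prime p"
begin

sublocale O: finite_category "orbit_category p C" by (rule orbit_finite_category)

text \<open>For \<open>b = 1\<close> the Brauer condition holds automatically, as the Brauer image of \<open>e\<close> is the unit. So the
  case distinction in the definition of \<open>b\<close>-weights disappears.\<close>

lemma b_weight_unit_orb:
  fixes T :: "(('m \<times> 'm set \<times> 'm set) set, 'k) kmodule"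
  assumes e: "idem_endo C e" and P: "psub p e P"
  shows "is_b_weight p C b (unit_orb P, T) \<longleftrightarrow> is_weight (orbit_category p C) (unit_orb P, T) \<and>
    (\<exists>x \<in> carrier T. orb_brauer e P (eb e) \<odot>\<^bsub>T\<^esub> x \<noteq> \<zero>\<^bsub>T\<^esub>)"
proof (cases "b = \<one>\<^bsub>A\<^esub>")
  case True
  then have ebe: "eb e = smon 1 e" using cat_one_right[OF e_A[OF e]] by simp
  have "\<exists>x \<in> carrier T. orb_brauer e P (eb e) \<odot>\<^bsub>T\<^esub> x \<noteq> \<zero>\<^bsub>T\<^esub>" if w: "is_weight (orbit_category p C) (unit_orb P, T)"
  proof -
    have s: "simple_module (group_algebra (idem_group (orbit_category p C) (unit_orb P))) T" using w by simp
    interpret T: left_module "group_algebra (idem_group (orbit_category p C) (unit_orb P))" T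
        by (rule simple_module_left[OF s])
    obtain x where x: "x \<in> carrier T" "x \<noteq> \<zero>\<^bsub>T\<^esub>" using simple_module_nonzero[OF s] .
    show ?thesis unfolding ebe orb_brauer_one[OF e P] using T.smult_one[OF x(1)] x by auto
  qed
  then show ?thesis using True by auto
next
  case False
  then have EI: "EI C" using b_cases by blast
  have s: "src (orbit_category p C) (unit_orb P) = (src C e, P)" by (rule unit_orb_idem(2)[OF e P])
  have i: "ident C (src C e) = e" using EI_idem(1)[OF EI e] by simp
  have "(\<exists>x \<in> carrier T. brauer_map (idem_group C e) P (eb e) \<odot>\<^bsub>inflate C (idem_group C e) P T\<^esub> x \<noteq> \<zero>\<^bsub>T\<^esub>) \<longleftrightarrow>
      (\<exists>x \<in> carrier T. orb_brauer e P (eb e) \<odot>\<^bsub>T\<^esub> x \<noteq> \<zero>\<^bsub>T\<^esub>)"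
    by (simp add: inflate_def inflate_brauer[OF e P])
  then show ?thesis using False by (simp add: s i basis_elt_eq)
qed

text \<open>Only \<open>b \<noteq> 1\<close> requires work, and then \<open>C\<close> is EI, so the
  idempotents of both weights are of the form \<open>unit_orb P\<close>. The semilinear isomorphism
  \<open>h\<close> takes the Brauer element of \<open>eb\<close> to that of \<open>fb\<close>, by
  \<open>orb_brauer_transport\<close> and \<open>transport_eb\<close>, hence nonvanishing is
  preserved.\<close>

lemma wrel_b_weight:
  assumes k: "kaut \<sigma> F" and w: "O.wrel \<sigma> (orbit_functor F) w w'" and b: "is_b_weight p C b w"
  shows "is_b_weight p C b w'"
proof -
  have W: "is_weight (orbit_category p C) w" "is_weight (orbit_category p C) w'" using w by (auto simp: O.wrel_def)
  obtain d T where dT: "w = (d, T)" by (cases w)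
  obtain d' T' where dT': "w' = (d', T')" by (cases w')
  show ?thesis
  proof (cases "b = \<one>\<^bsub>A\<^esub>")
    case True
    then show ?thesis using W(2) dT' by simp
  next
    case False
    then have EI: "EI C" using b_cases by blast
    obtain e P where eP: "idem_endo C e" "psub p e P" "d = unit_orb P"
      using orbit_idem_reduce[OF p, of d] O.is_weightD(1)[OF W(1)] EI dT by auto
    obtain f Q where fQ: "idem_endo C f" "psub p f Q" "d' = unit_orb Q"
      using orbit_idem_reduce[OF p, of d'] O.is_weightD(1)[OF W(2)] EI dT' by auto
    note kD = kautD[OF k]
    obtain S S' where S: "idem_iso (orbit_category p C) (unit_orb (snd F ` P)) (unit_orb Q) S S'"
      and iso: "semi_iso (group_algebra (idem_group (orbit_category p C) (unit_orb P)))
        (semilin_ext \<sigma> (carrier (idem_group (orbit_category p C) (unit_orb P))) (O.transport (orbit_functor F) S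
            S')) T T'"
      using w unfolding O.wrel_def dT dT' fst_conv snd_conv eP(3) fQ(3) unit_orb_aut by blast
    \<comment> \<open>The witnesses in the orbit category are traced back to \<open>C\<close>, since
      the Brauer condition compares elements of the group algebras of \<open>G\<^sub>e\<close> and
      \<open>G\<^sub>f\<close>.\<close>
    obtain s t where st: "idem_iso C (snd F e) f s t" "Q = (\<lambda>x. cmp C s (cmp C x t)) ` (snd F ` P)"
        "S = orb C s (snd F ` P) Q" "S' = orb C t Q (snd F ` P)"
      using orb_iso_reverse[OF aut_idem_endo[OF kD(2) eP(1)] fQ(1) psub_aut[OF kD(2) eP(1,2)] fQ(2) S] by blast
    have Q: "Q = transport F s t ` P" using st(2) by (simp add: image_image transport_def)
    obtain h where h: "bij_betw h (carrier T) (carrier T')"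
      and hadd: "\<And>x y. \<lbrakk>x \<in> carrier T; y \<in> carrier T\<rbrakk> \<Longrightarrow> h (x \<oplus>\<^bsub>T\<^esub> y) = h x \<oplus>\<^bsub>T'\<^esub> h y"
      and hact: "\<And>a x. \<lbrakk>a \<in> carrier (group_algebra (idem_group (orbit_category p C) (unit_orb P))); x \<in> carrier T\<rbrakk> \<Longrightarrow>
        h (a \<odot>\<^bsub>T\<^esub> x) = semilin_ext \<sigma> (carrier (idem_group (orbit_category p C) (unit_orb P))) (O.transport
            (orbit_functor F) S S') a \<odot>\<^bsub>T'\<^esub> h x"
      using semi_isoE[OF iso] by metis
    have "left_module (group_algebra (idem_group (orbit_category p C) d)) T" using O.is_weightD(4)[OF W(1)] dT by simp
    then interpret T: left_module "group_algebra (idem_group (orbit_category p C) (unit_orb P))" T unfolding eP(3) .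
    have "left_module (group_algebra (idem_group (orbit_category p C) d')) T'"
        using O.is_weightD(4)[OF W(2)] dT' by simp
    then interpret T': left_module "group_algebra (idem_group (orbit_category p C) (unit_orb Q))" T' unfolding fQ(3) .
    have h0: "h \<zero>\<^bsub>T\<^esub> = \<zero>\<^bsub>T'\<^esub>"
    proof (rule additive_map_zero[OF T.abelian_group_axioms T'.abelian_group_axioms])
      show "h ` carrier T \<subseteq> carrier T'" using bij_betwE[OF h] by blast
    qed (fact hadd)
    note cl = orb_brauer_closed[OF eP(1,2), of "eb e"]
    obtain x where x: "x \<in> carrier T" "orb_brauer e P (eb e) \<odot>\<^bsub>T\<^esub> x \<noteq> \<zero>\<^bsub>T\<^esub>"
      using b unfolding dT eP(3) b_weight_unit_orb[OF eP(1,2)] by blast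
    have "h (orb_brauer e P (eb e) \<odot>\<^bsub>T\<^esub> x) = orb_brauer f Q (eb f) \<odot>\<^bsub>T'\<^esub> h x"
      using hact[OF cl x(1)] orb_brauer_transport[OF kD(2) eP(1) fQ(1) st(1) eP(2) kD(1) Q, of "eb e"]
        transport_eb[OF k eP(1) fQ(1) st(1)] unfolding st(3,4) by simp
    moreover have "h (orb_brauer e P (eb e) \<odot>\<^bsub>T\<^esub> x) \<noteq> \<zero>\<^bsub>T'\<^esub>"
      using x(2) inj_on_eq_iff[OF bij_betw_imp_inj_on[OF h] T.smult_closed[OF cl x(1)] T.zero_closed] h0 by simp
    moreover have "h x \<in> carrier T'" using bij_betwE[OF h] x(1) by blast
    ultimately have "\<exists>x \<in> carrier T'. orb_brauer f Q (eb f) \<odot>\<^bsub>T'\<^esub> x \<noteq> \<zero>\<^bsub>T'\<^esub>" by auto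
    then show ?thesis using W(2) unfolding dT' fQ(3) b_weight_unit_orb[OF fQ(1,2)] by blast
  qed
qed

lemma b_weight_is_weight: "is_b_weight p C b w \<Longrightarrow> is_weight (orbit_category p C) w"
  by (cases w) simp

lemma b_weight_classes_iff: "c \<in> b_weight_classes p C b \<longleftrightarrow> (\<exists>w. is_b_weight p C b w \<and> c = O.wcls w)"
proof -
  have "weight_iso_rel (orbit_category p C) `` {w} = O.wcls w" for w :: "(('m \<times> 'm set \<times> 'm set) set, 'k) weight"
    by (auto simp: O.weight_iso_rel_eq O.wcls_def)
  then show ?thesis unfolding b_weight_classes_def quotient_def by auto
qed

lemma weight_act_wcls:
  assumes k: "kaut \<sigma> F" and w: "O.wrel \<sigma> (orbit_functor F) w w1"
  shows "weight_act p C \<sigma> F (O.wcls w) = O.wcls w1"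
  unfolding weight_act_def by (rule O.wcls_act[OF kautD(1)[OF k] orbit_functor_Aut[OF kautD(2)[OF k]] w])

lemma weight_twist_rel:
  assumes k: "kaut \<sigma> F" and w: "is_b_weight p C b w"
  obtains w1 where "O.wrel \<sigma> (orbit_functor F) w w1" "is_b_weight p C b w1"
  using O.wrel_twist[OF kautD(1)[OF k] orbit_functor_Aut[OF kautD(2)[OF k]] b_weight_is_weight[OF w]]
      wrel_b_weight[OF k _ w] by blast

lemma weight_act_closed:
  assumes k: "kaut \<sigma> F" and c: "c \<in> b_weight_classes p C b"
  shows "weight_act p C \<sigma> F c \<in> b_weight_classes p C b"
proof -
  obtain w where w: "is_b_weight p C b w" "c = O.wcls w" using c b_weight_classes_iff by blast
  obtain w1 where "O.wrel \<sigma> (orbit_functor F) w w1" "is_b_weight p C b w1" using weight_twist_rel[OF k w(1)] .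
  then show ?thesis unfolding w(2) b_weight_classes_iff using weight_act_wcls[OF k] by metis
qed

lemma weight_act_comp:
  assumes k: "kaut \<sigma> F" and l: "kaut \<tau> H" and c: "c \<in> b_weight_classes p C b"
  shows "weight_act p C (\<sigma> \<circ> \<tau>) (fst F \<circ> fst H, snd F \<circ> snd H) c = weight_act p C \<sigma> F (weight_act p C \<tau> H c)"
proof -
  obtain w where w: "is_b_weight p C b w" "c = O.wcls w" using c b_weight_classes_iff by blast
  obtain w1 where w1: "O.wrel \<tau> (orbit_functor H) w w1" "is_b_weight p C b w1" using weight_twist_rel[OF l w(1)] .
  obtain w2 where w2: "O.wrel \<sigma> (orbit_functor F) w1 w2" "is_b_weight p C b w2" using weight_twist_rel[OF k w1(2)] .
  have "O.wrel (\<sigma> \<circ> \<tau>) (orbit_functor (fst F \<circ> fst H, snd F \<circ> snd H)) w w2"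
    unfolding orbit_functor_comp
    by (rule O.wrel_comp[OF kautD(1)[OF l] kautD(1)[OF k] orbit_functor_Aut[OF kautD(2)[OF l]]
        orbit_functor_Aut[OF kautD(2)[OF k]] w1(1) w2(1)])
  then show ?thesis using weight_act_wcls[OF kaut_comp[OF k l]] weight_act_wcls[OF k w2(1)] weight_act_wcls[OF l
      w1(1)] w(2) by simp
qed

lemma orbit_functor_trivial:
  assumes "\<And>s. s \<in> Mor C \<Longrightarrow> snd F s = s" "\<omega> \<in> Mor (orbit_category p C)"
  shows "snd (orbit_functor F) \<omega> = \<omega>"
proof -
  obtain e P f Q s where s: "tm p e P f Q s" "\<omega> = orb C s P Q" using assms(2) unfolding Mor_orbit by blast
  note D = tmD[OF s(1)]
  have P: "snd F ` P = P" using assms(1) psub_Mor(1)[OF D(1,3)] by (simp add: image_def)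
  have Q: "snd F ` Q = Q" using assms(1) psub_Mor(1)[OF D(2,4)] by (simp add: image_def)
  have vs: "snd F (cmp C v s) = cmp C v s" if "v \<in> Q" for v
    using assms(1)[of "cmp C v s"] psub_Mor[OF D(2,4) that] D(5,7) by simp
  show ?thesis unfolding s(2) orb_def orbit_functor_def using vs P Q by (simp add: image_image)
qed

lemma weight_act_trivial:
  assumes k: "kaut id F" and F: "\<And>s. s \<in> Mor C \<Longrightarrow> snd F s = s" and c: "c \<in> b_weight_classes p C b"
  shows "weight_act p C id F c = c"
proof -
  obtain w where w: "is_b_weight p C b w" "c = O.wcls w" using c b_weight_classes_iff by blast
  have "O.wrel id (orbit_functor F) w w"
    by (rule O.wrel_cong[OF _ O.wrel_refl[OF b_weight_is_weight[OF w(1)]]]) (simp add: orbit_functor_trivial[OF F])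
  then show ?thesis using weight_act_wcls[OF k] w(2) by simp
qed

text \<open>A class lies in the fibre of every idempotent isomorphic to one of its own; by
  \<open>fibre_unique\<close> it lies in no others. This overlap is the same as for
  \<open>apex_classes\<close>.\<close>

definition fibre :: "'m \<Rightarrow> (('m \<times> 'm set \<times> 'm set) set, 'k) weight set set" where
  "fibre e = {c \<in> b_weight_classes p C b. \<exists>P T. psub p e P \<and> (unit_orb P, T) \<in> c}"

text \<open>Only members of the class whose idempotent comes from a \<open>p\<close>-subgroup of \<open>G\<^sub>e\<close> are weights of the orbit
  category of \<open>G\<^sub>e\<close>; \<open>SOME\<close> picks one of them.\<close>

definition \<delta> :: "'m \<Rightarrow> (('m \<times> 'm set \<times> 'm set) set, 'k) weight set \<Rightarrow> (('m \<times> 'm set \<times> 'm set) set, 'k) weight set" where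
  "\<delta> e c = finite_category.wcls (orbit_category p (group_category (idem_group C e)))
     (SOME w. w \<in> c \<and> (\<exists>P. psub p e P \<and> fst w = unit_orb P))"

lemma fibre_iff:
  "c \<in> fibre e \<longleftrightarrow> (\<exists>P T. psub p e P \<and> is_b_weight p C b (unit_orb P, T) \<and> c = O.wcls (unit_orb P, T))"
proof
  assume "c \<in> fibre e"
  then obtain w P T where w: "is_b_weight p C b w" "c = O.wcls w" and P: "psub p e P" "(unit_orb P, T) \<in> c"
    unfolding fibre_def b_weight_classes_iff by blast
  have r: "O.wrel id (id, id) w (unit_orb P, T)" using P(2) w(2) by (simp add: O.wcls_def)
  then have "is_b_weight p C b (unit_orb P, T)" using wrel_b_weight[OF kaut_id _ w(1)] orbit_functor_id by metis
  moreover have "O.wcls w = O.wcls (unit_orb P, T)"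
    using O.wcls_eq_iff r b_weight_is_weight[OF w(1)] b_weight_is_weight[OF calculation] by blast
  ultimately show "\<exists>P T. psub p e P \<and> is_b_weight p C b (unit_orb P, T) \<and> c = O.wcls (unit_orb P, T)"
      using P(1) w(2) by blast
next
  assume "\<exists>P T. psub p e P \<and> is_b_weight p C b (unit_orb P, T) \<and> c = O.wcls (unit_orb P, T)"
  then obtain P T where P: "psub p e P" "is_b_weight p C b (unit_orb P, T)" "c = O.wcls (unit_orb P, T)" by blast
  then have "(unit_orb P, T) \<in> c" using O.wrel_refl[OF b_weight_is_weight[OF P(2)]] by (simp add: O.wcls_def)
  then show "c \<in> fibre e" unfolding fibre_def b_weight_classes_iff using P by blast
qed

text \<open>By \<open>orbit_idem_reduce\<close> the idempotent of a weight may be replaced by the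
  identity orbit of a subgroup \<open>Q\<close>, and the module is carried along.\<close>

lemma fibre_cover: assumes "c \<in> b_weight_classes p C b" shows "\<exists>e. idem_endo C e \<and> c \<in> fibre e"
proof -
  obtain w where w: "is_b_weight p C b w" "c = O.wcls w" using assms b_weight_classes_iff by blast
  obtain d T where dT: "w = (d, T)" by (cases w)
  have W: "is_weight (orbit_category p C) (d, T)" using b_weight_is_weight[OF w(1)] dT by simp
  then have d: "idem_endo (orbit_category p C) d" by simp
  obtain f Q S S' where f: "idem_endo C f" "psub p f Q" "idem_iso (orbit_category p C) d (unit_orb Q) S S'"
    using orbit_idem_reduce[OF p d] by blast
  have "\<exists>T'. O.wrel id (id, id) (d, T) (unit_orb Q, T')"
    using O.wrel_exists[OF field_aut_id O.Aut_cat_id W unit_orb_idem(1)[OF f(1,2)]] f(3) by simp blast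
  then have "c \<in> fibre f" unfolding fibre_def using assms f(2) w(2) dT by (auto simp: O.wcls_def)
  then show ?thesis using f(1) by blast
qed

lemma fibre_unique:
  assumes e: "idem_endo C e" and f: "idem_endo C f" and "c \<in> fibre e" "c \<in> fibre f"
  shows "\<exists>s t. idem_iso C e f s t"
proof -
  obtain P T where P: "psub p e P" "is_b_weight p C b (unit_orb P, T)" "c = O.wcls (unit_orb P, T)"
      using assms(3) fibre_iff by blast
  obtain Q T' where Q: "psub p f Q" "is_b_weight p C b (unit_orb Q, T')" "c = O.wcls (unit_orb Q, T')"
      using assms(4) fibre_iff by blast
  have "O.wrel id (id, id) (unit_orb P, T) (unit_orb Q, T')"
    using O.wcls_eq_iff[OF b_weight_is_weight[OF P(2)] b_weight_is_weight[OF Q(2)]] P(3) Q(3) by simp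
  then obtain S S' where "idem_iso (orbit_category p C) (unit_orb P) (unit_orb Q) S S'" by (auto simp: O.wrel_def)
  then show ?thesis using orb_iso_reverse[OF e f P(1) Q(1)] by blast
qed

lemma fibre_transport:
  assumes k: "kaut \<sigma> F" and e: "idem_endo C e" and f: "idem_endo C f" and st: "idem_iso C (snd F e) f s t"
      and c: "c \<in> fibre e"
  shows "weight_act p C \<sigma> F c \<in> fibre f"
proof -
  note kD = kautD[OF k]
  obtain P T where P: "psub p e P" "is_b_weight p C b (unit_orb P, T)" "c = O.wcls (unit_orb P, T)"
      using c fibre_iff by blast
  note Q = orbit_transport(1,2)[OF kD(2) e f st P(1)]
  obtain T' where w: "O.wrel \<sigma> (orbit_functor F) (unit_orb P, T) (unit_orb (transport F s t ` P), T')"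
    using O.wrel_exists[OF kD(1) orbit_functor_Aut[OF kD(2)] b_weight_is_weight[OF P(2)] unit_orb_idem(1)[OF f
        Q(1)] Q(2)] by blast
  show ?thesis
    unfolding fibre_iff P(3) weight_act_wcls[OF k w] using Q(1) wrel_b_weight[OF k w P(2)] by blast
qed

section \<open>Comparison of the fibre over \<open>e\<close> with the weights of
  \<open>G\<^sub>e\<close>\<close>

context
  fixes e :: 'm assumes e: "idem_endo C e"
begin

interpretation D: finite_category "group_category (idem_group C e)" by (rule idem_group_category[OF e])

lemma smon_kG: "smon 1 e \<in> carrier (kG e)"
  using idem_group_one[OF e] by (intro smon_closed) simp

lemma group_block_weights: "block_weights (group_category (idem_group C e)) (eb e) p"
  by (intro block_weights.intro block_weights_axioms.intro alg_setup.intro alg_setup_axioms.intro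
      D.finite_category_axioms p disjI2 conjI
      group_cat_EI[OF e] eb_central[OF e])

interpretation D: block_weights "group_category (idem_group C e)" "eb e" p by (rule group_block_weights)

lemma eb_again: "smon 1 e \<otimes>\<^bsub>kG e\<^esub> eb e = eb e"
  using kG_mult[OF e smon_kG eb_kG[OF e]] kG_e(2)[OF e eb_kG[OF e]] by simp

text \<open>The idempotent that \<open>G\<^sub>e\<close> uses at its only object is
  \<open>e(eb) = eb\<close>. Centralisers and orbits coincide too, so both Brauer conditions concern
  the same element of the same group algebra.\<close>

lemma group_b_weight:
  assumes P: "psub p e P"
  shows "is_b_weight p (group_category (idem_group C e)) (eb e) (unit_orb P, T) \<longleftrightarrow> is_b_weight p C b (unit_orb P, T)"
proof -
  have "D.orb_brauer e P (eb e) = orb_brauer e P (eb e)"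
    unfolding D.orb_brauer_def orb_brauer_def D.cent_def cent_def group_cat_group[OF e] group_cat_orb[OF e] by simp
  then show ?thesis
    unfolding D.b_weight_unit_orb[OF group_cat_idem[OF e] iffD2[OF group_cat_psub[OF e] P]] b_weight_unit_orb[OF e P]
      eb_again group_cat_weight[OF e P] by simp
qed

lemma group_idem_iso:
  "idem_iso (group_category (idem_group C e)) e e s t \<longleftrightarrow> idem_iso C e e s t"
proof
  assume "idem_iso (group_category (idem_group C e)) e e s t"
  then show "idem_iso C e e s t" using idem_groupD[OF e, of s] idem_groupD[OF e, of t] unfolding idem_iso_def by simp
next
  assume *: "idem_iso C e e s t"
  note D = idem_isoD[OF *]
  have "s \<in> carrier (idem_monoid C e)" "t \<in> carrier (idem_monoid C e)" using idem_monoid_carrier[OF e] D by simp_all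
  then have "s \<in> carrier (idem_group C e)" "t \<in> carrier (idem_group C e)" using idem_one_sided[OF e _ _ D(12)]
      by simp_all
  then show "idem_iso (group_category (idem_group C e)) e e s t" unfolding idem_iso_def using D by simp
qed

text \<open>In both directions \<open>orb_iso_reverse\<close> provides witnesses in the base
  category, and morphisms \<open>s\<close>, \<open>t\<close> inverse to each other at
  \<open>e\<close> are units of \<open>E e\<close>. So subgroups of \<open>G\<^sub>e\<close> become
  isomorphic in the orbit category of \<open>C\<close> only if they are conjugate in
  \<open>G\<^sub>e\<close>.\<close>

lemma group_orbit_idem_iso:
  fixes Q :: "'m set"
  assumes P: "psub p e P" and Q: "psub p e Q"
  shows "idem_iso (orbit_category p (group_category (idem_group C e))) (unit_orb P) (unit_orb Q) S T \<longleftrightarrow>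
    idem_iso (orbit_category p C) (unit_orb P) (unit_orb Q) S T"
proof
  note P' = iffD2[OF group_cat_psub[OF e] P] and Q' = iffD2[OF group_cat_psub[OF e] Q] and e' = group_cat_idem[OF e]
  show "idem_iso (orbit_category p C) (unit_orb P) (unit_orb Q) S T"
    if *: "idem_iso (orbit_category p (group_category (idem_group C e))) (unit_orb P) (unit_orb Q) S T"
  proof -
    obtain s t where st: "idem_iso (group_category (idem_group C e)) e e s t" "Q
        = (\<lambda>x. cmp C s (cmp C x t)) ` P" "S = orb C s P Q" "T = orb C t Q P"
      using D.orb_iso_reverse[OF e' e' P' Q' *] unfolding group_cat_orb[OF e] group_category_sel idem_group_sel by blast
    show ?thesis unfolding st(3,4) by (rule orb_idem_iso[OF e e _ P st(2) Q]) (use st(1) group_idem_iso in simp)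
  qed
  show "idem_iso (orbit_category p (group_category (idem_group C e))) (unit_orb P) (unit_orb Q) S T"
    if *: "idem_iso (orbit_category p C) (unit_orb P) (unit_orb Q) S T"
  proof -
    obtain s t where st: "idem_iso C e e s t" "Q = (\<lambda>x. cmp C s (cmp C x t)) ` P" "S = orb C s P Q" "T = orb C t Q P"
      using orb_iso_reverse[OF e e P Q *] by blast
    show ?thesis
      unfolding st(3,4) group_cat_orb[OF e, symmetric]
      by (rule D.orb_idem_iso[OF e' e' _ P' _ Q']) (use st(1,2) group_idem_iso in simp_all)
  qed
qed

text \<open>The two relations agree ingredient by ingredient: weights, witnesses, groups and
  composition are the same on both sides.\<close>

lemma group_wrel:
  fixes Q :: "'m set" and T T' :: "(('m \<times> 'm set \<times> 'm set) set, 'k) kmodule"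
  assumes P: "psub p e P" and Q: "psub p e Q"
  shows "D.O.wrel id (id, id) (unit_orb P, T) (unit_orb Q, T') \<longleftrightarrow> O.wrel id (id, id) (unit_orb P, T) (unit_orb Q, T')"
  unfolding D.O.wrel_def O.wrel_def group_cat_weight[OF e P] group_cat_weight[OF e Q] fst_conv snd_conv id_apply
    group_orbit_idem_iso[OF P Q] group_cat_orbit_group[OF e P] D.O.transport_def O.transport_def
        group_cat_orbit_cmp[OF e] ..

text \<open>The member picked by \<open>SOME\<close> is isomorphic to the given weight in the orbit
  category of \<open>C\<close>; \<open>group_wrel\<close> makes it isomorphic there and in that of
  \<open>G\<^sub>e\<close> simultaneously.\<close>

lemma delta_wcls:
  assumes P: "psub p e P" and w: "is_weight (orbit_category p C) (unit_orb P, T)"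
  shows "\<delta> e (O.wcls (unit_orb P, T)) = D.O.wcls (unit_orb P, T)"
proof -
  define w' where "w' = (SOME w. w \<in> O.wcls (unit_orb P, T) \<and> (\<exists>P. psub p e P \<and> fst w = unit_orb P))"
  have "w' \<in> O.wcls (unit_orb P, T) \<and> (\<exists>P. psub p e P \<and> fst w' = unit_orb P)"
    unfolding w'_def by (rule someI[of _ "(unit_orb P, T)"]) (use O.wrel_refl[OF w] P in \<open>auto simp: O.wcls_def\<close>)
  then obtain Q T' where Q: "psub p e Q" "w' = (unit_orb Q, T')" "O.wrel id (id, id) (unit_orb P, T) (unit_orb Q, T')"
    unfolding O.wcls_def by (cases w') auto
  have "D.O.wrel id (id, id) (unit_orb P, T) (unit_orb Q, T')" using group_wrel[OF P Q(1)] Q(3) by simp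
  then have "D.O.wcls (unit_orb P, T) = D.O.wcls (unit_orb Q, T')" using D.O.wcls_eq_iff unfolding D.O.wrel_def by blast
  then show ?thesis unfolding \<delta>_def w'_def[symmetric] Q(2) by simp
qed

lemma delta_bij: "bij_betw (\<delta> e) (fibre e) (b_weight_classes p (group_category (idem_group C e)) (eb e))"
proof (rule bij_betw_imageI)
  show "inj_on (\<delta> e) (fibre e)"
  proof (rule inj_onI)
    fix c c' assume c: "c \<in> fibre e" and c': "c' \<in> fibre e" and eq: "\<delta> e c = \<delta> e c'"
    obtain P T where P: "psub p e P" "is_b_weight p C b (unit_orb P, T)" "c = O.wcls (unit_orb P, T)"
        using c fibre_iff by blast
    obtain Q T' where Q: "psub p e Q" "is_b_weight p C b (unit_orb Q, T')" "c' = O.wcls (unit_orb Q, T')"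
        using c' fibre_iff by blast
    note W = b_weight_is_weight[OF P(2)] and W' = b_weight_is_weight[OF Q(2)]
    have "D.O.wrel id (id, id) (unit_orb P, T) (unit_orb Q, T')"
      using eq D.O.wcls_eq_iff[OF iffD2[OF group_cat_weight[OF e P(1)] W] iffD2[OF group_cat_weight[OF e Q(1)] W']]
      unfolding P(3) Q(3) delta_wcls[OF P(1) W] delta_wcls[OF Q(1) W'] by simp
    then show "c = c'" unfolding P(3) Q(3) using O.wcls_eq_iff[OF W W'] group_wrel[OF P(1) Q(1)] by simp
  qed
  show "\<delta> e ` fibre e = b_weight_classes p (group_category (idem_group C e)) (eb e)"
  proof (intro equalityI subsetI)
    fix y assume "y \<in> \<delta> e ` fibre e"
    then obtain P T where P: "psub p e P" "is_b_weight p C b (unit_orb P, T)" "y = \<delta> e (O.wcls (unit_orb P, T))"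
      unfolding fibre_iff image_iff Bex_def by blast
    show "y \<in> b_weight_classes p (group_category (idem_group C e)) (eb e)"
      unfolding D.b_weight_classes_iff P(3) delta_wcls[OF P(1) b_weight_is_weight[OF P(2)]]
          using group_b_weight[OF P(1)] P(2) by blast
  next
    fix y assume "y \<in> b_weight_classes p (group_category (idem_group C e)) (eb e)"
    then obtain w where w: "is_b_weight p (group_category (idem_group C e)) (eb e) w" "y = D.O.wcls w"
      unfolding D.b_weight_classes_iff by blast
    obtain d T where dT: "w = (d, T)" by (cases w)
    have "idem_endo (orbit_category p (group_category (idem_group C e))) d" using w(1) dT by simp
    then obtain f P where f: "idem_endo (group_category (idem_group C e)) f" "D.psub p f P" "d = unit_orb P"
      using D.orbit_idem_reduce[OF p] group_cat_EI[OF e] by blast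
    have P: "psub p e P" using f(2) group_cat_idem_unique[OF e f(1)] group_cat_psub[OF e] by simp
    have bw: "is_b_weight p C b (unit_orb P, T)" using w(1) group_b_weight[OF P] unfolding dT f(3) by simp
    have "y = \<delta> e (O.wcls (unit_orb P, T))" unfolding delta_wcls[OF P b_weight_is_weight[OF bw]] w(2) dT f(3) ..
    moreover have "O.wcls (unit_orb P, T) \<in> fibre e" unfolding fibre_iff using P bw by blast
    ultimately show "y \<in> \<delta> e ` fibre e" by blast
  qed
qed

lemma group_kaut:
  assumes k: "kaut \<sigma> F" and st: "idem_iso C (snd F e) e s t"
  shows "D.kaut \<sigma> ((\<lambda>_. ()), transport F s t)"
proof -
  note kD = kautD[OF k]
  have "((\<lambda>_. ()), transport F s t) \<in> Aut_cat (group_category (idem_group C e))"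
    by (rule group_Aut_cat[OF idem_group[OF e] transport_bij[OF kD(2) e e st]])
      (use transport_cmp[OF kD(2) e e st] transport_one[OF kD(2) e e st] idem_group_sub[OF e] in simp_all)
  then show ?thesis unfolding D.kaut_def using kD(1) transport_eb[OF k e e st] by simp
qed

text \<open>For \<open>C\<close> the translate is formed with the functor \<open>F\<close> and
  witnesses \<open>s\<close>, \<open>t\<close>; for \<open>G\<^sub>e\<close> with the automorphism
  \<open>x \<mapsto> s F(x) t\<close> and trivial witnesses \<open>e\<close>. Both induce
  \<open>n \<mapsto> s F(n) t\<close> on orbits, so one module is a translate of \<open>T\<close> in
  both senses.\<close>

lemma delta_equivariant:
  assumes k: "kaut \<sigma> F" and st: "idem_iso C (snd F e) e s t" and c: "c \<in> fibre e"
  shows "\<delta> e (weight_act p C \<sigma> F c) =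
    weight_act p (group_category (idem_group C e)) \<sigma> ((\<lambda>_. ()), transport F s t) (\<delta> e c)"
proof -
  note kD = kautD[OF k]
  define F' :: "(unit, 'm) endofunctor" where "F' = ((\<lambda>_. ()), transport F s t)"
  have k': "D.kaut \<sigma> F'" unfolding F'_def by (rule group_kaut[OF k st])
  note kD' = D.kautD[OF k']
  note e' = group_cat_idem[OF e]
  obtain P T where P: "psub p e P" "is_b_weight p C b (unit_orb P, T)" "c = O.wcls (unit_orb P, T)"
      using c fibre_iff by blast
  note W = b_weight_is_weight[OF P(2)]
  note P' = iffD2[OF group_cat_psub[OF e] P(1)] and W' = iffD2[OF group_cat_weight[OF e P(1)] W]
  have F'e: "snd F' e = e" unfolding F'_def using transport_one[OF kD(2) e e st] by simp
  have st': "idem_iso (group_category (idem_group C e)) (snd F' e) e e e" unfolding F'e by (rule D.idem_iso_refl[OF e'])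
  define Q where "Q = transport F s t ` P"
  have tr: "D.transport F' e e n = transport F s t n" if n: "n \<in> carrier (idem_group C e)" for n
    using idem_groupD[OF e transport_group[OF kD(2) e e st n]] by (simp add: D.transport_def F'_def)
  have Q': "D.transport F' e e ` P = Q" unfolding Q_def using tr psubD(1)[OF P(1)] by (intro image_cong refl) blast
  note o = orbit_transport[OF kD(2) e e st P(1), folded Q_def]
  note o' = D.orbit_transport[OF kD'(2) e' e' st' P', unfolded Q']
  define S1 S2 where "S1 = orb C s (snd F ` P) Q" and "S2 = orb C t Q (snd F ` P)"
  define S1' S2' where "S1' = orb (group_category (idem_group C e)) e (snd F' ` P) Q" and "S2'
      = orb (group_category (idem_group C e)) e Q (snd F' ` P)"
  have "D.O.transport (orbit_functor F') S1' S2' \<omega> = O.transport (orbit_functor F) S1 S2 \<omega>"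
    if \<omega>: "\<omega> \<in> carrier (idem_group (orbit_category p C) (unit_orb P))" for \<omega>
  proof -
    obtain n where n: "tm p e P e P n" "n \<in> carrier (idem_group C e)" "\<omega> = orb C n P P"
      using \<omega> unfolding orb_idem_group[OF e P(1)] by blast
    have n': "D.tm p e P e P n" using group_cat_tm[OF e] n by blast
    show ?thesis
      using o(4)[OF n(1)] o'(4)[OF n'] tr[OF n(2)] unfolding n(3) S1_def S2_def S1'_def S2'_def group_cat_orb[OF
          e] by simp
  qed
  then have eq: "semilin_ext \<sigma> (carrier (idem_group (orbit_category p (group_category (idem_group C e)))
      (unit_orb P))) (D.O.transport (orbit_functor F') S1' S2')
      = semilin_ext \<sigma> (carrier (idem_group (orbit_category p C) (unit_orb P))) (O.transport (orbit_functor F) S1 S2)"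
    unfolding group_cat_orbit_group[OF e P(1)] by (intro semilin_cong)
  \<comment> \<open>The common translate: formed here on the side of \<open>C\<close>, and by
    \<open>eq\<close> equal to the twist formed on the side of \<open>G\<^sub>e\<close>.\<close>
  define T1 where "T1 = twist (group_algebra (idem_group (orbit_category p C) (unit_orb P)))
    (semilin_ext \<sigma> (carrier (idem_group (orbit_category p C) (unit_orb P))) (O.transport (orbit_functor F) S1 S2)) T"
  have w: "O.wrel \<sigma> (orbit_functor F) (unit_orb P, T) (unit_orb Q, T1)"
    unfolding T1_def S1_def S2_def by (rule O.wrel_exists[OF kD(1) orbit_functor_Aut[OF kD(2)] W
        unit_orb_idem(1)[OF e o(1)] o(2)])
  have w': "D.O.wrel \<sigma> (orbit_functor F') (unit_orb P, T) (unit_orb Q, T1)"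
    unfolding T1_def eq[symmetric]
    unfolding group_cat_orbit_group[OF e P(1), symmetric] S1'_def S2'_def
    by (rule D.O.wrel_exists[OF kD(1) D.orbit_functor_Aut[OF kD'(2)] W' D.unit_orb_idem(1)[OF e' o'(1)] o'(2)])
  have W1: "is_weight (orbit_category p C) (unit_orb Q, T1)" using w by (simp add: O.wrel_def)
  show ?thesis
    unfolding P(3) weight_act_wcls[OF k w] delta_wcls[OF o(1) W1] delta_wcls[OF P(1) W] F'_def[symmetric]
        D.weight_act_wcls[OF k' w'] ..
qed

end

end


section \<open>Gluing equivariant bijections along fibres\<close>

text \<open>Products and inverses in \<open>K\<close> are required only up to their effect on
  \<open>S\<close> and \<open>T\<close>, because functors are recorded by functions whose values
  outside \<open>C\<close> are arbitrary. The conditions \<open>refl\<close>, \<open>sym\<close> and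
  \<open>trans\<close> are separate from \<open>trS\<close> and \<open>trT\<close>, which say
  nothing about empty fibres. The bijection is the union of all \<open>K\<close>-translates of the
  local graphs at one chosen index per orbit; translates fit together because each local bijection
  commutes with its stabiliser.\<close>

lemma glue_equivariant_bij:
  fixes S :: "'x set" and T :: "'y set" and K :: "'k set" and E :: "'e set"
  assumes mul: "\<And>k l. \<lbrakk>k \<in> K; l \<in> K\<rbrakk> \<Longrightarrow> \<exists>m \<in> K. (\<forall>x \<in> S. aS m x = aS k (aS l x)) \<and> (\<forall>y \<in> T. aT m y = aT k (aT l y))"
    and inv: "\<And>k. k \<in> K \<Longrightarrow> \<exists>m \<in> K. (\<forall>x \<in> S. aS m (aS k x) = x \<and> aS k (aS m x) = x) \<and> (\<forall>y \<in> T. aT m (aT k y) = y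
        \<and> aT k (aT m y) = y)"
    and clS: "\<And>k x. \<lbrakk>k \<in> K; x \<in> S\<rbrakk> \<Longrightarrow> aS k x \<in> S" and clT: "\<And>k y. \<lbrakk>k \<in> K; y \<in> T\<rbrakk> \<Longrightarrow> aT k y \<in> T"
    and fS: "\<And>e. fS e \<subseteq> S" and fT: "\<And>e. fT e \<subseteq> T"
    and covS: "\<And>x. x \<in> S \<Longrightarrow> \<exists>e \<in> E. x \<in> fS e" and covT: "\<And>y. y \<in> T \<Longrightarrow> \<exists>e \<in> E. y \<in> fT e"
    and trS: "\<And>k e f x. \<lbrakk>k \<in> K; e \<in> E; f \<in> E; x \<in> fS e\<rbrakk> \<Longrightarrow> aS k x \<in> fS f \<longleftrightarrow> rel k e f"
    and trT: "\<And>k e f y. \<lbrakk>k \<in> K; e \<in> E; f \<in> E; y \<in> fT e\<rbrakk> \<Longrightarrow> aT k y \<in> fT f \<longleftrightarrow> rel k e f"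
    and refl: "\<And>e. e \<in> E \<Longrightarrow> \<exists>k \<in> K. rel k e e"
    and sym: "\<And>k e f. \<lbrakk>k \<in> K; e \<in> E; f \<in> E; rel k e f\<rbrakk> \<Longrightarrow> \<exists>l \<in> K. rel l f e"
    and trans: "\<And>k l e f g. \<lbrakk>k \<in> K; l \<in> K; e \<in> E; f \<in> E; g \<in> E; rel k e f; rel l f g\<rbrakk> \<Longrightarrow> \<exists>m \<in> K. rel m e g"
    and loc: "\<And>e. e \<in> E \<Longrightarrow> \<exists>\<Psi>. bij_betw \<Psi> (fS e) (fT e) \<and> (\<forall>k \<in> K. rel k e e \<longrightarrow> (\<forall>x \<in> fS e. \<Psi> (aS k x) = aT k (\<Psi> x)))"
  shows "\<exists>\<Phi>. bij_betw \<Phi> S T \<and> (\<forall>k \<in> K. \<forall>x \<in> S. \<Phi> (aS k x) = aT k (\<Phi> x))"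
proof -
  obtain \<Psi> where bij: "\<And>e. e \<in> E \<Longrightarrow> bij_betw (\<Psi> e) (fS e) (fT e)"
    and eqv: "\<And>e k x. \<lbrakk>e \<in> E; k \<in> K; rel k e e; x \<in> fS e\<rbrakk> \<Longrightarrow> \<Psi> e (aS k x) = aT k (\<Psi> e x)"
    using loc by metis
  \<comment> \<open>One index per orbit of \<open>rel\<close>. Related indices satisfy the same
    predicate, so \<open>SOME\<close> returns the same representative for both.\<close>
  define r where "r e = (SOME f. f \<in> E \<and> (\<exists>k \<in> K. rel k e f))" for e
  have r: "r e \<in> E" "\<exists>k \<in> K. rel k e (r e)" if "e \<in> E" for e
  proof -
    have "\<exists>f. f \<in> E \<and> (\<exists>k \<in> K. rel k e f)" using refl[OF that] that by blast
    note some = someI_ex[OF this, folded r_def]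
    show "r e \<in> E" by (rule conjunct1[OF some])
    show "\<exists>k \<in> K. rel k e (r e)" by (rule conjunct2[OF some])
  qed
  have r_eq: "r e = r f" if ef: "e \<in> E" "f \<in> E" "k \<in> K" "rel k e f" for e f k
  proof -
    have "(\<exists>l \<in> K. rel l e g) \<longleftrightarrow> (\<exists>l \<in> K. rel l f g)" if "g \<in> E" for g
    proof -
      obtain l where l: "l \<in> K" "rel l f e" using sym[OF ef(3,1,2,4)] by blast
      show ?thesis
      proof
        assume "\<exists>l \<in> K. rel l e g"
        then obtain m where m: "m \<in> K" "rel m e g" by (rule bexE)
        show "\<exists>l \<in> K. rel l f g" by (rule trans[OF l(1) m(1) ef(2,1) that l(2) m(2)])
      next
        assume "\<exists>l \<in> K. rel l f g"
        then obtain m where m: "m \<in> K" "rel m f g" by (rule bexE)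
        show "\<exists>l \<in> K. rel l e g" by (rule trans[OF ef(3) m(1) ef(1,2) that ef(4) m(2)])
      qed
    qed
    then show ?thesis unfolding r_def by (intro arg_cong[where f = Eps] HOL.ext conj_cong HOL.refl)
  qed
  have rr: "r (r e) = r e" if "e \<in> E" for e using r_eq[OF that r(1)[OF that]] r(2)[OF that] by metis
  \<comment> \<open>The graph of the bijection to be built, as translates of the local graphs over
    indices that are their own representatives.\<close>
  define Gr where "Gr x y \<longleftrightarrow> (\<exists>k \<in> K. \<exists>e \<in> E. r e = e \<and> (\<exists>z \<in> fS e. x = aS k z \<and> y = aT k (\<Psi> e z)))" for x y
  have \<Psi>T: "\<Psi> e z \<in> fT e" if "e \<in> E" "z \<in> fS e" for e z using bij_betwE[OF bij[OF that(1)]] that(2) by blast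
  have dom: "x \<in> S \<and> y \<in> T" if "Gr x y" for x y
    using that \<Psi>T fS fT clS clT unfolding Gr_def by blast
  \<comment> \<open>\<open>m\<close> acts as the inverse of \<open>l\<close> followed after
    \<open>k\<close>, on \<open>S\<close> and on \<open>T\<close> at once.\<close>
  have quot: "\<exists>m \<in> K. (\<forall>x \<in> S. aS l (aS m x) = aS k x) \<and> (\<forall>y \<in> T. aT l (aT m y) = aT k y) \<and>
      (\<forall>x \<in> S. \<forall>z \<in> S. aS k x = aS l z \<longrightarrow> aS m x = z) \<and> (\<forall>y \<in> T. \<forall>z \<in> T. aT k y = aT l z \<longrightarrow> aT m y = z)"
    if k: "k \<in> K" and l: "l \<in> K" for k l
  proof -
    obtain l' where l': "l' \<in> K" "\<forall>x \<in> S. aS l' (aS l x) = x \<and> aS l (aS l' x) = x" "\<forall>y \<in> T. aT l' (aT l y) = y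
        \<and> aT l (aT l' y) = y"
      using inv[OF l] by blast
    obtain m where "m \<in> K" "\<forall>x \<in> S. aS m x = aS l' (aS k x)" "\<forall>y \<in> T. aT m y = aT l' (aT k y)"
        using mul[OF l'(1) k] by blast
    then show ?thesis using l' clS[OF k] clT[OF k] by (intro bexI[of _ m]) simp_all
  qed
  \<comment> \<open>This equivalence yields single-valuedness, injectivity and equivariance
    together. If two pairs share a coordinate, the quotient \<open>m\<close> relates their indices;
    as both are representatives they are equal, and the local bijection commutes with
    \<open>m\<close>.\<close>
  have match: "y = y' \<longleftrightarrow> x = x'" if "Gr x y" "Gr x' y'" for x y x' y'
  proof -
    obtain k e z where k: "k \<in> K" "e \<in> E" "r e = e" "z \<in> fS e" "x = aS k z" "y = aT k (\<Psi> e z)"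
        using \<open>Gr x y\<close> Gr_def by blast
    obtain l f z' where l: "l \<in> K" "f \<in> E" "r f = f" "z' \<in> fS f" "x' = aS l z'" "y' = aT l (\<Psi> f z')"
        using \<open>Gr x' y'\<close> Gr_def by blast
    have z: "z \<in> S" "z' \<in> S" "\<Psi> e z \<in> T" "\<Psi> f z' \<in> T" using k l \<Psi>T fS fT by blast+
    obtain m where m: "m \<in> K" "\<forall>x \<in> S. aS l (aS m x) = aS k x" "\<forall>y \<in> T. aT l (aT m y) = aT k y"
      "\<forall>x \<in> S. \<forall>z \<in> S. aS k x = aS l z \<longrightarrow> aS m x = z" "\<forall>y \<in> T. \<forall>z \<in> T. aT k y = aT l z \<longrightarrow> aT m y = z"
      using quot[OF k(1) l(1)] by blast
    show ?thesis
    proof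
      assume "x = x'"
      then have mz: "aS m z = z'" using m(4) z(1,2) k(5) l(5) by simp
      then have rel: "rel m e f" using trS[OF m(1) k(2) l(2) k(4)] l(4) by simp
      then have ef: "e = f" using r_eq[OF k(2) l(2) m(1)] k(3) l(3) by simp
      have "\<Psi> f z' = aT m (\<Psi> e z)" using eqv[OF k(2) m(1) _ k(4)] rel ef mz by simp
      then show "y = y'" using m(3) z(3) k(6) l(6) by simp
    next
      assume "y = y'"
      then have mz: "aT m (\<Psi> e z) = \<Psi> f z'" using m(5) z(3,4) k(6) l(6) by simp
      then have rel: "rel m e f" using trT[OF m(1) k(2) l(2) \<Psi>T[OF k(2,4)]] \<Psi>T[OF l(2,4)] by simp
      then have ef: "e = f" using r_eq[OF k(2) l(2) m(1)] k(3) l(3) by simp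
      have "\<Psi> e (aS m z) = \<Psi> e z'" using eqv[OF k(2) m(1) _ k(4)] rel ef mz by simp
      moreover have "aS m z \<in> fS e" using trS[OF m(1) k(2) k(2) k(4)] rel ef by simp
      ultimately have "aS m z = z'" using inj_onD[OF bij_betw_imp_inj_on[OF bij[OF k(2)]]] l(4) ef by blast
      then show "x = x'" using m(2) z(1) k(5) l(5) by metis
    qed
  qed
  \<comment> \<open>Move \<open>x\<close> into the fibre over the representative index and come back
    with an inverse element.\<close>
  have totS: "\<exists>y. Gr x y" if x: "x \<in> S" for x
  proof -
    obtain e where e: "e \<in> E" "x \<in> fS e" using covS[OF x] by blast
    obtain k where k: "k \<in> K" "rel k e (r e)" using r(2)[OF e(1)] by blast
    obtain k' where k': "k' \<in> K" "\<forall>x \<in> S. aS k' (aS k x) = x" using inv[OF k(1)] by blast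
    have "aS k x \<in> fS (r e)" using trS[OF k(1) e(1) r(1)[OF e(1)] e(2)] k(2) by simp
    moreover have "x = aS k' (aS k x)" using k'(2) x by simp
    ultimately show ?thesis unfolding Gr_def using k'(1) r(1)[OF e(1)] rr[OF e(1)] by blast
  qed
  have totT: "\<exists>x. Gr x y" if y: "y \<in> T" for y
  proof -
    obtain e where e: "e \<in> E" "y \<in> fT e" using covT[OF y] by blast
    obtain k where k: "k \<in> K" "rel k e (r e)" using r(2)[OF e(1)] by blast
    obtain k' where k': "k' \<in> K" "\<forall>y \<in> T. aT k' (aT k y) = y" using inv[OF k(1)] by blast
    have "aT k y \<in> fT (r e)" using trT[OF k(1) e(1) r(1)[OF e(1)] e(2)] k(2) by simp
    then obtain z where z: "z \<in> fS (r e)" "aT k y = \<Psi> (r e) z"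
        using bij_betw_imp_surj_on[OF bij[OF r(1)[OF e(1)]]] by (metis imageE)
    have "y = aT k' (\<Psi> (r e) z)" using k'(2) y z(2) by metis
    then show ?thesis unfolding Gr_def using k'(1) r(1)[OF e(1)] rr[OF e(1)] z(1) by blast
  qed
  have act: "Gr (aS k x) (aT k y)" if k: "k \<in> K" and xy: "Gr x y" for k x y
  proof -
    obtain l e z where l: "l \<in> K" "e \<in> E" "r e = e" "z \<in> fS e" "x = aS l z" "y = aT l (\<Psi> e z)" using xy Gr_def by blast
    obtain m where m: "m \<in> K" "\<forall>x \<in> S. aS m x = aS k (aS l x)" "\<forall>y \<in> T. aT m y = aT k (aT l y)"
        using mul[OF k l(1)] by blast
    have "z \<in> S" "\<Psi> e z \<in> T" using l \<Psi>T fS fT by blast+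
    then have "aS k x = aS m z" "aT k y = aT m (\<Psi> e z)" using m l(5,6) by simp_all
    then show ?thesis unfolding Gr_def using m(1) l(2-4) by blast
  qed
  define \<Phi> where "\<Phi> x = (SOME y. Gr x y)" for x
  have \<Phi>: "Gr x (\<Phi> x)" if "x \<in> S" for x unfolding \<Phi>_def using someI_ex[OF totS[OF that]] .
  have "bij_betw \<Phi> S T"
  proof (rule bij_betw_imageI)
    show "inj_on \<Phi> S" using match \<Phi> by (metis inj_onI)
    show "\<Phi> ` S = T"
    proof (intro equalityI subsetI)
      show "y \<in> T" if "y \<in> \<Phi> ` S" for y using that dom \<Phi> by blast
      show "y \<in> \<Phi> ` S" if y: "y \<in> T" for y
      proof -
        obtain x where x: "Gr x y" using totT[OF y] by blast
        then have "x \<in> S" using dom by blast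
        moreover have "y = \<Phi> x" using match[OF x \<Phi>[OF calculation]] by simp
        ultimately show ?thesis by blast
      qed
    qed
  qed
  moreover have "\<Phi> (aS k x) = aT k (\<Phi> x)" if "k \<in> K" "x \<in> S" for k x
    using match[OF act[OF that(1) \<Phi>[OF that(2)]] \<Phi>[OF clS[OF that]]] by simp
  ultimately show ?thesis by blast
qed

section \<open>The global bijection\<close>

context block_weights begin

lemma kaut_inverse:
  assumes k: "kaut \<sigma> F"
  obtains F' where "kaut (inv_into UNIV \<sigma>) F'" "\<And>s. s \<in> Mor C \<Longrightarrow> snd F' (snd F s) = s" "\<And>s. s \<in> Mor C
      \<Longrightarrow> snd F (snd F' s) = s"
proof -
  note kD = kautD[OF k]
  obtain F' where F': "F' \<in> Aut_cat C" "\<And>s. s \<in> Mor C \<Longrightarrow> snd F' (snd F s) = s" "\<And>s. s \<in> Mor C \<Longrightarrow> snd F (snd F' s) = s"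
    using Aut_catE[OF kD(2)] by metis
  have \<sigma>: "inv_into UNIV \<sigma> \<circ> \<sigma> = id" using field_aut_simps(6)[OF kD(1)] by auto
  have "\<Phi> (inv_into UNIV \<sigma>) F' b = \<Phi> (inv_into UNIV \<sigma>) F' (\<Phi> \<sigma> F b)" using kD(3) by simp
  also have "\<dots> = semilin_ext id (Mor C) (snd F' \<circ> snd F) b"
    using semilin_comp[OF Aut_cat_bij[OF kD(2)] bij_betw_imp_inj_on[OF Aut_cat_bij[OF F'(1)]] field_aut_inv[OF
        kD(1)] kD(1)] \<sigma> by simp
  also have "\<dots> = semilin_ext id (Mor C) id b" using F'(2) by (intro semilin_cong[THEN fun_cong]) simp
  also have "\<dots> = b" using b(1) by (intro semilin_id) (simp add: cat_algebra_sel)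
  finally have "kaut (inv_into UNIV \<sigma>) F'" unfolding kaut_def using F'(1) field_aut_inv[OF kD(1)] by simp
  then show ?thesis using that F'(2,3) by blast
qed

text \<open>The bijection is \<open>\<Theta>\<close> framed by \<open>\<alpha> e\<close> and the
  inverse of \<open>\<delta> e\<close>. Both \<open>\<alpha>\<close> and \<open>\<delta>\<close>
  turn \<open>(\<sigma>, F)\<close> into the same pair, \<open>\<sigma>\<close> with the
  automorphism \<open>x \<mapsto> s F(x) t\<close> of \<open>G\<^sub>e\<close>; it stabilises
  \<open>eb\<close> by \<open>transport_eb\<close>, so the equivariance of \<open>\<Theta>\<close>
  applies to it.\<close>

lemma local_equivariant_bij:
  assumes H: "\<And>\<sigma>. \<sigma> \<in> H \<Longrightarrow> field_aut \<sigma>" and e: "idem_endo C e"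
    and bij: "has_equivariant_bij p H (group_category (idem_group C e)) (eb e)"
  shows "\<exists>\<Psi>. bij_betw \<Psi> (apex_classes e) (fibre e) \<and>
    (\<forall>(\<sigma>, F) \<in> stab H C b. (\<exists>s t. idem_iso C (snd F e) e s t) \<longrightarrow>
      (\<forall>c \<in> apex_classes e. \<Psi> (simple_act C b \<sigma> F c) = weight_act p C \<sigma> F (\<Psi> c)))"
proof -
  interpret D: block_weights "group_category (idem_group C e)" "eb e" p by (rule group_block_weights[OF e])
  obtain \<Theta> where \<Theta>: "bij_betw \<Theta> (simple_classes (Q e)) (b_weight_classes p (group_category (idem_group C e)) (eb e))"
    and eqv: "\<And>\<sigma> F c. \<lbrakk>(\<sigma>, F) \<in> stab H (group_category (idem_group C e)) (eb e); c \<in> simple_classes (Q e)\<rbrakk> \<Longrightarrow>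
      \<Theta> (simple_act (group_category (idem_group C e)) (eb e) \<sigma> F c)
          = weight_act p (group_category (idem_group C e)) \<sigma> F (\<Theta> c)"
    using bij unfolding has_equivariant_bij_def by blast
  note db = delta_bij[OF e] and ab = alpha_bij[OF e]
  define \<Psi> where "\<Psi> = inv_into (fibre e) (\<delta> e) \<circ> (\<Theta> \<circ> \<alpha> e)"
  have "bij_betw \<Psi> (apex_classes e) (fibre e)"
    unfolding \<Psi>_def by (rule bij_betw_trans[OF bij_betw_trans[OF ab \<Theta>] bij_betw_inv_into[OF db]])
  moreover have "\<Psi> (simple_act C b \<sigma> F c) = weight_act p C \<sigma> F (\<Psi> c)"
    if k: "(\<sigma>, F) \<in> stab H C b" and st: "idem_iso C (snd F e) e s t" and c: "c \<in> apex_classes e" for \<sigma> F s t c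
  proof -
    have ka: "kaut \<sigma> F" using k H unfolding stab_def kaut_def by blast
    define F' :: "(unit, 'm) endofunctor" where "F' = ((\<lambda>_. ()), transport F s t)"
    have "D.kaut \<sigma> F'" unfolding F'_def by (rule group_kaut[OF e ka st])
    then have k': "(\<sigma>, F') \<in> stab H (group_category (idem_group C e)) (eb e)" using k
        unfolding stab_def D.kaut_def by blast
    have ac: "\<alpha> e c \<in> simple_classes (Q e)" using bij_betwE[OF ab] c by blast
    have y: "\<Psi> c \<in> fibre e" using bij_betwE[OF calculation] c by blast
    have dy: "\<delta> e (\<Psi> c) = \<Theta> (\<alpha> e c)"
      unfolding \<Psi>_def o_apply by (rule bij_betw_inv_into_right[OF db]) (use bij_betwE[OF \<Theta>] ac in blast)
    have "\<Theta> (\<alpha> e (simple_act C b \<sigma> F c)) = weight_act p (group_category (idem_group C e)) \<sigma> F' (\<Theta> (\<alpha> e c))"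
      unfolding alpha_equivariant[OF ka e st c] F'_def[symmetric] by (rule eqv[OF k' ac])
    also have "\<dots> = \<delta> e (weight_act p C \<sigma> F (\<Psi> c))" unfolding dy[symmetric] F'_def
        by (rule delta_equivariant[OF e ka st y, symmetric])
    finally have "\<Psi> (simple_act C b \<sigma> F c) = inv_into (fibre e) (\<delta> e) (\<delta> e (weight_act p C \<sigma> F (\<Psi> c)))"
        by (simp add: \<Psi>_def)
    also have "\<dots> = weight_act p C \<sigma> F (\<Psi> c)" by (rule bij_betw_inv_into_left[OF db fibre_transport[OF ka e e st y]])
    finally show ?thesis .
  qed
  ultimately show ?thesis by blast
qed

lemma global_equivariant_bij:
  assumes H: "\<And>\<sigma>. \<sigma> \<in> H \<Longrightarrow> field_aut \<sigma>" "id \<in> H" "\<And>\<sigma> \<tau>. \<lbrakk>\<sigma> \<in> H; \<tau> \<in> H\<rbrakk> \<Longrightarrow> \<sigma> \<circ> \<tau> \<in> H" "\<And>\<sigma>. \<sigma> \<in> H \<Longrightarrow> inv_into UNIV \<sigma> \<in> H"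
    and loc: "\<And>e. idem_endo C e \<Longrightarrow> has_equivariant_bij p H (group_category (idem_group C e)) (eb e)"
  shows "has_equivariant_bij p H C b"
proof -
  define K where "K = stab H C b"
  define aS where "aS k = simple_act C b (fst k) (snd k)" for k
  define aT where "aT k = (weight_act p C (fst k) (snd k) :: (('m \<times> 'm set \<times> 'm set) set, 'k) weight set \<Rightarrow> _)" for k
  \<comment> \<open>Depends on the functor and the idempotents only; both fibrations will be
    governed by this one relation.\<close>
  define rel where "rel k e f \<longleftrightarrow> (\<exists>s t. idem_iso C (snd (snd k) e) f s t)" for k ::
      "('k \<Rightarrow> 'k) \<times> ('o, 'm) endofunctor" and e f
  have K: "(\<sigma>, F) \<in> K \<longleftrightarrow> \<sigma> \<in> H \<and> kaut \<sigma> F" for \<sigma> F unfolding K_def stab_def kaut_def using H(1) by blast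
  have inverse: "\<exists>F'. (inv_into UNIV \<sigma>, F') \<in> K \<and> (\<forall>s \<in> Mor C. snd F' (snd F s) = s \<and> snd F (snd F' s) = s)" if
      "(\<sigma>, F) \<in> K" for \<sigma> F
    using kaut_inverse[of \<sigma> F] that H(4) unfolding K by metis
  have "\<exists>\<Phi>. bij_betw \<Phi> (simple_classes R) (b_weight_classes p C b) \<and> (\<forall>k \<in> K. \<forall>x \<in> simple_classes R. \<Phi> (aS k x)
      = aT k (\<Phi> x))"
  proof (rule glue_equivariant_bij[where E = "Collect (idem_endo C)" and fS = apex_classes and fT = fibre
      and rel = rel])
    fix k l assume kl: "k \<in> K" "l \<in> K"
    obtain \<sigma> F \<tau> F' where k: "k = (\<sigma>, F)" and l: "l = (\<tau>, F')" by (metis surj_pair)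
    show "\<exists>m\<in>K. (\<forall>x\<in>simple_classes R. aS m x = aS k (aS l x)) \<and> (\<forall>y\<in>b_weight_classes p C b. aT m y = aT k (aT l y))"
      using kl H(3) kaut_comp[of \<sigma> F \<tau> F'] simple_act_comp[of \<sigma> F \<tau> F'] weight_act_comp[of \<sigma> F \<tau> F']
      unfolding k l K aS_def aT_def by (intro bexI[of _ "(\<sigma> \<circ> \<tau>, fst F \<circ> fst F', snd F \<circ> snd F')"]) (simp_all add: K)
  next
    fix k assume kK: "k \<in> K"
    obtain \<sigma> F where k: "k = (\<sigma>, F)" by (metis surj_pair)
    have kk: "kaut \<sigma> F" using kK unfolding k K by blast
    obtain F' where F': "(inv_into UNIV \<sigma>, F') \<in> K" "\<And>s. s \<in> Mor C \<Longrightarrow> snd F' (snd F s) = s" "\<And>s. s \<in> Mor C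
        \<Longrightarrow> snd F (snd F' s) = s"
      using inverse[OF kK[unfolded k]] by blast
    have kk': "kaut (inv_into UNIV \<sigma>) F'" using F'(1) K by blast
    have \<sigma>: "inv_into UNIV \<sigma> \<circ> \<sigma> = id" "\<sigma> \<circ> inv_into UNIV \<sigma> = id" using field_aut_simps(5,6)[OF kautD(1)[OF kk]] by auto
    \<comment> \<open>The composites consist of the identity of the field and a functor that is the
      identity on morphisms, the situation of \<open>simple_act_trivial\<close> and
      \<open>weight_act_trivial\<close>.\<close>
    note c1 = kaut_comp[OF kk' kk, unfolded \<sigma>] and c2 = kaut_comp[OF kk kk', unfolded \<sigma>]
    have "simple_act C b (inv_into UNIV \<sigma>) F' (simple_act C b \<sigma> F x) = x"
        "simple_act C b \<sigma> F (simple_act C b (inv_into UNIV \<sigma>) F' x) = x"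
      if "x \<in> simple_classes R" for x
      using simple_act_comp[OF kk' kk that] simple_act_trivial[OF c1 refl _ that] simple_act_comp[OF kk kk'
          that] simple_act_trivial[OF c2 refl _ that]
        F'(2,3) unfolding \<sigma> by simp_all
    moreover have "weight_act p C (inv_into UNIV \<sigma>) F' (weight_act p C \<sigma> F y) = y"
        "weight_act p C \<sigma> F (weight_act p C (inv_into UNIV \<sigma>) F' y) = y"
      if "y \<in> b_weight_classes p C b" for y
      using weight_act_comp[OF kk' kk that] weight_act_trivial[OF c1 _ that] weight_act_comp[OF kk kk' that]
          weight_act_trivial[OF c2 _ that]
        F'(2,3) unfolding \<sigma> by simp_all
    ultimately show "\<exists>m\<in>K. (\<forall>x\<in>simple_classes R. aS m (aS k x) = x \<and> aS k (aS m x) = x) \<and>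
        (\<forall>y\<in>b_weight_classes p C b. aT m (aT k y) = y \<and> aT k (aT m y) = y)"
      unfolding k aS_def aT_def by (intro bexI[OF _ F'(1)]) simp
  next
    show "aS k x \<in> simple_classes R" if "k \<in> K" "x \<in> simple_classes R" for k x
      using simple_act_closed[OF _ that(2)] that(1) unfolding aS_def by (cases k) (simp add: K)
    show "aT k y \<in> b_weight_classes p C b" if "k \<in> K" "y \<in> b_weight_classes p C b" for k y
      using weight_act_closed[OF _ that(2)] that(1) unfolding aT_def by (cases k) (simp add: K)
    show "apex_classes e \<subseteq> simple_classes R" "fibre e \<subseteq> b_weight_classes p C b" for e
      by (auto simp: apex_classes_def fibre_def)
    show "\<exists>e\<in>Collect (idem_endo C). x \<in> apex_classes e" if "x \<in> simple_classes R" for x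
        using apex_classes_cover[OF that] by blast
    show "\<exists>e\<in>Collect (idem_endo C). y \<in> fibre e" if "y \<in> b_weight_classes p C b" for y
        using fibre_cover[OF that] by blast
  next
    fix k e f x assume kK: "k \<in> K" and "e \<in> Collect (idem_endo C)" "f \<in> Collect (idem_endo C)"
    then have e: "idem_endo C e" and f: "idem_endo C f" by simp_all
    obtain \<sigma> F where k: "k = (\<sigma>, F)" by (metis surj_pair)
    have kk: "kaut \<sigma> F" using kK unfolding k K by blast
    note Fe = aut_idem_endo[OF kautD(2)[OF kk] e]
    \<comment> \<open>The translate certainly lies in the fibre over \<open>F(e)\<close>, so it lies
      in the one over \<open>f\<close> exactly when \<open>F(e)\<close> and \<open>f\<close> are
      isomorphic. The same reasoning applies to weights.\<close>
    show "aS k x \<in> apex_classes f \<longleftrightarrow> rel k e f" if x: "x \<in> apex_classes e"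
      using apex_classes_unique[OF Fe f apex_classes_transport[OF kk e Fe idem_iso_refl[OF Fe] x]]
          apex_classes_transport[OF kk e f _ x]
      unfolding k aS_def rel_def fst_conv snd_conv by blast
    show "aT k y \<in> fibre f \<longleftrightarrow> rel k e f" if y: "y \<in> fibre e" for y
      using fibre_unique[OF Fe f fibre_transport[OF kk e Fe idem_iso_refl[OF Fe] y]] fibre_transport[OF kk e f _ y]
      unfolding k aT_def rel_def fst_conv snd_conv by blast
  next
    show "\<exists>k\<in>K. rel k e e" if "e \<in> Collect (idem_endo C)" for e
      unfolding rel_def by (intro bexI[of _ "(id, (id, id))"]) (use that idem_iso_refl kaut_id H(2) K in auto)
  next
    fix k e f assume kK: "k \<in> K" and ef: "e \<in> Collect (idem_endo C)" "f \<in> Collect (idem_endo C)" and r: "rel k e f"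
    then have e: "idem_endo C e" and f: "idem_endo C f" by simp_all
    obtain \<sigma> F where k: "k = (\<sigma>, F)" by (metis surj_pair)
    obtain s t where st: "idem_iso C (snd F e) f s t" using r unfolding rel_def k by auto
    have FA: "F \<in> Aut_cat C" using kK kautD(2) unfolding k K by blast
    obtain F' where F': "(inv_into UNIV \<sigma>, F') \<in> K" "\<And>s. s \<in> Mor C \<Longrightarrow> snd F' (snd F s) = s"
      using inverse[OF kK[unfolded k]] by blast
    have "F' \<in> Aut_cat C" using F'(1) kautD(2) unfolding K by blast
    then have "idem_iso C (snd F' (snd F e)) (snd F' f) (snd F' s) (snd F' t)"
        by (rule aut_idem_iso[OF _ aut_idem_endo[OF FA e] f st])
    moreover have "snd F' (snd F e) = e" using F'(2) idem_endoD[OF e] by simp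
    ultimately have "idem_iso C (snd F' f) e (snd F' t) (snd F' s)" using idem_iso_sym by metis
    then show "\<exists>l\<in>K. rel l f e" unfolding rel_def by (intro bexI[OF _ F'(1)]) auto
  next
    fix k l e f g assume kl: "k \<in> K" "l \<in> K" and efg: "e \<in> Collect (idem_endo C)" "f \<in> Collect (idem_endo C)" "g
        \<in> Collect (idem_endo C)"
      and r: "rel k e f" "rel l f g"
    obtain \<sigma> F \<tau> F' where k: "k = (\<sigma>, F)" and l: "l = (\<tau>, F')" by (metis surj_pair)
    have ka: "kaut \<sigma> F" "kaut \<tau> F'" "\<tau> \<circ> \<sigma> \<in> H" using kl H(3) unfolding k l K by auto
    obtain s t u v where st: "idem_iso C (snd F e) f s t" "idem_iso C (snd F' f) g u v" using r
        unfolding rel_def k l by auto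
    have e: "idem_endo C e" "idem_endo C f" "idem_endo C g" using efg by simp_all
    note Fe = aut_idem_endo[OF kautD(2)[OF ka(1)] e(1)]
    note F' = kautD(2)[OF ka(2)]
    have "idem_iso C (snd F' (snd F e)) g (cmp C u (snd F' s)) (cmp C (snd F' t) v)"
      by (rule idem_iso_trans[OF aut_idem_endo[OF F' Fe] aut_idem_endo[OF F' e(2)] e(3) aut_idem_iso[OF F' Fe
          e(2) st(1)] st(2)])
    then show "\<exists>m\<in>K. rel m e g"
      unfolding rel_def by (intro bexI[of _ "(\<tau> \<circ> \<sigma>, fst F' \<circ> fst F, snd F' \<circ> snd F)"]) (use kaut_comp[OF
          ka(2,1)] ka(3) K in auto)
  next
    fix e assume "e \<in> Collect (idem_endo C)"
    then have e: "idem_endo C e" by simp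
    obtain \<Psi> where \<Psi>: "bij_betw \<Psi> (apex_classes e) (fibre e)"
      "\<forall>(\<sigma>, F) \<in> stab H C b. (\<exists>s t. idem_iso C (snd F e) e s t) \<longrightarrow>
      (\<forall>c \<in> apex_classes e. \<Psi> (simple_act C b \<sigma> F c) = weight_act p C \<sigma> F (\<Psi> c))"
      using local_equivariant_bij[OF H(1) e loc[OF e]] by blast
    then show "\<exists>\<Psi>. bij_betw \<Psi> (apex_classes e) (fibre e) \<and> (\<forall>k\<in>K. rel k e e \<longrightarrow> (\<forall>x\<in>apex_classes e. \<Psi> (aS k x)
        = aT k (\<Psi> x)))"
      unfolding K_def aS_def aT_def rel_def by (intro exI[of _ \<Psi>]) auto
  qed
  then show ?thesis unfolding has_equivariant_bij_def K_def[symmetric] aS_def aT_def by (auto simp: case_prod_beta)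
qed

end

section \<open>Galois automorphisms as field automorphisms, and the final assembly\<close>

lemma galois_field_aut:
  assumes "\<sigma> \<in> carrier (galois_group TYPE('k::field))" shows "field_aut \<sigma>"
  using assms by (auto simp: galois_group_def ring_iso_def ring_hom_def ring_of_type_algebra_def field_aut_def)

lemma galois_inverse:
  fixes \<sigma> :: "'k::field \<Rightarrow> 'k"
  assumes \<sigma>: "\<sigma> \<in> carrier (galois_group TYPE('k))"
  shows "inv_into UNIV \<sigma> \<in> carrier (galois_group TYPE('k))"
proof -
  note a = field_aut_inv[OF galois_field_aut[OF \<sigma>]]
  have "inv_into UNIV \<sigma> x = x" if "x \<in> range of_int" for x
  proof -
    have "\<sigma> x = x" using \<sigma> that unfolding galois_group_def by auto
    then show ?thesis using field_aut_simps(6)[OF galois_field_aut[OF \<sigma>], of x] by simp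
  qed
  then show ?thesis
    using a field_aut_simps(4)[OF a]
    by (auto simp: galois_group_def ring_iso_def ring_hom_def ring_of_type_algebra_def field_aut_def)
qed

text \<open>The abstract inverse is a definite description inside the stabiliser. Identifying it
  with the inverse function makes closure of a subgroup under inverses available for
  \<open>global_equivariant_bij\<close>.\<close>

lemma galois_stab_inv:
  fixes b :: "'m \<Rightarrow> 'k::field"
  assumes \<sigma>: "\<sigma> \<in> carrier (galois_stab C b)"
  shows "inv\<^bsub>galois_stab C b\<^esub> \<sigma> = inv_into UNIV \<sigma>"
proof -
  have g: "\<sigma> \<in> carrier (galois_group TYPE('k))" and s: "semilin_ext \<sigma> (Mor C) id b = b" using \<sigma>
      by (auto simp: galois_stab_def)
  note a = galois_field_aut[OF g]
  have \<sigma>\<sigma>: "inv_into UNIV \<sigma> \<circ> \<sigma> = id" "\<sigma> \<circ> inv_into UNIV \<sigma> = id" using field_aut_simps(5,6)[OF a] by auto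
  have "semilin_ext (inv_into UNIV \<sigma>) (Mor C) id (semilin_ext \<sigma> (Mor C) id b)
      = semilin_ext (inv_into UNIV \<sigma> \<circ> \<sigma>) (Mor C) (id \<circ> id) b"
    by (rule semilin_comp[OF bij_betw_id _ field_aut_inv[OF a] a]) simp
  then have "semilin_ext (inv_into UNIV \<sigma>) (Mor C) id b = semilin_ext id (Mor C) id b" using s \<sigma>\<sigma> by simp
  moreover have "semilin_ext id (Mor C) id b = b"
  proof (rule semilin_id)
    fix m assume "m \<notin> Mor C"
    \<comment> \<open>A semilinear extension vanishes outside \<open>Mor C\<close>; since
      \<open>\<sigma>\<close> fixes \<open>b\<close>, the support of \<open>b\<close> follows from
      the fixed point equation.\<close>
    then have "semilin_ext \<sigma> (Mor C) id b m = 0" using field_aut_simps(3)[OF a] by (subst semilin_outside) simp_all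
    then show "b m = 0" using s by simp
  qed
  ultimately have "inv_into UNIV \<sigma> \<in> carrier (galois_stab C b)" using galois_inverse[OF g]
      by (simp add: galois_stab_def)
  then show ?thesis
    unfolding m_inv_def
  proof (intro the_equality)
    fix \<tau> assume "\<tau> \<in> carrier (galois_stab C b) \<and> \<sigma> \<otimes>\<^bsub>galois_stab C b\<^esub> \<tau> = \<one>\<^bsub>galois_stab C b\<^esub>
        \<and> \<tau> \<otimes>\<^bsub>galois_stab C b\<^esub> \<sigma> = \<one>\<^bsub>galois_stab C b\<^esub>"
    then have "\<sigma> \<circ> \<tau> = id" by (simp add: galois_stab_def galois_group_def)
    then have "inv_into UNIV \<sigma> \<circ> (\<sigma> \<circ> \<tau>) = inv_into UNIV \<sigma>" by simp
    then show "\<tau> = inv_into UNIV \<sigma>" unfolding o_assoc \<sigma>\<sigma> by simp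
  qed (simp add: galois_stab_def galois_group_def \<sigma>\<sigma>)
qed

theorem theorem1p20:
  fixes p :: nat
    and C :: "('o, 'm) category"
    and b :: "'m \<Rightarrow> 'k::field"
  assumes "Factorial_Ring.prime p" and "CHAR('k) = p"
    and "algebraic_closure (ring_of_type_algebra :: 'k ring) (range of_int)"
    and "finite_category C"
    and "b = \<one>\<^bsub>cat_algebra C\<^esub> \<or> (EI C \<and> central_idempotent (cat_algebra C) b)"
  shows "(\<forall>e. idem_endo C e \<longrightarrow>
            central_idempotent (group_algebra (idem_group C e)) (basis_elt e \<otimes>\<^bsub>cat_algebra C\<^esub> b)) \<and>
         (\<forall>H. subgroup H (galois_stab C b) \<longrightarrow>
            (\<forall>e. idem_endo C e \<longrightarrow>
               has_equivariant_bij p H (group_category (idem_group C e))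
                 (basis_elt e \<otimes>\<^bsub>cat_algebra C\<^esub> b)) \<longrightarrow>
            has_equivariant_bij p H C b)"
proof -
  interpret block_weights C b p
    using assms(1,4,5) by (intro block_weights.intro block_weights_axioms.intro alg_setup.intro alg_setup_axioms.intro)
  show ?thesis
    unfolding basis_elt_eq
  proof (intro conjI allI impI)
    fix e assume "idem_endo C e"
    then show "central_idempotent (group_algebra (idem_group C e)) (eb e)" unfolding group_algebra_def
        by (rule eb_central)
  next
    fix H assume "subgroup H (galois_stab C b)" and loc: "\<forall>e. idem_endo C e
        \<longrightarrow> has_equivariant_bij p H (group_category (idem_group C e)) (eb e)"
    then interpret H: subgroup H "galois_stab C b" by simp
    have g: "\<sigma> \<in> carrier (galois_group TYPE('k))" if "\<sigma> \<in> H" for \<sigma> using H.subset that by (auto simp: galois_stab_def)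
    show "has_equivariant_bij p H C b"
    proof (rule global_equivariant_bij)
      show "field_aut \<sigma>" if "\<sigma> \<in> H" for \<sigma> using galois_field_aut[OF g[OF that]] .
      show "id \<in> H" using H.one_closed by (simp add: galois_stab_def galois_group_def)
      show "\<sigma> \<circ> \<tau> \<in> H" if "\<sigma> \<in> H" "\<tau> \<in> H" for \<sigma> \<tau> using H.m_closed[OF that]
          by (simp add: galois_stab_def galois_group_def)
      show "inv_into UNIV \<sigma> \<in> H" if "\<sigma> \<in> H" for \<sigma> using H.m_inv_closed[OF that] galois_stab_inv[of \<sigma> C b]
          H.subset that by (metis subsetD)
    qed (use loc in blast)
  qed
qed

end
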